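(* Let $X$ be an algebraic curve of $\mathbb{CP}^n$. The following statements are equivalent: (1) $X$ is LNE with respect to the Fubini-Study metric. (2) There exists a hyperplane $H$ of $\mathbb{CP}^n$ intersecting $X$ only at non-singular points of $X$ at which $X$ and $H$ are transverse, and such that the affine trace $X\setminus H$ of $X$ in $\mathbb{C}_H^n:=\mathbb{CP}^n\setminus H$ is LNE in $\mathbb{C}_H^n$. (3) For any hyperplane $H$ of $\mathbb{CP}^n$ intersecting $X$ only at non-singular points of $X$ at which $X$ and $H$ are transverse, the affine trace $X\setminus H$ is LNE in $\mathbb{C}_H^n$.
   Context: An algebraic curve of $\mathbb{CP}^n$ is a (closed) algebraic subset of complex dimension $1$ at each of its points. For a hyperplane $H$ of $\mathbb{CP}^n$, $\mathbb{C}_H^n=\mathbb{CP}^n\setminus H$ is identified with $\mathbb{C}^n$ (by a unitary change of projective coordinates sending $H$ to $\{z_{n+1}=0\}$, followed by the inverse of $\mathbf{x}\mapsto[\mathbf{x}:1]$) and is equipped with the Euclidean (canonical Hermitian) metric. "LNE in $\mathbb{C}_H^n$" means LNE with respect to this Euclidean metric. For a subset $S$ of a connected Riemannian manifold $(M,g_M)$ with associated distance $d_M$, the outer distance $d_S$ is the restriction of $d_M$ to $S\times S$, and the inner distance $d_{\rm inn}^S(\mathbf{s},\mathbf{s}')\in[0,+\infty]$ is the infimum of the lengths of rectifiable paths contained in $S$ joining $\mathbf{s}$ to $\mathbf{s}'$ ($+\infty$ if there is none). $S$ is Lipschitz normally embedded (LNE) if there is a constant $L>0$ such that $d_{\rm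 inn}^S(\mathbf{s},\mathbf{s}')\le L\,d_S(\mathbf{s},\mathbf{s}')$ for all $\mathbf{s},\mathbf{s}'\in S$. *)

theory Defs
  imports "HOL-Analysis.Analysis"
begin

section \<open>Lipschitz normal embedding in a metric space\<close>

text \<open>
  The ambient distance is passed as a function \<open>d\<close>, so that the same definition serves for the
  Fubini-Study distance and for Euclidean distances.  Everything below only depends on the values
  of \<open>d\<close> on the set under consideration.
\<close>

definition continuous_path :: "('a \<Rightarrow> 'a \<Rightarrow> real) \<Rightarrow> (real \<Rightarrow> 'a) \<Rightarrow> bool" where
  "continuous_path d \<gamma> \<longleftrightarrow>
     (\<forall>t\<in>{0..1}. \<forall>e>0. \<exists>\<delta>>0. \<forall>s\<in>{0..1}. \<bar>s - t\<bar> < \<delta> \<longrightarrow> d (\<gamma> t) (\<gamma> s) < e)"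

definition path_len :: "('a \<Rightarrow> 'a \<Rightarrow> real) \<Rightarrow> (real \<Rightarrow> 'a) \<Rightarrow> ennreal" where
  "path_len d \<gamma> =
     Sup {(\<Sum>i<N. ennreal (d (\<gamma> (t i)) (\<gamma> (t (Suc i))))) | (N::nat) t. mono t \<and> range t \<subseteq> {0..1}}"

definition inner_dist :: "('a \<Rightarrow> 'a \<Rightarrow> real) \<Rightarrow> 'a set \<Rightarrow> 'a \<Rightarrow> 'a \<Rightarrow> ennreal" where
  "inner_dist d S s s' =
     Inf {path_len d \<gamma> | \<gamma>. continuous_path d \<gamma> \<and> path_len d \<gamma> < top \<and>
            \<gamma> ` {0..1} \<subseteq> S \<and> \<gamma> 0 = s \<and> \<gamma> 1 = s'}"

definition LNE :: "('a \<Rightarrow> 'a \<Rightarrow> real) \<Rightarrow> 'a set \<Rightarrow> bool" where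
  "LNE d S \<longleftrightarrow> (\<exists>L>0. \<forall>s\<in>S. \<forall>s'\<in>S. inner_dist d S s s' \<le> ennreal (L * d s s'))"


section \<open>Complex projective space and the Fubini-Study distance\<close>

text \<open>
  With \<open>n = CARD('n)\<close>, homogeneous coordinates are indexed by \<open>'n option\<close>, the index \<open>None\<close>
  playing the role of \<open>n + 1\<close>.  A point of projective space is a complex line through the origin.
\<close>

typedef (overloaded) ('n::finite) cproj =
  "{L :: (complex ^ ('n option)) set. vec.subspace L \<and> vec.dim L = 1}"
proof
  let ?v = "axis None 1 :: complex ^ ('n option)"
  have "vec.independent {?v}"
    by (simp add: vec.dependent_single axis_eq_0_iff)
  then have "vec.dim (vec.span {?v}) = 1"
    using vec.dim_span_eq_card_independent[of "{?v}"] by simp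
  then show "vec.span {?v} \<in> {L. vec.subspace L \<and> vec.dim L = 1}"
    by simp
qed

definition hermitian :: "complex ^ 'm \<Rightarrow> complex ^ 'm \<Rightarrow> complex" where
  "hermitian z w = (\<Sum>i\<in>UNIV. z $ i * cnj (w $ i))"

text \<open>
  The Fubini-Study norm at the point \<open>[z]\<close> of the image of \<open>w\<close> under the differential at \<open>z\<close>
  of the quotient map: the Hermitian metric
  \<open>(|z|^2 |dz|^2 - |<dz, z>|^2) / |z|^4\<close>.
\<close>

definition fs_norm :: "complex ^ 'm \<Rightarrow> complex ^ 'm \<Rightarrow> real" where
  "fs_norm z w =
     sqrt ((norm z)\<^sup>2 * (norm w)\<^sup>2 - (cmod (hermitian w z))\<^sup>2) / (norm z)\<^sup>2"

text \<open>
  The associated Riemannian distance.  Piecewise \<open>C\<^sup>1\<close> curves in projective space are given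
  by lifts to nonzero vectors.  The library's notion of piecewise \<open>C\<^sup>1\<close> does not bound the
  derivative near the break points; using \<open>has_integral\<close> keeps exactly the curves of finite length.
\<close>

definition fs_dist :: "'n::finite cproj \<Rightarrow> 'n cproj \<Rightarrow> real" where
  "fs_dist p q =
     Inf {l. \<exists>\<gamma>. \<gamma> piecewise_C1_differentiable_on {0..1} \<and> (\<forall>t\<in>{0..1}. \<gamma> t \<noteq> 0) \<and>
               \<gamma> 0 \<in> Rep_cproj p \<and> \<gamma> 1 \<in> Rep_cproj q \<and>
               ((\<lambda>t. fs_norm (\<gamma> t) (vector_derivative \<gamma> (at t))) has_integral l) {0..1}}"


section \<open>Hyperplanes and affine charts\<close>

definition hyperplane :: "'n::finite cproj set \<Rightarrow> bool" where
  "hyperplane H \<longleftrightarrow>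
     (\<exists>a :: complex ^ ('n option). a \<noteq> 0 \<and>
        H = {p. \<forall>z\<in>Rep_cproj p. (\<Sum>i\<in>UNIV. a $ i * z $ i) = 0})"

definition unitary :: "complex ^ 'm ^ 'm \<Rightarrow> bool" where
  "unitary A \<longleftrightarrow> A ** (\<chi> i j. cnj (A $ j $ i)) = mat 1"

text \<open>The hyperplane sent to \<open>{z\<^sub>n\<^sub>+\<^sub>1 = 0}\<close> by the change of coordinates \<open>A\<close>.\<close>

definition hyperplane_at_inf :: "complex ^ ('n option) ^ ('n option) \<Rightarrow> 'n::finite cproj set" where
  "hyperplane_at_inf A = {p. \<forall>z\<in>Rep_cproj p. (A *v z) $ None = 0}"

text \<open>Homogeneous coordinates of \<open>[x : 1]\<close>.\<close>

definition affine_vec :: "complex ^ 'n \<Rightarrow> complex ^ ('n option)" where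
  "affine_vec x = (\<chi> j. case j of None \<Rightarrow> 1 | Some i \<Rightarrow> x $ i)"

text \<open>
  The change of coordinates \<open>A\<close> followed by the inverse of \<open>x \<mapsto> [x : 1]\<close>; meaningful for
  points outside \<open>hyperplane_at_inf A\<close>.
\<close>

definition affine_chart ::
    "complex ^ ('n option) ^ ('n option) \<Rightarrow> 'n::finite cproj \<Rightarrow> complex ^ 'n" where
  "affine_chart A p = (THE x. affine_vec x \<in> (\<lambda>z. A *v z) ` Rep_cproj p)"

definition affine_dist ::
    "complex ^ ('n option) ^ ('n option) \<Rightarrow> 'n::finite cproj \<Rightarrow> 'n cproj \<Rightarrow> real" where
  "affine_dist A p q = dist (affine_chart A p) (affine_chart A q)"

text \<open>
  The choice of the unitary change of coordinates is immaterial, see \<open>affine_LNE_iff\<close> below.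
\<close>

definition affine_LNE :: "'n::finite cproj set \<Rightarrow> 'n cproj set \<Rightarrow> bool" where
  "affine_LNE H S \<longleftrightarrow> (\<exists>A. unitary A \<and> hyperplane_at_inf A = H \<and> LNE (affine_dist A) S)"


section \<open>Algebraic curves, non-singular points, transversality\<close>

definition homogeneous_poly :: "nat \<Rightarrow> (complex ^ 'm::finite \<Rightarrow> complex) \<Rightarrow> bool" where
  "homogeneous_poly d F \<longleftrightarrow>
     (\<exists>c :: ('m \<Rightarrow> nat) \<Rightarrow> complex.
        \<forall>z. F z = (\<Sum>\<alpha> | (\<Sum>i\<in>UNIV. \<alpha> i) = d. c \<alpha> * (\<Prod>i\<in>UNIV. (z $ i) ^ \<alpha> i)))"

definition algebraic_subset :: "'n::finite cproj set \<Rightarrow> bool" where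
  "algebraic_subset X \<longleftrightarrow>
     (\<exists>\<F>. finite \<F> \<and> (\<forall>F\<in>\<F>. \<exists>d. homogeneous_poly d F) \<and>
        X = {p. \<forall>F\<in>\<F>. \<forall>z\<in>Rep_cproj p. F z = 0})"

definition holomorphic_map :: "(complex ^ 'a \<Rightarrow> complex ^ 'b) \<Rightarrow> (complex ^ 'a) set \<Rightarrow> bool" where
  "holomorphic_map f U \<longleftrightarrow>
     (\<forall>z\<in>U. \<exists>D :: complex ^ 'a ^ 'b. (f has_derivative (\<lambda>h. D *v h)) (at z))"

text \<open>
  Near \<open>x\<close>, the set \<open>S\<close> is a complex submanifold of dimension \<open>k\<close>: some biholomorphic map
  between open sets straightens it to a linear subspace of dimension \<open>k\<close>.
\<close>

definition submanifold_at :: "nat \<Rightarrow> (complex ^ 'm) set \<Rightarrow> complex ^ 'm \<Rightarrow> bool" where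
  "submanifold_at k S x \<longleftrightarrow>
     (\<exists>U V (f :: complex ^ 'm \<Rightarrow> complex ^ 'm) g E. open U \<and> open V \<and> x \<in> S \<inter> U \<and> homeomorphism U V f g \<and>
        holomorphic_map f U \<and> holomorphic_map g V \<and>
        vec.subspace E \<and> vec.dim E = k \<and> f ` (S \<inter> U) = V \<inter> E)"

text \<open>Velocities at \<open>x\<close> of curves in \<open>S\<close>; the tangent space when \<open>S\<close> is a submanifold near \<open>x\<close>.\<close>

definition tangent_vectors :: "(complex ^ 'm) set \<Rightarrow> complex ^ 'm \<Rightarrow> (complex ^ 'm) set" where
  "tangent_vectors S x =
     {w. \<exists>\<gamma> :: real \<Rightarrow> complex ^ 'm.
           \<gamma> 0 = x \<and> range \<gamma> \<subseteq> S \<and> (\<gamma> has_vector_derivative w) (at 0)}"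

definition in_chart ::
    "complex ^ ('n option) ^ ('n option) \<Rightarrow> 'n::finite cproj set \<Rightarrow> (complex ^ 'n) set" where
  "in_chart A X = affine_chart A ` (X - hyperplane_at_inf A)"

definition regular_point :: "nat \<Rightarrow> 'n::finite cproj set \<Rightarrow> 'n cproj \<Rightarrow> bool" where
  "regular_point k X p \<longleftrightarrow> p \<in> X \<and>
     (\<exists>A. unitary A \<and> p \<notin> hyperplane_at_inf A \<and> submanifold_at k (in_chart A X) (affine_chart A p))"

definition nonsingular_point :: "'n::finite cproj set \<Rightarrow> 'n cproj \<Rightarrow> bool" where
  "nonsingular_point X p \<longleftrightarrow> (\<exists>k. regular_point k X p)"

text \<open>
  The dimension at \<open>p\<close> of an algebraic set \<open>X\<close> containing \<open>p\<close>: the largest dimension of \<open>X\<close>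
  at non-singular points arbitrarily close to \<open>p\<close>.
\<close>

definition local_dim :: "'n::finite cproj set \<Rightarrow> 'n cproj \<Rightarrow> nat" where
  "local_dim X p = Max {k. \<forall>e>0. \<exists>q. regular_point k X q \<and> fs_dist p q < e}"

definition algebraic_curve :: "'n::finite cproj set \<Rightarrow> bool" where
  "algebraic_curve X \<longleftrightarrow> algebraic_subset X \<and> (\<forall>p\<in>X. local_dim X p = 1)"

definition transverse_at :: "'n::finite cproj set \<Rightarrow> 'n cproj set \<Rightarrow> 'n cproj \<Rightarrow> bool" where
  "transverse_at X Y p \<longleftrightarrow>
     (\<exists>A. unitary A \<and> p \<notin> hyperplane_at_inf A \<and>
        {u + v | u v. u \<in> tangent_vectors (in_chart A X) (affine_chart A p) \<and>
                      v \<in> tangent_vectors (in_chart A Y) (affine_chart A p)} = UNIV)"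


section \<open>The Euclidean structure of the complement of a hyperplane is well defined\<close>

lemma cproj_line:
  obtains v where "v \<noteq> 0" "Rep_cproj p = range (\<lambda>c. c *s v)"
proof -
  have *: "vec.subspace (Rep_cproj p)" "vec.dim (Rep_cproj p) = 1"
    using Rep_cproj[of p] by auto
  obtain B where B: "B \<subseteq> Rep_cproj p" "vec.independent B" "Rep_cproj p \<subseteq> vec.span B"
      "card B = vec.dim (Rep_cproj p)"
    using vec.basis_exists by blast
  then obtain v where v: "B = {v}"
    using * by (metis card_1_singletonE)
  have "v \<noteq> 0"
    using B v vec.dependent_zero by blast
  moreover have "Rep_cproj p = vec.span {v}"
    using B v * by (metis subset_antisym vec.span_minimal)
  ultimately show ?thesis
    using that by (simp add: vec.span_singleton)
qed

lemma affine_chart_works: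
  assumes "unitary A" "p \<notin> hyperplane_at_inf A"
  shows "\<exists>!x. affine_vec x \<in> (\<lambda>z. A *v z) ` Rep_cproj p"
    and "affine_vec (affine_chart A p) \<in> (\<lambda>z. A *v z) ` Rep_cproj p"
proof -
  obtain v where v: "v \<noteq> 0" "Rep_cproj p = range (\<lambda>c. c *s v)"
    by (rule cproj_line)
  define w where "w = A *v v"
  have im: "(\<lambda>z. A *v z) ` Rep_cproj p = range (\<lambda>c. c *s w)"
    by (simp add: v w_def image_image flip: vector_scalar_commute)
  have w0: "w $ None \<noteq> 0"
    using assms(2) by (auto simp: hyperplane_at_inf_def v w_def vector_scalar_commute)
  define x where "x = (\<chi> i. w $ Some i / w $ None)"
  have "affine_vec x = (1 / w $ None) *s w"
    using w0 by (auto simp: vec_eq_iff affine_vec_def x_def split: option.split)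
  then have ex: "affine_vec x \<in> range (\<lambda>c. c *s w)"
    by auto
  have un: "y = x" if y: "affine_vec y \<in> range (\<lambda>c. c *s w)" for y
  proof -
    obtain c where c: "affine_vec y = c *s w" using y by auto
    have n: "c * w $ None = 1"
      using arg_cong[OF c, of "\<lambda>u. u $ None"] by (simp add: affine_vec_def)
    have s: "y $ i = c * w $ Some i" for i
      using arg_cong[OF c, of "\<lambda>u. u $ Some i"] by (simp add: affine_vec_def)
    have "c = 1 / w $ None" using n w0 by (simp add: field_simps)
    then show ?thesis by (simp add: vec_eq_iff s x_def)
  qed
  show 1: "\<exists>!x. affine_vec x \<in> (\<lambda>z. A *v z) ` Rep_cproj p"
    unfolding im using ex un by blast
  show "affine_vec (affine_chart A p) \<in> (\<lambda>z. A *v z) ` Rep_cproj p"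
    unfolding affine_chart_def by (rule theI'[OF 1])
qed

lemma unitary_left: "unitary A \<Longrightarrow> (\<chi> i j. cnj (A $ j $ i)) ** A = mat 1"
  unfolding unitary_def by (simp add: matrix_left_right_inverse)

lemma norm_hermitian: "of_real ((norm z)\<^sup>2) = hermitian z z"
proof -
  have "(norm z)\<^sup>2 = (\<Sum>i\<in>UNIV. (cmod (z $ i))\<^sup>2)"
    by (simp add: norm_vec_def L2_set_def sum_nonneg)
  then show ?thesis
    by (simp only: hermitian_def of_real_sum complex_norm_square)
qed

lemma hermitian_adjoint: "hermitian (A *v z) w = hermitian z ((\<chi> i j. cnj (A $ j $ i)) *v w)"
proof -
  have "hermitian (A *v z) w = (\<Sum>i\<in>UNIV. \<Sum>j\<in>UNIV. A $ i $ j * z $ j * cnj (w $ i))"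
    by (simp add: hermitian_def matrix_vector_mult_def sum_distrib_right)
  also have "\<dots> = (\<Sum>j\<in>UNIV. \<Sum>i\<in>UNIV. A $ i $ j * z $ j * cnj (w $ i))"
    by (rule sum.swap)
  also have "\<dots> = hermitian z ((\<chi> i j. cnj (A $ j $ i)) *v w)"
    by (simp add: hermitian_def matrix_vector_mult_def sum_distrib_left mult_ac)
  finally show ?thesis .
qed

lemma norm_unitary: assumes "unitary A" shows "norm (A *v z) = norm z"
proof -
  have "hermitian (A *v z) (A *v z) = hermitian z z"
    by (simp add: hermitian_adjoint matrix_vector_mul_assoc unitary_left[OF assms])
  then have "(norm (A *v z))\<^sup>2 = (norm z)\<^sup>2"
    by (metis norm_hermitian of_real_eq_iff)
  then show ?thesis by simp
qed

lemma UNIV_option_sum: "(\<Sum>j\<in>(UNIV :: 'n::finite option set). f j) = f None + (\<Sum>i\<in>UNIV. f (Some i))"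
  by (simp add: UNIV_option_conv sum.reindex)

lemma norm_affine_vec_diff: "norm (affine_vec x - affine_vec y) = norm (x - y)"
  unfolding norm_vec_def L2_set_def UNIV_option_sum by (simp add: affine_vec_def)

lemma affine_dist_unique:
  assumes A: "unitary A" and B: "unitary B"
    and H: "hyperplane_at_inf A = hyperplane_at_inf B"
    and p: "p \<notin> hyperplane_at_inf A" and q: "q \<notin> hyperplane_at_inf A"
  shows "affine_dist A p q = affine_dist B p q"
proof -
  define A' where "A' = (\<chi> i j. cnj (A $ j $ i))"
  have A'A: "A' ** A = mat 1" and AA': "A ** A' = mat 1"
    using unitary_left[OF A] A by (simp_all add: A'_def unitary_def)
  define C where "C = B ** A'"
  have CA: "C *v (A *v z) = B *v z" for z
    by (simp add: C_def matrix_vector_mul_assoc matrix_mul_assoc[symmetric] A'A)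
  have nC: "norm (C *v u) = norm u" for u
  proof -
    have "norm (C *v u) = norm (A' *v u)"
      by (simp add: C_def matrix_vector_mul_assoc[symmetric] norm_unitary[OF B])
    also have "\<dots> = norm (A *v (A' *v u))"
      by (simp add: norm_unitary[OF A])
    finally show ?thesis
      by (simp add: matrix_vector_mul_assoc AA')
  qed
  define c where "c = C $ None $ None"
  have row: "C $ None $ Some i = 0" for i
  proof -
    let ?e = "axis (Some i) 1"
    define z where "z = A' *v ?e"
    have Az: "A *v z = ?e"
      by (simp add: z_def matrix_vector_mul_assoc AA')
    then have z0: "z \<noteq> 0"
      by (auto simp: axis_eq_0_iff)
    have "vec.independent {z}"
      using z0 by (simp add: vec.dependent_single)
    then have "vec.dim (vec.span {z}) = 1"
      using vec.dim_span_eq_card_independent[of "{z}"] by simp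
    then have R: "Rep_cproj (Abs_cproj (vec.span {z})) = vec.span {z}"
      by (intro Abs_cproj_inverse) simp
    have "Abs_cproj (vec.span {z}) \<in> hyperplane_at_inf A"
      unfolding hyperplane_at_inf_def mem_Collect_eq R
      by (auto simp: vec.span_singleton vector_scalar_commute Az axis_def)
    then have "Abs_cproj (vec.span {z}) \<in> hyperplane_at_inf B"
      using H by simp
    then have "(B *v z) $ None = 0"
      by (auto simp: hyperplane_at_inf_def R vec.span_base)
    then have "(C *v ?e) $ None = 0"
      by (simp flip: CA add: Az)
    then show ?thesis
      by (simp add: matrix_vector_mult_def axis_def if_distrib cong: if_cong)
  qed
  have Cn: "(C *v u) $ None = c * u $ None" for u
    by (simp add: matrix_vector_mult_def UNIV_option_sum row c_def)
  have key: "\<exists>k. k * c = 1 \<and> affine_vec (affine_chart B r) = k *s (C *v affine_vec (affine_chart A r))"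
    if r: "r \<notin> hyperplane_at_inf A" for r
  proof -
    obtain v where v: "v \<noteq> 0" "Rep_cproj r = range (\<lambda>c. c *s v)"
      by (rule cproj_line)
    obtain a where a: "affine_vec (affine_chart A r) = A *v (a *s v)"
      using affine_chart_works(2)[OF A r] v by auto
    obtain b where b: "affine_vec (affine_chart B r) = B *v (b *s v)"
      using affine_chart_works(2)[OF B, of r] r H v by auto
    have one: "affine_vec x $ None = 1" for x :: "complex ^ 'a"
      by (simp add: affine_vec_def)
    have a0: "a \<noteq> 0"
      using one[of "affine_chart A r"] by (auto simp: a)
    have eq: "affine_vec (affine_chart B r) = (b / a) *s (C *v affine_vec (affine_chart A r))"
      unfolding a b CA using a0 by (simp add: vector_scalar_commute)
    have "(b / a) * c = 1"
      using arg_cong[OF eq, of "\<lambda>u. u $ None"] by (simp add: Cn one)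
    with eq show ?thesis by blast
  qed
  obtain k where k: "k * c = 1"
    "affine_vec (affine_chart B p) = k *s (C *v affine_vec (affine_chart A p))"
    using key[OF p] by blast
  obtain k' where k': "k' * c = 1"
    "affine_vec (affine_chart B q) = k' *s (C *v affine_vec (affine_chart A q))"
    using key[OF q] by blast
  have kk: "k' = k"
    using k(1) k'(1) by (metis mult.commute mult.left_commute mult_1_right)
  have "cmod c = 1"
  proof -
    have "C ** (\<chi> i j. cnj (C $ j $ i)) = mat 1"
    proof -
      have "(\<chi> i j. cnj (C $ j $ i)) = A ** (\<chi> i j. cnj (B $ j $ i))"
        by (simp add: vec_eq_iff C_def matrix_matrix_mult_def A'_def mult.commute)
      then show ?thesis
        using B by (simp add: C_def unitary_def)
          (metis A'A matrix_mul_assoc matrix_mul_rid)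
    qed
    then have "(C ** (\<chi> i j. cnj (C $ j $ i))) $ None $ None = 1"
      by (simp add: mat_def)
    then have "c * cnj c = 1"
      by (simp add: matrix_matrix_mult_def UNIV_option_sum row c_def)
    then show ?thesis
      by (metis complex_norm_square norm_one norm_mult complex_mod_cnj power2_eq_square
          abs_norm_cancel abs_square_eq_1)
  qed
  then have k1: "cmod k = 1"
    using k(1) by (metis mult_1_right norm_mult norm_one)
  have "affine_vec (affine_chart B p) - affine_vec (affine_chart B q)
      = k *s (C *v (affine_vec (affine_chart A p) - affine_vec (affine_chart A q)))"
    unfolding k(2) k'(2) kk by (simp add: matrix_vector_mult_diff_distrib vector_ssub_ldistrib)
  moreover have "norm (k *s u) = norm u" for u :: "complex ^ 'a option"
    using k1 by (simp add: norm_vec_def norm_mult)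
  ultimately have "norm (affine_chart B p - affine_chart B q) = norm (affine_chart A p - affine_chart A q)"
    by (metis nC norm_affine_vec_diff)
  then show ?thesis
    by (simp add: affine_dist_def dist_norm)
qed

lemma LNE_cong:
  assumes d: "\<And>p q. p \<in> S \<Longrightarrow> q \<in> S \<Longrightarrow> d p q = d' p q"
  shows "LNE d S \<longleftrightarrow> LNE d' S"
proof -
  have c: "continuous_path d \<gamma> = continuous_path d' \<gamma>" if "\<gamma> ` {0..1} \<subseteq> S" for \<gamma>
    unfolding continuous_path_def using that
    by (intro ball_cong refl all_cong imp_cong ex_cong conj_cong) (auto simp: d image_subset_iff)
  have l: "path_len d \<gamma> = path_len d' \<gamma>" if "\<gamma> ` {0..1} \<subseteq> S" for \<gamma>
  proof -
    have "(\<Sum>i<N. ennreal (d (\<gamma> (t i)) (\<gamma> (t (Suc i)))))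
        = (\<Sum>i<N. ennreal (d' (\<gamma> (t i)) (\<gamma> (t (Suc i)))))" if "range t \<subseteq> {0..1}" for N and t :: "nat \<Rightarrow> real"
    proof (intro sum.cong refl)
      fix i
      have "\<gamma> (t j) \<in> S" for j
        using that \<open>\<gamma> ` {0..1} \<subseteq> S\<close> by (meson image_subset_iff range_subsetD)
      then show "ennreal (d (\<gamma> (t i)) (\<gamma> (t (Suc i)))) = ennreal (d' (\<gamma> (t i)) (\<gamma> (t (Suc i))))"
        by (simp add: d)
    qed
    then show ?thesis
      unfolding path_len_def by (intro arg_cong[where f = Sup]) (auto; metis)
  qed
  have "inner_dist d S = inner_dist d' S"
    unfolding inner_dist_def using c l by (intro ext arg_cong[where f = Inf]) (auto; metis)
  then show ?thesis
    by (simp add: LNE_def d)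
qed

lemma affine_LNE_iff:
  assumes "unitary A" and "S \<inter> hyperplane_at_inf A = {}"
  shows "affine_LNE (hyperplane_at_inf A) S \<longleftrightarrow> LNE (affine_dist A) S"
proof -
  have "LNE (affine_dist B) S \<longleftrightarrow> LNE (affine_dist A) S"
    if "unitary B" "hyperplane_at_inf B = hyperplane_at_inf A" for B
    using assms that by (intro LNE_cong affine_dist_unique) auto
  then show ?thesis
    using assms(1) unfolding affine_LNE_def by blast
qed

end

theory Submission
  imports Defs "HOL-Complex_Analysis.Complex_Analysis" "HOL-Computational_Algebra.Fundamental_Theorem_Algebra"
begin

text \<open>
  All the distances involved are compared in the compact space of orthogonal projectors, where the
  Fubini-Study distance becomes equivalent to a Euclidean one.  Away from the hyperplane at infinity
  this distance is locally equivalent to the affine one.  At a transverse non-singular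
  point at infinity the curve is a graph \<open>\<zeta> \<mapsto> \<zeta> N(1/\<zeta>)\<close> with \<open>N(0) \<noteq> 0\<close> over the exterior of a
  disc, which is Lipschitz normally embedded for both metrics.  Compactness and connectedness turn
  these local facts into the equivalence of the projective and the affine property, for any
  transverse hyperplane.

  It remains to find one transverse hyperplane.  Choose unitary coordinates and a
  minimal set \<open>K\<close> of them without common zero on \<open>X\<close>.  By minimality the affine trace of \<open>X\<close> projects
  onto the affine space of the coordinates in \<open>K\<close>, and by the Nullstellensatz all coordinates
  are roots of a monic polynomial over that space.  Where the number of distinct roots is maximal
  these are holomorphic functions, and off a thin set \<open>X\<close> is a union of their graphs.  As \<open>X\<close> is a
  curve, \<open>K\<close> has at most two elements; a generic fibre of the projection is the hyperplane wanted.
\<close>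

section \<open>Inner distances\<close>

text \<open>Everything reduces to one equivalence: for each fixed transverse hyperplane,
  \<open>X\<close> is LNE in projective space iff its affine trace is. A transverse hyperplane must
  still be produced, since otherwise (3) could hold vacuously. The two metrics are not bilipschitz
  to each other near infinity, where affine distances blow up. The weight
  \<open>norm (affine_vec x)\<close>, the reciprocal of the height over the hyperplane, measures the
  discrepancy and makes distances between points with distinct limits comparable. Connectedness of
  \<open>X\<close> is extracted from whichever LNE property is assumed. The search for a hyperplane
  is shaped by the definition of a curve, which enters only through the fact that no regular point
  has dimension above 1. So a fibre is wanted that is nonempty, which minimality of \<open>K\<close>
  gives, and along which \<open>X\<close> is a graph over all affine coordinates in
  \<open>K\<close>, which makes its points regular of dimension \<open>card K - 1\<close>.
  Transversality is then immediate: a graph over the single coordinate \<open>x $ j\<close> has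
  tangent vectors with any \<open>j\<close>-component, and the hyperplane
  \<open>x $ j = b $ j\<close> supplies the other components.\<close>

abbreviation pull_dist :: "('a \<Rightarrow> 'b::metric_space) \<Rightarrow> 'a \<Rightarrow> 'a \<Rightarrow> real" where
  "pull_dist j \<equiv> \<lambda>p q. dist (j p) (j q)"

lemma continuous_path_pull_dist: "continuous_path (pull_dist j) \<gamma> \<longleftrightarrow> continuous_on {0..1} (j \<circ> \<gamma>)"
  unfolding continuous_path_def continuous_on_iff o_def
  by (simp add: dist_real_def dist_commute)

lemma path_len_ge:
  assumes "0 \<le> s" "s \<le> t" "t \<le> 1"
  shows "ennreal (d (\<gamma> s) (\<gamma> t)) \<le> path_len d \<gamma>"
  unfolding path_len_def
proof (rule Sup_upper, rule CollectI, intro exI conjI)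
  let ?t = "\<lambda>i::nat. if i = 0 then s else t"
  show "ennreal (d (\<gamma> s) (\<gamma> t)) = (\<Sum>i<1. ennreal (d (\<gamma> (?t i)) (\<gamma> (?t (Suc i)))))"
    by simp
  show "mono ?t" using assms by (auto simp: mono_def)
  show "range ?t \<subseteq> {0..1}" using assms by auto
qed

lemma path_len_leI:
  assumes "\<And>N t. mono t \<Longrightarrow> range t \<subseteq> {0..1} \<Longrightarrow> (\<Sum>i<N. ennreal (d (\<gamma> (t i)) (\<gamma> (t (Suc i))))) \<le> B"
  shows "path_len d \<gamma> \<le> B"
  unfolding path_len_def by (rule Sup_least) (use assms in auto)

lemma path_len_sum_le:
  assumes "mono t" "range t \<subseteq> {0..1}"
  shows "(\<Sum>i<N. ennreal (d (\<gamma> (t i)) (\<gamma> (t (Suc i))))) \<le> path_len d \<gamma>"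
  unfolding path_len_def by (rule Sup_upper) (use assms in auto)

lemma path_len_scale:
  assumes "C \<ge> 0" "\<And>p q. p \<in> S \<Longrightarrow> q \<in> S \<Longrightarrow> d' p q \<le> C * d p q" "\<gamma> ` {0..1} \<subseteq> S"
  shows "path_len d' \<gamma> \<le> ennreal C * path_len d \<gamma>"
proof (rule path_len_leI)
  fix N and t :: "nat \<Rightarrow> real"
  assume t: "mono t" "range t \<subseteq> {0..1}"
  have "\<gamma> (t i) \<in> S" for i using t(2) assms(3) by (meson image_subset_iff range_subsetD)
  then have "(\<Sum>i<N. ennreal (d' (\<gamma> (t i)) (\<gamma> (t (Suc i)))))
     \<le> (\<Sum>i<N. ennreal C * ennreal (d (\<gamma> (t i)) (\<gamma> (t (Suc i)))))"
    using assms(1,2) by (intro sum_mono) (simp add: ennreal_mult'[symmetric] ennreal_leI)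
  also have "\<dots> = ennreal C * (\<Sum>i<N. ennreal (d (\<gamma> (t i)) (\<gamma> (t (Suc i)))))"
    by (simp add: sum_distrib_left)
  also have "\<dots> \<le> ennreal C * path_len d \<gamma>"
    by (intro mult_left_mono path_len_sum_le t) auto
  finally show "(\<Sum>i<N. ennreal (d' (\<gamma> (t i)) (\<gamma> (t (Suc i))))) \<le> ennreal C * path_len d \<gamma>" .
qed

lemma continuous_path_scale:
  assumes "C > 0" "\<And>p q. p \<in> S \<Longrightarrow> q \<in> S \<Longrightarrow> d' p q \<le> C * d p q" "\<gamma> ` {0..1} \<subseteq> S"
    and "continuous_path d \<gamma>"
  shows "continuous_path d' \<gamma>"
  unfolding continuous_path_def
proof (intro ballI allI impI)
  fix t :: real and e :: real assume t: "t \<in> {0..1}" and e: "e > 0"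
  have "e / C > 0" using e assms(1) by simp
  then obtain \<delta> where \<delta>: "\<delta> > 0" "\<forall>s\<in>{0..1}. \<bar>s - t\<bar> < \<delta> \<longrightarrow> d (\<gamma> t) (\<gamma> s) < e / C"
    using assms(4) t unfolding continuous_path_def by blast
  have "d' (\<gamma> t) (\<gamma> s) < e" if "s \<in> {0..1}" "\<bar>s - t\<bar> < \<delta>" for s
  proof -
    have "d' (\<gamma> t) (\<gamma> s) \<le> C * d (\<gamma> t) (\<gamma> s)" using assms(2,3) t that by blast
    also have "\<dots> < e" using \<delta>(2) that assms(1) by (simp add: field_simps)
    finally show ?thesis .
  qed
  then show "\<exists>\<delta>>0. \<forall>s\<in>{0..1}. \<bar>s - t\<bar> < \<delta> \<longrightarrow> d' (\<gamma> t) (\<gamma> s) < e" using \<delta>(1) by blast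
qed

lemma inner_dist_lessE:
  assumes "inner_dist d S s s' < r"
  obtains \<gamma> where "continuous_path d \<gamma>" "path_len d \<gamma> < r" "\<gamma> ` {0..1} \<subseteq> S" "\<gamma> 0 = s" "\<gamma> 1 = s'"
  using assms unfolding inner_dist_def Inf_less_iff by blast

lemma inner_dist_leI:
  assumes "continuous_path d \<gamma>" "path_len d \<gamma> \<le> ennreal r" "\<gamma> ` {0..1} \<subseteq> S" "\<gamma> 0 = s" "\<gamma> 1 = s'"
  shows "inner_dist d S s s' \<le> ennreal r"
proof -
  have "path_len d \<gamma> < top" using assms(2) by (meson ennreal_less_top order.strict_trans1)
  then have "inner_dist d S s s' \<le> path_len d \<gamma>"
    unfolding inner_dist_def by (intro Inf_lower) (use assms in auto)
  then show ?thesis using assms(2) by simp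
qed

text \<open>The same path serves for both distances, and a larger set only admits more paths. The
  infimum may fail to be attained; the margin \<open>e / C\<close> becomes \<open>e\<close> after
  scaling.\<close>

lemma inner_dist_transfer:
  assumes C: "C > 0" "\<And>p q. p \<in> S \<Longrightarrow> q \<in> S \<Longrightarrow> d' p q \<le> C * d p q" and "S \<subseteq> S'"
    and r: "inner_dist d S s s' \<le> ennreal r" "0 \<le> r"
  shows "inner_dist d' S' s s' \<le> ennreal (C * r)"
proof (rule ennreal_le_epsilon)
  fix e :: real assume e: "0 < e"
  have "inner_dist d S s s' < ennreal (r + e / C)"
    using r e C(1) by (simp add: order.strict_trans1 ennreal_lessI)
  then obtain \<gamma> where g: "continuous_path d \<gamma>" "path_len d \<gamma> < ennreal (r + e / C)" "\<gamma> ` {0..1} \<subseteq> S" "\<gamma> 0 = s" "\<gamma> 1 = s'"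
    by (rule inner_dist_lessE)
  have "path_len d' \<gamma> \<le> ennreal C * path_len d \<gamma>"
    by (rule path_len_scale[OF _ C(2) g(3)]) (use C(1) in auto)
  also have "\<dots> \<le> ennreal C * ennreal (r + e / C)" using g(2) by (intro mult_left_mono) auto
  also have "\<dots> = ennreal (C * r + e)" using C(1) r e by (simp add: ennreal_mult'[symmetric] distrib_left del: ennreal_plus)
  finally have "path_len d' \<gamma> \<le> ennreal (C * r + e)" .
  moreover have "continuous_path d' \<gamma>" by (rule continuous_path_scale[OF C(1) C(2) g(3,1)])
  ultimately have "inner_dist d' S' s s' \<le> ennreal (C * r + e)"
    using g assms(3) by (intro inner_dist_leI[of d' \<gamma>]) auto
  then show "inner_dist d' S' s s' \<le> ennreal (C * r) + ennreal e" using C(1) r e by (simp add: ennreal_plus)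
qed

text \<open>A path shorter than \<open>\<rho>\<close> cannot leave the ball of radius
  \<open>\<rho>\<close> about its starting point, so it may be measured in another metric that is
  controlled only on that ball.\<close>

lemma inner_dist_local:
  fixes j :: "'a \<Rightarrow> 'b::metric_space"
  assumes r: "inner_dist (pull_dist j) S s s' \<le> ennreal r" "0 \<le> r" "r < \<rho>"
  shows "inner_dist (pull_dist j) {x \<in> S. dist (j s) (j x) < \<rho>} s s' \<le> ennreal r"
proof (rule ennreal_le_epsilon)
  fix e :: real assume e: "0 < e"
  \<comment> \<open>Besides approximating the infimum, the path must stay shorter than
    \<open>\<rho>\<close>.\<close>
  define e' where "e' = min e (\<rho> - r)"
  have e': "e' > 0" "e' \<le> e" "r + e' \<le> \<rho>" using e r by (auto simp: e'_def)
  have "inner_dist (pull_dist j) S s s' < ennreal (r + e')"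
    using r e' by (simp add: order.strict_trans1 ennreal_lessI)
  then obtain \<gamma> where g: "continuous_path (pull_dist j) \<gamma>" "path_len (pull_dist j) \<gamma> < ennreal (r + e')" "\<gamma> ` {0..1} \<subseteq> S" "\<gamma> 0 = s" "\<gamma> 1 = s'"
    by (rule inner_dist_lessE)
  have "dist (j s) (j (\<gamma> t)) < \<rho>" if "t \<in> {0..1}" for t
  proof -
    have "ennreal (dist (j (\<gamma> 0)) (j (\<gamma> t))) < ennreal (r + e')"
      using path_len_ge[of 0 t "pull_dist j" \<gamma>] that g(2) by (auto simp: order.strict_trans1)
    then have "dist (j (\<gamma> 0)) (j (\<gamma> t)) < r + e'" using e' r by (simp add: ennreal_less_iff del: ennreal_plus)
    then show ?thesis using g(4) e' by simp
  qed
  then have "inner_dist (pull_dist j) {x \<in> S. dist (j s) (j x) < \<rho>} s s' \<le> ennreal (r + e')"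
    using g by (intro inner_dist_leI[of _ \<gamma>]) auto
  also have "\<dots> \<le> ennreal r + ennreal e" using e' r e by (simp add: ennreal_plus[symmetric] ennreal_leI del: ennreal_plus)
  finally show "inner_dist (pull_dist j) {x \<in> S. dist (j s) (j x) < \<rho>} s s' \<le> ennreal r + ennreal e" .
qed

text \<open>All explicit paths of the development, which are images of segments, enter through this
  criterion.\<close>

lemma inner_dist_lipschitz:
  fixes j :: "'a \<Rightarrow> 'b::metric_space"
  assumes L: "L \<ge> 0" "\<And>s t. 0 \<le> s \<Longrightarrow> s \<le> t \<Longrightarrow> t \<le> 1 \<Longrightarrow> dist (j (\<gamma> s)) (j (\<gamma> t)) \<le> L * (t - s)"
    and g: "\<And>t. 0 \<le> t \<Longrightarrow> t \<le> 1 \<Longrightarrow> \<gamma> t \<in> S" "\<gamma> 0 = s" "\<gamma> 1 = s'"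
  shows "inner_dist (pull_dist j) S s s' \<le> ennreal L"
proof (rule inner_dist_leI[of _ \<gamma>])
  have L': "dist (j (\<gamma> s)) (j (\<gamma> t)) \<le> L * dist s t" if "s \<in> {0..1}" "t \<in> {0..1}" for s t
  proof (cases "s \<le> t")
    case True then show ?thesis using L(2)[of s t] that by (simp add: dist_real_def)
  next
    case False then show ?thesis using L(2)[of t s] that by (simp add: dist_real_def dist_commute[of "j (\<gamma> s)"])
  qed
  show "continuous_path (pull_dist j) \<gamma>"
    unfolding continuous_path_pull_dist
    by (rule lipschitz_on_continuous_on[where L = L]) (use L' L(1) in \<open>simp add: lipschitz_on_def\<close>)
  show "path_len (pull_dist j) \<gamma> \<le> ennreal L"
  proof (rule path_len_leI)
    fix N and t :: "nat \<Rightarrow> real"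
    assume t: "mono t" "range t \<subseteq> {0..1}"
    have t01: "0 \<le> t i" "t i \<le> 1" "t i \<le> t (Suc i)" for i using t by (auto simp: mono_def image_subset_iff)
    have "(\<Sum>i<N. ennreal (dist (j (\<gamma> (t i))) (j (\<gamma> (t (Suc i)))))) \<le> (\<Sum>i<N. ennreal (L * (t (Suc i) - t i)))"
      using t01 L by (intro sum_mono ennreal_leI) auto
    also have "\<dots> = ennreal (\<Sum>i<N. L * (t (Suc i) - t i))"
      using t01 L(1) by (intro sum_ennreal) simp
    also have "(\<Sum>i<N. L * (t (Suc i) - t i)) = L * (t N - t 0)"
      by (simp add: sum_distrib_left[symmetric] sum_lessThan_telescope)
    also have "ennreal \<dots> \<le> ennreal L"
      using t01[of 0] t01[of N] L(1) by (intro ennreal_leI) (simp add: mult_left_le)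
    finally show "(\<Sum>i<N. ennreal (dist (j (\<gamma> (t i))) (j (\<gamma> (t (Suc i)))))) \<le> ennreal L" .
  qed
qed (use g in auto)

lemma less_add_ennreal: "x < top \<Longrightarrow> 0 < e \<Longrightarrow> x < x + ennreal e"
  by (cases x) (auto simp: ennreal_plus[symmetric] ennreal_less_iff simp del: ennreal_plus)

text \<open>Two almost shortest paths are concatenated; \<open>ennreal_le_epsilon\<close> allows
  both distances to be taken finite, so that such paths exist.\<close>

lemma inner_dist_triangle:
  fixes j :: "'a \<Rightarrow> 'b::metric_space"
  shows "inner_dist (pull_dist j) S a c \<le> inner_dist (pull_dist j) S a b + inner_dist (pull_dist j) S b c"
proof (rule ennreal_le_epsilon)
  fix e :: real assume e: "0 < e"
  let ?I = "inner_dist (pull_dist j) S"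
  assume "?I a b + ?I b c < top"
  then have fin: "?I a b < top" "?I b c < top" by auto
  have "?I a b < ?I a b + ennreal (e/2)" "?I b c < ?I b c + ennreal (e/2)"
    using fin e by (auto intro: less_add_ennreal)
  obtain g where g: "continuous_path (pull_dist j) g" "path_len (pull_dist j) g < ?I a b + ennreal (e/2)" "g ` {0..1} \<subseteq> S" "g 0 = a" "g 1 = b"
    using \<open>?I a b < ?I a b + ennreal (e/2)\<close> by (rule inner_dist_lessE)
  obtain h where h: "continuous_path (pull_dist j) h" "path_len (pull_dist j) h < ?I b c + ennreal (e/2)" "h ` {0..1} \<subseteq> S" "h 0 = b" "h 1 = c"
    using \<open>?I b c < ?I b c + ennreal (e/2)\<close> by (rule inner_dist_lessE)
  define \<gamma> where "\<gamma> = (\<lambda>t::real. if t \<le> 1/2 then g (2*t) else h (2*t-1))"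
  have \<gamma>: "\<gamma> 0 = a" "\<gamma> 1 = c" using g h by (auto simp: \<gamma>_def)
  have im: "\<gamma> ` {0..1} \<subseteq> S" using g(3) h(3) by (auto simp: \<gamma>_def image_subset_iff)
  have "continuous_path (pull_dist j) \<gamma>"
  proof -
    have "path (j \<circ> g)" "path (j \<circ> h)" using g(1) h(1) by (auto simp: continuous_path_pull_dist path_def)
    then have "path ((j \<circ> g) +++ (j \<circ> h))" using g(5) h(4)
      by (intro path_join_imp) (auto simp: pathfinish_def pathstart_def)
    moreover have "(j \<circ> g) +++ (j \<circ> h) = j \<circ> \<gamma>" by (auto simp: joinpaths_def \<gamma>_def)
    ultimately show ?thesis by (simp add: continuous_path_pull_dist path_def)
  qed
  moreover have "path_len (pull_dist j) \<gamma> \<le> path_len (pull_dist j) g + path_len (pull_dist j) h"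
  proof (rule path_len_leI)
    fix N and t :: "nat \<Rightarrow> real"
    assume t: "mono t" "range t \<subseteq> {0..1}"
    have t01: "0 \<le> t i" "t i \<le> 1" "t i \<le> t (Suc i)" for i using t by (auto simp: mono_def image_subset_iff)
    \<comment> \<open>A partition of the joined path is clipped to each half. An interval that
      straddles \<open>1/2\<close> is split at the common point \<open>b\<close>, and the triangle
      inequality pays for it.\<close>
    define u where "u i = min (2 * t i) 1" for i
    define v where "v i = max (2 * t i - 1) 0" for i
    have "u a \<le> u b" "v a \<le> v b" if "a \<le> b" for a b
      using monoD[OF t(1) that] by (auto simp: u_def v_def)
    then have uv: "mono u" "mono v" by (auto intro: monoI)
    have ran: "range u \<subseteq> {0..1}" "range v \<subseteq> {0..1}" using t01 by (auto simp: u_def v_def)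
    have key: "ennreal (dist (j (\<gamma> (t i))) (j (\<gamma> (t (Suc i)))))
       \<le> ennreal (dist (j (g (u i))) (j (g (u (Suc i))))) + ennreal (dist (j (h (v i))) (j (h (v (Suc i)))))" for i
    proof -
      have "dist (j (\<gamma> (t i))) (j (\<gamma> (t (Suc i)))) \<le> dist (j (g (u i))) (j (g (u (Suc i)))) + dist (j (h (v i))) (j (h (v (Suc i))))"
      proof -
        consider "t (Suc i) \<le> 1/2" | "t i \<le> 1/2" "t (Suc i) > 1/2" | "t i > 1/2" by linarith
        then show ?thesis
        proof cases
          case 1 then show ?thesis using t01(3)[of i] by (simp add: \<gamma>_def u_def v_def min_def max_def)
        next
          case 2
          then have "\<gamma> (t i) = g (u i)" "\<gamma> (t (Suc i)) = h (v (Suc i))" "g (u (Suc i)) = b" "h (v i) = b"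
            using g h by (auto simp: \<gamma>_def u_def v_def min_def max_def)
          then show ?thesis by (simp add: dist_triangle)
        next
          case 3 then show ?thesis using t01(3)[of i] by (simp add: \<gamma>_def u_def v_def min_def max_def)
        qed
      qed
      then show ?thesis by (simp add: ennreal_plus[symmetric] ennreal_leI del: ennreal_plus)
    qed
    have "(\<Sum>i<N. ennreal (dist (j (\<gamma> (t i))) (j (\<gamma> (t (Suc i))))))
      \<le> (\<Sum>i<N. ennreal (dist (j (g (u i))) (j (g (u (Suc i))))) + ennreal (dist (j (h (v i))) (j (h (v (Suc i))))))"
      by (intro sum_mono key)
    also have "\<dots> \<le> path_len (pull_dist j) g + path_len (pull_dist j) h"
      unfolding sum.distrib
      by (intro add_mono path_len_sum_le[where d = "pull_dist j"] uv ran)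
    finally show "(\<Sum>i<N. ennreal (dist (j (\<gamma> (t i))) (j (\<gamma> (t (Suc i)))))) \<le> path_len (pull_dist j) g + path_len (pull_dist j) h" .
  qed
  moreover have "path_len (pull_dist j) g + path_len (pull_dist j) h \<le> ?I a b + ennreal (e/2) + (?I b c + ennreal (e/2))"
    using g(2) h(2) by (intro add_mono) auto
  moreover have "?I a b + ennreal (e/2) + (?I b c + ennreal (e/2)) = ?I a b + ?I b c + ennreal e"
  proof -
    have "ennreal e = ennreal (e/2) + ennreal (e/2)" using e by (simp add: ennreal_plus[symmetric] del: ennreal_plus)
    then show ?thesis by (simp add: ac_simps)
  qed
  ultimately have le: "path_len (pull_dist j) \<gamma> \<le> ?I a b + ?I b c + ennreal e" by simp
  moreover have "?I a b + ?I b c + ennreal e < top" using fin by simp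
  ultimately have "path_len (pull_dist j) \<gamma> < top" by (rule order.strict_trans1)
  then have "?I a c \<le> path_len (pull_dist j) \<gamma>"
    unfolding inner_dist_def by (intro Inf_lower) (use \<gamma> im \<open>continuous_path (pull_dist j) \<gamma>\<close> in auto)
  then show "?I a c \<le> ?I a b + ?I b c + ennreal e" using le by simp
qed

lemma LNE_bilipschitz:
  assumes C: "C > 0" "\<And>p q. p \<in> S \<Longrightarrow> q \<in> S \<Longrightarrow> d' p q \<le> C * d p q"
    and C': "C' > 0" "\<And>p q. p \<in> S \<Longrightarrow> q \<in> S \<Longrightarrow> d p q \<le> C' * d' p q"
    and nn: "\<And>p q. p \<in> S \<Longrightarrow> q \<in> S \<Longrightarrow> 0 \<le> d p q" and LNE: "LNE d S"
  shows "LNE d' S"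
proof -
  obtain L where L: "L > 0" "\<And>s s'. s \<in> S \<Longrightarrow> s' \<in> S \<Longrightarrow> inner_dist d S s s' \<le> ennreal (L * d s s')"
    using LNE unfolding LNE_def by blast
  have "inner_dist d' S s s' \<le> ennreal (C * L * C' * d' s s')" if s: "s \<in> S" "s' \<in> S" for s s'
  proof -
    have "inner_dist d' S s s' \<le> ennreal (C * (L * d s s'))"
      using C L(2)[OF s] mult_nonneg_nonneg[OF less_imp_le[OF L(1)] nn[OF s]]
      by (intro inner_dist_transfer[of C S d' d S]) blast+
    also have "\<dots> \<le> ennreal (C * L * C' * d' s s')"
    proof (rule ennreal_leI)
      have "(C * L) * d s s' \<le> (C * L) * (C' * d' s s')"
        by (rule mult_left_mono[OF C'(2)[OF s]]) (use C(1) L(1) in simp)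
      then show "C * (L * d s s') \<le> C * L * C' * d' s s'" by (simp only: mult.assoc)
    qed
    finally show ?thesis .
  qed
  moreover have "C * L * C' > 0" using C(1) C'(1) L(1) by simp
  ultimately show ?thesis unfolding LNE_def by blast
qed

text \<open>\<open>\<iota>\<close> embeds \<open>X\<close> in a compact space and \<open>j\<close> is the metric to be studied on the dense part \<open>S\<close>;
  \<open>W\<close> measures how far out a point of \<open>S\<close> is.  Points that are \<open>\<iota>\<close>-close are handled by \<open>loc\<close>; for
  the others, \<open>up\<close> and \<open>low\<close> say that both distances are comparable to \<open>W s + W s'\<close>, and a path can be
  routed through finitely many base points.\<close>

lemma LNE_glue:
  fixes \<iota> :: "'a \<Rightarrow> 'b::metric_space" and j :: "'a \<Rightarrow> 'c::metric_space"
  assumes comp: "compact (\<iota> ` X)" and conn: "connected (\<iota> ` X)" and SX: "S \<subseteq> X"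
    and dense: "\<And>p e. p \<in> X \<Longrightarrow> e > 0 \<Longrightarrow> \<exists>s\<in>S. dist (\<iota> s) (\<iota> p) < e"
    and loc: "\<And>p. p \<in> X \<Longrightarrow> \<exists>e>0. \<exists>C>0. \<forall>s\<in>S. \<forall>s'\<in>S. dist (\<iota> s) (\<iota> p) < e \<longrightarrow> dist (\<iota> s') (\<iota> p) < e \<longrightarrow>
            inner_dist (pull_dist j) S s s' \<le> ennreal (C * dist (j s) (j s'))"
    and B: "B > 0" and W: "\<And>s. s \<in> S \<Longrightarrow> 1 \<le> W s"
    and up: "\<And>s s'. s \<in> S \<Longrightarrow> s' \<in> S \<Longrightarrow> dist (j s) (j s') \<le> B * (W s + W s')"
    and low: "\<And>s s'. s \<in> S \<Longrightarrow> s' \<in> S \<Longrightarrow> dist (\<iota> s) (\<iota> s') * W s \<le> B * dist (j s) (j s')"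
  shows "LNE (pull_dist j) S"
proof -
  let ?I = "inner_dist (pull_dist j) S"
  let ?K = "\<iota> ` X"
  have loc': "\<exists>e>0. \<exists>C>0. \<forall>s\<in>S. \<forall>s'\<in>S. dist (\<iota> s) x < e \<longrightarrow> dist (\<iota> s') x < e \<longrightarrow>
            ?I s s' \<le> ennreal (C * dist (j s) (j s'))" if "x \<in> ?K" for x
    using loc that by blast
  have dense': "\<exists>s\<in>S. dist (\<iota> s) x < e" if "x \<in> ?K" "e > 0" for x e
    using dense that by blast
  \<comment> \<open>Points of \<open>?K\<close> may lie outside the image of \<open>S\<close>, so
    finite inner distance is expressed through all points of \<open>S\<close> near \<open>x\<close>
    and near \<open>y\<close>. This is an equivalence relation with open classes, and connectedness
    leaves a single class.\<close>
  define R where "R x y \<longleftrightarrow> (\<exists>e>0. \<forall>s\<in>S. \<forall>s'\<in>S. dist (\<iota> s) x < e \<longrightarrow> dist (\<iota> s') y < e \<longrightarrow> ?I s s' < top \<and> ?I s' s < top)" for x y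
  have R: "R x y" if "x \<in> ?K" "y \<in> ?K" for x y
  proof (rule connected_equivalence_relation[OF conn that])
    show "R y x" if "R x y" for x y using that unfolding R_def by blast
    show "R x z" if "R x y" "R y z" "x \<in> ?K" "y \<in> ?K" "z \<in> ?K" for x y z
    proof -
      obtain e where e: "e > 0" "\<forall>s\<in>S. \<forall>s'\<in>S. dist (\<iota> s) x < e \<longrightarrow> dist (\<iota> s') y < e \<longrightarrow> ?I s s' < top \<and> ?I s' s < top"
        using \<open>R x y\<close> unfolding R_def by blast
      obtain e' where e': "e' > 0" "\<forall>s\<in>S. \<forall>s'\<in>S. dist (\<iota> s) y < e' \<longrightarrow> dist (\<iota> s') z < e' \<longrightarrow> ?I s s' < top \<and> ?I s' s < top"
        using \<open>R y z\<close> unfolding R_def by blast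
      obtain m where m: "m \<in> S" "dist (\<iota> m) y < min e e'"
        using dense'[OF \<open>y \<in> ?K\<close>, of "min e e'"] e e' by auto
      have "?I s s' < top \<and> ?I s' s < top" if "s \<in> S" "s' \<in> S" "dist (\<iota> s) x < min e e'" "dist (\<iota> s') z < min e e'" for s s'
      proof -
        have "?I s m < top" "?I m s < top" "?I m s' < top" "?I s' m < top" using e e' m that by auto
        then have "?I s m + ?I m s' < top" "?I s' m + ?I m s < top" by auto
        then show ?thesis using inner_dist_triangle[of j S s s' m] inner_dist_triangle[of j S s' s m]
          by (meson order.strict_trans1)
      qed
      then show ?thesis unfolding R_def using e(1) e'(1) by (intro exI[of _ "min e e'"]) auto
    qed
    show "\<exists>T. openin (top_of_set ?K) T \<and> x \<in> T \<and> (\<forall>y\<in>T. R x y)" if x: "x \<in> ?K" for x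
    proof -
      obtain e C where e: "e > 0" "\<forall>s\<in>S. \<forall>s'\<in>S. dist (\<iota> s) x < e \<longrightarrow> dist (\<iota> s') x < e \<longrightarrow> ?I s s' \<le> ennreal (C * dist (j s) (j s'))"
        using loc'[OF x] by blast
      have "R x y" if "dist x y < e/2" for y
        unfolding R_def
      proof (intro exI[of _ "e/2"] conjI ballI impI)
        fix s s' assume s: "s \<in> S" "s' \<in> S" "dist (\<iota> s) x < e/2" "dist (\<iota> s') y < e/2"
        have "dist (\<iota> s') x < e" using dist_triangle[of "\<iota> s'" x y] s(4) that by (simp add: dist_commute)
        moreover have "dist (\<iota> s) x < e" using s(3) e(1) by linarith
        ultimately have "?I s s' \<le> ennreal (C * dist (j s) (j s'))" "?I s' s \<le> ennreal (C * dist (j s') (j s))"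
          using e(2) s by auto
        then show "?I s s' < top" "?I s' s < top" by (meson ennreal_less_top order.strict_trans1)+
      qed (use e in auto)
      then show ?thesis using e(1) x by (intro exI[of _ "?K \<inter> ball x (e/2)"]) auto
    qed
  qed
  have fin: "?I a b < top" if "a \<in> S" "b \<in> S" for a b
  proof -
    have "R (\<iota> a) (\<iota> b)" using that SX by (intro R) auto
    then show ?thesis unfolding R_def using that by (metis dist_self)
  qed
  have pair: "\<exists>e>0. \<exists>C>0. \<forall>s\<in>S. \<forall>s'\<in>S. dist (\<iota> s) x < e \<longrightarrow> dist (\<iota> s') y < e \<longrightarrow>
            ?I s s' \<le> ennreal (C * dist (j s) (j s'))" if xy: "x \<in> ?K" "y \<in> ?K" for x y
  proof (cases "x = y")
    case True then show ?thesis using loc' xy by blast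
  next
    case False
    \<comment> \<open>Once the images of \<open>s\<close> and \<open>s'\<close> lie within
      \<open>c\<close> of \<open>x\<close> and \<open>y\<close>, a third of the distance remains
      between them.\<close>
    define c where "c = dist x y / 3"
    have c: "c > 0" using False by (simp add: c_def)
    obtain e1 C1 where 1: "e1 > 0" "C1 > 0" "\<forall>s\<in>S. \<forall>s'\<in>S. dist (\<iota> s) x < e1 \<longrightarrow> dist (\<iota> s') x < e1 \<longrightarrow> ?I s s' \<le> ennreal (C1 * dist (j s) (j s'))"
      using loc'[OF xy(1)] by blast
    obtain e2 C2 where 2: "e2 > 0" "C2 > 0" "\<forall>s\<in>S. \<forall>s'\<in>S. dist (\<iota> s) y < e2 \<longrightarrow> dist (\<iota> s') y < e2 \<longrightarrow> ?I s s' \<le> ennreal (C2 * dist (j s) (j s'))"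
      using loc'[OF xy(2)] by blast
    obtain a where a: "a \<in> S" "dist (\<iota> a) x < e1" using dense'[OF xy(1) 1(1)] by blast
    obtain b where b: "b \<in> S" "dist (\<iota> b) y < e2" using dense'[OF xy(2) 2(1)] by blast
    obtain M where M: "M \<ge> 0" "?I a b = ennreal M" using fin[OF a(1) b(1)] by (cases "?I a b") auto
    \<comment> \<open>Collects the three legs of the route from \<open>s\<close> through
      \<open>a\<close> and \<open>b\<close> to \<open>s'\<close>; each leg is at most its summand
      times \<open>W s + W s'\<close>.\<close>
    define K where "K = C1 * B * (1 + W a) + M + C2 * B * (1 + W b)"
    have "0 \<le> C1 * B * (1 + W a)" "0 \<le> C2 * B * (1 + W b)"
      using 1 2 B W[OF a(1)] W[OF b(1)] by auto
    then have K: "K \<ge> 0" using M by (simp add: K_def)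
    define e where "e = min c (min e1 e2)"
    have main: "?I s s' \<le> ennreal ((2 * K * B / c + 1) * dist (j s) (j s'))"
      if s: "s \<in> S" "s' \<in> S" "dist (\<iota> s) x < e" "dist (\<iota> s') y < e" for s s'
    proof -
      have "?I s s' \<le> ?I s a + ?I a s'" by (rule inner_dist_triangle)
      also have "\<dots> \<le> ?I s a + (?I a b + ?I b s')" by (intro add_mono inner_dist_triangle order.refl)
      also have "\<dots> \<le> ennreal (C1 * dist (j s) (j a)) + (ennreal M + ennreal (C2 * dist (j b) (j s')))"
        using 1(3) 2(3) s a b M(2) by (intro add_mono) (auto simp: e_def)
      also have "\<dots> = ennreal (C1 * dist (j s) (j a) + (M + C2 * dist (j b) (j s')))"
        using 1 2 M by (simp add: ennreal_plus[symmetric] del: ennreal_plus)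
      also have "\<dots> \<le> ennreal (K * (W s + W s'))"
      proof (rule ennreal_leI)
        have Ws: "1 \<le> W s" "1 \<le> W s'" "1 \<le> W a" "1 \<le> W b" using W s a b by auto
        have "C1 * dist (j s) (j a) \<le> C1 * (B * (W s + W a))"
          using up[OF s(1) a(1)] 1(2) by (intro mult_left_mono) auto
        also have "\<dots> \<le> C1 * (B * ((1 + W a) * (W s + W s')))"
        proof (intro mult_left_mono)
          have "W a * 1 \<le> W a * (W s + W s')" using Ws by (intro mult_left_mono) auto
          then show "W s + W a \<le> (1 + W a) * (W s + W s')" using Ws by (simp add: algebra_simps)
        qed (use 1 B in auto)
        finally have A1: "C1 * dist (j s) (j a) \<le> C1 * B * (1 + W a) * (W s + W s')" by (simp add: mult.assoc)
        have "C2 * dist (j b) (j s') \<le> C2 * (B * (W b + W s'))"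
          using up[OF b(1) s(2)] 2(2) by (intro mult_left_mono) auto
        also have "\<dots> \<le> C2 * (B * ((1 + W b) * (W s + W s')))"
        proof (intro mult_left_mono)
          have "W b * 1 \<le> W b * (W s + W s')" using Ws by (intro mult_left_mono) auto
          then show "W b + W s' \<le> (1 + W b) * (W s + W s')" using Ws by (simp add: algebra_simps)
        qed (use 2 B in auto)
        finally have A2: "C2 * dist (j b) (j s') \<le> C2 * B * (1 + W b) * (W s + W s')" by (simp add: mult.assoc)
        have A3: "M * 1 \<le> M * (W s + W s')" using M(1) Ws by (intro mult_left_mono) auto
        show "C1 * dist (j s) (j a) + (M + C2 * dist (j b) (j s')) \<le> K * (W s + W s')"
          unfolding K_def distrib_right using A1 A2 A3 by linarith
      qed
      \<comment> \<open>The images stay \<open>c\<close> apart, so \<open>low\<close>, applied in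
        both orders, bounds either weight by the distance in \<open>j\<close>.\<close>
      also have "\<dots> \<le> ennreal ((2 * K * B / c + 1) * dist (j s) (j s'))"
      proof (rule ennreal_leI)
        have cs: "c \<le> dist (\<iota> s) (\<iota> s')"
        proof -
          have "dist x y \<le> dist (\<iota> s) x + dist (\<iota> s) (\<iota> s') + dist (\<iota> s') y"
            using dist_triangle[of x y "\<iota> s"] dist_triangle[of "\<iota> s" y "\<iota> s'"] by (simp add: dist_commute)
          then show ?thesis using s by (simp add: c_def e_def)
        qed
        have "c * W s \<le> dist (\<iota> s) (\<iota> s') * W s" using cs W[OF s(1)] by (intro mult_right_mono) auto
        then have w1: "W s \<le> B * dist (j s) (j s') / c" using low[OF s(1,2)] c by (simp add: field_simps)
        have "c * W s' \<le> dist (\<iota> s') (\<iota> s) * W s'" using cs W[OF s(2)] by (intro mult_right_mono) (auto simp: dist_commute)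
        then have w2: "W s' \<le> B * dist (j s) (j s') / c" using low[OF s(2,1)] c by (simp add: field_simps dist_commute)
        have "K * (W s + W s') \<le> K * (2 * (B * dist (j s) (j s') / c))" using w1 w2 K by (intro mult_left_mono) auto
        also have "\<dots> = 2 * K * B / c * dist (j s) (j s')" by simp
        also have "\<dots> \<le> (2 * K * B / c + 1) * dist (j s) (j s')" by (intro mult_right_mono) auto
        finally show "K * (W s + W s') \<le> (2 * K * B / c + 1) * dist (j s) (j s')" .
      qed
      finally show ?thesis .
    qed
    \<comment> \<open>The summand 1 makes the constant positive even when \<open>K\<close> is
      0.\<close>
    have "2 * K * B / c + 1 > 0" using K B c by (simp add: add_nonneg_pos)
    moreover have "e > 0" using c 1 2 by (simp add: e_def)
    ultimately show ?thesis using main by blast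
  qed
  define Q where "Q x y e C \<longleftrightarrow> e > 0 \<and> C > 0 \<and> (\<forall>s\<in>S. \<forall>s'\<in>S. dist (\<iota> s) x < e \<longrightarrow> dist (\<iota> s') y < e \<longrightarrow>
            ?I s s' \<le> ennreal (C * dist (j s) (j s')))" for x y e C
  have "\<forall>x\<in>?K. \<forall>y\<in>?K. \<exists>e C. Q x y e C" unfolding Q_def using pair by blast
  then obtain e C where Q: "\<forall>x\<in>?K. \<forall>y\<in>?K. Q x y (e x y) (C x y)" by metis
  then have eC: "e x y > 0" "C x y > 0"
    "\<lbrakk>s \<in> S; s' \<in> S; dist (\<iota> s) x < e x y; dist (\<iota> s') y < e x y\<rbrakk> \<Longrightarrow> ?I s s' \<le> ennreal (C x y * dist (j s) (j s'))"
    if "x \<in> ?K" "y \<in> ?K" for x y s s'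
    using that unfolding Q_def by blast+
  have "compact (?K \<times> ?K)" by (intro compact_Times comp)
  then obtain D where D: "D \<subseteq> ?K \<times> ?K" "finite D" "?K \<times> ?K \<subseteq> (\<Union>(x,y)\<in>D. ball x (e x y) \<times> ball y (e x y))"
  proof (rule compactE_image[where C = "?K \<times> ?K" and f = "\<lambda>(x,y). ball x (e x y) \<times> ball y (e x y)"])
    show "open (case t of (x, y) \<Rightarrow> ball x (e x y) \<times> ball y (e x y))" for t
      by (auto split: prod.split intro: open_Times)
    show "?K \<times> ?K \<subseteq> (\<Union>c\<in>?K \<times> ?K. case c of (x, y) \<Rightarrow> ball x (e x y) \<times> ball y (e x y))"
    proof
      fix z assume z: "z \<in> ?K \<times> ?K"
      obtain x y where xy: "z = (x, y)" by (cases z)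
      then have "e x y > 0" using eC(1) z by blast
      then have "z \<in> (case z of (x, y) \<Rightarrow> ball x (e x y) \<times> ball y (e x y))" by (simp add: xy)
      then show "z \<in> (\<Union>c\<in>?K \<times> ?K. case c of (x, y) \<Rightarrow> ball x (e x y) \<times> ball y (e x y))" using z by blast
    qed
  qed auto
  \<comment> \<open>The sum dominates every summand, and the added 1 makes it positive also for
    empty \<open>D\<close>.\<close>
  define L where "L = 1 + (\<Sum>(x,y)\<in>D. C x y)"
  have Cpos: "C x y > 0" if "(x,y) \<in> D" for x y using that D(1) eC(2) by blast
  have L1: "L \<ge> 1" unfolding L_def using Cpos by (auto intro!: sum_nonneg simp: less_imp_le)
  have "?I s s' \<le> ennreal (L * dist (j s) (j s'))" if s: "s \<in> S" "s' \<in> S" for s s'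
  proof -
    have "(\<iota> s, \<iota> s') \<in> ?K \<times> ?K" using s SX by auto
    then have "(\<iota> s, \<iota> s') \<in> (\<Union>(x,y)\<in>D. ball x (e x y) \<times> ball y (e x y))" using D(3) by blast
    then obtain x y where xy: "(x,y) \<in> D" "dist (\<iota> s) x < e x y" "dist (\<iota> s') y < e x y"
      by (auto simp: dist_commute)
    then have "?I s s' \<le> ennreal (C x y * dist (j s) (j s'))" using eC(3)[of x y s s'] D(1) s by blast
    also have "\<dots> \<le> ennreal (L * dist (j s) (j s'))"
    proof (intro ennreal_leI mult_right_mono)
      have "(case (x,y) of (x,y) \<Rightarrow> C x y) \<le> (\<Sum>(x,y)\<in>D. C x y)"
        by (rule member_le_sum[OF xy(1)]) (use Cpos D(2) in \<open>auto simp: less_imp_le\<close>)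
      then show "C x y \<le> L" by (simp add: L_def)
    qed auto
    finally show ?thesis .
  qed
  then show ?thesis unfolding LNE_def using L1 by (intro exI[of _ L]) auto
qed

section \<open>The Fubini-Study distance and the projector embedding\<close>

lemma hermitian_add_right: "hermitian z (x + y) = hermitian z x + hermitian z y"
  by (simp add: hermitian_def distrib_left sum.distrib)

lemma hermitian_scale_left: "hermitian (c *s x) z = c * hermitian x z"
  by (simp add: hermitian_def sum_distrib_left mult.assoc)

lemma hermitian_scale_right: "hermitian z (c *s x) = cnj c * hermitian z x"
  by (simp add: hermitian_def sum_distrib_left mult_ac)

lemma cnj_hermitian: "cnj (hermitian x y) = hermitian y x"
  by (simp add: hermitian_def mult.commute)

lemma hermitian_self: "hermitian z z = of_real ((norm z)\<^sup>2)"
  by (rule norm_hermitian[symmetric])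

lemma hermitian_unitary: "unitary A \<Longrightarrow> hermitian (A *v z) (A *v w) = hermitian z w"
  by (simp add: hermitian_adjoint matrix_vector_mul_assoc unitary_left)

lemma norm_hermitian_le: "cmod (hermitian z w) \<le> norm z * norm w"
proof -
  have "cmod (hermitian z w) \<le> (\<Sum>i\<in>UNIV. cmod (z $ i) * cmod (w $ i))"
    unfolding hermitian_def by (rule order.trans[OF norm_sum]) (simp add: norm_mult)
  also have "\<dots> \<le> L2_set (\<lambda>i. cmod (z $ i)) UNIV * L2_set (\<lambda>i. cmod (w $ i)) UNIV"
    using L2_set_mult_ineq[of "\<lambda>i. cmod (z $ i)" "\<lambda>i. cmod (w $ i)" UNIV] by simp
  finally show ?thesis by (simp add: norm_vec_def)
qed

lemma norm_scale_vec: "norm (c *s (z :: complex ^ 'm)) = cmod c * norm z"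
  by (simp add: norm_vec_def norm_mult L2_set_right_distrib)

lemma inner_eq_hermitian: "inner z w = Re (hermitian z w)"
  by (simp add: hermitian_def inner_vec_def inner_complex_def)

definition outer :: "complex ^ 'm \<Rightarrow> complex ^ 'm \<Rightarrow> complex ^ 'm ^ 'm" where
  "outer v w = (\<chi> i j. v $ i * cnj (w $ j))"

lemma inner_outer: "inner (outer a b) (outer c d) = Re (hermitian a c * hermitian d b)"
proof -
  have *: "inner x y = Re (x * cnj y)" for x y by (simp add: inner_complex_def)
  have "hermitian a c * hermitian d b = (\<Sum>i\<in>UNIV. \<Sum>j\<in>UNIV. (a $ i * cnj (c $ i)) * (d $ j * cnj (b $ j)))"
    by (simp add: hermitian_def sum_product)
  moreover have "inner (outer a b) (outer c d) = (\<Sum>i\<in>UNIV. \<Sum>j\<in>UNIV. Re ((a $ i * cnj (b $ j)) * cnj (c $ i * cnj (d $ j))))"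
    by (simp only: inner_vec_def outer_def vec_lambda_beta *)
  moreover have "(a $ i * cnj (b $ j)) * cnj (c $ i * cnj (d $ j)) = (a $ i * cnj (c $ i)) * (d $ j * cnj (b $ j))" for i j
    by (simp only: complex_cnj_mult complex_cnj_cnj mult_ac)
  ultimately show ?thesis by (simp only: Re_sum)
qed

lemma norm_outer: "norm (outer v w) = norm v * norm w"
proof -
  have "(norm (outer v w))\<^sup>2 = (norm v * norm w)\<^sup>2"
    by (simp add: power2_norm_eq_inner inner_outer hermitian_self power_mult_distrib)
  then show ?thesis by simp
qed

lemma bounded_bilinear_outer: "bounded_bilinear outer"
proof
  show "\<exists>K. \<forall>a b. norm (outer a b) \<le> norm a * norm b * K"
    by (intro exI[of _ 1]) (simp add: norm_outer)
qed (simp_all add: outer_def vec_eq_iff algebra_simps)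

text \<open>The orthogonal projector onto the line of \<open>z\<close>, as a matrix. The real inner
  product of matrices is the real part of the Hilbert-Schmidt product.\<close>

definition proj :: "complex ^ 'm \<Rightarrow> complex ^ 'm ^ 'm" where
  "proj z = (1 / inner z z) *\<^sub>R outer z z"

lemma proj_scale: "c \<noteq> 0 \<Longrightarrow> proj (c *s z) = proj z"
proof -
  assume c: "c \<noteq> 0"
  have "outer (c *s z) (c *s z) = (cmod c)\<^sup>2 *\<^sub>R outer z z"
    by (simp only: vec_eq_iff outer_def vector_scaleR_component vec_lambda_beta vector_smult_component
        scaleR_conv_of_real[where 'a = complex] complex_norm_square complex_cnj_mult mult_ac simp_thms)
  moreover have "inner (c *s z) (c *s z) = (cmod c)\<^sup>2 * inner z z"
    by (simp add: power2_norm_eq_inner[symmetric] norm_scale_vec power_mult_distrib)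
  ultimately show ?thesis using c by (simp add: proj_def)
qed

text \<open>The Gram determinant of the pair. It does not change when \<open>z\<close> is added to
  the second argument, so it measures the position of two lines.\<close>

definition gram :: "complex ^ 'm \<Rightarrow> complex ^ 'm \<Rightarrow> real" where
  "gram z w = (norm z)\<^sup>2 * (norm w)\<^sup>2 - (cmod (hermitian z w))\<^sup>2"

lemma gram_commute: "gram z w = gram w z"
  unfolding gram_def by (metis cnj_hermitian complex_mod_cnj mult.commute)

lemma gram_nonneg: "0 \<le> gram z w"
  using norm_hermitian_le[of z w] by (simp add: gram_def power_mult_distrib[symmetric] power_mono)

lemma gram_add: "gram z (z + d) = gram z d"
proof -
  have n: "(norm (z + d))\<^sup>2 = (norm z)\<^sup>2 + 2 * Re (hermitian z d) + (norm d)\<^sup>2"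
    by (simp add: power2_norm_eq_inner inner_add_left inner_add_right inner_commute inner_eq_hermitian[symmetric])
  have "(cmod (of_real r + h))\<^sup>2 = r\<^sup>2 + 2 * r * Re h + (cmod h)\<^sup>2" for r :: real and h
    unfolding cmod_power2 by (simp add: power2_eq_square algebra_simps)
  from this[of "(norm z)\<^sup>2" "hermitian z d"] show ?thesis
    unfolding gram_def n hermitian_add_right hermitian_self by (simp add: power2_eq_square algebra_simps)
qed

lemma gram_le: "gram z w \<le> (norm z)\<^sup>2 * (norm (z - w))\<^sup>2"
proof -
  have "gram z w = gram z (w - z)" using gram_add[of z "w - z"] by simp
  also have "\<dots> \<le> (norm z)\<^sup>2 * (norm (w - z))\<^sup>2" by (simp add: gram_def)
  finally show ?thesis by (simp add: norm_minus_commute)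
qed

text \<open>Both projectors have norm 1 and their inner product is the squared cosine of the angle
  between the lines, so their distance is \<open>sqrt 2\<close> times the sine.\<close>

lemma dist_proj:
  assumes "z \<noteq> 0" "w \<noteq> 0"
  shows "(dist (proj z) (proj w))\<^sup>2 = 2 * gram z w / ((norm z)\<^sup>2 * (norm w)\<^sup>2)"
proof -
  have i: "inner (proj z) (proj w) = (cmod (hermitian z w))\<^sup>2 / ((norm z)\<^sup>2 * (norm w)\<^sup>2)" for z w :: "complex ^ 'a"
  proof -
    have "hermitian z w * hermitian w z = of_real ((cmod (hermitian z w))\<^sup>2)"
      by (metis cnj_hermitian complex_norm_square)
    then have "Re (hermitian z w * hermitian w z) = (cmod (hermitian z w))\<^sup>2" by (metis Re_complex_of_real)
    then show ?thesis by (simp add: proj_def inner_outer power2_norm_eq_inner mult.commute)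
  qed
  have 1: "inner (proj z) (proj z) = 1" if "z \<noteq> 0" for z :: "complex ^ 'a"
    using that by (simp add: i hermitian_self power2_eq_square norm_mult)
  have "(dist (proj z) (proj w))\<^sup>2 = 2 - 2 * inner (proj z) (proj w)"
    by (simp add: dist_norm power2_norm_eq_inner inner_diff_left inner_diff_right 1 assms inner_commute)
  also have "\<dots> = 2 * gram z w / ((norm z)\<^sup>2 * (norm w)\<^sup>2)"
    using assms by (simp add: i gram_def field_simps)
  finally show ?thesis .
qed

lemma dist_proj_unitary:
  assumes "unitary A" "z \<noteq> 0" "w \<noteq> 0"
  shows "dist (proj (A *v z)) (proj (A *v w)) = dist (proj z) (proj w)"
proof -
  have "A *v z \<noteq> 0" "A *v w \<noteq> 0" using assms norm_unitary norm_eq_zero by metis+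
  then have "(dist (proj (A *v z)) (proj (A *v w)))\<^sup>2 = (dist (proj z) (proj w))\<^sup>2"
    using assms by (simp add: dist_proj gram_def norm_unitary hermitian_unitary)
  then show ?thesis by simp
qed

lemma fs_norm_gram: "fs_norm z w = sqrt (gram z w) / (norm z)\<^sup>2"
  unfolding fs_norm_def gram_def by (metis cnj_hermitian complex_mod_cnj)

text \<open>The quotient map to projectors stretches the Fubini-Study norm by exactly
  \<open>sqrt 2\<close>. Integrated, this bounds the chord between two projectors by the length of
  any curve joining the lines.\<close>

lemma has_vector_derivative_proj:
  assumes g: "(\<gamma> has_vector_derivative w) (at t)" and z: "\<gamma> t \<noteq> 0"
  shows "\<exists>D. ((\<lambda>s. proj (\<gamma> s)) has_vector_derivative D) (at t) \<and> norm D = sqrt 2 * fs_norm (\<gamma> t) w"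
proof -
  define z where "z = \<gamma> t"
  let ?n = "inner z z"
  have n: "?n > 0" "?n \<noteq> 0" using assms by (auto simp: z_def)
  have 1: "((\<lambda>s. outer (\<gamma> s) (\<gamma> s)) has_vector_derivative (outer z w + outer w z)) (at t)"
    using bounded_bilinear.has_vector_derivative[OF bounded_bilinear_outer g g] by (simp add: z_def)
  have "((\<lambda>s. inner (\<gamma> s) (\<gamma> s)) has_vector_derivative (inner z w + inner w z)) (at t)"
    using bounded_bilinear.has_vector_derivative[OF bounded_bilinear_inner g g] by (simp add: z_def)
  then have "((\<lambda>s. inner (\<gamma> s) (\<gamma> s)) has_field_derivative (2 * inner z w)) (at t)"
    by (simp add: has_real_derivative_iff_has_vector_derivative inner_commute)
  then have 2: "((\<lambda>s. 1 / inner (\<gamma> s) (\<gamma> s)) has_field_derivative (- (2 * inner z w) / ?n\<^sup>2)) (at t)"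
    using n by (auto intro!: derivative_eq_intros simp: z_def power2_eq_square)
  define D where "D = (1/?n) *\<^sub>R (outer z w + outer w z) + (- (2 * inner z w) / ?n\<^sup>2) *\<^sub>R outer z z"
  have D: "((\<lambda>s. proj (\<gamma> s)) has_vector_derivative D) (at t)"
    unfolding proj_def D_def using has_vector_derivative_scaleR[OF 2 1] by (simp add: z_def)
  define a where "a = hermitian w z"
  have a': "hermitian z w = cnj a" by (simp add: a_def cnj_hermitian)
  have za: "inner z w = Re a" by (simp add: inner_eq_hermitian a')
  have hz: "hermitian z z = of_real ?n" "hermitian w w = of_real (inner w w)"
    by (simp_all add: hermitian_self power2_norm_eq_inner)
  have "(norm D)\<^sup>2 = 2 * gram z w / ?n\<^sup>2"
    unfolding power2_norm_eq_inner D_def inner_add_left inner_add_right inner_scaleR_left inner_scaleR_right inner_outer hz a' a_def[symmetric] za gram_def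
    using n by (simp add: field_simps power2_eq_square inner_complex_def)
  also have "\<dots> = (sqrt 2 * fs_norm z w)\<^sup>2"
    by (simp add: fs_norm_gram power_mult_distrib power_divide gram_nonneg power2_norm_eq_inner)
  finally have "norm D = sqrt 2 * fs_norm z w"
    by (rule power2_eq_imp_eq) (auto simp: fs_norm_gram gram_nonneg)
  with D show ?thesis unfolding z_def by blast
qed

lemma dist_proj_le_fs_len:
  assumes "\<gamma> piecewise_C1_differentiable_on {0..1}" "\<forall>t\<in>{0..1}. \<gamma> t \<noteq> 0"
    and l: "((\<lambda>t. fs_norm (\<gamma> t) (vector_derivative \<gamma> (at t))) has_integral l) {0..1}"
  shows "dist (proj (\<gamma> 0)) (proj (\<gamma> 1)) \<le> sqrt 2 * l"
proof -
  obtain S where S: "finite S" "\<gamma> C1_differentiable_on ({0..1} - S)" and cont: "continuous_on {0..1} \<gamma>"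
    using assms(1) unfolding piecewise_C1_differentiable_on_def by blast
  let ?N = "\<lambda>t. sqrt 2 * fs_norm (\<gamma> t) (vector_derivative \<gamma> (at t))"
  have "\<exists>D. ((\<lambda>s. proj (\<gamma> s)) has_vector_derivative D) (at t) \<and> norm D = ?N t" if "t \<in> {0<..<1} - S" for t
  proof (rule has_vector_derivative_proj)
    show "(\<gamma> has_vector_derivative vector_derivative \<gamma> (at t)) (at t)"
      using S(2) that by (auto simp: C1_differentiable_on_eq vector_derivative_works)
  qed (use assms that in auto)
  then obtain D where D: "\<And>t. t \<in> {0<..<1} - S \<Longrightarrow> ((\<lambda>s. proj (\<gamma> s)) has_vector_derivative D t) (at t) \<and> norm (D t) = ?N t"
    by metis
  \<comment> \<open>The value 0 at the break points and end points keeps the bound by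
    \<open>?N\<close> valid everywhere, and the fundamental theorem tolerates finitely many
    exceptions.\<close>
  define D' where "D' t = (if t \<in> {0<..<1} - S then D t else 0)" for t
  have "(D' has_integral (proj (\<gamma> 1) - proj (\<gamma> 0))) {0..1}"
  proof (rule fundamental_theorem_of_calculus_interior_strong[OF S(1)])
    have "continuous_on {0..1} (\<lambda>t. inner (\<gamma> t) (\<gamma> t))" "continuous_on {0..1} (\<lambda>t. outer (\<gamma> t) (\<gamma> t))"
      by (intro bounded_bilinear.continuous_on[OF bounded_bilinear_outer cont cont] continuous_on_inner[OF cont cont])+
    then show "continuous_on {0..1} (\<lambda>s. proj (\<gamma> s))" unfolding proj_def
      using assms(2) cont by (intro continuous_intros) auto
  qed (use D in \<open>auto simp: D'_def\<close>)
  moreover have "norm (D' t) \<le> ?N t" for t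
    using D by (auto simp: D'_def fs_norm_gram gram_nonneg)
  moreover have "(?N has_integral sqrt 2 * l) {0..1}" using l by (rule has_integral_mult_right)
  ultimately have "norm (proj (\<gamma> 1) - proj (\<gamma> 0)) \<le> sqrt 2 * l"
    using integral_norm_bound_integral[of D' "{0..1}" ?N] by (auto simp: has_integral_iff)
  then show ?thesis by (simp add: dist_norm norm_minus_commute)
qed

definition rep :: "'n::finite cproj \<Rightarrow> complex ^ ('n option)" where
  "rep p = (SOME z. z \<in> Rep_cproj p \<and> z \<noteq> 0)"

lemma rep: "rep p \<in> Rep_cproj p" "rep p \<noteq> 0"
proof -
  obtain v where "v \<noteq> 0" "Rep_cproj p = range (\<lambda>c. c *s v)" by (rule cproj_line)
  then have "v \<in> Rep_cproj p \<and> v \<noteq> 0" by (metis rangeI vector_smult_lid)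
  then have "rep p \<in> Rep_cproj p \<and> rep p \<noteq> 0" unfolding rep_def by (rule someI)
  then show "rep p \<in> Rep_cproj p" "rep p \<noteq> 0" by auto
qed

lemma Rep_cproj_eq: assumes "z \<in> Rep_cproj p" "z \<noteq> 0" shows "Rep_cproj p = range (\<lambda>c. c *s z)"
proof -
  obtain v where v: "v \<noteq> 0" "Rep_cproj p = range (\<lambda>c. c *s v)" by (rule cproj_line)
  obtain c where c: "z = c *s v" using assms v by auto
  then have "c \<noteq> 0" using assms by auto
  then have "v = inverse c *s z" by (simp add: c)
  then have "range (\<lambda>c. c *s v) \<subseteq> range (\<lambda>c. c *s z)" by auto
  moreover have "range (\<lambda>c. c *s z) \<subseteq> range (\<lambda>c. c *s v)" using c by auto
  ultimately show ?thesis using v by auto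
qed

definition pt :: "complex ^ ('n option) \<Rightarrow> 'n::finite cproj" where
  "pt z = Abs_cproj (range (\<lambda>c. c *s z))"

lemma Rep_pt: assumes "z \<noteq> 0" shows "Rep_cproj (pt z) = range (\<lambda>c. c *s z)"
proof -
  have "vec.independent {z}" using assms by (simp add: vec.dependent_single)
  then have "vec.dim (vec.span {z}) = 1" using vec.dim_span_eq_card_independent[of "{z}"] by simp
  then show ?thesis unfolding pt_def
    by (intro Abs_cproj_inverse) (simp add: vec.span_singleton[symmetric])
qed

lemma pt_rep: assumes "z \<in> Rep_cproj p" "z \<noteq> 0" shows "pt z = p"
  using Rep_pt[OF assms(2)] Rep_cproj_eq[OF assms] Rep_cproj_inject by metis

lemma pt_self: "z \<noteq> 0 \<Longrightarrow> z \<in> Rep_cproj (pt z)"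
  by (metis Rep_pt rangeI vector_smult_lid)

text \<open>Sends a line to the orthogonal projector onto it; the Fubini-Study distance is equivalent to the
  distance of projectors.\<close>

definition emb :: "'n::finite cproj \<Rightarrow> complex ^ ('n option) ^ ('n option)" where
  "emb p = proj (rep p)"

lemma emb_eq: assumes "z \<in> Rep_cproj p" "z \<noteq> 0" shows "emb p = proj z"
proof -
  obtain c where "rep p = c *s z" using Rep_cproj_eq[OF assms] rep by blast
  moreover from this have "c \<noteq> 0" using rep[of p] by auto
  ultimately show ?thesis by (simp add: emb_def proj_scale)
qed

text \<open>Any curve is at least as long as the chord in the space of projectors. Conversely, the
  straight segment between unit representatives with matching phases is a curve of comparable
  length.\<close>

lemma fs_dist_bounds:
  "dist (emb p) (emb q) \<le> 2 * fs_dist p q" "fs_dist p q \<le> 2 * dist (emb p) (emb q)"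
proof -
  let ?L = "{l. \<exists>\<gamma>. \<gamma> piecewise_C1_differentiable_on {0..1} \<and> (\<forall>t\<in>{0..1}. \<gamma> t \<noteq> 0) \<and>
               \<gamma> 0 \<in> Rep_cproj p \<and> \<gamma> 1 \<in> Rep_cproj q \<and>
               ((\<lambda>t. fs_norm (\<gamma> t) (vector_derivative \<gamma> (at t))) has_integral l) {0..1}}"
  have low: "dist (emb p) (emb q) / sqrt 2 \<le> l" if l: "l \<in> ?L" for l
  proof -
    obtain \<gamma> where g: "\<gamma> piecewise_C1_differentiable_on {0..1}" "\<forall>t\<in>{0..1}. \<gamma> t \<noteq> 0"
               "\<gamma> 0 \<in> Rep_cproj p" "\<gamma> 1 \<in> Rep_cproj q"
               "((\<lambda>t. fs_norm (\<gamma> t) (vector_derivative \<gamma> (at t))) has_integral l) {0..1}"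
      using l by blast
    have "emb p = proj (\<gamma> 0)" "emb q = proj (\<gamma> 1)" using g by (auto intro: emb_eq)
    then show ?thesis using dist_proj_le_fs_len[OF g(1,2,5)] by (simp add: field_simps)
  qed
  have ex: "\<exists>l\<in>?L. l \<le> 2 * dist (emb p) (emb q)"
  proof -
    define u where "u = (1 / of_real (norm (rep p))) *s rep p"
    define v0 where "v0 = (1 / of_real (norm (rep q))) *s rep q"
    have u: "norm u = 1" "u \<in> Rep_cproj p"
      using rep(2)[of p] Rep_cproj_eq[OF rep, of p] by (auto simp: u_def norm_scale_vec norm_divide)
    have v0: "norm v0 = 1" "v0 \<in> Rep_cproj q"
      using rep(2)[of q] Rep_cproj_eq[OF rep, of q] by (auto simp: v0_def norm_scale_vec norm_divide)
    define h where "h = hermitian u v0"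
    \<comment> \<open>The phase of \<open>h\<close> is moved into \<open>v\<close>, so that
      \<open>hermitian u v\<close> becomes the nonnegative real number \<open>c\<close>; this brings
      the two unit representatives as close as possible.\<close>
    define ph where "ph = (if h = 0 then 1 else h / of_real (cmod h))"
    have ph: "cmod ph = 1" by (simp add: ph_def norm_divide)
    define v where "v = ph *s v0"
    have v0': "v0 \<noteq> 0" "u \<noteq> 0" using v0 u by auto
    have v: "norm v = 1" "v \<in> Rep_cproj q"
      using v0 ph Rep_cproj_eq[OF v0(2)] v0' by (auto simp: v_def norm_scale_vec)
    define c where "c = cmod h"
    have c: "hermitian u v = of_real c" "0 \<le> c"
    proof -
      have "h * cnj h = of_real (cmod h) * of_real (cmod h)" by (metis complex_norm_square power2_eq_square of_real_mult)
      then show "hermitian u v = of_real c" by (simp add: v_def hermitian_scale_right h_def[symmetric] ph_def c_def mult.commute field_simps)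
    qed (simp add: c_def)
    have uv: "u \<noteq> 0" "v \<noteq> 0" using u v by auto
    have emb: "emb p = proj u" "emb q = proj v" using uv u v by (auto intro: emb_eq)
    have iuv: "inner u v = c" by (simp add: inner_eq_hermitian c)
    have d2: "(dist (emb p) (emb q))\<^sup>2 = 2 * (1 - c\<^sup>2)"
      using dist_proj[OF uv] by (simp add: emb gram_def u v c)
    have n2: "(norm (u - v))\<^sup>2 = 2 * (1 - c)"
    proof -
      have "inner u u = 1" "inner v v = 1" using u v by (simp_all add: dot_square_norm)
      then show ?thesis by (simp add: power2_norm_eq_inner inner_diff_left inner_diff_right iuv inner_commute[of v u])
    qed
    have c1: "c \<le> 1" using norm_hermitian_le[of u v] c u v by simp
    \<comment> \<open>For \<open>0 \<le> c\<close> and \<open>c \<le> 1\<close>,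
      \<open>1 - c\<close> is at most 1 minus the square of \<open>c\<close>.\<close>
    have le: "norm (u - v) \<le> dist (emb p) (emb q)"
    proof (rule power2_le_imp_le)
      have "c\<^sup>2 \<le> c" using c c1 by (simp add: power2_eq_square mult_left_le)
      then show "(norm (u - v))\<^sup>2 \<le> (dist (emb p) (emb q))\<^sup>2" by (simp add: d2 n2)
    qed simp
    define \<gamma> where "\<gamma> t = (1 - t) *\<^sub>R u + t *\<^sub>R v" for t :: real
    have dg: "(\<gamma> has_vector_derivative (v - u)) (at t)" for t
      unfolding \<gamma>_def by (auto intro!: derivative_eq_intros simp: has_vector_derivative_def algebra_simps)
    have "\<gamma> C1_differentiable_on {0..1}"
      unfolding C1_differentiable_on_def by (intro exI[of _ "\<lambda>_. v - u"]) (use dg in auto)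
    then have pw: "\<gamma> piecewise_C1_differentiable_on {0..1}" by (rule C1_differentiable_imp_piecewise)
    have vd: "vector_derivative \<gamma> (at t) = v - u" for t using dg by (rule vector_derivative_at)
    \<comment> \<open>A nonnegative inner product keeps the chord away from 0, so its Fubini-Study
      speed is at most twice its Euclidean speed.\<close>
    have ng: "(norm (\<gamma> t))\<^sup>2 \<ge> 1/2" if "t \<in> {0..1}" for t
    proof -
      have "(norm (\<gamma> t))\<^sup>2 = (1-t)\<^sup>2 + t\<^sup>2 + 2 * (t * (1-t) * c)"
      proof -
        have "inner u u = 1" "inner v v = 1" "inner v u = c" using u v iuv by (simp_all add: dot_square_norm inner_commute)
        then show ?thesis unfolding power2_norm_eq_inner \<gamma>_def
          by (simp add: inner_add_left inner_add_right iuv) (simp add: power2_eq_square algebra_simps)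
      qed
      moreover have "0 \<le> t * (1-t) * c" using that c by auto
      moreover have "(1-t)\<^sup>2 + t\<^sup>2 - 1/2 = 2 * (t - 1/2)\<^sup>2" by (simp add: power2_eq_square field_simps)
      ultimately show ?thesis using zero_le_power2[of "t-1/2"] by linarith
    qed
    then have g0: "\<forall>t\<in>{0..1}. \<gamma> t \<noteq> 0" by fastforce
    have cont: "continuous_on {0..1} \<gamma>" unfolding \<gamma>_def by (intro continuous_intros)
    have "continuous_on {0..1} (\<lambda>t. fs_norm (\<gamma> t) (v - u))"
      unfolding fs_norm_def hermitian_def using g0 by (intro continuous_intros cont) auto
    then have "(\<lambda>t. fs_norm (\<gamma> t) (v - u)) integrable_on {0..1}" by (rule integrable_continuous_real)
    then obtain l where l: "((\<lambda>t. fs_norm (\<gamma> t) (v - u)) has_integral l) {0..1}" by blast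
    have "l \<le> 2 * norm (u - v)"
    proof -
      have "fs_norm (\<gamma> t) (v - u) \<le> 2 * norm (u - v)" if t: "t \<in> {0..1}" for t
      proof -
        have gp: "norm (\<gamma> t) > 0" using g0 t by simp
        have n12: "norm (\<gamma> t) \<ge> 1/2"
          by (rule power2_le_imp_le) (use ng[OF t] in \<open>auto simp: power2_eq_square\<close>)
        have "sqrt (gram (\<gamma> t) (v - u)) \<le> sqrt ((norm (\<gamma> t))\<^sup>2 * (norm (v - u))\<^sup>2)"
          by (simp add: gram_def)
        also have "\<dots> = norm (\<gamma> t) * norm (v - u)" by (simp add: real_sqrt_mult)
        finally have "fs_norm (\<gamma> t) (v - u) \<le> norm (v - u) / norm (\<gamma> t)"
          unfolding fs_norm_gram using gp by (simp add: field_simps power2_eq_square)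
        also have "\<dots> \<le> norm (v - u) / (1/2)" using n12 by (intro divide_left_mono) (use gp in auto)
        finally show ?thesis by (simp add: norm_minus_commute)
      qed
      then show ?thesis using has_integral_le[OF l has_integral_const_real[of "2 * norm (u - v)" 0 1]] by simp
    qed
    moreover have "l \<in> ?L"
      using pw g0 l u v by (intro CollectI exI[of _ \<gamma>]) (auto simp: vd \<gamma>_def)
    ultimately show ?thesis using le by - (rule bexI[of _ l], linarith, assumption)
  qed
  have bdd: "bdd_below ?L" using low by (intro bdd_belowI) blast
  obtain l where l: "l \<in> ?L" "l \<le> 2 * dist (emb p) (emb q)" using ex by blast
  show "fs_dist p q \<le> 2 * dist (emb p) (emb q)"
    unfolding fs_dist_def using cInf_lower[OF l(1) bdd] l(2) by linarith
  have fs: "dist (emb p) (emb q) / sqrt 2 \<le> fs_dist p q"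
    unfolding fs_dist_def by (rule cInf_greatest) (use l low in auto)
  have "sqrt 2 \<le> (2::real)" by (simp add: real_le_lsqrt)
  have "dist (emb p) (emb q) / 2 \<le> dist (emb p) (emb q) / sqrt 2"
    by (intro divide_left_mono) (use \<open>sqrt 2 \<le> 2\<close> in auto)
  then show "dist (emb p) (emb q) \<le> 2 * fs_dist p q" using fs by linarith
qed

lemma LNE_fs_dist_iff: "LNE fs_dist X \<longleftrightarrow> LNE (pull_dist emb) X"
proof
  assume "LNE fs_dist X"
  then show "LNE (pull_dist emb) X"
  proof (rule LNE_bilipschitz[of 2 X "pull_dist emb" fs_dist 2, rotated 5])
    show "0 \<le> fs_dist p q" for p q :: "'a cproj"
      using fs_dist_bounds(1)[of p q] zero_le_dist[of "emb p" "emb q"] by linarith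
  qed (use fs_dist_bounds in auto)
next
  assume "LNE (pull_dist emb) X"
  then show "LNE fs_dist X"
    by (rule LNE_bilipschitz[of 2 X fs_dist "pull_dist emb" 2, rotated 5]) (use fs_dist_bounds in auto)
qed

section \<open>Zero sets of homogeneous polynomials\<close>

lemma homogeneous_poly_scale: "homogeneous_poly d F \<Longrightarrow> F (c *s z) = c ^ d * F z"
  unfolding homogeneous_poly_def
  by (elim exE) (simp add: power_mult_distrib prod.distrib sum_distrib_left mult_ac power_sum[symmetric])

lemma homogeneous_poly_continuous: "homogeneous_poly d F \<Longrightarrow> continuous_on UNIV F"
proof -
  assume "homogeneous_poly d F"
  then obtain c where "F = (\<lambda>z. (\<Sum>\<alpha> | (\<Sum>i\<in>UNIV. \<alpha> i) = d. c \<alpha> * (\<Prod>i\<in>UNIV. (z $ i) ^ \<alpha> i)))"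
    unfolding homogeneous_poly_def by blast
  then show ?thesis by (simp only:) (intro continuous_intros)
qed

text \<open>Homogeneity makes vanishing independent of the representative, so one nonzero vector
  decides membership.\<close>

lemma algebraic_subset_cone:
  assumes "algebraic_subset X"
  obtains \<F> where "finite \<F>" "\<And>F. F \<in> \<F> \<Longrightarrow> \<exists>d. homogeneous_poly d F"
    "\<And>p z. z \<in> Rep_cproj p \<Longrightarrow> z \<noteq> 0 \<Longrightarrow> p \<in> X \<longleftrightarrow> (\<forall>F\<in>\<F>. F z = 0)"
proof -
  obtain \<F> where F: "finite \<F>" "\<forall>F\<in>\<F>. \<exists>d. homogeneous_poly d F" "X = {p. \<forall>F\<in>\<F>. \<forall>z\<in>Rep_cproj p. F z = 0}"
    using assms unfolding algebraic_subset_def by blast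
  have "p \<in> X \<longleftrightarrow> (\<forall>F\<in>\<F>. F z = 0)" if z: "z \<in> Rep_cproj p" "z \<noteq> 0" for p z
  proof -
    have "F y = 0" if F': "F \<in> \<F>" "F z = 0" "y \<in> Rep_cproj p" for F y
    proof -
      obtain c where c: "y = c *s z" using Rep_cproj_eq[OF z] F'(3) by blast
      obtain d where "homogeneous_poly d F" using F(2) F'(1) by blast
      from homogeneous_poly_scale[OF this] show ?thesis by (simp add: c F'(2))
    qed
    then show ?thesis using z unfolding F(3) by blast
  qed
  from that[OF F(1) bspec[OF F(2)] this] show ?thesis .
qed

lemma continuous_on_proj: "0 \<notin> S \<Longrightarrow> continuous_on S proj"
  unfolding proj_def
  by (intro continuous_intros bounded_bilinear.continuous_on[OF bounded_bilinear_outer]) auto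

text \<open>The unit vectors of the cone form a compact set, and \<open>proj\<close> maps it
  continuously onto the image of \<open>X\<close>.\<close>

lemma compact_emb: assumes "algebraic_subset X" shows "compact (emb ` X)"
proof -
  obtain \<F> where F: "finite \<F>" "\<And>F. F \<in> \<F> \<Longrightarrow> \<exists>d. homogeneous_poly d F"
    "\<And>p z. z \<in> Rep_cproj p \<Longrightarrow> z \<noteq> 0 \<Longrightarrow> p \<in> X \<longleftrightarrow> (\<forall>F\<in>\<F>. F z = 0)"
    using algebraic_subset_cone[OF assms] by blast
  let ?S = "sphere 0 1 \<inter> (\<Inter>F\<in>\<F>. {z. F z = 0})"
  have "closed {z. F z = 0}" if "F \<in> \<F>" for F
    using closed_vimage[of "{0}" F] F(2)[OF that] homogeneous_poly_continuous by (auto simp: vimage_def)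
  then have "compact ?S" by (intro compact_Int_closed compact_sphere closed_INT) auto
  then have "compact (proj ` ?S)" by (intro compact_continuous_image continuous_on_proj) auto
  moreover have "proj ` ?S = emb ` X"
  proof (intro equalityI subsetI)
    fix m assume "m \<in> proj ` ?S"
    then obtain z where z: "m = proj z" "norm z = 1" "\<forall>F\<in>\<F>. F z = 0" by auto
    then have "z \<noteq> 0" by auto
    then have "pt z \<in> X" "emb (pt z) = m" using z F(3)[OF pt_self] emb_eq[OF pt_self] by auto
    then show "m \<in> emb ` X" by blast
  next
    fix m assume "m \<in> emb ` X"
    then obtain p where p: "p \<in> X" "m = emb p" by blast
    define z where "z = (1 / of_real (norm (rep p))) *s rep p"
    have z: "norm z = 1" "z \<in> Rep_cproj p"
      using rep(2)[of p] Rep_cproj_eq[OF rep, of p] by (auto simp: z_def norm_scale_vec norm_divide)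
    then have "z \<noteq> 0" by auto
    then show "m \<in> proj ` ?S" using p z F(3)[OF z(2)] emb_eq[OF z(2)] by (intro image_eqI[of _ _ z]) auto
  qed
  ultimately show ?thesis by simp
qed

section \<open>Affine charts\<close>

lemma matrix_smult: "A *v (c *s z) = c *s (A *v (z :: complex ^ 'm))"
  by (simp add: vector_scalar_commute)

definition adj :: "complex ^ 'm ^ 'm \<Rightarrow> complex ^ 'm ^ 'm" where
  "adj A = (\<chi> i j. cnj (A $ j $ i))"

lemma adj_inverse:
  assumes "unitary A"
  shows "adj A *v (A *v z) = z" "A *v (adj A *v z) = z"
  using assms unitary_left[OF assms] by (simp_all add: adj_def matrix_vector_mul_assoc unitary_def)

text \<open>For unitary \<open>A\<close>, the sine of the angle between the line \<open>p\<close>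
  and the hyperplane at infinity. Off that hyperplane it is the reciprocal of
  \<open>norm (affine_vec x)\<close>, by \<open>hval_chart\<close>.\<close>

definition hval :: "complex ^ ('n option) ^ ('n option) \<Rightarrow> 'n::finite cproj \<Rightarrow> real" where
  "hval A p = cmod ((A *v rep p) $ None) / norm (rep p)"

lemma Rep_scale: assumes "z \<in> Rep_cproj p" "z \<noteq> 0" "w \<in> Rep_cproj p" obtains c where "w = c *s z"
  using Rep_cproj_eq[OF assms(1,2)] assms(3) by blast

lemma Rep_smult: assumes "z \<in> Rep_cproj p" shows "c *s z \<in> Rep_cproj p"
proof -
  obtain v where v: "v \<noteq> 0" "Rep_cproj p = range (\<lambda>c. c *s v)" by (rule cproj_line)
  then show ?thesis using assms by auto
qed

lemma hval_eq: assumes "z \<in> Rep_cproj p" "z \<noteq> 0" shows "hval A p = cmod ((A *v z) $ None) / norm z"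
proof -
  obtain c where c: "rep p = c *s z" using Rep_scale[OF assms rep(1)] .
  then have "c \<noteq> 0" using rep[of p] by auto
  then show ?thesis by (simp add: hval_def c matrix_smult norm_scale_vec norm_mult)
qed

lemma hyperplane_at_inf_iff:
  assumes "z \<in> Rep_cproj p" "z \<noteq> 0" shows "p \<in> hyperplane_at_inf A \<longleftrightarrow> (A *v z) $ None = 0"
proof -
  have "(A *v y) $ None = 0" if "(A *v z) $ None = 0" "y \<in> Rep_cproj p" for y
    using Rep_scale[OF assms that(2)] that(1) by (metis matrix_smult mult_zero_right vector_smult_component)
  then show ?thesis using assms(1) unfolding hyperplane_at_inf_def by blast
qed

lemma hval_zero_iff: "hval A p = 0 \<longleftrightarrow> p \<in> hyperplane_at_inf A"
  using hyperplane_at_inf_iff[OF rep, of p A] rep(2)[of p] by (simp add: hval_def)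

lemma hval_nonneg: "0 \<le> hval A p" by (simp add: hval_def)

text \<open>The squared height is a diagonal entry of the projector in the coordinates
  \<open>A\<close>, and an entry changes by no more than the matrix.\<close>

lemma hval_lipschitz: assumes "unitary A" shows "\<bar>(hval A p)\<^sup>2 - (hval A q)\<^sup>2\<bar> \<le> dist (emb p) (emb q)"
proof -
  have v: "proj (A *v rep p) $ None $ None = of_real ((hval A p)\<^sup>2)" for p
  proof -
    have "proj (A *v rep p) $ None $ None = (1 / inner (A *v rep p) (A *v rep p)) *\<^sub>R of_real ((cmod ((A *v rep p) $ None))\<^sup>2)"
      by (simp only: proj_def outer_def vector_scaleR_component vec_lambda_beta complex_norm_square)
    also have "inner (A *v rep p) (A *v rep p) = (norm (rep p))\<^sup>2"
      using norm_unitary[OF assms] by (metis power2_norm_eq_inner)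
    finally show ?thesis by (simp add: hval_def power_divide scaleR_conv_of_real)
  qed
  have "\<bar>(hval A p)\<^sup>2 - (hval A q)\<^sup>2\<bar> = cmod ((proj (A *v rep p) - proj (A *v rep q)) $ None $ None)"
    by (simp only: vector_minus_component v of_real_diff[symmetric] norm_of_real)
  also have "\<dots> \<le> norm (proj (A *v rep p) - proj (A *v rep q))"
    by (meson Finite_Cartesian_Product.norm_nth_le order.trans)
  also have "\<dots> = dist (emb p) (emb q)"
    using dist_proj_unitary[OF assms rep(2) rep(2), of p q] by (simp only: dist_norm emb_def)
  finally show ?thesis .
qed

lemma affine_vec_None: "affine_vec x $ None = 1" by (simp add: affine_vec_def)
lemma affine_vec_Some: "affine_vec x $ Some i = x $ i" by (simp add: affine_vec_def)

lemma affine_vec_nonzero: "affine_vec x \<noteq> 0"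
  by (metis affine_vec_None zero_index zero_neq_one)

lemma norm_affine_vec: "(norm (affine_vec x))\<^sup>2 = 1 + (norm x)\<^sup>2"
  unfolding norm_vec_def L2_set_def UNIV_option_sum
  by (simp add: affine_vec_None affine_vec_Some add_nonneg_nonneg sum_nonneg)

lemma norm_affine_vec_ge: "1 \<le> norm (affine_vec x)" "norm x \<le> norm (affine_vec x)"
  by (rule power2_le_imp_le; simp add: norm_affine_vec)+

lemma chart_eqI:
  assumes A: "unitary A" and z: "z \<in> Rep_cproj p" "A *v z = c *s affine_vec x" "c \<noteq> 0"
  shows "p \<notin> hyperplane_at_inf A" "affine_chart A p = x"
proof -
  have "(A *v z) $ None \<noteq> 0" using z by (simp add: affine_vec_None)
  then show p: "p \<notin> hyperplane_at_inf A" using z(1) unfolding hyperplane_at_inf_def by blast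
  have "A *v (inverse c *s z) = affine_vec x" using z by (simp add: matrix_smult)
  then have "affine_vec x \<in> (\<lambda>z. A *v z) ` Rep_cproj p" using Rep_smult[OF z(1)] by (metis image_eqI)
  then show "affine_chart A p = x" using affine_chart_works[OF A p] by blast
qed

lemma chart_eq:
  assumes A: "unitary A" and z: "z \<in> Rep_cproj p" "(A *v z) $ None \<noteq> 0"
  shows "affine_chart A p = (\<chi> i. (A *v z) $ Some i / (A *v z) $ None)"
  by (rule chart_eqI(2)[OF A z(1) _ z(2)])
    (use z(2) in \<open>auto simp: vec_eq_iff affine_vec_def split: option.split\<close>)

lemma chart_vec:
  assumes A: "unitary A" and p: "p \<notin> hyperplane_at_inf A"
  shows "adj A *v affine_vec (affine_chart A p) \<in> Rep_cproj p"
  using affine_chart_works(2)[OF A p] adj_inverse(1)[OF A] by auto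

lemma adj_affine_nonzero: assumes "unitary A" shows "adj A *v affine_vec x \<noteq> 0"
  by (metis adj_inverse(2)[OF assms] affine_vec_nonzero matrix_vector_mult_0_right)

definition unchart :: "complex ^ ('n option) ^ ('n option) \<Rightarrow> complex ^ 'n \<Rightarrow> 'n::finite cproj" where
  "unchart A x = pt (adj A *v affine_vec x)"

lemma unchart: assumes A: "unitary A"
  shows "unchart A x \<notin> hyperplane_at_inf A" "affine_chart A (unchart A x) = x"
    "adj A *v affine_vec x \<in> Rep_cproj (unchart A x)"
proof -
  show 1: "adj A *v affine_vec x \<in> Rep_cproj (unchart A x)"
    unfolding unchart_def by (rule pt_self) (rule adj_affine_nonzero[OF A])
  have "A *v (adj A *v affine_vec x) = 1 *s affine_vec x" by (simp add: adj_inverse[OF A])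
  from chart_eqI[OF A 1 this] show "unchart A x \<notin> hyperplane_at_inf A" "affine_chart A (unchart A x) = x" by auto
qed

lemma unchart_chart: assumes "unitary A" "p \<notin> hyperplane_at_inf A" shows "unchart A (affine_chart A p) = p"
  unfolding unchart_def by (rule pt_rep) (use assms in \<open>auto simp: chart_vec adj_affine_nonzero\<close>)

lemma in_chart_iff: assumes "unitary A" shows "x \<in> in_chart A X \<longleftrightarrow> unchart A x \<in> X"
proof
  assume "x \<in> in_chart A X"
  then obtain q where "q \<in> X" "q \<notin> hyperplane_at_inf A" "x = affine_chart A q" unfolding in_chart_def by blast
  then show "unchart A x \<in> X" by (simp add: unchart_chart[OF assms])
next
  assume "unchart A x \<in> X"
  then show "x \<in> in_chart A X" unfolding in_chart_def
    using unchart[OF assms, of x] by (intro image_eqI[of _ _ "unchart A x"]) auto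
qed

lemma hval_chart: assumes A: "unitary A" and p: "p \<notin> hyperplane_at_inf A"
  shows "hval A p = 1 / norm (affine_vec (affine_chart A p))"
proof -
  have "norm (adj A *v affine_vec (affine_chart A p)) = norm (affine_vec (affine_chart A p))"
    using norm_unitary[OF A, of "adj A *v affine_vec (affine_chart A p)"] by (simp add: adj_inverse[OF A])
  then show ?thesis
    using hval_eq[OF chart_vec[OF A p] adj_affine_nonzero[OF A], of A]
    by (simp add: adj_inverse[OF A] affine_vec_None)
qed

lemma emb_dist_chart:
  assumes A: "unitary A" and p: "p \<notin> hyperplane_at_inf A" and q: "q \<notin> hyperplane_at_inf A"
  shows "dist (emb p) (emb q) = dist (proj (affine_vec (affine_chart A p))) (proj (affine_vec (affine_chart A q)))"
proof -
  have "emb p = proj (adj A *v affine_vec (affine_chart A p))" "emb q = proj (adj A *v affine_vec (affine_chart A q))"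
    using chart_vec[OF A] adj_affine_nonzero[OF A] p q by (auto intro: emb_eq)
  then show ?thesis
    using dist_proj_unitary[OF A adj_affine_nonzero[OF A] adj_affine_nonzero[OF A], of "affine_chart A p" "affine_chart A q"]
    by (simp add: adj_inverse[OF A])
qed

text \<open>Expanding in \<open>y - x\<close> shows that the right side exceeds the left one by
  \<open>gram x (y - x)\<close>, which is nonnegative.\<close>

lemma gram_affine: "(norm (x - y))\<^sup>2 \<le> gram (affine_vec x) (affine_vec y)"
proof -
  let ?d = "affine_vec y - affine_vec x"
  have h: "hermitian (affine_vec x) ?d = hermitian x (y - x)"
    unfolding hermitian_def UNIV_option_sum by (simp add: affine_vec_None affine_vec_Some)
  have "gram (affine_vec x) (affine_vec y) = gram (affine_vec x) ?d"
    using gram_add[of "affine_vec x" ?d] by simp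
  also have "\<dots> = (1 + (norm x)\<^sup>2) * (norm (y - x))\<^sup>2 - (cmod (hermitian x (y - x)))\<^sup>2"
    unfolding gram_def h norm_affine_vec norm_affine_vec_diff ..
  also have "\<dots> = (norm (y - x))\<^sup>2 + gram x (y - x)" by (simp add: gram_def algebra_simps)
  finally show ?thesis using gram_nonneg[of x "y - x"] by (simp add: norm_minus_commute)
qed

text \<open>Both follow from the formula for the distance of projectors, with the Gram determinant
  estimated from above and from below. The first keeps the weight of \<open>x\<close> and becomes
  the hypothesis \<open>low\<close> of \<open>LNE_glue\<close> for the affine metric. The second
  degenerates only at infinity.\<close>

lemma chart_bounds:
  assumes A: "unitary A" and p: "p \<notin> hyperplane_at_inf A" and q: "q \<notin> hyperplane_at_inf A"
  defines "x \<equiv> affine_chart A p" and "y \<equiv> affine_chart A q"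
  shows "dist (emb p) (emb q) * norm (affine_vec x) \<le> 2 * dist x y"
    and "dist x y \<le> norm (affine_vec x) * norm (affine_vec y) * dist (emb p) (emb q)"
proof -
  let ?X = "affine_vec x" and ?Y = "affine_vec y"
  have d: "(dist (emb p) (emb q))\<^sup>2 = 2 * gram ?X ?Y / ((norm ?X)\<^sup>2 * (norm ?Y)\<^sup>2)"
    unfolding emb_dist_chart[OF A p q] x_def y_def by (rule dist_proj) (rule affine_vec_nonzero)+
  have pos: "norm ?X > 0" "norm ?Y > 0" by (simp_all add: affine_vec_nonzero)
  have "(dist (emb p) (emb q) * norm ?X)\<^sup>2 = 2 * gram ?Y ?X / (norm ?Y)\<^sup>2"
    unfolding power_mult_distrib d using pos by (simp add: field_simps gram_commute)
  also have "\<dots> \<le> 2 * ((norm ?Y)\<^sup>2 * (norm (?Y - ?X))\<^sup>2) / (norm ?Y)\<^sup>2"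
    using gram_le[of ?Y ?X] pos by (intro divide_right_mono mult_left_mono) auto
  also have "\<dots> = 2 * (dist x y)\<^sup>2" using pos by (simp add: norm_affine_vec_diff dist_norm norm_minus_commute)
  also have "\<dots> \<le> (2 * dist x y)\<^sup>2" by (simp add: power_mult_distrib)
  finally show "dist (emb p) (emb q) * norm ?X \<le> 2 * dist x y" by (rule power2_le_imp_le) simp
  have "(dist x y)\<^sup>2 \<le> 2 * gram ?X ?Y" using gram_affine[of x y] gram_nonneg[of ?X ?Y] by (simp add: dist_norm)
  also have "\<dots> = (norm ?X * norm ?Y * dist (emb p) (emb q))\<^sup>2"
    unfolding power_mult_distrib d using pos by simp
  finally show "dist x y \<le> norm ?X * norm ?Y * dist (emb p) (emb q)" by (rule power2_le_imp_le) simp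
qed

lemma emb_le_chart:
  assumes A: "unitary A" and p: "p \<notin> hyperplane_at_inf A" and q: "q \<notin> hyperplane_at_inf A"
  shows "dist (emb p) (emb q) \<le> 2 * dist (affine_chart A p) (affine_chart A q)"
proof -
  have "dist (emb p) (emb q) * 1 \<le> dist (emb p) (emb q) * norm (affine_vec (affine_chart A p))"
    by (intro mult_left_mono norm_affine_vec_ge) simp
  then show ?thesis using chart_bounds(1)[OF A p q] by linarith
qed

text \<open>The height is positive at \<open>p\<close> and its square is Lipschitz, so it stays
  above half its value nearby; this bounds both weights in \<open>chart_bounds\<close>.\<close>

lemma chart_local:
  assumes A: "unitary A" and p: "p \<notin> hyperplane_at_inf A"
  shows "\<exists>e>0. \<exists>R>0. \<forall>q. dist (emb q) (emb p) < e \<longrightarrow> q \<notin> hyperplane_at_inf A \<and>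
    (\<forall>q'. dist (emb q') (emb p) < e \<longrightarrow> dist (affine_chart A q) (affine_chart A q') \<le> R * dist (emb q) (emb q'))"
proof -
  define h where "h = hval A p"
  have h: "h > 0" using p hval_zero_iff[of A p] hval_nonneg[of A p] by (auto simp: h_def less_le)
  \<comment> \<open>On this ball at least half of the squared height survives, more than the quarter
    that is wanted.\<close>
  have q: "q \<notin> hyperplane_at_inf A \<and> norm (affine_vec (affine_chart A q)) \<le> 2 / h" if "dist (emb q) (emb p) < h\<^sup>2 / 2" for q
  proof -
    have "(h / 2)\<^sup>2 \<le> (hval A q)\<^sup>2"
      using hval_lipschitz[OF A, of q p] that zero_le_power2[of h] by (simp add: h_def[symmetric] abs_le_iff power_divide)
    then have le: "h / 2 \<le> hval A q" by (rule power2_le_imp_le) (rule hval_nonneg)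
    then have "hval A q \<noteq> 0" using h by auto
    then have qn: "q \<notin> hyperplane_at_inf A" using hval_zero_iff by blast
    have "norm (affine_vec (affine_chart A q)) = 1 / hval A q"
      using hval_chart[OF A qn] by simp
    also have "\<dots> \<le> 1 / (h / 2)" using le h by (intro divide_left_mono) auto
    finally show ?thesis using qn by simp
  qed
  have "dist (affine_chart A a) (affine_chart A b) \<le> (2 / h) * (2 / h) * dist (emb a) (emb b)"
    if ab: "dist (emb a) (emb p) < h\<^sup>2 / 2" "dist (emb b) (emb p) < h\<^sup>2 / 2" for a b
  proof -
    have "dist (affine_chart A a) (affine_chart A b)
       \<le> norm (affine_vec (affine_chart A a)) * norm (affine_vec (affine_chart A b)) * dist (emb a) (emb b)"
      using q ab by (intro chart_bounds[OF A]) auto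
    also have "\<dots> \<le> (2 / h) * (2 / h) * dist (emb a) (emb b)"
      using q ab h by (intro mult_right_mono mult_mono) auto
    finally show ?thesis .
  qed
  note dist = this
  define e where "e = h\<^sup>2 / 2"
  define R where "R = (2 / h) * (2 / h)"
  have "e > 0" "R > 0" using h by (simp_all add: e_def R_def)
  moreover have "\<forall>q. dist (emb q) (emb p) < e \<longrightarrow> q \<notin> hyperplane_at_inf A \<and>
    (\<forall>q'. dist (emb q') (emb p) < e \<longrightarrow> dist (affine_chart A q) (affine_chart A q') \<le> R * dist (emb q) (emb q'))"
    unfolding e_def R_def using q dist by blast
  ultimately show ?thesis by blast
qed

section \<open>Holomorphic maps and non-singular points\<close>

text \<open>Restriction to a complex line gives access to one-variable function theory, in
  particular to Cauchy estimates.\<close>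

lemma holomorphic_map_line:
  assumes "(f has_derivative (\<lambda>h. D *v h)) (at (y + \<zeta> *s h))"
  shows "((\<lambda>\<zeta>. f (y + \<zeta> *s h) $ i) has_field_derivative ((D *v h) $ i :: complex)) (at \<zeta>)"
proof -
  have "bounded_linear (\<lambda>e. e *s h)"
    by (rule bounded_linear_intro[where K = "norm h"]) (simp_all add: vector_sadd_rdistrib vec_eq_iff norm_scale_vec)
  then have 1: "((\<lambda>\<zeta>. y + \<zeta> *s h) has_derivative (\<lambda>e. e *s h)) (at \<zeta>)"
    by (auto intro!: derivative_eq_intros dest: bounded_linear_imp_has_derivative)
  have "((\<lambda>\<zeta>. f (y + \<zeta> *s h)) has_derivative (\<lambda>e. D *v (e *s h))) (at \<zeta>)"
    using has_derivative_compose[OF 1 assms] .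
  then have "((\<lambda>\<zeta>. f (y + \<zeta> *s h) $ i) has_derivative (\<lambda>e. (D *v (e *s h)) $ i)) (at \<zeta>)"
    by (rule bounded_linear.has_derivative[OF bounded_linear_vec_nth])
  then show ?thesis unfolding has_field_derivative_def by (simp add: matrix_smult mult.commute[of _ "(D *v h) $ i"])
qed

text \<open>\<open>holomorphic_map\<close> asks for a complex derivative at each point and says
  nothing about its continuity. That the derivative is locally bounded comes from Cauchy's
  inequality on complex lines.\<close>

lemma holomorphic_map_lipschitz:
  fixes f :: "complex ^ 'a \<Rightarrow> complex ^ 'b"
  assumes U: "open U" and f: "holomorphic_map f U" and x: "x \<in> U"
  shows "\<exists>r>0. \<exists>L>0. ball x r \<subseteq> U \<and> (\<forall>y\<in>ball x r. \<forall>z\<in>ball x r. dist (f y) (f z) \<le> L * dist y z)"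
proof -
  obtain D where D: "\<And>z. z \<in> U \<Longrightarrow> (f has_derivative (\<lambda>h. D z *v h)) (at z)"
    using f unfolding holomorphic_map_def by metis
  obtain r0 where r0: "r0 > 0" "cball x r0 \<subseteq> U" using U x open_contains_cball by blast
  define r where "r = r0 / 2"
  have r: "r > 0" using r0 by (simp add: r_def)
  have "continuous_on U f" using D by (meson continuous_at_imp_continuous_on has_derivative_continuous)
  then have "compact (f ` cball x r0)" using r0 by (intro compact_continuous_image compact_cball) (rule continuous_on_subset)
  then obtain M where M: "M > 0" "\<And>z. z \<in> cball x r0 \<Longrightarrow> norm (f z) \<le> M"
    using compact_imp_bounded bounded_pos by (metis image_eqI)
  have comp: "cmod ((D y *v h) $ i) \<le> M / r * norm h" if y: "y \<in> ball x r" for y h i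
  proof (cases "h = 0")
    case False
    \<comment> \<open>The largest radius for which the disc in direction \<open>h\<close> stays
      within \<open>r\<close> of \<open>y\<close>, hence within \<open>r0\<close> of
      \<open>x\<close>. It produces the factor \<open>norm h\<close> in the bound.\<close>
    define \<rho> where "\<rho> = r / norm h"
    have rho: "\<rho> > 0" using False r by (simp add: \<rho>_def)
    have in_U: "y + \<zeta> *s h \<in> cball x r0" if "\<zeta> \<in> cball 0 \<rho>" for \<zeta>
    proof -
      have "cmod \<zeta> * norm h \<le> r" using that False by (simp add: \<rho>_def field_simps)
      then have "norm (\<zeta> *s h) \<le> r" by (simp add: norm_scale_vec)
      moreover have "norm (x - y) < r" using y by (simp add: dist_norm)
      ultimately show ?thesis using norm_triangle_ineq4[of "x - y" "\<zeta> *s h"] by (simp add: dist_norm r_def diff_diff_add)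
    qed
    let ?\<phi> = "\<lambda>\<zeta>. f (y + \<zeta> *s h) $ i"
    have dphi: "(?\<phi> has_field_derivative ((D (y + \<zeta> *s h) *v h) $ i)) (at \<zeta>)" if "\<zeta> \<in> cball 0 \<rho>" for \<zeta>
      using holomorphic_map_line[OF D] in_U[OF that] r0 by blast
    have cont: "continuous_on (cball 0 \<rho>) ?\<phi>"
      using dphi by (meson DERIV_continuous continuous_at_imp_continuous_on)
    have hol: "?\<phi> holomorphic_on ball 0 \<rho>"
      unfolding holomorphic_on_def using dphi by (meson ball_subset_cball field_differentiable_at_within field_differentiable_def subsetD)
    have "norm ((deriv ^^ 1) ?\<phi> 0) \<le> fact 1 * M / \<rho> ^ 1"
    proof (rule Cauchy_inequality[OF hol cont rho])
      fix \<zeta> :: complex assume "norm (0 - \<zeta>) = \<rho>"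
      then have "\<zeta> \<in> cball 0 \<rho>" by simp
      then show "norm (?\<phi> \<zeta>) \<le> M"
        using M(2)[OF in_U] Finite_Cartesian_Product.norm_nth_le order.trans by blast
    qed
    moreover have "deriv ?\<phi> 0 = (D y *v h) $ i"
      using dphi[of 0] rho by (intro DERIV_imp_deriv) auto
    ultimately show ?thesis by (simp add: \<rho>_def mult.commute)
  qed simp
  define L where "L = real CARD('b) * (M / r)"
  have ons: "onorm (\<lambda>h. D y *v h) \<le> L" if y: "y \<in> ball x r" for y
  proof (rule onorm_le)
    fix h
    have "norm (D y *v h) \<le> (\<Sum>i\<in>UNIV. cmod ((D y *v h) $ i))" by (simp add: norm_vec_def L2_set_le_sum)
    also have "\<dots> \<le> (\<Sum>i\<in>(UNIV :: 'b set). M / r * norm h)" by (intro sum_mono comp y)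
    finally show "norm (D y *v h) \<le> L * norm h" by (simp add: L_def)
  qed
  have rU: "ball x r \<subseteq> U"
  proof -
    have "ball x r \<subseteq> cball x r0" using r by (auto simp: r_def)
    then show ?thesis using r0 by blast
  qed
  have "dist (f y) (f z) \<le> L * dist y z" if yz: "y \<in> ball x r" "z \<in> ball x r" for y z
  proof -
    have "norm (f y - f z) \<le> L * norm (y - z)"
    proof (rule differentiable_bound[OF convex_ball])
      show "(f has_derivative (\<lambda>h. D y *v h)) (at y within ball x r)" if "y \<in> ball x r" for y
        using D that rU by (meson has_derivative_at_withinI subsetD)
    qed (use ons yz in auto)
    then show ?thesis by (simp add: dist_norm)
  qed
  note lip = this
  have "L > 0" using M r by (simp add: L_def)
  show ?thesis
    by (intro exI[of _ r] exI[of _ L] conjI ballI r rU \<open>L > 0\<close> lip)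
qed

text \<open>In straightening coordinates the set is linear, hence convex: the segment between two
  image points is carried back by \<open>g\<close>, and the Lipschitz constants of \<open>f\<close>,
  \<open>g\<close> and the chart multiply.\<close>

lemma local_LNE_nonsingular:
  fixes X :: "'n::finite cproj set"
  assumes "nonsingular_point X p"
  shows "\<exists>e>0. \<exists>C>0. \<forall>s\<in>X. \<forall>s'\<in>X. dist (emb s) (emb p) < e \<longrightarrow> dist (emb s') (emb p) < e \<longrightarrow>
            inner_dist (pull_dist emb) X s s' \<le> ennreal (C * dist (emb s) (emb s'))"
proof -
  obtain k A where A: "unitary A" "p \<notin> hyperplane_at_inf A" "submanifold_at k (in_chart A X) (affine_chart A p)"
    using assms unfolding nonsingular_point_def regular_point_def by (elim exE conjE) (rule that)
  define x0 where "x0 = affine_chart A p"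
  obtain U V and f g :: "complex ^ 'n \<Rightarrow> complex ^ 'n" and E where "open U \<and> open V \<and> x0 \<in> in_chart A X \<inter> U \<and> homeomorphism U V f g \<and>
        holomorphic_map f U \<and> holomorphic_map g V \<and> vec.subspace E \<and> vec.dim E = k \<and>
        f ` (in_chart A X \<inter> U) = V \<inter> E"
    using A(3) unfolding submanifold_at_def x0_def[symmetric] by (elim exE) (rule that)
  then have U: "open U" "open V" "x0 \<in> in_chart A X \<inter> U" "homeomorphism U V f g"
        "holomorphic_map f U" "holomorphic_map g V"
        "vec.subspace E" "f ` (in_chart A X \<inter> U) = V \<inter> E" by auto
  have y0: "f x0 \<in> V" using U by blast
  obtain r1 L1 where 1: "r1 > 0" "L1 > 0" "ball x0 r1 \<subseteq> U" "\<forall>y\<in>ball x0 r1. \<forall>z\<in>ball x0 r1. dist (f y) (f z) \<le> L1 * dist y z"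
    using holomorphic_map_lipschitz[OF U(1) U(5) IntD2[OF U(3)]] by blast
  obtain r2 L2 where 2: "r2 > 0" "L2 > 0" "ball (f x0) r2 \<subseteq> V" "\<forall>y\<in>ball (f x0) r2. \<forall>z\<in>ball (f x0) r2. dist (g y) (g z) \<le> L2 * dist y z"
    using holomorphic_map_lipschitz[OF U(2) U(6) y0] by blast
  obtain e0 R where "e0 > 0" "R > 0"
    and eR: "\<forall>q. dist (emb q) (emb p) < e0 \<longrightarrow> q \<notin> hyperplane_at_inf A \<and>
    (\<forall>q'. dist (emb q') (emb p) < e0 \<longrightarrow> dist (affine_chart A q) (affine_chart A q') \<le> R * dist (emb q) (emb q'))"
    using chart_local[OF A(1,2)] by blast
  then have e0: "e0 > 0" "R > 0"
    "\<And>q. dist (emb q) (emb p) < e0 \<Longrightarrow> q \<notin> hyperplane_at_inf A"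
    "\<And>q q'. dist (emb q) (emb p) < e0 \<Longrightarrow> dist (emb q') (emb p) < e0 \<Longrightarrow>
       dist (affine_chart A q) (affine_chart A q') \<le> R * dist (emb q) (emb q')" by blast+
  \<comment> \<open>Small enough that \<open>f\<close> maps the ball into the one around
    \<open>f x0\<close> on which \<open>g\<close> is Lipschitz; \<open>e\<close> plays the same role
    for the chart.\<close>
  define \<delta> where "\<delta> = min r1 (r2 / L1)"
  have \<delta>: "\<delta> > 0" "\<delta> \<le> r1" "L1 * \<delta> \<le> r2" using 1 2 by (auto simp: \<delta>_def min_def field_simps)
  define e where "e = min e0 (\<delta> / R)"
  have e: "e > 0" "e \<le> e0" "R * e \<le> \<delta>" using e0 \<delta> by (auto simp: e_def min_def field_simps)
  define C where "C = 2 * L2 * L1 * R"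
  have main: "inner_dist (pull_dist emb) X s s' \<le> ennreal (C * dist (emb s) (emb s'))"
    if s: "s \<in> X" "s' \<in> X" "dist (emb s) (emb p) < e" "dist (emb s') (emb p) < e" for s s'
  proof -
    let ?x = "affine_chart A s" and ?x' = "affine_chart A s'"
    have near: "q \<notin> hyperplane_at_inf A \<and> affine_chart A q \<in> ball x0 \<delta> \<and> affine_chart A q \<in> in_chart A X"
      if q: "q \<in> X" "dist (emb q) (emb p) < e" for q
    proof -
      have "dist (affine_chart A q) x0 \<le> R * dist (emb q) (emb p)"
        unfolding x0_def using q e e0(1) by (intro e0(4)) auto
      also have "\<dots> < R * e" using q e0(2) by simp
      finally have "affine_chart A q \<in> ball x0 \<delta>" using e by (simp add: dist_commute)
      moreover have "q \<notin> hyperplane_at_inf A" using e0(3) q e by simp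
      ultimately show ?thesis using q unfolding in_chart_def by blast
    qed
    note ns = near[OF s(1,3)] and ns' = near[OF s(2,4)]
    have inU: "?x \<in> in_chart A X \<inter> U" "?x' \<in> in_chart A X \<inter> U" using ns ns' 1(3) \<delta>(2) by auto
    have fE: "f ?x \<in> E" "f ?x' \<in> E" using U(8) inU by auto
    have fb: "f y \<in> ball (f x0) r2" if "y \<in> ball x0 \<delta>" for y
    proof -
      have "dist (f x0) (f y) \<le> L1 * dist x0 y" using 1(1) that \<delta> by (intro 1(4)[rule_format]) auto
      also have "\<dots> < L1 * \<delta>" using that 1(2) by simp
      finally show ?thesis using \<delta> by simp
    qed
    have fb': "f ?x \<in> ball (f x0) r2" "f ?x' \<in> ball (f x0) r2" using fb ns ns' by auto
    define c where "c t = (1 - t) *\<^sub>R f ?x + t *\<^sub>R f ?x'" for t :: real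
    have cb: "c t \<in> ball (f x0) r2" if "0 \<le> t" "t \<le> 1" for t
      unfolding c_def using fb' that by (intro convexD_alt[OF convex_ball]) auto
    have sc: "r *\<^sub>R w = of_real r *s w" for r and w :: "complex ^ 'a"
      by (simp add: vec_eq_iff scaleR_conv_of_real[where 'a = complex])
    have cE: "c t \<in> E" for t unfolding c_def sc using fE U(7) by (intro vec.subspace_add vec.subspace_scale)
    have gS: "g (c t) \<in> in_chart A X" if "0 \<le> t" "t \<le> 1" for t
    proof -
      have "c t \<in> V \<inter> E" using cb[OF that] cE 2(3) by blast
      then obtain y where "y \<in> in_chart A X \<inter> U" "c t = f y" using U(8) by blast
      then show ?thesis using homeomorphism_apply1[OF U(4)] by auto
    qed
    define \<gamma> where "\<gamma> t = unchart A (g (c t))" for t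
    have "inner_dist (pull_dist emb) X s s' \<le> ennreal (2 * (L2 * dist (f ?x) (f ?x')))"
    proof (rule inner_dist_lipschitz[where \<gamma> = \<gamma>])
      fix a b :: real assume ab: "0 \<le> a" "a \<le> b" "b \<le> 1"
      have "dist (emb (\<gamma> a)) (emb (\<gamma> b)) \<le> 2 * dist (g (c a)) (g (c b))"
        using emb_le_chart[OF A(1) unchart(1)[OF A(1)] unchart(1)[OF A(1)]]
        by (simp add: \<gamma>_def unchart(2)[OF A(1)])
      also have "\<dots> \<le> 2 * (L2 * dist (c a) (c b))" using ab by (intro mult_left_mono 2(4)[rule_format] cb) auto
      also have "dist (c a) (c b) = (b - a) * dist (f ?x) (f ?x')"
      proof -
        have "c a - c b = (b - a) *\<^sub>R (f ?x - f ?x')" by (simp add: c_def algebra_simps)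
        then show ?thesis using ab by (simp add: dist_norm)
      qed
      finally show "dist (emb (\<gamma> a)) (emb (\<gamma> b)) \<le> 2 * (L2 * dist (f ?x) (f ?x')) * (b - a)" by (simp add: mult_ac)
    next
      show "\<gamma> t \<in> X" if "0 \<le> t" "t \<le> 1" for t
        using gS[OF that] in_chart_iff[OF A(1)] by (simp add: \<gamma>_def)
      show "\<gamma> 0 = s" "\<gamma> 1 = s'"
        using homeomorphism_apply1[OF U(4)] inU ns ns' by (auto simp: \<gamma>_def c_def unchart_chart[OF A(1)])
    qed (use 2 in simp)
    also have "\<dots> \<le> ennreal (C * dist (emb s) (emb s'))"
    proof (rule ennreal_leI)
      have "dist (f ?x) (f ?x') \<le> L1 * dist ?x ?x'" using ns ns' \<delta> by (intro 1(4)[rule_format]) auto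
      also have "\<dots> \<le> L1 * (R * dist (emb s) (emb s'))" using s e 1(2) by (intro mult_left_mono e0(4)) auto
      finally have "2 * L2 * dist (f ?x) (f ?x') \<le> 2 * L2 * (L1 * (R * dist (emb s) (emb s')))"
        using 2(2) by (intro mult_left_mono) auto
      then show "2 * (L2 * dist (f ?x) (f ?x')) \<le> C * dist (emb s) (emb s')" by (simp add: C_def mult_ac)
    qed
    finally show ?thesis .
  qed
  have "C > 0" using 1 2 e0 by (simp add: C_def)
  then show ?thesis using main e(1) by blast
qed

section \<open>Unitary changes of coordinates and transversality\<close>

lemma hermitian_diff_left: "hermitian (x - y) z = hermitian x z - hermitian y z"
  by (simp add: hermitian_def left_diff_distrib sum_subtractf)

lemma hermitian_axis: "hermitian z (c *s axis k 1) = z $ k * cnj c"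
  by (simp add: hermitian_def axis_def if_distrib cong: if_cong)

text \<open>A reflection along \<open>u - c *s axis k 1\<close> with \<open>cmod c = norm u\<close>.
  This vector is supported in \<open>K\<close>, so nothing outside \<open>K\<close> is touched; that
  locality is what the minimality argument for projections relies on.\<close>

lemma householder:
  fixes u :: "complex ^ 'm"
  assumes u: "u \<noteq> 0" and K: "\<forall>i. i \<notin> K \<longrightarrow> u $ i = 0" "k \<in> K"
  shows "\<exists>U c. unitary U \<and> c \<noteq> 0 \<and> U *v u = c *s axis k 1 \<and>
     (\<forall>w i. i \<notin> K \<longrightarrow> (U *v w) $ i = w $ i) \<and>
     (\<forall>w. (\<forall>i\<in>K. w $ i = 0) \<longrightarrow> U *v w = w)"
proof -
  define ph where "ph = (if u $ k = 0 then 1 else u $ k / of_real (cmod (u $ k)))"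
  have ph: "cmod ph = 1" "u $ k * cnj ph = of_real (cmod (u $ k))"
  proof -
    show "cmod ph = 1" by (simp add: ph_def norm_divide)
    have "u $ k * cnj (u $ k) = of_real (cmod (u $ k)) * of_real (cmod (u $ k))"
      by (metis complex_norm_square power2_eq_square of_real_mult)
    then show "u $ k * cnj ph = of_real (cmod (u $ k))" by (simp add: ph_def)
  qed
  \<comment> \<open>Opposite in phase to \<open>u $ k\<close>: no cancellation occurs in
    \<open>v\<close>, so \<open>v\<close> cannot vanish.\<close>
  define c where "c = - (of_real (norm u) * ph)"
  define v where "v = u - c *s axis k 1"
  have c: "c \<noteq> 0" using u ph by (auto simp: c_def)
  have cc: "cmod c = norm u" using ph by (simp add: c_def norm_mult)
  have uc: "hermitian u (c *s axis k 1) = - of_real (norm u * cmod (u $ k))"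
    unfolding hermitian_axis using ph by (simp add: c_def mult.left_commute)
  have uv: "hermitian u v = of_real ((norm u)\<^sup>2 + norm u * cmod (u $ k))"
  proof -
    have "hermitian v u = hermitian u u - hermitian (c *s axis k 1) u" by (simp add: v_def hermitian_diff_left)
    also have "hermitian (c *s axis k 1) u = cnj (hermitian u (c *s axis k 1))" by (rule cnj_hermitian[symmetric])
    finally have "hermitian v u = of_real ((norm u)\<^sup>2 + norm u * cmod (u $ k))" by (simp add: uc hermitian_self)
    then show ?thesis by (metis cnj_hermitian complex_cnj_complex_of_real)
  qed
  \<comment> \<open>A consequence of \<open>cmod c = norm u\<close>; the reflection then moves
    \<open>u\<close> by exactly \<open>v\<close>.\<close>
  have vv: "hermitian v v = 2 * hermitian u v"
  proof -
    have "hermitian v v = hermitian u v - hermitian (c *s axis k 1) v" by (subst (1) v_def) (rule hermitian_diff_left)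
    also have "hermitian (c *s axis k 1) v = cnj (hermitian v (c *s axis k 1))" by (rule cnj_hermitian[symmetric])
    also have "hermitian v (c *s axis k 1) = hermitian u (c *s axis k 1) - hermitian (c *s axis k 1) (c *s axis k 1)"
      by (simp add: v_def hermitian_diff_left)
    also have "hermitian (c *s axis k 1) (c *s axis k 1) = of_real ((norm u)\<^sup>2)"
      by (simp add: hermitian_self norm_scale_vec cc)
    finally show ?thesis by (simp add: uc uv)
  qed
  have upos: "norm u > 0" using u by simp
  have "(norm u)\<^sup>2 + norm u * cmod (u $ k) > 0" using upos by (simp add: add_pos_nonneg)
  then have uv0: "hermitian u v \<noteq> 0" unfolding uv of_real_eq_0_iff by simp
  then have vv0: "hermitian v v \<noteq> 0" using vv by simp
  define U :: "complex ^ 'm ^ 'm" where "U = (\<chi> i j. (if i = j then 1 else 0) - 2 * v $ i * cnj (v $ j) / hermitian v v)"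
  have Uw: "U *v w = w - (2 * hermitian w v / hermitian v v) *s v" for w
  proof -
    have "(U *v w) $ i = w $ i - (2 * hermitian w v / hermitian v v) * v $ i" for i
    proof -
      have "U $ i $ j * w $ j = (if i = j then w $ j else 0) - (2 * v $ i / hermitian v v) * (w $ j * cnj (v $ j))" for j
        by (simp add: U_def left_diff_distrib)
      then have "(U *v w) $ i = (\<Sum>j\<in>UNIV. (if i = j then w $ j else 0)) - (\<Sum>j\<in>UNIV. (2 * v $ i / hermitian v v) * (w $ j * cnj (v $ j)))"
        by (simp add: matrix_vector_mult_def sum_subtractf)
      also have "\<dots> = w $ i - (2 * v $ i / hermitian v v) * hermitian w v"
        by (simp only: sum_distrib_left[symmetric] hermitian_def[of w v, symmetric]) simp
      finally show ?thesis by simp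
    qed
    then show ?thesis by (simp add: vec_eq_iff)
  qed
  have UU: "U *v (U *v w) = w" for w
  proof -
    have "hermitian (U *v w) v = - hermitian w v"
      using vv0 by (simp add: Uw hermitian_diff_left hermitian_scale_left)
    then show ?thesis unfolding Uw[of "U *v w"] by (simp add: Uw vec_eq_iff)
  qed
  have "cnj (hermitian v v) = hermitian v v" by (rule cnj_hermitian)
  then have adjU: "(\<chi> i j. cnj (U $ j $ i)) = U"
    by (simp add: U_def vec_eq_iff mult_ac)
  have "unitary U"
    unfolding unitary_def adjU matrix_eq by (simp add: matrix_vector_mul_assoc[symmetric] UU)
  moreover have "U *v u = c *s axis k 1"
    unfolding Uw vv using uv0 by (simp add: v_def)
  moreover have vK: "v $ i = 0" if "i \<notin> K" for i using that K by (auto simp: v_def axis_def)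
  then have "\<forall>w i. i \<notin> K \<longrightarrow> (U *v w) $ i = w $ i" by (simp add: Uw)
  moreover have "U *v w = w" if "\<forall>i\<in>K. w $ i = 0" for w
  proof -
    have "hermitian w v = 0" unfolding hermitian_def using that vK by (intro sum.neutral) fastforce
    then show ?thesis by (simp add: Uw)
  qed
  ultimately show ?thesis using c by blast
qed

text \<open>The conjugated coefficients form a normal vector of \<open>H\<close>, and a reflection
  turns it to the axis \<open>None\<close>.\<close>

lemma unitary_of_hyperplane:
  fixes H :: "'n::finite cproj set"
  assumes "hyperplane H" obtains A where "unitary A" "hyperplane_at_inf A = H"
proof -
  obtain a :: "complex ^ ('n option)" where a: "a \<noteq> 0" "H = {p. \<forall>z\<in>Rep_cproj p. (\<Sum>i\<in>UNIV. a $ i * z $ i) = 0}"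
    using assms unfolding hyperplane_def by blast
  define u where "u = (\<chi> i. cnj (a $ i))"
  have "u \<noteq> 0" using a(1) by (auto simp: u_def vec_eq_iff)
  then obtain U c where U: "unitary U" "c \<noteq> 0" "U *v u = c *s axis None 1"
    using householder[of u UNIV None] by auto
  have "(U *v z) $ None * cnj c = (\<Sum>i\<in>UNIV. a $ i * z $ i)" for z
  proof -
    have "(U *v z) $ None * cnj c = hermitian (U *v z) (U *v u)" by (simp add: U(3) hermitian_axis)
    also have "\<dots> = hermitian z u" by (rule hermitian_unitary[OF U(1)])
    finally show ?thesis by (simp add: hermitian_def u_def mult.commute)
  qed
  then have "(\<Sum>i\<in>UNIV. a $ i * z $ i) = 0 \<longleftrightarrow> (U *v z) $ None = 0" for z
    using U(2) by (metis complex_cnj_zero_iff mult_eq_0_iff)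
  then have "hyperplane_at_inf U = H" unfolding a(2) hyperplane_at_inf_def by simp
  with U(1) that show ?thesis by blast
qed

lemma hyperplane_at_inf_hyperplane:
  fixes A :: "complex ^ ('n::finite option) ^ ('n option)"
  assumes "unitary A" shows "hyperplane (hyperplane_at_inf A :: 'n cproj set)"
proof -
  have "A $ None \<noteq> 0"
  proof
    assume "A $ None = 0"
    then have "(A *v (adj A *v axis None 1)) $ None = 0" by (simp add: matrix_vector_mult_def)
    then show False by (simp add: adj_inverse[OF assms])
  qed
  then show ?thesis unfolding hyperplane_def hyperplane_at_inf_def
    by (intro exI[of _ "A $ None"]) (simp add: matrix_vector_mult_def)
qed

text \<open>The increment of \<open>affine_vec\<close>: directions have last homogeneous coordinate
  0.\<close>

definition lin_vec :: "complex ^ 'n \<Rightarrow> complex ^ ('n option)" where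
  "lin_vec x = (\<chi> j. case j of None \<Rightarrow> 0 | Some i \<Rightarrow> x $ i)"

lemma affine_vec_add: "affine_vec (x + v) = affine_vec x + lin_vec v"
  by (simp add: vec_eq_iff affine_vec_def lin_vec_def split: option.split)

lemma lin_vec_add: "lin_vec (x + y) = lin_vec x + lin_vec y"
  by (simp add: vec_eq_iff lin_vec_def split: option.split)

lemma lin_vec_scaleR: "lin_vec (r *\<^sub>R x) = r *\<^sub>R lin_vec x"
  by (simp add: vec_eq_iff lin_vec_def split: option.split)

lemma bounded_linear_lin_form: "bounded_linear (\<lambda>v. (M *v lin_vec v) $ i)"
proof -
  have "linear (\<lambda>v. (M *v lin_vec v) $ i)"
  proof (rule linearI)
    show "(M *v lin_vec (x + y)) $ i = (M *v lin_vec x) $ i + (M *v lin_vec y) $ i" for x y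
      by (simp add: lin_vec_add matrix_vector_right_distrib)
    show "(M *v lin_vec (r *\<^sub>R x)) $ i = r *\<^sub>R (M *v lin_vec x) $ i" for r x
      unfolding lin_vec_scaleR by (simp add: matrix_vector_mult_def scaleR_sum_right)
  qed
  then show ?thesis by (simp add: linear_conv_bounded_linear)
qed

text \<open>Transversality yields a point of \<open>X\<close> near \<open>p\<close> whose distance to the hyperplane is comparable to its
  distance to \<open>p\<close>; unlike transversality itself this does not depend on a chart.\<close>

lemma transverse_hval:
  fixes X :: "'n::finite cproj set"
  assumes B: "unitary B" and p: "p \<in> X" "p \<in> hyperplane_at_inf B"
    and tr: "transverse_at X (hyperplane_at_inf B) p"
  shows "\<exists>c>0. \<forall>e>0. \<exists>q\<in>X. dist (emb q) (emb p) < e \<and> 0 < hval B q \<and> c * dist (emb q) (emb p) \<le> hval B q"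
proof -
  obtain A where A: "unitary A" "p \<notin> hyperplane_at_inf A"
    "{u + v | u v. u \<in> tangent_vectors (in_chart A X) (affine_chart A p) \<and>
                      v \<in> tangent_vectors (in_chart A (hyperplane_at_inf B)) (affine_chart A p)} = UNIV"
    using tr unfolding transverse_at_def by blast
  define x0 where "x0 = affine_chart A p"
  define l where "l x = (B *v (adj A *v affine_vec x)) $ None" for x
  define l1 where "l1 v = ((B ** adj A) *v lin_vec v) $ None" for v
  have bl: "bounded_linear l1" unfolding l1_def by (rule bounded_linear_lin_form)
  have l_add: "l (x + v) = l x + l1 v" for x v
    by (simp add: l_def l1_def affine_vec_add matrix_vector_right_distrib matrix_vector_mul_assoc)
  have hyp: "unchart A x \<in> hyperplane_at_inf B \<longleftrightarrow> l x = 0" for x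
    unfolding l_def by (rule hyperplane_at_inf_iff[OF unchart(3)[OF A(1)] adj_affine_nonzero[OF A(1)]])
  have p0: "unchart A x0 = p" unfolding x0_def by (rule unchart_chart[OF A(1,2)])
  have l0: "l x0 = 0" using hyp[of x0] p p0 by simp
  \<comment> \<open>\<open>l\<close> is the equation of the hyperplane in the chart and
    \<open>l1\<close> its linear part. If \<open>l1\<close> vanished, \<open>l\<close> would be
    constant with value 0, and the last coordinate of \<open>B *v z\<close> would vanish for every
    \<open>z\<close>.\<close>
  have nonzero: "\<exists>v. l1 v \<noteq> 0"
  proof (rule ccontr)
    assume "\<nexists>v. l1 v \<noteq> 0"
    then have z: "l1 v = 0" for v by blast
    have lz: "l x = 0" for x using l_add[of x0 "x - x0"] l0 z by simp
    have all: "(B *v (adj A *v y)) $ None = 0" for y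
    proof -
      define v where "v = (\<chi> i. y $ Some i)"
      have "y = (y $ None) *s affine_vec 0 + lin_vec v"
        by (simp add: vec_eq_iff affine_vec_def lin_vec_def v_def split: option.split)
      then have "(B *v (adj A *v y)) $ None = (y $ None) * l 0 + l1 v"
        by (metis (no_types, lifting) l1_def l_def matrix_smult matrix_vector_mul_assoc matrix_vector_right_distrib vector_add_component vector_smult_component)
      then show ?thesis by (simp add: lz z)
    qed
    from all[of "A *v (adj B *v axis None 1)"] show False by (simp add: adj_inverse[OF A(1)] adj_inverse[OF B])
  qed
  \<comment> \<open>Tangent vectors of the hyperplane lie in the kernel of \<open>l1\<close>, so
    transversality forces one of \<open>X\<close> to lie outside it.\<close>
  have "\<exists>w\<in>tangent_vectors (in_chart A X) x0. l1 w \<noteq> 0"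
  proof (rule ccontr)
    assume *: "\<not> ?thesis"
    have H0: "l1 v = 0" if v: "v \<in> tangent_vectors (in_chart A (hyperplane_at_inf B)) x0" for v
    proof -
      obtain \<gamma> :: "real \<Rightarrow> complex ^ 'n" where g: "\<gamma> 0 = x0" "range \<gamma> \<subseteq> in_chart A (hyperplane_at_inf B)" "(\<gamma> has_vector_derivative v) (at 0)"
        using v unfolding tangent_vectors_def by blast
      have "l (\<gamma> t) = 0" for t using g(2) hyp in_chart_iff[OF A(1)] by blast
      then have z: "l1 (\<gamma> t) = l1 (\<gamma> 0)" for t
        using l_add[of "\<gamma> 0" "\<gamma> t - \<gamma> 0"] by (simp add: linear_diff[OF bounded_linear.linear[OF bl]])
      have "((\<lambda>t. l1 (\<gamma> t)) has_vector_derivative l1 v) (at 0)"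
        by (rule bounded_linear.has_vector_derivative[OF bl g(3)])
      moreover have "(\<lambda>t. l1 (\<gamma> t)) = (\<lambda>t. l1 (\<gamma> 0))" by (rule ext) (rule z)
      ultimately have "((\<lambda>t::real. l1 (\<gamma> 0)) has_vector_derivative l1 v) (at 0)" by (simp only:)
      then show ?thesis by (rule vector_derivative_unique_at[OF _ has_vector_derivative_const])
    qed
    obtain v where v: "l1 v \<noteq> 0" using nonzero by blast
    have "v \<in> {u + v | u v. u \<in> tangent_vectors (in_chart A X) (affine_chart A p) \<and>
                      v \<in> tangent_vectors (in_chart A (hyperplane_at_inf B)) (affine_chart A p)}" unfolding A(3) by simp
    then obtain a b where "v = a + b" "a \<in> tangent_vectors (in_chart A X) x0" "b \<in> tangent_vectors (in_chart A (hyperplane_at_inf B)) x0"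
      unfolding mem_Collect_eq x0_def[symmetric] by (elim exE conjE) (rule that)
    then have "l1 v = 0" using * H0 by (simp add: linear_add[OF bounded_linear.linear[OF bl]])
    with v show False by simp
  qed
  then obtain w \<gamma> where w: "l1 w \<noteq> 0" and g: "\<gamma> 0 = x0" "range \<gamma> \<subseteq> in_chart A X" "(\<gamma> has_vector_derivative w) (at (0::real))"
    unfolding tangent_vectors_def by blast
  obtain K where K: "K > 0" "\<And>v. norm (l1 v) \<le> norm v * K" using bounded_linear.pos_bounded[OF bl] by blast
  \<comment> \<open>Small enough that the remainder of the curve changes \<open>l\<close> by at most
    half of the linear term.\<close>
  define \<epsilon> where "\<epsilon> = min 1 (cmod (l1 w) / (2 * K))"
  have eps: "\<epsilon> > 0" "\<epsilon> \<le> 1" "\<epsilon> * K \<le> cmod (l1 w) / 2" using K w by (auto simp: \<epsilon>_def min_def field_simps)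
  obtain d where d: "d > 0" "\<And>t. norm (t - 0) < d \<Longrightarrow> norm (\<gamma> t - \<gamma> 0 - (t - 0) *\<^sub>R w) \<le> \<epsilon> * norm (t - 0)"
    using g(3) eps(1) unfolding has_vector_derivative_def has_derivative_at_alt by blast
  \<comment> \<open>A bound for \<open>norm (affine_vec (\<gamma> t))\<close> with
    \<open>t \<le> 1\<close>; it turns a lower bound for \<open>l\<close> into one for the
    height.\<close>
  define N where "N = norm x0 + norm w + 2"
  define c where "c = cmod (l1 w) / (4 * N * (norm w + 1))"
  have N: "N > 0" by (simp add: N_def add_nonneg_pos)
  have w1: "norm w + 1 > 0" by (simp add: add_nonneg_pos)
  have c: "c > 0" using N w w1 by (simp add: c_def)
  have "\<exists>q\<in>X. dist (emb q) (emb p) < e \<and> 0 < hval B q \<and> c * dist (emb q) (emb p) \<le> hval B q" if e: "e > 0" for e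
  proof -
    define t where "t = min (min (d / 2) 1) (e / (4 * (norm w + 1)))"
    have t: "t > 0" "t < d" "t \<le> 1" "t * (4 * (norm w + 1)) \<le> e"
    proof -
      show "t > 0" "t < d" "t \<le> 1" using d(1) e w1 by (auto simp: t_def)
      have "t \<le> e / (4 * (norm w + 1))" by (simp add: t_def)
      then show "t * (4 * (norm w + 1)) \<le> e" using w1 by (simp add: field_simps)
    qed
    define r where "r = \<gamma> t - x0 - t *\<^sub>R w"
    have r: "norm r \<le> \<epsilon> * t" using d(2)[of t] t by (simp add: r_def g)
    then have r1: "norm r \<le> t" using eps(2) t(1) mult_right_mono[of \<epsilon> 1 t] by linarith
    have gt: "\<gamma> t = x0 + (t *\<^sub>R w + r)" by (simp add: r_def)
    have n1: "norm (\<gamma> t - x0) \<le> t * (norm w + 1)"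
      using norm_triangle_ineq[of "t *\<^sub>R w" r] r1 t(1) by (simp add: gt algebra_simps)
    have lt: "cmod (l (\<gamma> t)) \<ge> t * cmod (l1 w) / 2"
    proof -
      have eq: "l (\<gamma> t) = t *\<^sub>R l1 w + l1 r"
        unfolding gt l_add l0 by (simp add: linear_add[OF bounded_linear.linear[OF bl]] linear_scale[OF bounded_linear.linear[OF bl]])
      moreover have "cmod (l1 r) \<le> t * cmod (l1 w) / 2"
      proof -
        have "cmod (l1 r) \<le> norm r * K" by (rule K(2))
        also have "\<dots> \<le> (\<epsilon> * t) * K" using r K(1) by (intro mult_right_mono) auto
        also have "\<dots> = t * (\<epsilon> * K)" by simp
        also have "\<dots> \<le> t * (cmod (l1 w) / 2)" using eps(3) t(1) by (intro mult_left_mono) auto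
        finally show ?thesis by simp
      qed
      moreover have "norm (t *\<^sub>R l1 w) = t * cmod (l1 w)" using t(1) by simp
      ultimately show ?thesis unfolding eq using norm_diff_ineq[of "t *\<^sub>R l1 w" "l1 r"] by linarith
    qed
    define q where "q = unchart A (\<gamma> t)"
    have q: "q \<in> X" using g(2) in_chart_iff[OF A(1)] by (auto simp: q_def)
    have dq: "dist (emb q) (emb p) \<le> 2 * (t * (norm w + 1))"
      using emb_le_chart[OF A(1) unchart(1)[OF A(1), of "\<gamma> t"] A(2)] n1 unchart(2)[OF A(1), of "\<gamma> t"]
      by (simp add: q_def x0_def dist_norm)
    have na: "norm (affine_vec (\<gamma> t)) \<le> N"
    proof -
      have "norm (affine_vec (\<gamma> t)) \<le> 1 + norm (\<gamma> t)"
        by (rule power2_le_imp_le) (simp_all add: norm_affine_vec power2_sum)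
      moreover have "norm (\<gamma> t) \<le> norm x0 + norm (\<gamma> t - x0)" by (metis add.commute diff_add_cancel norm_triangle_ineq)
      moreover have "t * (norm w + 1) \<le> 1 * (norm w + 1)" using t w1 by (intro mult_right_mono) auto
      ultimately show ?thesis using n1 by (simp add: N_def)
    qed
    have hq: "hval B q = cmod (l (\<gamma> t)) / norm (affine_vec (\<gamma> t))"
    proof -
      have "norm (adj A *v affine_vec (\<gamma> t)) = norm (affine_vec (\<gamma> t))"
        using norm_unitary[OF A(1), of "adj A *v affine_vec (\<gamma> t)"] by (simp add: adj_inverse[OF A(1)])
      then show ?thesis using hval_eq[OF unchart(3)[OF A(1)] adj_affine_nonzero[OF A(1)], of B "\<gamma> t"]
        by (simp add: q_def l_def)
    qed
    have pos: "norm (affine_vec (\<gamma> t)) > 0" by (simp add: affine_vec_nonzero)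
    have "(t * cmod (l1 w) / 2) / N \<le> cmod (l (\<gamma> t)) / norm (affine_vec (\<gamma> t))"
      using lt na pos by (intro frac_le) auto
    then have h1: "t * cmod (l1 w) / (2 * N) \<le> hval B q" unfolding hq by (simp add: field_simps)
    have "t * cmod (l1 w) / (2 * N) > 0" using t(1) w N by simp
    moreover have "c * dist (emb q) (emb p) \<le> t * cmod (l1 w) / (2 * N)"
    proof -
      have "c * dist (emb q) (emb p) \<le> c * (2 * (t * (norm w + 1)))" using dq c by (intro mult_left_mono) auto
      also have "\<dots> = t * cmod (l1 w) / (2 * N)"
      proof -
        have "a / (4 * N * b) * (2 * (t * b)) = t * a / (2 * N)" if "b > 0" for a b :: real
          using N that by (simp add: field_simps)
        from this[OF w1] show ?thesis unfolding c_def .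
      qed
      finally show ?thesis .
    qed
    moreover have "dist (emb q) (emb p) < e"
    proof -
      have "t * (norm w + 1) > 0" using t(1) w1 by simp
      then show ?thesis using dq t(4) by (simp add: algebra_simps)
    qed
    ultimately show ?thesis using q h1 by (intro bexI[of _ q]) auto
  qed
  then show ?thesis using c by blast
qed

text \<open>A regular point is arbitrarily close to itself, so its dimension is one of the numbers
  whose maximum is \<open>local_dim\<close>. All of them are at most \<open>CARD('n)\<close>, hence
  the maximum is taken over a finite set.\<close>

lemma regular_point_dim_le:
  fixes X :: "'n::finite cproj set"
  assumes "algebraic_curve X" "regular_point k X p" shows "k \<le> 1"
proof -
  let ?S = "{k. \<forall>e>0. \<exists>q. regular_point k X q \<and> fs_dist p q < e}"
  have "k \<le> CARD('n)" if reg: "regular_point k X q" for k q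
  proof -
    obtain A where "submanifold_at k (in_chart A X) (affine_chart A q)"
      using reg unfolding regular_point_def by blast
    then have "\<exists>E :: (complex ^ 'n) set. vec.dim E = k"
      unfolding submanifold_at_def by (elim exE conjE) (rule exI)
    then obtain E :: "(complex ^ 'n) set" where "vec.dim E = k" by blast
    then show ?thesis using vec.dim_subset_UNIV[of E] by (simp add: vec.dimension_def card_cart_basis)
  qed
  then have "?S \<subseteq> {..CARD('n)}" using zero_less_one by blast
  then have fin: "finite ?S" using finite_subset by blast
  have "fs_dist p p < e" if "e > 0" for e using fs_dist_bounds(2)[of p p] that by simp
  then have "k \<in> ?S" using assms(2) by blast
  then have "k \<le> Max ?S" by (rule Max_ge[OF fin])
  moreover have "p \<in> X" using assms(2) by (simp add: regular_point_def)
  ultimately show ?thesis using assms(1) unfolding algebraic_curve_def local_dim_def by simp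
qed

section \<open>Ends of the affine trace\<close>

lemma dim_1_line:
  fixes E :: "(complex ^ 'n) set"
  assumes "vec.subspace E" "vec.dim E = 1"
  obtains v where "v \<noteq> 0" "E = range (\<lambda>c. c *s v)"
proof -
  obtain B where B: "B \<subseteq> E" "vec.independent B" "E \<subseteq> vec.span B" "card B = vec.dim E"
    using vec.basis_exists by blast
  then obtain v where v: "B = {v}" using assms by (metis card_1_singletonE)
  have "v \<noteq> 0" using B v vec.dependent_zero by blast
  moreover have "E = vec.span {v}" using B v assms by (metis subset_antisym vec.span_minimal)
  ultimately show ?thesis using that by (simp add: vec.span_singleton)
qed

lemma submanifold_atE:
  fixes S :: "(complex ^ 'n) set"
  assumes "submanifold_at k S x"
  obtains U V and f g :: "complex ^ 'n \<Rightarrow> complex ^ 'n" and E where "open U" "open V" "x \<in> S" "x \<in> U"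
    "\<forall>y\<in>U. f y \<in> V \<and> g (f y) = y" "holomorphic_map f U" "holomorphic_map g V"
    "vec.subspace E" "vec.dim E = k" "f ` (S \<inter> U) = V \<inter> E"
proof -
  obtain U V and f g :: "complex ^ 'n \<Rightarrow> complex ^ 'n" and E where *: "open U \<and> open V \<and> x \<in> S \<inter> U \<and> homeomorphism U V f g \<and>
        holomorphic_map f U \<and> holomorphic_map g V \<and> vec.subspace E \<and> vec.dim E = k \<and> f ` (S \<inter> U) = V \<inter> E"
    using assms unfolding submanifold_at_def by (elim exE) (rule that)
  then have "\<forall>y\<in>U. f y \<in> V \<and> g (f y) = y" by (auto simp: homeomorphism_def)
  with * show ?thesis using that[of U V f g E] by simp
qed

text \<open>Excludes dimension 0 at a transverse point at infinity, where
  \<open>transverse_hval\<close> provides other points of \<open>X\<close> arbitrarily close. The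
  straightening map is injective and sends all nearby points of the set to 0.\<close>

lemma isolated_of_dim_0:
  fixes X :: "'n::finite cproj set"
  assumes A: "unitary A" "p \<notin> hyperplane_at_inf A" "submanifold_at 0 (in_chart A X) (affine_chart A p)"
  shows "\<exists>e>0. \<forall>q\<in>X. dist (emb q) (emb p) < e \<longrightarrow> q = p"
proof -
  define x0 where "x0 = affine_chart A p"
  obtain U V and f g :: "complex ^ 'n \<Rightarrow> complex ^ 'n" and E where U: "open U" "open V" "x0 \<in> in_chart A X" "x0 \<in> U"
    "\<forall>y\<in>U. f y \<in> V \<and> g (f y) = y" "holomorphic_map f U" "holomorphic_map g V"
    "vec.subspace E" "vec.dim E = 0" "f ` (in_chart A X \<inter> U) = V \<inter> E"
    using A(3) unfolding x0_def[symmetric] by (rule submanifold_atE)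
  have E: "E \<subseteq> {0}" using U(9) by simp
  obtain r where r: "r > 0" "ball x0 r \<subseteq> U" using U(1,4) open_contains_ball by blast
  obtain e R where e: "e > 0" "R > 0"
    and eR: "\<forall>q. dist (emb q) (emb p) < e \<longrightarrow> q \<notin> hyperplane_at_inf A \<and>
    (\<forall>q'. dist (emb q') (emb p) < e \<longrightarrow> dist (affine_chart A q) (affine_chart A q') \<le> R * dist (emb q) (emb q'))"
    using chart_local[OF A(1,2)] by blast
  have pp: "dist (emb p) (emb p) < e" using e by simp
  have "q = p" if q: "q \<in> X" "dist (emb q) (emb p) < min e (r / R)" for q
  proof -
    have qe: "dist (emb q) (emb p) < e" "dist (emb q) (emb p) < r / R" using q by auto
    have qn: "q \<notin> hyperplane_at_inf A" using eR qe by blast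
    have "dist (affine_chart A q) x0 \<le> R * dist (emb q) (emb p)"
      unfolding x0_def using eR qe(1) pp by blast
    also have "\<dots> < r" using qe(2) e(2) by (simp add: field_simps)
    finally have "affine_chart A q \<in> ball x0 r" by (simp add: dist_commute)
    then have qU: "affine_chart A q \<in> U" using r(2) by blast
    have fE: "f y = 0" if "y \<in> in_chart A X" "y \<in> U" for y
    proof -
      have "f y \<in> f ` (in_chart A X \<inter> U)" using that by (intro imageI IntI)
      then show ?thesis unfolding U(10) using E by blast
    qed
    have "affine_chart A q \<in> in_chart A X" using q(1) qn unfolding in_chart_def by blast
    from fE[OF this qU] fE[OF U(3,4)] have "f (affine_chart A q) = f x0" by simp
    then have "g (f (affine_chart A q)) = g (f x0)" by simp
    then have "affine_chart A q = x0" using U(4,5) qU by simp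
    then have "unchart A (affine_chart A q) = unchart A (affine_chart A p)" by (simp only: x0_def)
    then show ?thesis by (simp only: unchart_chart[OF A(1) qn] unchart_chart[OF A(1,2)])
  qed
  moreover have "min e (r / R) > 0" using e r by simp
  ultimately show ?thesis by blast
qed

text \<open>The inverse chart restricted to the line \<open>E\<close> parametrizes \<open>X\<close>.
  The last clause bounds the parameter by a multiple of the distance to \<open>p\<close>, so that
  \<open>end_param\<close> can turn a linear lower bound on heights into a nonzero
  derivative.\<close>

lemma smooth_curve_param:
  fixes X :: "'n::finite cproj set"
  assumes A: "unitary A" "p \<notin> hyperplane_at_inf A" "submanifold_at 1 (in_chart A X) (affine_chart A p)"
  shows "\<exists>r>0. \<exists>\<psi> :: complex \<Rightarrow> complex ^ 'n. (\<forall>i. (\<lambda>\<zeta>. \<psi> \<zeta> $ i) holomorphic_on ball 0 r) \<and>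
    \<psi> 0 = affine_chart A p \<and> (\<forall>\<zeta>\<in>ball 0 r. unchart A (\<psi> \<zeta>) \<in> X) \<and>
    (\<exists>K>0. \<exists>e>0. \<forall>q\<in>X. dist (emb q) (emb p) < e \<longrightarrow>
       (\<exists>\<zeta>\<in>ball 0 r. cmod \<zeta> \<le> K * dist (emb q) (emb p) \<and> q = unchart A (\<psi> \<zeta>)))"
proof -
  define x0 where "x0 = affine_chart A p"
  obtain U V and f g :: "complex ^ 'n \<Rightarrow> complex ^ 'n" and E where U: "open U" "open V" "x0 \<in> in_chart A X" "x0 \<in> U"
    "\<forall>y\<in>U. f y \<in> V \<and> g (f y) = y" "holomorphic_map f U" "holomorphic_map g V"
    "vec.subspace E" "vec.dim E = 1" "f ` (in_chart A X \<inter> U) = V \<inter> E"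
    using A(3) unfolding x0_def[symmetric] by (rule submanifold_atE)
  obtain v where v: "v \<noteq> 0" "E = range (\<lambda>c. c *s v)" using dim_1_line[OF U(8,9)] .
  have y0: "f x0 \<in> V" "f x0 \<in> E" using U(3,4,10) by auto
  obtain r1 L where 1: "r1 > 0" "L > 0" "ball x0 r1 \<subseteq> U" "\<forall>y\<in>ball x0 r1. \<forall>z\<in>ball x0 r1. dist (f y) (f z) \<le> L * dist y z"
    using holomorphic_map_lipschitz[OF U(1) U(6) U(4)] by blast
  obtain r2 where r2: "r2 > 0" "ball (f x0) r2 \<subseteq> V" using U(2) y0 open_contains_ball by blast
  define nv where "nv = norm v"
  have nv: "nv > 0" using v by (simp add: nv_def)
  define r where "r = r2 / nv"
  have r: "r > 0" using r2 nv by (simp add: r_def)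
  define \<psi> where "\<psi> \<zeta> = g (f x0 + \<zeta> *s v)" for \<zeta>
  have inV: "f x0 + \<zeta> *s v \<in> V" if "\<zeta> \<in> ball 0 r" for \<zeta>
  proof -
    have "norm (\<zeta> *s v) < r2" using that nv by (simp add: r_def norm_scale_vec nv_def[symmetric] field_simps)
    then have "f x0 + \<zeta> *s v \<in> ball (f x0) r2" by (simp add: dist_norm)
    then show ?thesis using r2 by blast
  qed
  have inE: "f x0 + \<zeta> *s v \<in> E" for \<zeta>
  proof -
    have "\<zeta> *s v \<in> E" using v by auto
    then show ?thesis using y0 U(8) vec.subspace_add by blast
  qed
  have hol: "(\<lambda>\<zeta>. \<psi> \<zeta> $ i) holomorphic_on ball 0 r" for i
    unfolding holomorphic_on_def
  proof
    fix \<zeta> :: complex assume "\<zeta> \<in> ball 0 r"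
    then obtain D :: "complex ^ 'n ^ 'n" where "(g has_derivative (\<lambda>h. D *v h)) (at (f x0 + \<zeta> *s v))"
      using U(7) inV unfolding holomorphic_map_def by blast
    from holomorphic_map_line[OF this] show "(\<lambda>\<zeta>. \<psi> \<zeta> $ i) field_differentiable at \<zeta> within ball 0 r"
      unfolding \<psi>_def field_differentiable_def by (blast intro: has_field_derivative_at_within)
  qed
  have \<psi>0: "\<psi> 0 = x0" using U(4,5) by (simp add: \<psi>_def)
  have inX: "unchart A (\<psi> \<zeta>) \<in> X" if "\<zeta> \<in> ball 0 r" for \<zeta>
  proof -
    have "f x0 + \<zeta> *s v \<in> f ` (in_chart A X \<inter> U)" using inV[OF that] inE U(10) by blast
    then obtain y where y: "y \<in> in_chart A X" "y \<in> U" "f x0 + \<zeta> *s v = f y" by blast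
    then have "\<psi> \<zeta> = y" using U(5) by (simp add: \<psi>_def)
    then show ?thesis using y(1) in_chart_iff[OF A(1)] by simp
  qed
  obtain e R where e: "e > 0" "R > 0"
    and eR: "\<forall>q. dist (emb q) (emb p) < e \<longrightarrow> q \<notin> hyperplane_at_inf A \<and>
    (\<forall>q'. dist (emb q') (emb p) < e \<longrightarrow> dist (affine_chart A q) (affine_chart A q') \<le> R * dist (emb q) (emb q'))"
    using chart_local[OF A(1,2)] by blast
  have pp: "dist (emb p) (emb p) < e" using e by simp
  define e' where "e' = min e (min (r1 / R) (r2 / (L * R)))"
  have e': "e' > 0" using e 1 r2 by (simp add: e'_def)
  have K: "L * R / nv > 0" using 1 e nv by simp
  have "\<exists>\<zeta>\<in>ball 0 r. cmod \<zeta> \<le> (L * R / nv) * dist (emb q) (emb p) \<and> q = unchart A (\<psi> \<zeta>)"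
    if q: "q \<in> X" "dist (emb q) (emb p) < e'" for q
  proof -
    define d where "d = dist (emb q) (emb p)"
    have qe: "d < e" "d < r1 / R" "d < r2 / (L * R)" using q by (auto simp: e'_def d_def)
    have qn: "q \<notin> hyperplane_at_inf A" using eR qe unfolding d_def by blast
    define x where "x = affine_chart A q"
    have dx: "dist x x0 \<le> R * d"
      unfolding x0_def x_def d_def using eR qe(1)[unfolded d_def] pp by blast
    have "R * d < r1" using qe(2) e(2) by (simp add: field_simps)
    then have xb: "x \<in> ball x0 r1" using dx by (simp add: dist_commute)
    then have xU: "x \<in> U" using 1(3) by blast
    have xX: "x \<in> in_chart A X" using q qn unfolding in_chart_def x_def by blast
    have "f x \<in> E" using U(10) xU xX by blast
    then have "f x - f x0 \<in> E" using y0 U(8) vec.subspace_diff by blast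
    then obtain \<zeta> where z: "f x - f x0 = \<zeta> *s v" using v by auto
    have "dist (f x) (f x0) \<le> L * dist x x0" using 1(1,4) xb by (meson centre_in_ball)
    also have "\<dots> \<le> L * (R * d)" using dx 1(2) by (intro mult_left_mono) auto
    finally have zn: "cmod \<zeta> * nv \<le> L * R * d" by (simp add: dist_norm z norm_scale_vec nv_def)
    have "L * R * d < r2" using qe(3) e(2) 1(2) by (simp add: field_simps)
    then have "cmod \<zeta> * nv < r2" using zn by linarith
    then have "\<zeta> \<in> ball 0 r" using nv by (simp add: r_def field_simps)
    moreover have "cmod \<zeta> \<le> (L * R / nv) * d" using zn nv by (simp add: field_simps)
    moreover have "\<psi> \<zeta> = x" using U(5) xU by (simp add: \<psi>_def z[symmetric])
    then have "unchart A (\<psi> \<zeta>) = unchart A (affine_chart A q)" by (simp only: x_def)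
    then have "q = unchart A (\<psi> \<zeta>)" by (simp only: unchart_chart[OF A(1) qn])
    ultimately show ?thesis unfolding d_def by blast
  qed
  then have "\<exists>K>0. \<exists>e>0. \<forall>q\<in>X. dist (emb q) (emb p) < e \<longrightarrow>
       (\<exists>\<zeta>\<in>ball 0 r. cmod \<zeta> \<le> K * dist (emb q) (emb p) \<and> q = unchart A (\<psi> \<zeta>))"
    using K e' by blast
  then show ?thesis using r hol \<psi>0 inX unfolding x0_def by blast
qed

text \<open>Near a transverse point at infinity the last homogeneous coordinate is itself a local parameter
  \<open>\<eta>\<close> of the curve, which therefore has a simple pole there.\<close>

lemma end_param:
  fixes X :: "'n::finite cproj set"
  assumes X: "algebraic_curve X" and B: "unitary B" and p: "p \<in> X" "p \<in> hyperplane_at_inf B"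
    and ns: "nonsingular_point X p" and tr: "transverse_at X (hyperplane_at_inf B) p"
  shows "\<exists>\<rho>>0. \<exists>N :: complex \<Rightarrow> complex ^ 'n. (\<forall>i. (\<lambda>\<eta>. N \<eta> $ i) holomorphic_on ball 0 \<rho>) \<and> N 0 \<noteq> 0 \<and>
    (\<forall>\<eta>. \<eta> \<noteq> 0 \<longrightarrow> cmod \<eta> < \<rho> \<longrightarrow> unchart B ((1 / \<eta>) *s N \<eta>) \<in> X) \<and>
    (\<forall>r>0. \<exists>e>0. \<forall>s\<in>X - hyperplane_at_inf B. dist (emb s) (emb p) < e \<longrightarrow>
       (\<exists>\<eta>. \<eta> \<noteq> 0 \<and> cmod \<eta> < r \<and> affine_chart B s = (1 / \<eta>) *s N \<eta>))"
proof -
  obtain k where "regular_point k X p" using ns unfolding nonsingular_point_def by blast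
  then have k1: "k \<le> 1" and "\<exists>A. unitary A \<and> p \<notin> hyperplane_at_inf A \<and> submanifold_at k (in_chart A X) (affine_chart A p)"
    using regular_point_dim_le[OF X] unfolding regular_point_def by blast+
  then obtain A where A: "unitary A" "p \<notin> hyperplane_at_inf A" and sub: "submanifold_at k (in_chart A X) (affine_chart A p)" by blast
  obtain c where c: "c > 0" "\<And>e. e > 0 \<Longrightarrow> \<exists>q\<in>X. dist (emb q) (emb p) < e \<and> 0 < hval B q \<and> c * dist (emb q) (emb p) \<le> hval B q"
    using transverse_hval[OF B p tr] by blast
  have hp: "hval B p = 0" using p hval_zero_iff by blast
  have "k \<noteq> 0"
  proof
    assume "k = 0"
    then obtain e where "e > 0" "\<forall>q\<in>X. dist (emb q) (emb p) < e \<longrightarrow> q = p"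
      using isolated_of_dim_0[OF A] sub by blast
    then show False using c(2)[of e] hp by fastforce
  qed
  with k1 sub have sub: "submanifold_at 1 (in_chart A X) (affine_chart A p)" by (cases k) auto
  obtain r and \<psi> :: "complex \<Rightarrow> complex ^ 'n" and K e0 where r: "r > 0" and hol: "\<And>i. (\<lambda>\<zeta>. \<psi> \<zeta> $ i) holomorphic_on ball 0 r"
    and \<psi>0: "\<psi> 0 = affine_chart A p" and inX: "\<forall>\<zeta>\<in>ball 0 r. unchart A (\<psi> \<zeta>) \<in> X"
    and K: "K > 0" and e0: "e0 > 0" and par: "\<forall>q\<in>X. dist (emb q) (emb p) < e0 \<longrightarrow>
       (\<exists>\<zeta>\<in>ball 0 r. cmod \<zeta> \<le> K * dist (emb q) (emb p) \<and> q = unchart A (\<psi> \<zeta>))"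
    using smooth_curve_param[OF A sub] by blast
  \<comment> \<open>Homogeneous coordinates along the curve in the system \<open>B\<close>; below,
    \<open>l\<close> is the one that vanishes on the hyperplane and \<open>M\<close> holds the
    others.\<close>
  define Z where "Z \<zeta> = (B ** adj A) *v affine_vec (\<psi> \<zeta>)" for \<zeta>
  have Zhol: "(\<lambda>\<zeta>. Z \<zeta> $ i) holomorphic_on ball 0 r" for i
  proof -
    have "(\<lambda>\<zeta>. affine_vec (\<psi> \<zeta>) $ j) holomorphic_on ball 0 r" for j
      using hol by (cases j) (simp_all add: affine_vec_None affine_vec_Some)
    then show ?thesis unfolding Z_def matrix_vector_mult_def by (simp, intro holomorphic_intros)
  qed
  have Z: "Z \<zeta> = B *v (adj A *v affine_vec (\<psi> \<zeta>))" for \<zeta> by (simp add: Z_def matrix_vector_mul_assoc)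
  have Znz: "Z \<zeta> \<noteq> 0" for \<zeta>
    unfolding Z using adj_affine_nonzero[OF A(1)] norm_unitary[OF B] by (metis norm_eq_zero)
  define l where "l \<zeta> = Z \<zeta> $ None" for \<zeta>
  define M where "M \<zeta> = (\<chi> i. Z \<zeta> $ Some i)" for \<zeta>
  have lhol: "l holomorphic_on ball 0 r" unfolding l_def by (rule Zhol)
  have hyp: "unchart A (\<psi> \<zeta>) \<in> hyperplane_at_inf B \<longleftrightarrow> l \<zeta> = 0" for \<zeta>
    unfolding l_def Z by (rule hyperplane_at_inf_iff[OF unchart(3)[OF A(1)] adj_affine_nonzero[OF A(1)]])
  have up0: "unchart A (\<psi> 0) = p" unfolding \<psi>0 by (rule unchart_chart[OF A])
  have l0: "l 0 = 0" using hyp[of 0] up0 p by simp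
  have M0: "M 0 \<noteq> 0"
  proof
    assume "M 0 = 0"
    then have "Z 0 $ j = 0" for j using l0 by (cases j) (auto simp: M_def l_def vec_eq_iff)
    then show False using Znz[of 0] by (simp add: vec_eq_iff)
  qed
  have chart: "affine_chart B (unchart A (\<psi> \<zeta>)) = (1 / l \<zeta>) *s M \<zeta>" if "l \<zeta> \<noteq> 0" for \<zeta>
    using chart_eq[OF B unchart(3)[OF A(1)], of "\<psi> \<zeta>"] that unfolding Z[symmetric] l_def[symmetric]
    by (simp add: M_def vec_eq_iff)
  have hv: "hval B (unchart A (\<psi> \<zeta>)) \<le> cmod (l \<zeta>)" for \<zeta>
  proof -
    have "norm (adj A *v affine_vec (\<psi> \<zeta>)) = norm (affine_vec (\<psi> \<zeta>))"
      using norm_unitary[OF A(1), of "adj A *v affine_vec (\<psi> \<zeta>)"] by (simp add: adj_inverse[OF A(1)])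
    then have "hval B (unchart A (\<psi> \<zeta>)) = cmod (l \<zeta>) / norm (affine_vec (\<psi> \<zeta>))"
      using hval_eq[OF unchart(3)[OF A(1)] adj_affine_nonzero[OF A(1)], of B "\<psi> \<zeta>"] by (simp add: l_def Z)
    also have "\<dots> \<le> cmod (l \<zeta>) / 1" by (intro divide_left_mono norm_affine_vec_ge) (simp_all add: affine_vec_nonzero)
    finally show ?thesis by simp
  qed
  \<comment> \<open>A vanishing derivative would make the height small of higher order in the
    distance to \<open>p\<close>, against the linear lower bound \<open>c\<close>.\<close>
  have dl: "deriv l 0 \<noteq> 0"
  proof
    assume d0: "deriv l 0 = 0"
    have "(l has_field_derivative 0) (at 0)"
      using holomorphic_derivI[OF lhol open_ball, of 0] r d0 by simp
    moreover have "(*) (0::complex) = (\<lambda>h. 0)" by (rule ext) simp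
    ultimately have "(l has_derivative (\<lambda>h. 0)) (at 0)" by (simp add: has_field_derivative_def)
    moreover have "c / (2 * K) > 0" using c K by simp
    ultimately obtain \<delta> where \<delta>: "\<delta> > 0" "\<forall>\<zeta>. norm (\<zeta> - 0) < \<delta> \<longrightarrow> norm (l \<zeta> - l 0 - 0) \<le> (c / (2 * K)) * norm (\<zeta> - 0)"
      unfolding has_derivative_at_alt by blast
    obtain q where q: "q \<in> X" "dist (emb q) (emb p) < min e0 (\<delta> / K)" "0 < hval B q" "c * dist (emb q) (emb p) \<le> hval B q"
      using c(2)[of "min e0 (\<delta> / K)"] e0 \<delta> K by auto
    define d where "d = dist (emb q) (emb p)"
    have d: "d < e0" "d < \<delta> / K" using q(2) by (auto simp: d_def)
    obtain \<zeta> where z: "\<zeta> \<in> ball 0 r" "cmod \<zeta> \<le> K * d" "q = unchart A (\<psi> \<zeta>)"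
      using par q(1) d(1) unfolding d_def by blast
    have "K * d < \<delta>" using d(2) K by (simp add: field_simps)
    then have "cmod (l \<zeta>) \<le> (c / (2 * K)) * cmod \<zeta>" using \<delta>(2) z(2) l0 by simp
    also have "\<dots> \<le> (c / (2 * K)) * (K * d)" using z(2) c K by (intro mult_left_mono) auto
    also have "\<dots> = c * d / 2" using K by simp
    finally have "hval B q \<le> c * d / 2" using hv[of \<zeta>] z(3) by simp
    then show False using q(3,4) unfolding d_def[symmetric] by linarith
  qed
  have z0: "0 \<in> ball (0::complex) r" using r by simp
  have "\<exists>r1. 0 < r1 \<and> ball 0 r1 \<subseteq> ball (0::complex) r \<and> inj_on l (ball 0 r1)"
  proof (rule has_complex_derivative_locally_injective[OF lhol z0 open_ball dl])
    fix t assume t: "t > 0" "ball 0 t \<subseteq> ball (0::complex) r" "inj_on l (ball 0 t)"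
    show ?thesis by (intro exI[of _ t] conjI t)
  qed
  then obtain r1 where r1: "r1 > 0" "ball 0 r1 \<subseteq> ball (0::complex) r" "inj_on l (ball 0 r1)" by (elim exE conjE)
  have lhol1: "l holomorphic_on ball 0 r1" using lhol r1(2) holomorphic_on_subset by blast
  have "\<exists>h. h holomorphic_on (l ` ball 0 r1) \<and> (\<forall>z\<in>ball 0 r1. h (l z) = z)"
  proof (rule holomorphic_has_inverse[OF lhol1 open_ball r1(3)])
    fix g assume g: "g holomorphic_on (l ` ball 0 r1)" "\<And>z. z \<in> ball 0 r1 \<Longrightarrow> g (l z) = z"
    show ?thesis by (intro exI[of _ g] conjI ballI g)
  qed
  then obtain h where h: "h holomorphic_on (l ` ball 0 r1)" "\<And>z. z \<in> ball 0 r1 \<Longrightarrow> h (l z) = z" by blast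
  have opn: "open (l ` ball 0 r1)" by (rule open_mapping_thm3[OF lhol1 open_ball r1(3)])
  have "l 0 \<in> l ` ball 0 r1" using r1(1) by (intro imageI) simp
  then obtain \<rho> where \<rho>: "\<rho> > 0" "ball 0 \<rho> \<subseteq> l ` ball 0 r1"
    using opn l0 open_contains_ball by metis
  have hb: "h \<eta> \<in> ball 0 r1 \<and> l (h \<eta>) = \<eta>" if eb: "\<eta> \<in> ball 0 \<rho>" for \<eta>
  proof -
    obtain z where "z \<in> ball 0 r1" "\<eta> = l z" using \<rho>(2) eb by blast
    then show ?thesis using h(2) by simp
  qed
  have h0: "h 0 = 0" using h(2)[of 0] l0 r1(1) by simp
  \<comment> \<open>The point has homogeneous coordinates \<open>M\<close> and \<open>l\<close>.
    With \<open>l\<close> itself as parameter \<open>\<eta>\<close>, its affine coordinates become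
    \<open>N \<eta>\<close> divided by \<open>\<eta>\<close>.\<close>
  define N where "N \<eta> = M (h \<eta>)" for \<eta>
  have Nhol: "(\<lambda>\<eta>. N \<eta> $ i) holomorphic_on ball 0 \<rho>" for i
  proof -
    have "((\<lambda>\<zeta>. Z \<zeta> $ Some i) \<circ> h) holomorphic_on ball 0 \<rho>"
    proof (rule holomorphic_on_compose_gen[where t = "ball 0 r"])
      show "h holomorphic_on ball 0 \<rho>" using h(1) \<rho>(2) holomorphic_on_subset by blast
      show "h ` ball 0 \<rho> \<subseteq> ball 0 r" using hb r1(2) by blast
    qed (rule Zhol)
    then show ?thesis by (simp add: N_def M_def o_def)
  qed
  have N1: "unchart B ((1 / \<eta>) *s N \<eta>) \<in> X" if e: "\<eta> \<noteq> 0" "cmod \<eta> < \<rho>" for \<eta>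
  proof -
    have hh: "h \<eta> \<in> ball 0 r1" "l (h \<eta>) = \<eta>" using hb[of \<eta>] e by auto
    let ?s = "unchart A (\<psi> (h \<eta>))"
    have "?s \<in> X" using inX hh(1) r1(2) by blast
    moreover have "?s \<notin> hyperplane_at_inf B" using hyp[of "h \<eta>"] hh e by simp
    moreover have "affine_chart B ?s = (1 / \<eta>) *s N \<eta>" using chart[of "h \<eta>"] hh e by (simp add: N_def)
    ultimately show ?thesis using unchart_chart[OF B] by metis
  qed
  have N2: "\<exists>e>0. \<forall>s\<in>X - hyperplane_at_inf B. dist (emb s) (emb p) < e \<longrightarrow>
       (\<exists>\<eta>. \<eta> \<noteq> 0 \<and> cmod \<eta> < r' \<and> affine_chart B s = (1 / \<eta>) *s N \<eta>)" if r': "r' > 0" for r' :: real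
  proof -
    have "continuous_on (ball 0 r) l" by (rule holomorphic_on_imp_continuous_on[OF lhol])
    then have "isCont l 0" by (rule continuous_on_interior) (use r in simp)
    then have "eventually (\<lambda>\<zeta>. dist (l \<zeta>) (l 0) < r') (nhds 0)"
      using r' unfolding isCont_def by (intro tendstoD) (simp_all add: tendsto_nhds_iff)
    then obtain \<delta> where \<delta>: "\<delta> > 0" "\<forall>\<zeta>. dist \<zeta> 0 < \<delta> \<longrightarrow> dist (l \<zeta>) (l 0) < r'"
      unfolding eventually_nhds_metric by blast
    define e where "e = min e0 (min \<delta> r1 / K)"
    have e: "e > 0" using e0 \<delta> r1 K by (simp add: e_def)
    have "\<exists>\<eta>. \<eta> \<noteq> 0 \<and> cmod \<eta> < r' \<and> affine_chart B s = (1 / \<eta>) *s N \<eta>"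
      if s: "s \<in> X - hyperplane_at_inf B" "dist (emb s) (emb p) < e" for s
    proof -
      define d where "d = dist (emb s) (emb p)"
      have d: "d < e0" "d < min \<delta> r1 / K" using s(2) by (auto simp: d_def e_def)
      obtain \<zeta> where z: "\<zeta> \<in> ball 0 r" "cmod \<zeta> \<le> K * d" "s = unchart A (\<psi> \<zeta>)"
        using par s(1) d(1) unfolding d_def by blast
      have "K * d < min \<delta> r1" using d(2) K by (simp add: field_simps)
      then have z1: "cmod \<zeta> < \<delta>" "\<zeta> \<in> ball 0 r1" using z(2) by auto
      have "cmod (l \<zeta>) < r'" using \<delta>(2) z1(1) l0 by simp
      moreover have nz: "l \<zeta> \<noteq> 0" using hyp[of \<zeta>] s(1) z(3) by simp
      moreover have "affine_chart B s = (1 / l \<zeta>) *s N (l \<zeta>)"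
        using chart[OF nz] h(2)[OF z1(2)] z(3) by (simp add: N_def)
      ultimately show ?thesis by blast
    qed
    then show ?thesis using e by blast
  qed
  have N0: "N 0 \<noteq> 0" using M0 by (simp add: N_def h0)
  show ?thesis
    by (rule exI[of _ \<rho>], rule conjI[OF \<rho>(1)], rule exI[of _ N], intro conjI allI impI, rule Nhol, rule N0,
        (rule N1; assumption), (rule N2; assumption))
qed

section \<open>Ends as images of the exterior of a disc\<close>

lemma holomorphic_curve_lipschitz:
  fixes f :: "complex \<Rightarrow> complex ^ 'n"
  assumes hol: "\<And>i. (\<lambda>z. f z $ i) holomorphic_on ball 0 \<rho>" and r: "0 < r" "r < \<rho>"
  shows "\<exists>L>0. \<forall>a\<in>cball 0 r. \<forall>b\<in>cball 0 r. dist (f a) (f b) \<le> L * dist a b"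
proof -
  have sub: "cball (0::complex) r \<subseteq> ball 0 \<rho>" using r by auto
  have "\<exists>M. \<forall>z\<in>cball 0 r. cmod (deriv (\<lambda>z. f z $ i) z) \<le> M" for i
  proof -
    have "continuous_on (cball 0 r) (deriv (\<lambda>z. f z $ i))"
      using holomorphic_on_imp_continuous_on[OF holomorphic_deriv[OF hol open_ball]] sub by (rule continuous_on_subset)
    then have "compact (deriv (\<lambda>z. f z $ i) ` cball 0 r)" by (rule compact_continuous_image) (rule compact_cball)
    then have "bounded (deriv (\<lambda>z. f z $ i) ` cball 0 r)" by (rule compact_imp_bounded)
    then show ?thesis unfolding bounded_iff by blast
  qed
  then obtain M where M: "\<And>i z. z \<in> cball 0 r \<Longrightarrow> cmod (deriv (\<lambda>z. f z $ i) z) \<le> M i" by metis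
  define L where "L = (\<Sum>i\<in>UNIV. \<bar>M i\<bar>) + 1"
  have L: "L > 0" unfolding L_def by (intro add_nonneg_pos sum_nonneg) auto
  have "dist (f a) (f b) \<le> L * dist a b" if ab: "a \<in> cball 0 r" "b \<in> cball 0 r" for a b
  proof -
    have "cmod (f a $ i - f b $ i) \<le> \<bar>M i\<bar> * cmod (a - b)" for i
    proof (rule field_differentiable_bound[OF convex_cball _ _ ab])
      fix z :: complex assume z: "z \<in> cball 0 r"
      show "((\<lambda>z. f z $ i) has_field_derivative deriv (\<lambda>z. f z $ i) z) (at z within cball 0 r)"
        using holomorphic_derivI[OF hol open_ball] z sub by blast
      show "cmod (deriv (\<lambda>z. f z $ i) z) \<le> \<bar>M i\<bar>" using M[OF z, of i] by linarith
    qed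
    then have "(\<Sum>i\<in>UNIV. cmod ((f a - f b) $ i)) \<le> (\<Sum>i\<in>UNIV. \<bar>M i\<bar> * cmod (a - b))"
      by (intro sum_mono) simp
    moreover have "norm (f a - f b) \<le> (\<Sum>i\<in>UNIV. cmod ((f a - f b) $ i))"
      by (simp only: norm_vec_def L2_set_le_sum norm_ge_zero)
    ultimately have "norm (f a - f b) \<le> (\<Sum>i\<in>UNIV. \<bar>M i\<bar>) * cmod (a - b)" by (simp add: sum_distrib_right)
    also have "\<dots> \<le> L * cmod (a - b)" unfolding L_def by (intro mult_right_mono) auto
    finally show ?thesis by (simp add: dist_norm)
  qed
  then show ?thesis using L by blast
qed

text \<open>Splitting off the value at 0 gives \<open>\<zeta> *s N (1 / \<zeta>) = \<zeta> *s N 0 +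
  M (1 / \<zeta>)\<close> with \<open>M\<close> holomorphic: an injective linear map plus a
  perturbation whose Lipschitz constant is at most a multiple of \<open>1 / R\<close>.\<close>

lemma end_bilipschitz:
  fixes N :: "complex \<Rightarrow> complex ^ 'n"
  assumes hol: "\<And>i. (\<lambda>z. N z $ i) holomorphic_on ball 0 \<rho>" and \<rho>: "\<rho> > 0" and N0: "N 0 \<noteq> 0"
  shows "\<exists>R>0. \<exists>a>0. \<exists>b>0. 1 / R < \<rho> \<and> (\<forall>\<zeta> \<zeta>'. R \<le> cmod \<zeta> \<longrightarrow> R \<le> cmod \<zeta>' \<longrightarrow>
     a * cmod (\<zeta> - \<zeta>') \<le> dist (\<zeta> *s N (1 / \<zeta>)) (\<zeta>' *s N (1 / \<zeta>')) \<and>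
     dist (\<zeta> *s N (1 / \<zeta>)) (\<zeta>' *s N (1 / \<zeta>')) \<le> b * cmod (\<zeta> - \<zeta>'))"
proof -
  define M :: "complex \<Rightarrow> complex ^ 'n" where
    "M z = (\<chi> i. if z = 0 then deriv (\<lambda>z. N z $ i) 0 else (N z $ i - N 0 $ i) / (z - 0))" for z
  have "(\<lambda>z. M z $ i) holomorphic_on ball 0 \<rho>" for i
    unfolding M_def vec_lambda_beta by (rule pole_lemma_open[OF hol open_ball])
  then obtain L where L: "L > 0" "\<forall>a\<in>cball 0 (\<rho>/2). \<forall>b\<in>cball 0 (\<rho>/2). dist (M a) (M b) \<le> L * dist a b"
    using holomorphic_curve_lipschitz[of M \<rho> "\<rho>/2"] \<rho> by auto
  define n where "n = norm (N 0)"
  have n: "n > 0" using N0 by (simp add: n_def)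
  define R where "R = max (2 / \<rho>) (1 + 2 * L / n)"
  have R: "R \<ge> 2 / \<rho>" "R \<ge> 1" "R \<ge> 2 * L / n" using L n by (auto simp: R_def le_max_iff_disj)
  have Rpos: "R > 0" using R(2) by simp
  have y: "\<zeta> *s N (1 / \<zeta>) = \<zeta> *s N 0 + M (1 / \<zeta>)" if "\<zeta> \<noteq> 0" for \<zeta>
    using that by (simp add: vec_eq_iff M_def field_simps)
  have main: "\<bar>dist (\<zeta> *s N (1 / \<zeta>)) (\<zeta>' *s N (1 / \<zeta>')) - cmod (\<zeta> - \<zeta>') * n\<bar> \<le> n / 2 * cmod (\<zeta> - \<zeta>')"
    if z: "R \<le> cmod \<zeta>" "R \<le> cmod \<zeta>'" for \<zeta> \<zeta>'
  proof -
    have nz: "\<zeta> \<noteq> 0" "\<zeta>' \<noteq> 0" using z Rpos by auto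
    have inb: "1 / w \<in> cball 0 (\<rho>/2)" if "R \<le> cmod w" for w
    proof -
      have "2 / \<rho> \<le> cmod w" using that R by simp
      moreover have "0 < 2 / \<rho>" using \<rho> by simp
      ultimately have "1 / cmod w \<le> 1 / (2 / \<rho>)" by (intro divide_left_mono mult_pos_pos) linarith+
      then show ?thesis by (simp add: norm_divide)
    qed
    have "dist (M (1 / \<zeta>)) (M (1 / \<zeta>')) \<le> L * dist (1 / \<zeta>) (1 / \<zeta>')" using L(2) inb z by blast
    also have "dist (1 / \<zeta>) (1 / \<zeta>') = cmod (\<zeta> - \<zeta>') / (cmod \<zeta> * cmod \<zeta>')"
    proof -
      have "1 / \<zeta> - 1 / \<zeta>' = (\<zeta>' - \<zeta>) / (\<zeta> * \<zeta>')" using nz by (simp add: field_simps)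
      then show ?thesis by (simp add: dist_norm norm_divide norm_mult norm_minus_commute)
    qed
    also have "L * (cmod (\<zeta> - \<zeta>') / (cmod \<zeta> * cmod \<zeta>')) \<le> L * (cmod (\<zeta> - \<zeta>') / R)"
    proof (intro mult_left_mono divide_left_mono)
      have "R * 1 \<le> cmod \<zeta> * cmod \<zeta>'" using z R(2) Rpos by (intro mult_mono) auto
      then show "R \<le> cmod \<zeta> * cmod \<zeta>'" by simp
    qed (use L Rpos nz in auto)
    also have "\<dots> \<le> n / 2 * cmod (\<zeta> - \<zeta>')"
    proof -
      have "L / R \<le> n / 2" using R(3) n Rpos by (simp add: field_simps)
      then have "L / R * cmod (\<zeta> - \<zeta>') \<le> n / 2 * cmod (\<zeta> - \<zeta>')" by (intro mult_right_mono) auto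
      then show ?thesis by simp
    qed
    finally have M: "norm (M (1 / \<zeta>) - M (1 / \<zeta>')) \<le> n / 2 * cmod (\<zeta> - \<zeta>')" by (simp add: dist_norm)
    have "\<zeta> *s N (1 / \<zeta>) - \<zeta>' *s N (1 / \<zeta>') = (\<zeta> - \<zeta>') *s N 0 + (M (1 / \<zeta>) - M (1 / \<zeta>'))"
      unfolding y[OF nz(1)] y[OF nz(2)] by (simp add: vec_eq_iff algebra_simps)
    then have e: "dist (\<zeta> *s N (1 / \<zeta>)) (\<zeta>' *s N (1 / \<zeta>')) = norm ((\<zeta> - \<zeta>') *s N 0 + (M (1 / \<zeta>) - M (1 / \<zeta>')))"
      by (simp only: dist_norm)
    have e2: "norm ((\<zeta> - \<zeta>') *s N 0) = cmod (\<zeta> - \<zeta>') * n" by (simp only: norm_scale_vec n_def)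
    show ?thesis unfolding e e2[symmetric]
      using M norm_triangle_ineq3[of "(\<zeta> - \<zeta>') *s N 0 + (M (1 / \<zeta>) - M (1 / \<zeta>'))" "(\<zeta> - \<zeta>') *s N 0"] by simp
  qed
  have res: "n / 2 * cmod (\<zeta> - \<zeta>') \<le> dist (\<zeta> *s N (1 / \<zeta>)) (\<zeta>' *s N (1 / \<zeta>')) \<and>
     dist (\<zeta> *s N (1 / \<zeta>)) (\<zeta>' *s N (1 / \<zeta>')) \<le> 2 * n * cmod (\<zeta> - \<zeta>')"
    if z: "R \<le> cmod \<zeta>" "R \<le> cmod \<zeta>'" for \<zeta> \<zeta>'
  proof -
    define D where "D = dist (\<zeta> *s N (1 / \<zeta>)) (\<zeta>' *s N (1 / \<zeta>'))"
    define w where "w = n * cmod (\<zeta> - \<zeta>')"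
    have "w \<ge> 0" using n by (simp add: w_def)
    moreover have "\<bar>D - w\<bar> \<le> w / 2" using main[OF z] by (simp add: D_def w_def mult.commute)
    ultimately have "w / 2 \<le> D \<and> D \<le> 2 * w" by linarith
    then show ?thesis unfolding D_def[symmetric] by (simp add: w_def)
  qed
  have "1 / R < \<rho>"
  proof -
    have "0 < 2 / \<rho>" using \<rho> by simp
    then have "1 / R \<le> 1 / (2 / \<rho>)" using R(1) Rpos by (intro divide_left_mono mult_pos_pos) auto
    then show ?thesis using \<rho> by simp
  qed
  then have "0 < R \<and> 0 < n / 2 \<and> 0 < 2 * n \<and> 1 / R < \<rho>" using Rpos n by simp
  then show ?thesis
    by (intro exI[of _ R] conjI exI[of _ "n / 2"] exI[of _ "2 * n"] allI impI res) (simp_all only:)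
qed

text \<open>A nonnegative real part means that the two directions enclose at most a right angle; the
  chord between points of modulus at least \<open>2 * R\<close> then avoids the disc of radius
  \<open>R\<close>.\<close>

lemma inner_dist_segment:
  fixes j :: "'a \<Rightarrow> 'c::metric_space"
  assumes S: "\<And>\<zeta>. R \<le> cmod \<zeta> \<Longrightarrow> \<sigma> \<zeta> \<in> S" and b: "b > 0" and R: "R > 0"
    and lip: "\<And>\<zeta> \<zeta>'. R \<le> cmod \<zeta> \<Longrightarrow> R \<le> cmod \<zeta>' \<Longrightarrow> dist (j (\<sigma> \<zeta>)) (j (\<sigma> \<zeta>')) \<le> b * cmod (\<zeta> - \<zeta>')"
    and z: "2 * R \<le> cmod \<zeta>" "2 * R \<le> cmod \<zeta>'" "0 \<le> Re (\<zeta>' * cnj \<zeta>)"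
  shows "inner_dist (pull_dist j) S (\<sigma> \<zeta>) (\<sigma> \<zeta>') \<le> ennreal (b * cmod (\<zeta> - \<zeta>'))"
proof -
  define c where "c t = (1 - t) *\<^sub>R \<zeta> + t *\<^sub>R \<zeta>'" for t :: real
  have c: "R \<le> cmod (c t)" if t: "0 \<le> t" "t \<le> 1" for t
  proof (rule power2_le_imp_le)
    have "(cmod (c t))\<^sup>2 = (1-t)\<^sup>2 * (cmod \<zeta>)\<^sup>2 + t\<^sup>2 * (cmod \<zeta>')\<^sup>2 + 2 * (t * (1-t)) * Re (\<zeta>' * cnj \<zeta>)"
      unfolding cmod_power2 c_def by (simp add: power2_eq_square algebra_simps)
    moreover have "0 \<le> 2 * (t * (1-t)) * Re (\<zeta>' * cnj \<zeta>)" using t z(3) by (intro mult_nonneg_nonneg) auto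
    moreover have "(2*R)\<^sup>2 \<le> (cmod \<zeta>)\<^sup>2" "(2*R)\<^sup>2 \<le> (cmod \<zeta>')\<^sup>2"
      by (rule power_mono[OF z(1)], use R in simp, rule power_mono[OF z(2)], use R in simp)
    then have "(1-t)\<^sup>2 * (2*R)\<^sup>2 \<le> (1-t)\<^sup>2 * (cmod \<zeta>)\<^sup>2" "t\<^sup>2 * (2*R)\<^sup>2 \<le> t\<^sup>2 * (cmod \<zeta>')\<^sup>2"
      by (auto intro: mult_left_mono)
    moreover have "R\<^sup>2 \<le> ((1-t)\<^sup>2 + t\<^sup>2) * (2*R)\<^sup>2"
    proof -
      have "(1-t)\<^sup>2 + t\<^sup>2 - 1/2 = 2 * (t - 1/2)\<^sup>2" by (simp add: power2_eq_square field_simps)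
      then have "1/2 \<le> (1-t)\<^sup>2 + t\<^sup>2" using zero_le_power2[of "t-1/2"] by linarith
      then have "1/2 * (2*R)\<^sup>2 \<le> ((1-t)\<^sup>2 + t\<^sup>2) * (2*R)\<^sup>2" by (intro mult_right_mono) auto
      moreover have "R\<^sup>2 \<le> 1/2 * (2*R)\<^sup>2" by (simp add: power_mult_distrib)
      ultimately show ?thesis by linarith
    qed
    then have "R\<^sup>2 \<le> (1-t)\<^sup>2 * (2*R)\<^sup>2 + t\<^sup>2 * (2*R)\<^sup>2" by (simp only: distrib_right)
    ultimately show "R\<^sup>2 \<le> (cmod (c t))\<^sup>2" by linarith
  qed simp
  show ?thesis
  proof (rule inner_dist_lipschitz[where \<gamma> = "\<lambda>t. \<sigma> (c t)"])
    fix s t :: real assume st: "0 \<le> s" "s \<le> t" "t \<le> 1"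
    have "dist (j (\<sigma> (c s))) (j (\<sigma> (c t))) \<le> b * cmod (c s - c t)" using st by (intro lip c) auto
    also have "c s - c t = (t - s) *\<^sub>R (\<zeta> - \<zeta>')" by (simp add: c_def algebra_simps)
    finally show "dist (j (\<sigma> (c s))) (j (\<sigma> (c t))) \<le> b * cmod (\<zeta> - \<zeta>') * (t - s)"
      using st by (simp add: mult_ac)
  qed (use b S c in \<open>auto simp: c_def\<close>)
qed

text \<open>Points of an end in opposite directions are joined around the removed disc, through a point
  at a right angle.\<close>

lemma inner_dist_exterior:
  fixes j :: "'a \<Rightarrow> 'c::metric_space"
  assumes S: "\<And>\<zeta>. R \<le> cmod \<zeta> \<Longrightarrow> \<sigma> \<zeta> \<in> S" and b: "b > 0" and R: "R > 0"
    and lip: "\<And>\<zeta> \<zeta>'. R \<le> cmod \<zeta> \<Longrightarrow> R \<le> cmod \<zeta>' \<Longrightarrow> dist (j (\<sigma> \<zeta>)) (j (\<sigma> \<zeta>')) \<le> b * cmod (\<zeta> - \<zeta>')"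
    and z: "2 * R \<le> cmod \<zeta>" "2 * R \<le> cmod \<zeta>'"
  shows "inner_dist (pull_dist j) S (\<sigma> \<zeta>) (\<sigma> \<zeta>') \<le> ennreal (4 * b * cmod (\<zeta> - \<zeta>'))"
proof -
  have seg: "inner_dist (pull_dist j) S (\<sigma> u) (\<sigma> v) \<le> ennreal (b * cmod (u - v))"
    if "2 * R \<le> cmod u" "2 * R \<le> cmod v" "0 \<le> Re (v * cnj u)" for u v
    by (rule inner_dist_segment[where R = R, OF _ b R _ that]) (erule S, erule (1) lip)
  show ?thesis
  proof (cases "0 \<le> Re (\<zeta>' * cnj \<zeta>)")
  case True
  have "inner_dist (pull_dist j) S (\<sigma> \<zeta>) (\<sigma> \<zeta>') \<le> ennreal (b * cmod (\<zeta> - \<zeta>'))"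
    by (rule seg[OF z True])
  also have "\<dots> \<le> ennreal (4 * b * cmod (\<zeta> - \<zeta>'))" using b by (intro ennreal_leI mult_right_mono) auto
  finally show ?thesis .
next
  case False
  \<comment> \<open>A rotation of \<open>\<zeta>\<close> by a right angle, towards the side of the
    other point.\<close>
  have "\<exists>w. cmod w = cmod \<zeta> \<and> 0 \<le> Re (w * cnj \<zeta>) \<and> 0 \<le> Re (\<zeta>' * cnj w)"
  proof (cases "0 \<le> Re (\<zeta>' * cnj (\<i> * \<zeta>))")
    case True
    then show ?thesis by (intro exI[of _ "\<i> * \<zeta>"]) (simp add: norm_mult)
  next
    case False
    then show ?thesis by (intro exI[of _ "- (\<i> * \<zeta>)"]) (simp add: norm_mult)
  qed
  then obtain w where w: "cmod w = cmod \<zeta>" "0 \<le> Re (w * cnj \<zeta>)" "0 \<le> Re (\<zeta>' * cnj w)" by blast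
  have wR: "2 * R \<le> cmod w" using w(1) z(1) by simp
  note 1 = seg[OF z(1) wR w(2)] and 2 = seg[OF wR z(2) w(3)]
  have sq: "(cmod (\<zeta> - \<zeta>'))\<^sup>2 = (cmod \<zeta>)\<^sup>2 + (cmod \<zeta>')\<^sup>2 - 2 * Re (\<zeta>' * cnj \<zeta>)"
    unfolding cmod_power2 by (simp add: power2_eq_square algebra_simps)
  \<comment> \<open>An obtuse angle makes the chord at least as long as either side. The detour
    through \<open>w\<close> costs at most four moduli, hence four chords.\<close>
  have "(cmod \<zeta>)\<^sup>2 \<le> (cmod (\<zeta> - \<zeta>'))\<^sup>2" "(cmod \<zeta>')\<^sup>2 \<le> (cmod (\<zeta> - \<zeta>'))\<^sup>2"
    using sq False zero_le_power2[of "cmod \<zeta>"] zero_le_power2[of "cmod \<zeta>'"] by linarith+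
  then have le: "cmod \<zeta> \<le> cmod (\<zeta> - \<zeta>')" "cmod \<zeta>' \<le> cmod (\<zeta> - \<zeta>')"
    by (auto intro: power2_le_imp_le)
  have "inner_dist (pull_dist j) S (\<sigma> \<zeta>) (\<sigma> \<zeta>') \<le> ennreal (b * cmod (\<zeta> - w)) + ennreal (b * cmod (w - \<zeta>'))"
    using inner_dist_triangle[of j S "\<sigma> \<zeta>" "\<sigma> \<zeta>'" "\<sigma> w"] add_mono[OF 1 2] by (rule order.trans)
  also have "\<dots> = ennreal (b * cmod (\<zeta> - w) + b * cmod (w - \<zeta>'))" using b by (simp add: ennreal_plus)
  also have "\<dots> \<le> ennreal (4 * b * cmod (\<zeta> - \<zeta>'))"
  proof (rule ennreal_leI)
    have "cmod (\<zeta> - w) + cmod (w - \<zeta>') \<le> 4 * cmod (\<zeta> - \<zeta>')"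
      using norm_triangle_ineq4[of \<zeta> w] norm_triangle_ineq4[of w \<zeta>'] w(1) le by linarith
    then have "b * (cmod (\<zeta> - w) + cmod (w - \<zeta>')) \<le> b * (4 * cmod (\<zeta> - \<zeta>'))" using b by (intro mult_left_mono) auto
    then show "b * cmod (\<zeta> - w) + b * cmod (w - \<zeta>') \<le> 4 * b * cmod (\<zeta> - \<zeta>')" by (simp add: algebra_simps)
  qed
  finally show ?thesis .
  qed
qed

text \<open>The end is a bilipschitz copy of the exterior of the disc of radius \<open>R\<close>.
  Points close to \<open>p\<close> have parameters of modulus at least \<open>2 * R\<close>, as
  \<open>inner_dist_exterior\<close> demands.\<close>

lemma end_local_LNE:
  fixes X :: "'n::finite cproj set"
  assumes X: "algebraic_curve X" and B: "unitary B" and p: "p \<in> X" "p \<in> hyperplane_at_inf B"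
    and ns: "nonsingular_point X p" and tr: "transverse_at X (hyperplane_at_inf B) p"
  shows "\<exists>e>0. \<exists>C>0. \<forall>s\<in>X - hyperplane_at_inf B. \<forall>s'\<in>X - hyperplane_at_inf B.
    dist (emb s) (emb p) < e \<longrightarrow> dist (emb s') (emb p) < e \<longrightarrow>
      inner_dist (pull_dist (affine_chart B)) (X - hyperplane_at_inf B) s s' \<le> ennreal (C * dist (affine_chart B s) (affine_chart B s'))"
proof -
  let ?S = "X - hyperplane_at_inf B"
  obtain \<rho> and N :: "complex \<Rightarrow> complex ^ 'n" where \<rho>: "\<rho> > 0" and hol: "\<And>i. (\<lambda>\<eta>. N \<eta> $ i) holomorphic_on ball 0 \<rho>"
    and N0: "N 0 \<noteq> 0" and N1: "\<And>\<eta>. \<eta> \<noteq> 0 \<Longrightarrow> cmod \<eta> < \<rho> \<Longrightarrow> unchart B ((1 / \<eta>) *s N \<eta>) \<in> X"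
    and N2: "\<And>r. r > 0 \<Longrightarrow> \<exists>e>0. \<forall>s\<in>?S. dist (emb s) (emb p) < e \<longrightarrow>
       (\<exists>\<eta>. \<eta> \<noteq> 0 \<and> cmod \<eta> < r \<and> affine_chart B s = (1 / \<eta>) *s N \<eta>)"
    using end_param[OF assms] by metis
  obtain R a b where R: "R > 0" and ab: "a > 0" "b > 0" and R\<rho>: "1 / R < \<rho>" and bi: "\<forall>\<zeta> \<zeta>'. R \<le> cmod \<zeta> \<longrightarrow> R \<le> cmod \<zeta>' \<longrightarrow>
     a * cmod (\<zeta> - \<zeta>') \<le> dist (\<zeta> *s N (1 / \<zeta>)) (\<zeta>' *s N (1 / \<zeta>')) \<and>
     dist (\<zeta> *s N (1 / \<zeta>)) (\<zeta>' *s N (1 / \<zeta>')) \<le> b * cmod (\<zeta> - \<zeta>')"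
    using end_bilipschitz[OF hol \<rho> N0] by blast
  define \<sigma> where "\<sigma> \<zeta> = unchart B (\<zeta> *s N (1 / \<zeta>))" for \<zeta>
  have \<sigma>c: "affine_chart B (\<sigma> \<zeta>) = \<zeta> *s N (1 / \<zeta>)" for \<zeta> by (simp add: \<sigma>_def unchart(2)[OF B])
  have \<sigma>S: "\<sigma> \<zeta> \<in> ?S" if "R \<le> cmod \<zeta>" for \<zeta>
  proof -
    have nz: "\<zeta> \<noteq> 0" using that R by auto
    have "cmod (1 / \<zeta>) \<le> 1 / R" using that R by (simp add: norm_divide frac_le)
    then have "unchart B ((1 / (1 / \<zeta>)) *s N (1 / \<zeta>)) \<in> X" using N1[of "1 / \<zeta>"] nz R\<rho> by simp
    then show ?thesis using nz unchart(1)[OF B] by (simp add: \<sigma>_def)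
  qed
  have lip: "dist (affine_chart B (\<sigma> \<zeta>)) (affine_chart B (\<sigma> \<zeta>')) \<le> b * cmod (\<zeta> - \<zeta>')"
    if "R \<le> cmod \<zeta>" "R \<le> cmod \<zeta>'" for \<zeta> \<zeta>' using bi that unfolding \<sigma>c by blast
  have "1 / (2 * R) > 0" using R by simp
  then obtain e where e: "e > 0" "\<forall>s\<in>?S. dist (emb s) (emb p) < e \<longrightarrow>
       (\<exists>\<eta>. \<eta> \<noteq> 0 \<and> cmod \<eta> < 1 / (2 * R) \<and> affine_chart B s = (1 / \<eta>) *s N \<eta>)"
    using N2 by blast
  have par: "\<exists>\<zeta>. 2 * R \<le> cmod \<zeta> \<and> s = \<sigma> \<zeta>" if s: "s \<in> ?S" "dist (emb s) (emb p) < e" for s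
  proof -
    obtain \<eta> where eta: "\<eta> \<noteq> 0" "cmod \<eta> < 1 / (2 * R)" "affine_chart B s = (1 / \<eta>) *s N \<eta>" using e(2) s by blast
    have "2 * R \<le> cmod (1 / \<eta>)" using eta R by (simp add: norm_divide field_simps)
    moreover have "s = \<sigma> (1 / \<eta>)"
    proof -
      have "\<sigma> (1 / \<eta>) = unchart B (affine_chart B s)" unfolding eta(3) by (simp add: \<sigma>_def)
      also have "\<dots> = s" using s by (intro unchart_chart[OF B]) simp
      finally show ?thesis by simp
    qed
    ultimately show ?thesis by blast
  qed
  have "inner_dist (pull_dist (affine_chart B)) ?S s s' \<le> ennreal (4 * b / a * dist (affine_chart B s) (affine_chart B s'))"
    if s: "s \<in> ?S" "s' \<in> ?S" "dist (emb s) (emb p) < e" "dist (emb s') (emb p) < e" for s s'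
  proof -
    obtain \<zeta> where z: "2 * R \<le> cmod \<zeta>" "s = \<sigma> \<zeta>" using par s by blast
    obtain \<zeta>' where z': "2 * R \<le> cmod \<zeta>'" "s' = \<sigma> \<zeta>'" using par s by blast
    have "inner_dist (pull_dist (affine_chart B)) ?S s s' \<le> ennreal (4 * b * cmod (\<zeta> - \<zeta>'))"
      unfolding z(2) z'(2) by (rule inner_dist_exterior[OF \<sigma>S ab(2) R lip z(1) z'(1)])
    also have "\<dots> \<le> ennreal (4 * b / a * dist (affine_chart B s) (affine_chart B s'))"
    proof (rule ennreal_leI)
      have "a * cmod (\<zeta> - \<zeta>') \<le> dist (affine_chart B s) (affine_chart B s')"
        unfolding z(2) z'(2) \<sigma>c using bi z(1) z'(1) R by simp
      then have "4 * b / a * (a * cmod (\<zeta> - \<zeta>')) \<le> 4 * b / a * dist (affine_chart B s) (affine_chart B s')"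
        using ab by (intro mult_left_mono) auto
      then show "4 * b * cmod (\<zeta> - \<zeta>') \<le> 4 * b / a * dist (affine_chart B s) (affine_chart B s')" using ab by simp
    qed
    finally show ?thesis .
  qed
  moreover have "4 * b / a > 0" using ab by simp
  ultimately show ?thesis using e(1) by blast
qed

section \<open>Projective and affine Lipschitz normal embedding\<close>

text \<open>Extracts from an LNE property the connectedness that \<open>LNE_glue\<close>
  requires.\<close>

lemma connected_of_inner_dist_finite:
  fixes j :: "'a \<Rightarrow> 'b::metric_space"
  assumes "\<And>a b. a \<in> S \<Longrightarrow> b \<in> S \<Longrightarrow> inner_dist (pull_dist j) S a b < top"
  shows "connected (j ` S)"
proof -
  have "path_component (j ` S) (j a) (j b)" if ab: "a \<in> S" "b \<in> S" for a b
  proof -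
    obtain \<gamma> where g: "continuous_path (pull_dist j) \<gamma>" "\<gamma> ` {0..1} \<subseteq> S" "\<gamma> 0 = a" "\<gamma> 1 = b"
      using assms[OF ab] by (rule inner_dist_lessE)
    show ?thesis unfolding path_component_def
      by (rule exI[of _ "j \<circ> \<gamma>"])
        (use g in \<open>auto simp: continuous_path_pull_dist path_def path_image_def pathstart_def pathfinish_def\<close>)
  qed
  then have "path_connected (j ` S)" unfolding path_connected_component by blast
  then show ?thesis by (rule path_connected_imp_connected)
qed

text \<open>At infinity, transversality prevents \<open>X\<close> from staying in the hyperplane
  near the point.\<close>

lemma dense_affine_part:
  fixes X :: "'n::finite cproj set"
  assumes B: "unitary B" and tr: "\<And>p. p \<in> X \<Longrightarrow> p \<in> hyperplane_at_inf B \<Longrightarrow> transverse_at X (hyperplane_at_inf B) p"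
    and p: "p \<in> X" and e: "e > 0"
  shows "\<exists>s\<in>X - hyperplane_at_inf B. dist (emb s) (emb p) < e"
proof (cases "p \<in> hyperplane_at_inf B")
  case True
  obtain q where "q \<in> X" "dist (emb q) (emb p) < e" "0 < hval B q"
    using transverse_hval[OF B p True tr[OF p True]] e by blast
  moreover from this have "q \<notin> hyperplane_at_inf B" using hval_zero_iff[of B q] by auto
  ultimately show ?thesis by blast
next
  case False
  then show ?thesis using p e by (intro bexI[of _ p]) auto
qed

text \<open>Projective distances are bounded, so the constant weight 1 serves in
  \<open>LNE_glue\<close>. At infinity the local estimate is that of a non-singular point, elsewhere
  it is transferred from the affine trace, whose density also makes \<open>X\<close>
  connected.\<close>

lemma LNE_fs_of_affine:
  fixes X :: "'n::finite cproj set"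
  assumes X: "algebraic_curve X" and B: "unitary B"
    and tr: "\<And>p. p \<in> X \<Longrightarrow> p \<in> hyperplane_at_inf B \<Longrightarrow> nonsingular_point X p \<and> transverse_at X (hyperplane_at_inf B) p"
    and LNE: "LNE (affine_dist B) (X - hyperplane_at_inf B)"
  shows "LNE fs_dist X"
proof -
  let ?S = "X - hyperplane_at_inf B"
  have ad: "affine_dist B = pull_dist (affine_chart B)" by (intro ext) (simp add: affine_dist_def)
  obtain L where L: "L > 0" "\<And>s s'. s \<in> ?S \<Longrightarrow> s' \<in> ?S \<Longrightarrow>
      inner_dist (pull_dist (affine_chart B)) ?S s s' \<le> ennreal (L * dist (affine_chart B s) (affine_chart B s'))"
    using LNE unfolding LNE_def ad by blast
  have dense: "\<exists>s\<in>?S. dist (emb s) (emb p) < e" if "p \<in> X" "e > 0" for p e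
    using dense_affine_part[OF B _ that] tr by blast
  have emb2: "dist (emb p) (emb q) \<le> 2 * dist (affine_chart B p) (affine_chart B q)" if "p \<in> ?S" "q \<in> ?S" for p q
    using emb_le_chart[OF B] that by blast
  have inn: "inner_dist (pull_dist emb) S' s s' \<le> ennreal (2 * (L * dist (affine_chart B s) (affine_chart B s')))"
    if s: "s \<in> ?S" "s' \<in> ?S" and "?S \<subseteq> S'" for s s' S'
    by (rule inner_dist_transfer[where d = "pull_dist (affine_chart B)" and S = ?S])
      (use emb2 L s that in auto)
  have "connected (emb ` ?S)"
    by (rule connected_of_inner_dist_finite, rule order.strict_trans1[OF inn ennreal_less_top]) auto
  moreover have "emb ` ?S \<subseteq> emb ` X" by blast
  moreover have "emb ` X \<subseteq> closure (emb ` ?S)"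
    using dense unfolding closure_approachable image_subset_iff by blast
  ultimately have conn: "connected (emb ` X)" by (rule connected_intermediate_closure)
  have comp: "compact (emb ` X)" using X unfolding algebraic_curve_def by (intro compact_emb) simp
  have "LNE (pull_dist emb) X"
  \<comment> \<open>Projectors have norm 1, whence distances of at most
    \<open>1 * (1 + 1)\<close>.\<close>
  proof (rule LNE_glue[where \<iota> = emb and W = "\<lambda>_. 1" and B = 1, OF comp conn])
    fix p assume p: "p \<in> X"
    show "\<exists>e>0. \<exists>C>0. \<forall>s\<in>X. \<forall>s'\<in>X. dist (emb s) (emb p) < e \<longrightarrow> dist (emb s') (emb p) < e \<longrightarrow>
            inner_dist (pull_dist emb) X s s' \<le> ennreal (C * dist (emb s) (emb s'))"
    proof (cases "p \<in> hyperplane_at_inf B")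
      case True
      then show ?thesis using local_LNE_nonsingular tr p by blast
    next
      case False
      obtain e R where e: "e > 0" "R > 0"
        and eR: "\<forall>q. dist (emb q) (emb p) < e \<longrightarrow> q \<notin> hyperplane_at_inf B \<and>
        (\<forall>q'. dist (emb q') (emb p) < e \<longrightarrow> dist (affine_chart B q) (affine_chart B q') \<le> R * dist (emb q) (emb q'))"
        using chart_local[OF B False] by blast
      have "inner_dist (pull_dist emb) X s s' \<le> ennreal (2 * L * R * dist (emb s) (emb s'))"
        if s: "s \<in> X" "s' \<in> X" "dist (emb s) (emb p) < e" "dist (emb s') (emb p) < e" for s s'
      proof -
        have "s \<in> ?S" "s' \<in> ?S" using s eR by blast+
        then have "inner_dist (pull_dist emb) X s s' \<le> ennreal (2 * (L * dist (affine_chart B s) (affine_chart B s')))"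
          by (rule inn) blast
        also have "\<dots> \<le> ennreal (2 * L * R * dist (emb s) (emb s'))"
        proof (rule ennreal_leI)
          have "dist (affine_chart B s) (affine_chart B s') \<le> R * dist (emb s) (emb s')" using eR s by blast
          then have "2 * L * dist (affine_chart B s) (affine_chart B s') \<le> 2 * L * (R * dist (emb s) (emb s'))"
            using L by (intro mult_left_mono) auto
          then show "2 * (L * dist (affine_chart B s) (affine_chart B s')) \<le> 2 * L * R * dist (emb s) (emb s')"
            by (simp only: mult.assoc)
        qed
        finally show ?thesis .
      qed
      moreover have "2 * L * R > 0" using L e by simp
      ultimately show ?thesis using e(1) by blast
    qed
  next
    fix s s' :: "'n cproj"
    have n1: "norm (emb q) = 1" for q :: "'n cproj"
      using rep(2)[of q] by (simp add: emb_def proj_def norm_outer dot_square_norm power2_eq_square)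
    show "dist (emb s) (emb s') \<le> 1 * (1 + 1)"
      using norm_triangle_ineq4[of "emb s" "emb s'"] by (simp add: dist_norm n1)
  next
    show "\<exists>s\<in>X. dist (emb s) (emb p) < e" if "p \<in> X" "e > 0" for p :: "'n cproj" and e
      using that by (intro bexI[of _ p]) auto
  qed auto
  then show ?thesis by (simp only: LNE_fs_dist_iff)
qed

text \<open>With the weight \<open>norm (affine_vec x)\<close>, the triangle inequality gives
  \<open>up\<close> and \<open>chart_bounds\<close> gives \<open>low\<close>. Off infinity,
  projectively short paths are affinely short as long as they stay near \<open>p\<close>, which
  \<open>inner_dist_local\<close> ensures.\<close>

lemma affine_LNE_of_fs:
  fixes X :: "'n::finite cproj set"
  assumes X: "algebraic_curve X" and B: "unitary B"
    and tr: "\<And>p. p \<in> X \<Longrightarrow> p \<in> hyperplane_at_inf B \<Longrightarrow> nonsingular_point X p \<and> transverse_at X (hyperplane_at_inf B) p"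
    and LNE: "LNE fs_dist X"
  shows "LNE (affine_dist B) (X - hyperplane_at_inf B)"
proof -
  let ?S = "X - hyperplane_at_inf B" and ?x = "affine_chart B"
  have ad: "affine_dist B = pull_dist ?x" by (intro ext) (simp add: affine_dist_def)
  have "LNE (pull_dist emb) X" using LNE LNE_fs_dist_iff by blast
  then obtain L where L: "L > 0" "\<And>s s'. s \<in> X \<Longrightarrow> s' \<in> X \<Longrightarrow> inner_dist (pull_dist emb) X s s' \<le> ennreal (L * dist (emb s) (emb s'))"
    unfolding LNE_def by blast
  have conn: "connected (emb ` X)"
    by (rule connected_of_inner_dist_finite, rule order.strict_trans1[OF L(2) ennreal_less_top]) auto
  have comp: "compact (emb ` X)" using X unfolding algebraic_curve_def by (intro compact_emb) simp
  have "LNE (pull_dist ?x) ?S"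
  proof (rule LNE_glue[where \<iota> = emb and W = "\<lambda>s. norm (affine_vec (?x s))" and B = 2, OF comp conn])
    show "\<exists>s\<in>?S. dist (emb s) (emb p) < e" if "p \<in> X" "e > 0" for p e
      using dense_affine_part[OF B _ that] tr by blast
    fix p assume p: "p \<in> X"
    show "\<exists>e>0. \<exists>C>0. \<forall>s\<in>?S. \<forall>s'\<in>?S. dist (emb s) (emb p) < e \<longrightarrow> dist (emb s') (emb p) < e \<longrightarrow>
            inner_dist (pull_dist ?x) ?S s s' \<le> ennreal (C * dist (?x s) (?x s'))"
    proof (cases "p \<in> hyperplane_at_inf B")
      case True
      then show ?thesis using end_local_LNE[OF X B p True] tr[OF p True] by blast
    next
      case False
      obtain e R where e: "e > 0" "R > 0"
        and eR: "\<forall>q. dist (emb q) (emb p) < e \<longrightarrow> q \<notin> hyperplane_at_inf B \<and>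
        (\<forall>q'. dist (emb q') (emb p) < e \<longrightarrow> dist (?x q) (?x q') \<le> R * dist (emb q) (emb q'))"
        using chart_local[OF B False] by blast
      \<comment> \<open>A path of length below \<open>e / 2\<close> that starts within
        \<open>\<delta>\<close> of \<open>p\<close> never leaves the ball of radius \<open>e\<close>
        on which the chart is controlled.\<close>
      define \<delta> where "\<delta> = e / (2 * (2 * L + 1))"
      have d: "\<delta> > 0" "\<delta> \<le> e / 2" "L * (2 * \<delta>) < e / 2"
        using e L by (auto simp: \<delta>_def field_simps add_pos_pos)
      have "inner_dist (pull_dist ?x) ?S s s' \<le> ennreal (R * L * 2 * dist (?x s) (?x s'))"
        if s: "s \<in> ?S" "s' \<in> ?S" "dist (emb s) (emb p) < \<delta>" "dist (emb s') (emb p) < \<delta>" for s s'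
      proof -
        have "dist (emb s) (emb s') < 2 * \<delta>" using dist_triangle2[of "emb s" "emb s'" "emb p"] s by linarith
        then have "L * dist (emb s) (emb s') \<le> L * (2 * \<delta>)" using L by (intro mult_left_mono) auto
        then have "L * dist (emb s) (emb s') < e / 2" using d(3) by linarith
        moreover have "0 \<le> L * dist (emb s) (emb s')" using L(1) by simp
        moreover have "s \<in> X" "s' \<in> X" using s by auto
        ultimately have T0: "inner_dist (pull_dist emb) {x \<in> X. dist (emb s) (emb x) < e / 2} s s' \<le> ennreal (L * dist (emb s) (emb s'))"
          by (intro inner_dist_local L(2))
        have near: "dist (emb x) (emb p) < e" if "dist (emb s) (emb x) < e / 2" for x
          using dist_triangle[of "emb x" "emb p" "emb s"] that s(3) d(2) by (simp add: dist_commute)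
        then have T: "{x \<in> X. dist (emb s) (emb x) < e / 2} \<subseteq> ?S" using eR by blast
        have T1: "dist (?x a) (?x b) \<le> R * dist (emb a) (emb b)"
          if "a \<in> {x \<in> X. dist (emb s) (emb x) < e / 2}" "b \<in> {x \<in> X. dist (emb s) (emb x) < e / 2}" for a b
          using near eR that by blast
        have "inner_dist (pull_dist ?x) ?S s s' \<le> ennreal (R * (L * dist (emb s) (emb s')))"
          by (rule inner_dist_transfer[where d = "pull_dist emb", OF e(2) T1 T T0]) (use L in auto)
        also have "\<dots> \<le> ennreal (R * L * 2 * dist (?x s) (?x s'))"
        proof (rule ennreal_leI)
          have "dist (emb s) (emb s') \<le> 2 * dist (?x s) (?x s')" using emb_le_chart[OF B] s by blast
          then have "(R * L) * dist (emb s) (emb s') \<le> (R * L) * (2 * dist (?x s) (?x s'))"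
            using e L by (intro mult_left_mono) auto
          then show "R * (L * dist (emb s) (emb s')) \<le> R * L * 2 * dist (?x s) (?x s')" by (simp only: mult.assoc)
        qed
        finally show ?thesis .
      qed
      moreover have "R * L * 2 > 0" using e L by simp
      ultimately show ?thesis using d(1) by blast
    qed
  next
    fix s s' assume s: "s \<in> ?S" "s' \<in> ?S"
    have "dist (?x s) (?x s') \<le> norm (?x s) + norm (?x s')" by (simp add: dist_norm norm_triangle_ineq4)
    also have "\<dots> \<le> norm (affine_vec (?x s)) + norm (affine_vec (?x s'))" by (intro add_mono norm_affine_vec_ge)
    also have "\<dots> \<le> 2 * (norm (affine_vec (?x s)) + norm (affine_vec (?x s')))" by simp
    finally show "dist (?x s) (?x s') \<le> 2 * (norm (affine_vec (?x s)) + norm (affine_vec (?x s')))" .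
    show "dist (emb s) (emb s') * norm (affine_vec (?x s)) \<le> 2 * dist (?x s) (?x s')"
      using chart_bounds(1)[OF B] s by blast
  qed (auto simp: norm_affine_vec_ge)
  then show ?thesis by (simp only: ad)
qed

section \<open>Polynomial functions and the weak Nullstellensatz\<close>

definition in_span_on :: "'a set \<Rightarrow> 'i set \<Rightarrow> ('i \<Rightarrow> 'a \<Rightarrow> complex) \<Rightarrow> ('a \<Rightarrow> complex) \<Rightarrow> bool" where
  "in_span_on V I g f \<longleftrightarrow> (\<exists>c. \<forall>z\<in>V. f z = (\<Sum>i\<in>I. c i * g i z))"

lemma in_span_on_base: assumes "finite I" "i \<in> I" shows "in_span_on V I g (g i)"
  unfolding in_span_on_def
  by (rule exI[of _ "\<lambda>j. if j = i then 1 else 0"]) (use assms in \<open>simp add: if_distrib[of "\<lambda>x. x * _"] cong: if_cong\<close>)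

lemma in_span_on_zero: "in_span_on V I g (\<lambda>_. 0)"
  unfolding in_span_on_def by (rule exI[of _ "\<lambda>_. 0"]) simp

lemma in_span_on_add: assumes "in_span_on V I g f" "in_span_on V I g f'" shows "in_span_on V I g (\<lambda>z. f z + f' z)"
proof -
  obtain c d where "\<forall>z\<in>V. f z = (\<Sum>i\<in>I. c i * g i z)" "\<forall>z\<in>V. f' z = (\<Sum>i\<in>I. d i * g i z)"
    using assms unfolding in_span_on_def by blast
  then show ?thesis unfolding in_span_on_def
    by (intro exI[of _ "\<lambda>i. c i + d i"]) (simp add: distrib_right sum.distrib)
qed

lemma in_span_on_smult: assumes "in_span_on V I g f" shows "in_span_on V I g (\<lambda>z. a * f z)"
proof -
  obtain c where "\<forall>z\<in>V. f z = (\<Sum>i\<in>I. c i * g i z)"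
    using assms unfolding in_span_on_def by blast
  then show ?thesis unfolding in_span_on_def
    by (intro exI[of _ "\<lambda>i. a * c i"]) (simp add: sum_distrib_left mult.assoc)
qed

lemma in_span_on_sum: assumes "\<And>j. j \<in> B \<Longrightarrow> in_span_on V I g (f j)" shows "in_span_on V I g (\<lambda>z. \<Sum>j\<in>B. f j z)"
  using assms by (induction B rule: infinite_finite_induct) (simp_all add: in_span_on_zero in_span_on_add)

lemma in_span_on_cong: assumes "in_span_on V I g f" "\<And>z. z \<in> V \<Longrightarrow> f' z = f z" shows "in_span_on V I g f'"
  using assms unfolding in_span_on_def by simp

lemma in_span_on_trans: assumes "in_span_on V I g f" "\<And>i. i \<in> I \<Longrightarrow> in_span_on V I' g' (g i)" shows "in_span_on V I' g' f"
proof -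
  obtain c where c: "\<forall>z\<in>V. f z = (\<Sum>i\<in>I. c i * g i z)" using assms(1) unfolding in_span_on_def by blast
  have "in_span_on V I' g' (\<lambda>z. \<Sum>i\<in>I. c i * g i z)" by (intro in_span_on_sum in_span_on_smult assms(2))
  then show ?thesis by (rule in_span_on_cong) (use c in simp)
qed

text \<open>Gaussian elimination by induction on the equations: a pivot \<open>e\<close> expresses
  its unknown through the others.\<close>

lemma underdetermined_system:
  fixes a :: "'c \<Rightarrow> 'b \<Rightarrow> complex"
  assumes "finite B" "finite C" "card B < card C"
  shows "\<exists>\<beta>. (\<exists>c\<in>C. \<beta> c \<noteq> 0) \<and> (\<forall>b\<in>B. (\<Sum>c\<in>C. \<beta> c * a c b) = 0)"
  using assms
proof (induction B arbitrary: C a rule: finite_induct)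
  case empty
  then obtain c where "c \<in> C" by fastforce
  then show ?case by (intro exI[of _ "\<lambda>_. 1"]) auto
next
  case (insert b B)
  show ?case
  proof (cases "\<forall>c\<in>C. a c b = 0")
    case True
    have "card B < card C" using insert by simp
    then obtain \<beta> where "\<exists>c\<in>C. \<beta> c \<noteq> 0" "\<forall>b\<in>B. (\<Sum>c\<in>C. \<beta> c * a c b) = 0"
      using insert.IH[OF insert.prems(1)] by blast
    then show ?thesis using True by (intro exI[of _ \<beta>]) auto
  next
    case False
    then obtain e where e: "e \<in> C" "a e b \<noteq> 0" by blast
    define C' where "C' = C - {e}"
    have C': "finite C'" "card B < card C'" "C = insert e C'" "e \<notin> C'"
      using insert e by (auto simp: C'_def)
    obtain \<beta> where \<beta>: "\<exists>c\<in>C'. \<beta> c \<noteq> 0" "\<forall>x\<in>B. (\<Sum>c\<in>C'. \<beta> c * (a c x - a c b / a e b * a e x)) = 0"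
      using insert.IH[OF C'(1,2), of "\<lambda>c x. a c x - a c b / a e b * a e x"] by blast
    define S where "S = (\<Sum>c\<in>C'. \<beta> c * a c b)"
    define \<beta>' where "\<beta>' c = (if c = e then - S / a e b else \<beta> c)" for c
    have sum: "(\<Sum>c\<in>C. \<beta>' c * a c x) = (\<Sum>c\<in>C'. \<beta> c * a c x) - S / a e b * a e x" for x
    proof -
      have "(\<Sum>c\<in>C'. \<beta>' c * a c x) = (\<Sum>c\<in>C'. \<beta> c * a c x)"
        using C'(4) by (intro sum.cong) (auto simp: \<beta>'_def)
      then show ?thesis using C'(1,4) unfolding C'(3) by (simp add: \<beta>'_def)
    qed
    have "(\<Sum>c\<in>C. \<beta>' c * a c x) = 0" if "x \<in> insert b B" for x
    proof (cases "x = b")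
      case True
      then show ?thesis using e by (simp add: sum S_def)
    next
      case False
      then have "(\<Sum>c\<in>C'. \<beta> c * (a c x - a c b / a e b * a e x)) = 0" using \<beta>(2) that by blast
      moreover have "(\<Sum>c\<in>C'. \<beta> c * (a c x - a c b / a e b * a e x)) = (\<Sum>c\<in>C'. \<beta> c * a c x) - S / a e b * a e x"
        by (simp add: S_def right_diff_distrib sum_subtractf sum_divide_distrib sum_distrib_right mult.assoc)
      ultimately show ?thesis by (simp add: sum)
    qed
    moreover have "\<exists>c\<in>C. \<beta>' c \<noteq> 0" using \<beta>(1) C'(3,4) unfolding \<beta>'_def by (metis insertCI)
    ultimately show ?thesis by blast
  qed
qed

text \<open>Polynomials in several variables are handled as functions, so that ideals are sets of
  functions and substitution is composition.\<close>

inductive polyfun :: "(complex ^ 'm \<Rightarrow> complex) \<Rightarrow> bool" where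
  polyfun_const: "polyfun (\<lambda>_. c)"
| polyfun_coord: "polyfun (\<lambda>z. z $ i)"
| polyfun_add: "polyfun f \<Longrightarrow> polyfun g \<Longrightarrow> polyfun (\<lambda>z. f z + g z)"
| polyfun_mult: "polyfun f \<Longrightarrow> polyfun g \<Longrightarrow> polyfun (\<lambda>z. f z * g z)"

lemma polyfun_uminus: "polyfun f \<Longrightarrow> polyfun (\<lambda>z. - f z)"
  using polyfun_mult[OF polyfun_const[of "-1"]] by fastforce

lemma polyfun_diff: "polyfun f \<Longrightarrow> polyfun g \<Longrightarrow> polyfun (\<lambda>z. f z - g z)"
  using polyfun_add[OF _ polyfun_uminus] by fastforce

lemma polyfun_sum: "(\<And>i. i \<in> I \<Longrightarrow> polyfun (f i)) \<Longrightarrow> polyfun (\<lambda>z. \<Sum>i\<in>I. f i z)"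
  by (induction I rule: infinite_finite_induct) (simp_all add: polyfun_const polyfun_add)

lemma polyfun_prod: "(\<And>i. i \<in> I \<Longrightarrow> polyfun (f i)) \<Longrightarrow> polyfun (\<lambda>z. \<Prod>i\<in>I. f i z)"
  by (induction I rule: infinite_finite_induct) (simp_all add: polyfun_const polyfun_mult)

lemma polyfun_power: "polyfun f \<Longrightarrow> polyfun (\<lambda>z. f z ^ n)"
  by (induction n) (simp_all add: polyfun_const polyfun_mult)

lemma polyfun_poly: "polyfun f \<Longrightarrow> polyfun (\<lambda>z. poly q (f z))"
  by (induction q) (simp_all add: polyfun_const polyfun_mult polyfun_add)

definition monomial :: "('m \<Rightarrow> nat) \<Rightarrow> complex ^ 'm \<Rightarrow> complex" where
  "monomial \<alpha> z = (\<Prod>i\<in>UNIV. (z $ i) ^ \<alpha> i)"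

lemma monomial_mult: "monomial \<alpha> z * monomial \<beta> z = monomial (\<lambda>i. \<alpha> i + \<beta> i) z"
  by (simp add: monomial_def power_add prod.distrib)

lemma monomial_0: "monomial (\<lambda>_. 0) z = 1"
  by (simp add: monomial_def)

lemma monomial_single: "monomial (\<lambda>j. if j = i then k else 0) z = z $ i ^ k"
  by (simp add: monomial_def if_distrib[of "\<lambda>n. _ ^ n"] cong: if_cong)

definition expbox :: "nat \<Rightarrow> ('m::finite \<Rightarrow> nat) set" where "expbox D = {\<alpha>. \<forall>i. \<alpha> i \<le> D}"

lemma finite_expbox: "finite (expbox D)"
proof -
  have "expbox D = (PiE UNIV (\<lambda>_. {..D}) :: ('a \<Rightarrow> nat) set)" by (auto simp: expbox_def PiE_def Pi_def)
  then show ?thesis by (simp add: finite_PiE)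
qed

lemma in_span_on_expbox_mono:
  assumes "in_span_on V (expbox D) monomial f" "D \<le> E" shows "in_span_on V (expbox E) monomial f"
proof (rule in_span_on_trans[OF assms(1)])
  fix \<alpha> :: "'a \<Rightarrow> nat" assume "\<alpha> \<in> expbox D"
  then have "\<alpha> \<in> expbox E" using assms(2) by (auto simp: expbox_def intro: order.trans)
  then show "in_span_on V (expbox E) monomial (monomial \<alpha>)" by (rule in_span_on_base[OF finite_expbox])
qed

text \<open>The combinations of monomials from \<open>expbox D\<close> form a space of finite
  dimension, and countably many such spaces exhaust the polynomial functions;
  \<open>poly_ideal_adjoin_proper\<close> rests on this count.\<close>

lemma polyfun_expand: "polyfun f \<Longrightarrow> \<exists>D. in_span_on UNIV (expbox D) monomial f"
proof (induction rule: polyfun.induct)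
  case (polyfun_const c)
  have "in_span_on UNIV (expbox 0) monomial (\<lambda>z. c * monomial (\<lambda>_. 0) z)"
    by (intro in_span_on_smult in_span_on_base finite_expbox) (simp add: expbox_def)
  then show ?case by (auto simp: monomial_0)
next
  case (polyfun_coord i)
  have "in_span_on UNIV (expbox 1) monomial (monomial (\<lambda>j. if j = i then 1 else 0))"
    by (intro in_span_on_base finite_expbox) (simp add: expbox_def)
  then have "in_span_on UNIV (expbox 1) monomial (\<lambda>z. z $ i)" by (rule in_span_on_cong) (simp add: monomial_single)
  then show ?case by blast
next
  case (polyfun_add f g)
  then obtain D E where "in_span_on UNIV (expbox D) monomial f" "in_span_on UNIV (expbox E) monomial g" by blast
  then have "in_span_on UNIV (expbox (D + E)) monomial f" "in_span_on UNIV (expbox (D + E)) monomial g"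
    by (auto intro: in_span_on_expbox_mono)
  then show ?case using in_span_on_add by blast
next
  case (polyfun_mult f g)
  then obtain D E where f: "in_span_on UNIV (expbox D) monomial f" and g: "in_span_on UNIV (expbox E) monomial g" by blast
  obtain c where c: "\<And>z. f z = (\<Sum>\<alpha>\<in>expbox D. c \<alpha> * monomial \<alpha> z)" using f unfolding in_span_on_def by auto
  obtain d where d: "\<And>z. g z = (\<Sum>\<alpha>\<in>expbox E. d \<alpha> * monomial \<alpha> z)" using g unfolding in_span_on_def by auto
  have "in_span_on UNIV (expbox (D + E)) monomial (\<lambda>z. \<Sum>\<alpha>\<in>expbox D. \<Sum>\<beta>\<in>expbox E. (c \<alpha> * d \<beta>) * monomial (\<lambda>i. \<alpha> i + \<beta> i) z)"
    by (intro in_span_on_sum in_span_on_smult in_span_on_base finite_expbox) (auto simp: expbox_def intro: add_mono)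
  then have "in_span_on UNIV (expbox (D + E)) monomial (\<lambda>z. f z * g z)"
    by (rule in_span_on_cong) (simp add: c d sum_product monomial_mult[symmetric] mult_ac)
  then show ?case by blast
qed

section \<open>Ideals of polynomial functions\<close>

definition poly_ideal :: "(complex ^ 'm \<Rightarrow> complex) set \<Rightarrow> bool" where
  "poly_ideal J \<longleftrightarrow> (\<lambda>_. 0) \<in> J \<and> (\<forall>f\<in>J. \<forall>g\<in>J. (\<lambda>z. f z + g z) \<in> J) \<and>
     (\<forall>f\<in>J. \<forall>h. polyfun h \<longrightarrow> (\<lambda>z. h z * f z) \<in> J)"

lemma poly_idealD:
  assumes "poly_ideal J"
  shows "(\<lambda>_. 0) \<in> J" "f \<in> J \<Longrightarrow> g \<in> J \<Longrightarrow> (\<lambda>z. f z + g z) \<in> J"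
    "f \<in> J \<Longrightarrow> polyfun h \<Longrightarrow> (\<lambda>z. h z * f z) \<in> J"
  using assms unfolding poly_ideal_def by blast+

lemma poly_ideal_sum:
  fixes f :: "'i \<Rightarrow> complex ^ 'm \<Rightarrow> complex"
  assumes "poly_ideal J" "\<And>i. i \<in> I \<Longrightarrow> f i \<in> J" shows "(\<lambda>z. \<Sum>i\<in>I. f i z) \<in> J"
  using assms(2)
proof (induction I rule: infinite_finite_induct)
  case (insert x F)
  have "(\<lambda>z. f x z + (\<Sum>i\<in>F. f i z)) \<in> J"
    using insert by (intro poly_idealD(2)[OF assms(1)]) auto
  then show ?case using insert by simp
qed (simp_all add: poly_idealD(1)[OF assms(1)])

lemma poly_ideal_diff:
  fixes f g :: "complex ^ 'm \<Rightarrow> complex"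
  assumes "poly_ideal J" "f \<in> J" "g \<in> J" shows "(\<lambda>z. f z - g z) \<in> J"
proof -
  have "(\<lambda>z. f z + (-1) * g z) \<in> J"
    by (intro poly_idealD(2)[OF assms(1,2)] poly_idealD(3)[OF assms(1,3)] polyfun_const)
  then show ?thesis by simp
qed

text \<open>Each \<open>z $ i - c\<close> is invertible modulo \<open>J\<close>, so the linear
  factors of \<open>q\<close> can be cancelled one by one until a nonzero constant is found in
  \<open>J\<close>.\<close>

lemma poly_ideal_no_root:
  fixes J :: "(complex ^ 'm \<Rightarrow> complex) set"
  assumes J: "poly_ideal J" and q: "q \<noteq> 0" "(\<lambda>z. poly q (z $ i)) \<in> J"
    and h: "\<And>c. \<exists>h. polyfun h \<and> (\<lambda>z. 1 - (z $ i - c) * h z) \<in> J"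
  shows "(\<lambda>_. 1) \<in> J"
  using q
proof (induction "degree q" arbitrary: q)
  case 0
  obtain a where a: "q = [:a:]" using degree_eq_zeroE[OF 0(1)[symmetric]] by blast
  then have "a \<noteq> 0" using 0(2) by auto
  have "(\<lambda>z. (1 / a) * poly q (z $ i)) \<in> J" by (rule poly_idealD(3)[OF J 0(3) polyfun_const])
  then show ?case using a \<open>a \<noteq> 0\<close> by simp
next
  case (Suc n)
  have "\<not> constant (poly q)" using Suc(2) by (simp add: constant_degree)
  then obtain r where r: "poly q r = 0" using fundamental_theorem_of_algebra by blast
  then have "[:-r, 1:] dvd q" by (simp add: poly_eq_0_iff_dvd)
  then obtain q' where q': "q = [:-r, 1:] * q'" by (rule dvdE)
  have q0: "q' \<noteq> 0" using Suc(3) q' by auto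
  have deg: "n = degree q'"
  proof -
    have "degree ([:-r, 1:] * q') = degree [:-r, 1:] + degree q'" by (rule degree_mult_eq) (use q0 in simp_all)
    also have "degree [:-r, 1:] = 1" by simp
    finally have "degree q = 1 + degree q'" by (simp only: q'[symmetric])
    then show ?thesis using Suc(2) by linarith
  qed
  obtain h where h: "polyfun h" "(\<lambda>z. 1 - (z $ i - r) * h z) \<in> J" using h by blast
  have "(\<lambda>z. h z * poly q (z $ i)) \<in> J" by (rule poly_idealD(3)[OF J Suc(4) h(1)])
  moreover have "(\<lambda>z. poly q' (z $ i) * (1 - (z $ i - r) * h z)) \<in> J"
    by (intro poly_idealD(3)[OF J h(2)] polyfun_poly polyfun_coord)
  ultimately have "(\<lambda>z. h z * poly q (z $ i) + poly q' (z $ i) * (1 - (z $ i - r) * h z)) \<in> J"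
    by (rule poly_idealD(2)[OF J])
  moreover have "(\<lambda>z. h z * poly q (z $ i) + poly q' (z $ i) * (1 - (z $ i - r) * h z)) = (\<lambda>z. poly q' (z $ i))"
    by (rule ext) (simp add: q' algebra_simps)
  ultimately have "(\<lambda>z. poly q' (z $ i)) \<in> J" by (simp only:)
  then show ?case by (rule Suc(1)[OF deg q0])
qed

text \<open>For an ideal \<open>J\<close>, the part that \<open>z $ i - c\<close> adds to it: the
  sum of \<open>J\<close> and the polynomial multiples of \<open>z $ i - c\<close>.\<close>

definition adjoin :: "(complex ^ 'm \<Rightarrow> complex) set \<Rightarrow> 'm \<Rightarrow> complex \<Rightarrow> (complex ^ 'm \<Rightarrow> complex) set" where
  "adjoin J i c = {f. \<exists>h. polyfun h \<and> (\<lambda>z. f z - (z $ i - c) * h z) \<in> J}"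

lemma adjoin:
  fixes J :: "(complex ^ 'm \<Rightarrow> complex) set"
  assumes J: "poly_ideal J"
  shows "poly_ideal (adjoin J i c)" "J \<subseteq> adjoin J i c" "(\<lambda>z. z $ i - c) \<in> adjoin J i c"
proof -
  show "J \<subseteq> adjoin J i c" unfolding adjoin_def using polyfun_const[of 0] by force
  show "(\<lambda>z. z $ i - c) \<in> adjoin J i c"
    unfolding adjoin_def using polyfun_const[of 1] poly_idealD(1)[OF J] by force
  show "poly_ideal (adjoin J i c)" unfolding poly_ideal_def
  proof (intro conjI ballI allI impI)
    show "(\<lambda>_. 0) \<in> adjoin J i c" using \<open>J \<subseteq> adjoin J i c\<close> poly_idealD(1)[OF J] by blast
    fix f assume "f \<in> adjoin J i c"
    then obtain h where h: "polyfun h" "(\<lambda>z. f z - (z $ i - c) * h z) \<in> J" unfolding adjoin_def by blast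
    {
      fix g assume "g \<in> adjoin J i c"
      then obtain k where k: "polyfun k" "(\<lambda>z. g z - (z $ i - c) * k z) \<in> J" unfolding adjoin_def by blast
      have "(\<lambda>z. (f z - (z $ i - c) * h z) + (g z - (z $ i - c) * k z)) \<in> J"
        by (rule poly_idealD(2)[OF J h(2) k(2)])
      moreover have "(\<lambda>z. (f z - (z $ i - c) * h z) + (g z - (z $ i - c) * k z)) = (\<lambda>z. (f z + g z) - (z $ i - c) * (h z + k z))"
        by (rule ext) (simp add: algebra_simps)
      ultimately show "(\<lambda>z. f z + g z) \<in> adjoin J i c"
        unfolding adjoin_def using polyfun_add[OF h(1) k(1)] by auto
    }
    fix k :: "complex ^ 'm \<Rightarrow> complex" assume k: "polyfun k"
    have "(\<lambda>z. k z * (f z - (z $ i - c) * h z)) \<in> J" by (rule poly_idealD(3)[OF J h(2) k])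
    moreover have "(\<lambda>z. k z * (f z - (z $ i - c) * h z)) = (\<lambda>z. k z * f z - (z $ i - c) * (k z * h z))"
      by (rule ext) (simp add: algebra_simps)
    ultimately show "(\<lambda>z. k z * f z) \<in> adjoin J i c"
      unfolding adjoin_def using polyfun_mult[OF k h(1)] by auto
  qed
qed

text \<open>The resolvents \<open>(z\<^sub>i - c)\<inverse>\<close> modulo \<open>J\<close>, one for each of uncountably many \<open>c\<close>, live in a space
  of countable dimension; a linear relation between them is a polynomial equation for \<open>z\<^sub>i\<close>.\<close>

lemma poly_ideal_adjoin_proper:
  fixes J :: "(complex ^ 'm \<Rightarrow> complex) set"
  assumes J: "poly_ideal J" and proper: "(\<lambda>_. 1) \<notin> J"
  shows "\<exists>c. (\<lambda>_. 1) \<notin> adjoin J i c"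
proof (rule ccontr)
  assume "\<nexists>c. (\<lambda>_. 1) \<notin> adjoin J i c"
  then have ex: "\<exists>h. polyfun h \<and> (\<lambda>z. 1 - (z $ i - c) * h z) \<in> J" for c unfolding adjoin_def by blast
  then obtain h where h: "\<And>c. polyfun (h c)" "\<And>c. (\<lambda>z. 1 - (z $ i - c) * h c z) \<in> J" by metis
  have "\<exists>D. in_span_on UNIV (expbox D) monomial (h c)" for c by (rule polyfun_expand[OF h(1)])
  then obtain D where D: "\<And>c. in_span_on UNIV (expbox (D c)) monomial (h c)" by metis
  \<comment> \<open>Uncountably many \<open>c\<close> share countably many bounds, so some bound
    occurs infinitely often.\<close>
  have "\<exists>d. infinite {c. D c = d}"
  proof (rule ccontr)
    assume "\<not> ?thesis"
    then have "countable (\<Union>d. {c. D c = d})" by (intro countable_UN) (auto intro: countable_finite)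
    moreover have "(\<Union>d. {c. D c = d}) = UNIV" by blast
    ultimately show False using uncountable_UNIV_complex by simp
  qed
  then obtain d where d: "infinite {c. D c = d}" by blast
  \<comment> \<open>One more resolvent than there are monomials, which forces a linear
    relation.\<close>
  obtain C where C: "finite C" "card C = Suc (card (expbox d :: ('m \<Rightarrow> nat) set))" "C \<subseteq> {c. D c = d}"
    using infinite_arbitrarily_large[OF d] by blast
  have "\<exists>a. \<forall>z. h c z = (\<Sum>\<alpha>\<in>expbox d. a \<alpha> * monomial \<alpha> z)" if "c \<in> C" for c
    using D[of c] C(3) that unfolding in_span_on_def by auto
  then obtain a where a: "\<And>c z. c \<in> C \<Longrightarrow> h c z = (\<Sum>\<alpha>\<in>expbox d. a c \<alpha> * monomial \<alpha> z)" by metis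
  obtain \<beta> where \<beta>: "\<exists>c\<in>C. \<beta> c \<noteq> 0" "\<forall>\<alpha>\<in>expbox d. (\<Sum>c\<in>C. \<beta> c * a c \<alpha>) = 0"
    using underdetermined_system[OF finite_expbox C(1), of d a] C(2) by auto
  have hz: "(\<Sum>c\<in>C. \<beta> c * h c z) = 0" for z
  proof -
    have "(\<Sum>c\<in>C. \<beta> c * h c z) = (\<Sum>c\<in>C. \<Sum>\<alpha>\<in>expbox d. \<beta> c * a c \<alpha> * monomial \<alpha> z)"
      by (intro sum.cong refl) (simp add: a sum_distrib_left mult.assoc)
    also have "\<dots> = (\<Sum>\<alpha>\<in>expbox d. (\<Sum>c\<in>C. \<beta> c * a c \<alpha>) * monomial \<alpha> z)"
      by (subst sum.swap) (simp add: sum_distrib_right)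
    also have "\<dots> = 0" using \<beta>(2) by simp
    finally show ?thesis .
  qed
  \<comment> \<open>The relation between the resolvents with denominators cleared. At a point
    \<open>e\<close> of nonzero coefficient only one summand survives, so \<open>Q\<close> is not
    the zero polynomial.\<close>
  define Q where "Q = (\<Sum>c\<in>C. smult (\<beta> c) (\<Prod>k\<in>C - {c}. [:-k, 1:]))"
  have Qp: "poly Q x = (\<Sum>c\<in>C. \<beta> c * (\<Prod>k\<in>C - {c}. x - k))" for x
    by (simp add: Q_def poly_sum poly_prod)
  obtain e where e: "e \<in> C" "\<beta> e \<noteq> 0" using \<beta>(1) by blast
  have "poly Q e = \<beta> e * (\<Prod>k\<in>C - {e}. e - k)"
  proof -
    have "(\<Sum>c\<in>C - {e}. \<beta> c * (\<Prod>k\<in>C - {c}. e - k)) = 0"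
    proof (rule sum.neutral, rule ballI)
      fix c assume "c \<in> C - {e}"
      then have "(\<Prod>k\<in>C - {c}. e - k) = 0" using C(1) e(1) by (subst prod_zero_iff) auto
      then show "\<beta> c * (\<Prod>k\<in>C - {c}. e - k) = 0" by simp
    qed
    then show ?thesis unfolding Qp using sum.remove[OF C(1) e(1), of "\<lambda>c. \<beta> c * (\<Prod>k\<in>C - {c}. e - k)"] by simp
  qed
  moreover have "(\<Prod>k\<in>C - {e}. e - k) \<noteq> 0" using C(1) by (subst prod_zero_iff) auto
  ultimately have Q0: "Q \<noteq> 0" using e(2) by auto
  have QJ: "(\<lambda>z. poly Q (z $ i)) \<in> J"
  proof -
    have "(\<lambda>z. \<Sum>c\<in>C. (\<beta> c * (\<Prod>k\<in>C - {c}. z $ i - k)) * (1 - (z $ i - c) * h c z)) \<in> J"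
      by (intro poly_ideal_sum[OF J] poly_idealD(3)[OF J h(2)] polyfun_mult polyfun_const polyfun_prod polyfun_diff polyfun_coord)
    moreover have "(\<Sum>c\<in>C. (\<beta> c * (\<Prod>k\<in>C - {c}. z $ i - k)) * (1 - (z $ i - c) * h c z)) = poly Q (z $ i)" for z
    proof -
      have "(\<beta> c * (\<Prod>k\<in>C - {c}. z $ i - k)) * (1 - (z $ i - c) * h c z)
          = \<beta> c * (\<Prod>k\<in>C - {c}. z $ i - k) - (\<Prod>k\<in>C. z $ i - k) * (\<beta> c * h c z)" if "c \<in> C" for c
        unfolding prod.remove[OF C(1) that, of "\<lambda>k. z $ i - k"] by (simp add: algebra_simps)
      then have "(\<Sum>c\<in>C. (\<beta> c * (\<Prod>k\<in>C - {c}. z $ i - k)) * (1 - (z $ i - c) * h c z))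
          = poly Q (z $ i) - (\<Prod>k\<in>C. z $ i - k) * (\<Sum>c\<in>C. \<beta> c * h c z)"
        by (simp add: Qp sum_subtractf sum_distrib_left)
      then show ?thesis by (simp add: hz)
    qed
    ultimately show ?thesis by simp
  qed
  show False using poly_ideal_no_root[OF J Q0 QJ ex] proper by blast
qed

text \<open>Some \<open>z $ i - c i\<close> is adjoined for every coordinate while the ideal stays
  proper. In the end the ideal contains \<open>f - f p\<close> for every polynomial function
  \<open>f\<close>, so a nonzero \<open>f p\<close> with \<open>f\<close> in \<open>J\<close> would
  put a unit into it.\<close>

theorem weak_nullstellensatz:
  fixes J :: "(complex ^ 'm::finite \<Rightarrow> complex) set"
  assumes J: "poly_ideal J" "\<And>f. f \<in> J \<Longrightarrow> polyfun f" and proper: "(\<lambda>_. 1) \<notin> J"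
  shows "\<exists>z. \<forall>f\<in>J. f z = 0"
proof -
  have "\<exists>(J' :: (complex ^ 'm \<Rightarrow> complex) set) c. poly_ideal J' \<and> J \<subseteq> J' \<and> (\<lambda>_. 1) \<notin> J' \<and> (\<forall>i\<in>S. (\<lambda>z. z $ i - c i) \<in> J')" for S :: "'m set"
  proof (induction S rule: finite_induct[OF finite])
    case 1
    then show ?case using J(1) proper by blast
  next
    case (2 i S)
    then obtain J' :: "(complex ^ 'm \<Rightarrow> complex) set" and c where J': "poly_ideal J'" "J \<subseteq> J'" "(\<lambda>_. 1) \<notin> J'" "\<forall>i\<in>S. (\<lambda>z. z $ i - c i) \<in> J'" by blast
    obtain b where b: "(\<lambda>_. 1) \<notin> adjoin J' i b" using poly_ideal_adjoin_proper[OF J'(1,3)] by blast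
    have "(\<lambda>z. z $ k - (c(i := b)) k) \<in> adjoin J' i b" if "k \<in> insert i S" for k
    proof (cases "k = i")
      case True
      then show ?thesis using adjoin(3)[OF J'(1), of i b] by simp
    next
      case False
      then have "(\<lambda>z. z $ k - (c(i := b)) k) \<in> J'" using J'(4) that by simp
      then show ?thesis using adjoin(2)[OF J'(1)] by blast
    qed
    then show ?case using adjoin(1,2)[OF J'(1), of i b] J'(2) b by (intro exI[of _ "adjoin J' i b"] exI[of _ "c(i := b)"]) blast
  qed
  from this[of UNIV] obtain J' :: "(complex ^ 'm \<Rightarrow> complex) set" and c where J': "poly_ideal J'" "J \<subseteq> J'" "(\<lambda>_. 1) \<notin> J'" "\<And>i. (\<lambda>z. z $ i - c i) \<in> J'" by blast
  define p where "p = (\<chi> i. c i)"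
  have mem: "(\<lambda>z. f z - f p) \<in> J'" if "polyfun f" for f
    using that
  proof (induction rule: polyfun.induct)
    case (polyfun_const c)
    then show ?case using poly_idealD(1)[OF J'(1)] by simp
  next
    case (polyfun_coord i)
    then show ?case using J'(4)[of i] by (simp add: p_def)
  next
    case (polyfun_add f g)
    then have "(\<lambda>z. (f z - f p) + (g z - g p)) \<in> J'" by (intro poly_idealD(2)[OF J'(1)])
    then show ?case by (simp add: algebra_simps)
  next
    case (polyfun_mult f g)
    then have "(\<lambda>z. g z * (f z - f p) + f p * (g z - g p)) \<in> J'"
      by (intro poly_idealD(2)[OF J'(1)] poly_idealD(3)[OF J'(1)] polyfun.polyfun_const)
    then show ?case by (simp add: algebra_simps)
  qed
  have "f p = 0" if "f \<in> J" for f
  proof (rule ccontr)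
    assume nz: "f p \<noteq> 0"
    have "(\<lambda>z. f z - (f z - f p)) \<in> J'"
      by (rule poly_ideal_diff[OF J'(1)]) (use that J'(2) mem J(2) in blast)+
    then have "(\<lambda>z. (1 / f p) * f p) \<in> J'" by (intro poly_idealD(3)[OF J'(1)] polyfun_const) simp
    then show False using J'(3) nz by simp
  qed
  then show ?thesis by blast
qed

section \<open>Finite projections of cones\<close>

definition expts :: "nat \<Rightarrow> ('m::finite \<Rightarrow> nat) set" where "expts d = {\<alpha>. (\<Sum>i\<in>UNIV. \<alpha> i) = d}"

lemma expts_le: "\<alpha> \<in> expts d \<Longrightarrow> \<alpha> i \<le> d"
  unfolding expts_def by (metis (mono_tags, lifting) UNIV_I finite le0 mem_Collect_eq member_le_sum)

lemma finite_expts: "finite (expts d)"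
  by (rule finite_subset[OF _ finite_expbox[of d]]) (auto simp: expbox_def expts_le)

lemma homogeneous_poly_in_span_on: "homogeneous_poly d F \<longleftrightarrow> in_span_on UNIV (expts d) monomial F"
  by (simp add: homogeneous_poly_def in_span_on_def expts_def monomial_def)

lemma polyfun_monomial: "polyfun (monomial \<alpha>)"
  unfolding monomial_def[abs_def] by (intro polyfun_prod polyfun_power polyfun_coord)

lemma polyfun_homogeneous: assumes "homogeneous_poly d F" shows "polyfun F"
proof -
  obtain c where "\<And>z. F z = (\<Sum>\<alpha>\<in>expts d. c \<alpha> * monomial \<alpha> z)"
    using assms unfolding homogeneous_poly_in_span_on in_span_on_def by auto
  then have "F = (\<lambda>z. \<Sum>\<alpha>\<in>expts d. c \<alpha> * monomial \<alpha> z)" by (rule ext)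
  then show ?thesis by (simp only:) (intro polyfun_sum polyfun_mult polyfun_const polyfun_monomial)
qed

lemma in_span_on_monomial_mult:
  assumes "in_span_on UNIV (expts a) monomial f" "(\<Sum>i\<in>UNIV. \<beta> i) = b"
  shows "in_span_on UNIV (expts (a + b)) monomial (\<lambda>z. f z * monomial \<beta> z)"
proof -
  obtain c where c: "\<And>z. f z = (\<Sum>\<alpha>\<in>expts a. c \<alpha> * monomial \<alpha> z)" using assms unfolding in_span_on_def by auto
  have "in_span_on UNIV (expts (a + b)) monomial (\<lambda>z. \<Sum>\<alpha>\<in>expts a. c \<alpha> * monomial (\<lambda>i. \<alpha> i + \<beta> i) z)"
    by (intro in_span_on_sum in_span_on_smult in_span_on_base finite_expts) (use assms(2) in \<open>auto simp: expts_def sum.distrib\<close>)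
  then show ?thesis by (rule in_span_on_cong) (simp add: c sum_distrib_right monomial_mult mult.assoc)
qed

lemma monomial_scale: "monomial \<alpha> (c *s z) = c ^ (\<Sum>i\<in>UNIV. \<alpha> i) * monomial \<alpha> z"
  by (simp add: monomial_def power_mult_distrib prod.distrib power_sum)

text \<open>The coordinate \<open>i\<close> is the homogenizing variable. Every sufficiently large
  degree is offered, so that several polynomials can be brought to a common one.\<close>

lemma polyfun_homogenize:
  assumes "polyfun h"
  shows "\<exists>E0. \<forall>E\<ge>E0. \<exists>H. in_span_on UNIV (expts E) monomial H \<and>
    (\<forall>z. z $ i \<noteq> 0 \<longrightarrow> H z = (z $ i) ^ E * h ((1 / z $ i) *s z))"
proof -
  obtain D where "in_span_on UNIV (expbox D) monomial h" using polyfun_expand[OF assms] by blast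
  then obtain c where c: "\<And>z. h z = (\<Sum>\<alpha>\<in>expbox D. c \<alpha> * monomial \<alpha> z)" unfolding in_span_on_def by auto
  define s :: "('a \<Rightarrow> nat) \<Rightarrow> nat" where "s \<alpha> = (\<Sum>i\<in>UNIV. \<alpha> i)" for \<alpha>
  have s: "s \<alpha> \<le> CARD('a) * D" if "\<alpha> \<in> expbox D" for \<alpha>
    unfolding s_def using that sum_bounded_above[of UNIV \<alpha> D] by (simp add: expbox_def)
  have "\<exists>H. in_span_on UNIV (expts E) monomial H \<and> (\<forall>z. z $ i \<noteq> 0 \<longrightarrow> H z = (z $ i) ^ E * h ((1 / z $ i) *s z))"
    if E: "CARD('a) * D \<le> E" for E
  proof -
    define e where "e \<alpha> j = \<alpha> j + (if j = i then E - s \<alpha> else 0)" for \<alpha> :: "'a \<Rightarrow> nat" and j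
    have e: "e \<alpha> \<in> expts E" if "\<alpha> \<in> expbox D" for \<alpha>
    proof -
      have "(\<Sum>j\<in>UNIV. e \<alpha> j) = s \<alpha> + (E - s \<alpha>)" by (simp add: e_def sum.distrib s_def)
      then show ?thesis using s[OF that] E by (simp add: expts_def)
    qed
    have em: "monomial (e \<alpha>) z = z $ i ^ (E - s \<alpha>) * monomial \<alpha> z" for \<alpha> z
      unfolding e_def by (simp add: monomial_mult[symmetric] monomial_single)
    define H where "H z = (\<Sum>\<alpha>\<in>expbox D. c \<alpha> * monomial (e \<alpha>) z)" for z
    have "in_span_on UNIV (expts E) monomial H" unfolding H_def[abs_def]
      by (intro in_span_on_sum in_span_on_smult in_span_on_base finite_expts e)
    moreover have "H z = (z $ i) ^ E * h ((1 / z $ i) *s z)" if z: "z $ i \<noteq> 0" for z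
    proof -
      have "z $ i ^ (E - s \<alpha>) = z $ i ^ E * (1 / z $ i) ^ s \<alpha>" if "\<alpha> \<in> expbox D" for \<alpha>
        using s[OF that] E z by (simp add: power_diff power_one_over divide_inverse power_inverse)
      then show ?thesis
        unfolding H_def c sum_distrib_left em monomial_scale s_def[symmetric]
        by (intro sum.cong refl) (simp add: mult_ac)
    qed
    ultimately show ?thesis by blast
  qed
  then show ?thesis by blast
qed

text \<open>The cone over a projective set; the last conjunct says that the set misses the centre of
  the projection to the coordinates in \<open>K\<close>.\<close>

definition polynomial_cone :: "(complex ^ 'm \<Rightarrow> complex) set \<Rightarrow> (complex ^ 'm) set \<Rightarrow> 'm set \<Rightarrow> bool" where
  "polynomial_cone \<G> V K \<longleftrightarrow> V = {z. \<forall>G\<in>\<G>. G z = 0} \<and> (\<forall>G\<in>\<G>. polyfun G) \<and>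
     (\<forall>z\<in>V. \<forall>c. c *s z \<in> V) \<and> (\<forall>z\<in>V. (\<forall>k\<in>K. z $ k = 0) \<longrightarrow> z = 0)"

text \<open>On \<open>V\<close> the functions \<open>z $ k\<close> for \<open>k\<close> in
  \<open>K\<close> and \<open>z $ i - 1\<close> have no common zero, hence they generate 1 there.
  Evaluation at points scaled to \<open>z $ i = 1\<close> removes the last generator, and
  homogenizing yields the power of \<open>z $ i\<close>.\<close>

lemma cone_power_in_ideal:
  fixes V :: "(complex ^ 'm::finite) set"
  assumes pc: "polynomial_cone \<G> V K"
  shows "\<exists>M H. (\<forall>k\<in>K. in_span_on UNIV (expts M) monomial (H k)) \<and> (\<forall>z\<in>V. (z $ i) ^ Suc M = (\<Sum>k\<in>K. z $ k * H k z))"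
proof -
  have V: "V = {z. \<forall>G\<in>\<G>. G z = 0}" and G: "\<forall>G\<in>\<G>. polyfun G"
    and cone: "\<forall>z\<in>V. \<forall>c. c *s z \<in> V" and K: "\<forall>z\<in>V. (\<forall>k\<in>K. z $ k = 0) \<longrightarrow> z = 0"
    using pc unfolding polynomial_cone_def by blast+
  \<comment> \<open>Equality is required on \<open>V\<close> only, so the polynomials vanishing on
    \<open>V\<close> belong to this ideal and its zeros lie in \<open>V\<close>.\<close>
  define J where "J = {f. polyfun f \<and> (\<exists>h g. (\<forall>k. polyfun (h k)) \<and> polyfun g \<and>
     (\<forall>z\<in>V. f z = (\<Sum>k\<in>K. z $ k * h k z) + (z $ i - 1) * g z))}"
  have JI: "f \<in> J" if "polyfun f" "\<forall>k. polyfun (h k)" "polyfun g"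
    "\<forall>z\<in>V. f z = (\<Sum>k\<in>K. z $ k * h k z) + (z $ i - 1) * g z" for f h g
    using that unfolding J_def by blast
  have J: "poly_ideal J" unfolding poly_ideal_def
  proof (intro conjI ballI allI impI)
    show "(\<lambda>_. 0) \<in> J" by (rule JI[where h = "\<lambda>_ _. 0" and g = "\<lambda>_. 0"]) (simp_all add: polyfun_const)
    fix f assume "f \<in> J"
    then obtain h g where f: "polyfun f" "\<forall>k. polyfun (h k)" "polyfun g"
      "\<forall>z\<in>V. f z = (\<Sum>k\<in>K. z $ k * h k z) + (z $ i - 1) * g z" unfolding J_def by blast
    {
      fix f' assume "f' \<in> J"
      then obtain h' g' where f': "polyfun f'" "\<forall>k. polyfun (h' k)" "polyfun g'"
        "\<forall>z\<in>V. f' z = (\<Sum>k\<in>K. z $ k * h' k z) + (z $ i - 1) * g' z" unfolding J_def by blast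
      show "(\<lambda>z. f z + f' z) \<in> J"
      proof (rule JI[where h = "\<lambda>k z. h k z + h' k z" and g = "\<lambda>z. g z + g' z"])
        show "\<forall>z\<in>V. f z + f' z = (\<Sum>k\<in>K. z $ k * (h k z + h' k z)) + (z $ i - 1) * (g z + g' z)"
          using f(4) f'(4) by (simp add: distrib_left sum.distrib)
      qed (use f(1-3) f'(1-3) in \<open>simp_all add: polyfun_add\<close>)
    }
    fix u :: "complex ^ 'm \<Rightarrow> complex" assume u: "polyfun u"
    show "(\<lambda>z. u z * f z) \<in> J"
    proof (rule JI[where h = "\<lambda>k z. u z * h k z" and g = "\<lambda>z. u z * g z"])
      show "\<forall>z\<in>V. u z * f z = (\<Sum>k\<in>K. z $ k * (u z * h k z)) + (z $ i - 1) * (u z * g z)"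
        using f(4) by (simp add: distrib_left sum_distrib_left mult.left_commute)
    qed (use f(1-3) u in \<open>simp_all add: polyfun_mult\<close>)
  qed
  have Jp: "polyfun f" if "f \<in> J" for f using that unfolding J_def by blast
  have "(\<lambda>_. 1) \<in> J"
  proof (rule ccontr)
    assume "(\<lambda>_. 1) \<notin> J"
    then have "\<exists>z. \<forall>f\<in>J. f z = 0" by (intro weak_nullstellensatz[OF J] Jp)
    then obtain z where z: "\<forall>f\<in>J. f z = 0" by (elim exE)
    have "F \<in> J" if F: "F \<in> \<G>" for F
    proof (rule JI[where h = "\<lambda>_ _. 0" and g = "\<lambda>_. 0"])
      have "\<forall>z\<in>V. F z = 0" using F V by blast
      then show "\<forall>z\<in>V. F z = (\<Sum>k\<in>K. z $ k * 0) + (z $ i - 1) * 0" by simp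
    qed (use G F in \<open>simp_all add: polyfun_const\<close>)
    then have "\<forall>F\<in>\<G>. F z = 0" using z by blast
    then have zV: "z \<in> V" by (subst V) blast
    have "(\<lambda>z. z $ k) \<in> J" if k: "k \<in> K" for k
    proof (rule JI[where h = "\<lambda>j _. if j = k then 1 else 0" and g = "\<lambda>_. 0"])
      show "\<forall>z\<in>V. z $ k = (\<Sum>j\<in>K. z $ j * (if j = k then 1 else 0)) + (z $ i - 1) * 0"
        using k by (simp add: if_distrib[of "\<lambda>x. _ * x"] cong: if_cong)
    qed (simp_all add: polyfun_const polyfun_coord)
    note zk = this
    have "\<forall>k\<in>K. z $ k = 0"
    proof
      fix k assume "k \<in> K"
      from bspec[OF z zk[OF this]] show "z $ k = 0" .
    qed
    then have z0: "z = 0" using K zV by blast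
    have "(\<lambda>z. z $ i - 1) \<in> J"
      by (rule JI[where h = "\<lambda>_ _. 0" and g = "\<lambda>_. 1"])
        (simp_all add: polyfun_const polyfun_diff polyfun_coord)
    from bspec[OF z this] have "z $ i - 1 = 0" .
    then show False using z0 by simp
  qed
  then obtain h g where hg: "\<forall>k. polyfun (h k)" "\<forall>z\<in>V. 1 = (\<Sum>k\<in>K. z $ k * h k z) + (z $ i - 1) * g z"
    unfolding J_def by blast
  have "\<exists>E0. \<forall>E\<ge>E0. \<exists>H. in_span_on UNIV (expts E) monomial H \<and>
    (\<forall>z. z $ i \<noteq> 0 \<longrightarrow> H z = (z $ i) ^ E * h k ((1 / z $ i) *s z))" for k
    using polyfun_homogenize hg(1) by blast
  then have "\<forall>k. \<exists>E0. \<forall>E\<ge>E0. \<exists>H. in_span_on UNIV (expts E) monomial H \<and>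
    (\<forall>z. z $ i \<noteq> 0 \<longrightarrow> H z = (z $ i) ^ E * h k ((1 / z $ i) *s z))" by (rule allI)
  from choice[OF this] obtain E0 where E0: "\<forall>k. \<forall>E\<ge>E0 k. \<exists>H. in_span_on UNIV (expts E) monomial H \<and>
    (\<forall>z. z $ i \<noteq> 0 \<longrightarrow> H z = (z $ i) ^ E * h k ((1 / z $ i) *s z))" by (elim exE)
  define E where "E = (\<Sum>k\<in>UNIV. E0 k)"
  have "E0 k \<le> E" for k unfolding E_def by (rule member_le_sum) auto
  then have "\<forall>k. \<exists>H. in_span_on UNIV (expts E) monomial H \<and>
    (\<forall>z. z $ i \<noteq> 0 \<longrightarrow> H z = (z $ i) ^ E * h k ((1 / z $ i) *s z))" using E0 by blast
  from choice[OF this] obtain H where "\<forall>k. in_span_on UNIV (expts E) monomial (H k) \<and>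
    (\<forall>z. z $ i \<noteq> 0 \<longrightarrow> H k z = (z $ i) ^ E * h k ((1 / z $ i) *s z))" by (elim exE)
  then have H: "\<And>k. in_span_on UNIV (expts E) monomial (H k)"
    "\<And>k z. z $ i \<noteq> 0 \<Longrightarrow> H k z = (z $ i) ^ E * h k ((1 / z $ i) *s z)" by blast+
  \<comment> \<open>The additional factor \<open>z $ i\<close> makes the identity hold also where
    \<open>z $ i = 0\<close>, at the price of one degree.\<close>
  have "in_span_on UNIV (expts (E + 1)) monomial (\<lambda>z. H k z * monomial (\<lambda>j. if j = i then 1 else 0) z)" for k
    by (rule in_span_on_monomial_mult[OF H(1)]) simp
  moreover have "(z $ i) ^ Suc (E + 1) = (\<Sum>k\<in>K. z $ k * (H k z * monomial (\<lambda>j. if j = i then 1 else 0) z))" if z: "z \<in> V" for z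
  proof (cases "z $ i = 0")
    case False
    let ?y = "(1 / z $ i) *s z"
    have "1 = (\<Sum>k\<in>K. ?y $ k * h k ?y) + (?y $ i - 1) * g ?y" using hg(2) cone z by blast
    also have "?y $ i - 1 = 0" using False by simp
    finally have one: "1 = (\<Sum>k\<in>K. ?y $ k * h k ?y)" by simp
    have "(z $ i) ^ Suc (E + 1) = (z $ i) ^ Suc (E + 1) * (\<Sum>k\<in>K. ?y $ k * h k ?y)" using one by simp
    also have "\<dots> = (\<Sum>k\<in>K. z $ k * (H k z * z $ i))"
      unfolding sum_distrib_left H(2)[OF False] using False by (intro sum.cong refl) (simp add: field_simps)
    finally show ?thesis by (simp add: monomial_single)
  qed (simp add: monomial_single)
  ultimately show ?thesis by (intro exI[of _ "E + 1"] exI[of _ "\<lambda>k z. H k z * monomial (\<lambda>j. if j = i then 1 else 0) z"]) blast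
qed

text \<open>Pigeonhole: a monomial of degree above the sum of all \<open>M i\<close> contains a
  power of some coordinate that \<open>cone_power_in_ideal\<close> covers.\<close>

lemma cone_monomials_in_ideal:
  fixes V :: "(complex ^ 'm::finite) set"
  assumes pc: "polynomial_cone \<G> V K"
  shows "\<exists>D. \<forall>\<alpha>\<in>expts (Suc D). \<exists>H. (\<forall>k\<in>K. in_span_on UNIV (expts D) monomial (H k)) \<and>
     (\<forall>z\<in>V. monomial \<alpha> z = (\<Sum>k\<in>K. z $ k * H k z))"
proof -
  have "\<forall>i. \<exists>M H. (\<forall>k\<in>K. in_span_on UNIV (expts M) monomial (H k)) \<and> (\<forall>z\<in>V. (z $ i) ^ Suc M = (\<Sum>k\<in>K. z $ k * H k z))"
    by (rule allI) (rule cone_power_in_ideal[OF pc])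
  from choice[OF this] obtain M where M: "\<forall>i. \<exists>H. (\<forall>k\<in>K. in_span_on UNIV (expts (M i)) monomial (H k)) \<and> (\<forall>z\<in>V. (z $ i) ^ Suc (M i) = (\<Sum>k\<in>K. z $ k * H k z))"
    by (elim exE)
  from choice[OF M] obtain H where "\<forall>i. (\<forall>k\<in>K. in_span_on UNIV (expts (M i)) monomial (H i k)) \<and> (\<forall>z\<in>V. (z $ i) ^ Suc (M i) = (\<Sum>k\<in>K. z $ k * H i k z))"
    by (elim exE)
  then have MH: "\<And>i k. k \<in> K \<Longrightarrow> in_span_on UNIV (expts (M i)) monomial (H i k)"
    "\<And>i z. z \<in> V \<Longrightarrow> (z $ i) ^ Suc (M i) = (\<Sum>k\<in>K. z $ k * H i k z)"
    by blast+
  define D where "D = (\<Sum>i\<in>UNIV. M i)"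
  have MD: "M i \<le> D" for i unfolding D_def by (rule member_le_sum) auto
  have "\<exists>H. (\<forall>k\<in>K. in_span_on UNIV (expts D) monomial (H k)) \<and> (\<forall>z\<in>V. monomial \<alpha> z = (\<Sum>k\<in>K. z $ k * H k z))"
    if \<alpha>: "\<alpha> \<in> expts (Suc D)" for \<alpha> :: "'m \<Rightarrow> nat"
  proof -
    have "\<exists>i. Suc (M i) \<le> \<alpha> i"
    proof (rule ccontr)
      assume "\<not> ?thesis"
      then have "\<alpha> i \<le> M i" for i by (simp add: not_less_eq_eq)
      then have "(\<Sum>i\<in>UNIV. \<alpha> i) \<le> D" unfolding D_def by (intro sum_mono)
      then show False using \<alpha> by (simp add: expts_def)
    qed
    then obtain i where i: "Suc (M i) \<le> \<alpha> i" by blast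
    define \<beta> where "\<beta> j = \<alpha> j - (if j = i then Suc (M i) else 0)" for j
    have \<alpha>\<beta>: "\<alpha> = (\<lambda>j. (if j = i then Suc (M i) else 0) + \<beta> j)" using i by (auto simp: \<beta>_def)
    have "(\<Sum>j\<in>UNIV. \<alpha> j) = Suc (M i) + (\<Sum>j\<in>UNIV. \<beta> j)" by (subst \<alpha>\<beta>) (simp add: sum.distrib)
    then have "(\<Sum>j\<in>UNIV. \<beta> j) = D - M i" using \<alpha> by (simp add: expts_def)
    then have "in_span_on UNIV (expts (M i + (D - M i))) monomial (\<lambda>z. H i k z * monomial \<beta> z)" if "k \<in> K" for k
      by (rule in_span_on_monomial_mult[OF MH(1)[OF that]])
    then have "\<forall>k\<in>K. in_span_on UNIV (expts D) monomial (\<lambda>z. H i k z * monomial \<beta> z)" using MD by simp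
    moreover have "monomial \<alpha> z = (\<Sum>k\<in>K. z $ k * (H i k z * monomial \<beta> z))" if "z \<in> V" for z
    proof -
      have "monomial \<alpha> z = (z $ i) ^ Suc (M i) * monomial \<beta> z"
        by (subst \<alpha>\<beta>) (simp only: monomial_mult[symmetric] monomial_single)
      then show ?thesis unfolding MH(2)[OF that] by (simp add: sum_distrib_right mult.assoc)
    qed
    ultimately show ?thesis by (intro exI[of _ "\<lambda>k z. H i k z * monomial \<beta> z"]) blast
  qed
  then show ?thesis by blast
qed

section \<open>Univariate polynomials with polynomial coefficients\<close>

definition poly_family :: "(complex ^ 'm \<Rightarrow> complex poly) \<Rightarrow> bool" where
  "poly_family P \<longleftrightarrow> (\<forall>k. polyfun (\<lambda>b. coeff (P b) k))"

lemma poly_family_mult: "poly_family P \<Longrightarrow> poly_family Q \<Longrightarrow> poly_family (\<lambda>b. P b * Q b)"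
  unfolding poly_family_def coeff_mult by (intro allI polyfun_sum polyfun_mult) blast+

lemma poly_family_diff: "poly_family P \<Longrightarrow> poly_family Q \<Longrightarrow> poly_family (\<lambda>b. P b - Q b)"
  unfolding poly_family_def coeff_diff by (intro allI polyfun_diff) blast+

lemma poly_family_const: "poly_family (\<lambda>_. p)"
  unfolding poly_family_def by (simp add: polyfun_const)

lemma poly_family_coeff0: assumes "polyfun f" shows "poly_family (\<lambda>b. [:f b:])"
proof -
  have "polyfun (\<lambda>b. coeff [:f b:] k)" for k
    using assms by (cases k) (simp_all add: polyfun_const)
  then show ?thesis unfolding poly_family_def by blast
qed

text \<open>The degree is the same for every parameter: roots cannot escape to infinity, which
  expresses the finiteness of the projection.\<close>

definition monic_family :: "nat \<Rightarrow> (complex ^ 'm \<Rightarrow> complex poly) \<Rightarrow> bool" where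
  "monic_family e P \<longleftrightarrow> poly_family P \<and> (\<forall>b. degree (P b) = e \<and> lead_coeff (P b) = 1)"

lemma monic_family_mult:
  assumes "monic_family d P" "monic_family e Q" shows "monic_family (d + e) (\<lambda>b. P b * Q b)"
proof -
  have P: "poly_family P" "degree (P b) = d" "lead_coeff (P b) = 1" for b using assms(1) unfolding monic_family_def by blast+
  have Q: "poly_family Q" "degree (Q b) = e" "lead_coeff (Q b) = 1" for b using assms(2) unfolding monic_family_def by blast+
  have "degree (P b * Q b) = d + e" for b
  proof -
    have "P b \<noteq> 0" "Q b \<noteq> 0" using P(3)[of b] Q(3)[of b] by auto
    then show ?thesis by (simp add: degree_mult_eq P(2) Q(2))
  qed
  moreover have "lead_coeff (P b * Q b) = 1" for b by (simp only: lead_coeff_mult P(3) Q(3) mult_1)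
  ultimately show ?thesis unfolding monic_family_def using poly_family_mult[OF P(1) Q(1)] by blast
qed

text \<open>Elimination of one unknown after the other; every pivot is a monic polynomial and one of
  them has to vanish when the system has a nonzero solution.  This replaces determinants of
  matrices over a ring of polynomials.\<close>

lemma pivot_elimination:
  fixes M :: "'g \<Rightarrow> 'g \<Rightarrow> complex ^ 'm \<Rightarrow> complex poly"
  assumes "finite G" "\<And>g. g \<in> G \<Longrightarrow> monic_family q (M g g)"
    and "\<And>g h. g \<in> G \<Longrightarrow> h \<in> G \<Longrightarrow> poly_family (M g h)"
    and "\<And>g h b. g \<in> G \<Longrightarrow> h \<in> G \<Longrightarrow> g \<noteq> h \<Longrightarrow> degree (M g h b) < q"
  shows "\<exists>P e. monic_family e P \<and> (\<forall>b s v. (\<forall>g\<in>G. (\<Sum>h\<in>G. poly (M g h b) s * v h) = 0) \<longrightarrow> (\<exists>g\<in>G. v g \<noteq> 0) \<longrightarrow> poly (P b) s = 0)"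
  using assms
proof (induction G arbitrary: M q rule: finite_induct)
  case empty
  have "monic_family 0 (\<lambda>_. 1)" by (simp add: monic_family_def poly_family_const)
  then show ?case by (intro exI[of _ "\<lambda>_. 1"] exI[of _ 0]) simp
next
  case (insert g G)
  \<comment> \<open>Row \<open>h\<close> is multiplied by the pivot, not divided, to stay within
    polynomials. The diagonal becomes monic of degree \<open>q + q\<close> and the other entries
    stay below, so the induction continues with the doubled degree.\<close>
  define M' where "M' h k b = M g g b * M h k b - M h g b * M g k b" for h k b
  have mg: "monic_family q (M g g)" using insert by simp
  have dg: "degree (M g g b) = q" "lead_coeff (M g g b) = 1" for b using mg unfolding monic_family_def by auto
  have gh: "g \<noteq> h" if "h \<in> G" for h using that insert by auto
  have fam: "poly_family (M' h k)" if "h \<in> G" "k \<in> G" for h k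
    unfolding M'_def using that insert by (intro poly_family_diff poly_family_mult) auto
  have small: "degree (M h g b * M g k b) < q + q" if "h \<in> G" "k \<in> G" for h k b
  proof -
    have "degree (M h g b) < q" "degree (M g k b) < q" using insert.prems(3) gh that by (metis insertCI)+
    then show ?thesis using degree_mult_le[of "M h g b" "M g k b"] by linarith
  qed
  have diag: "monic_family (q + q) (M' h h)" if h: "h \<in> G" for h
  proof -
    have m: "monic_family (q + q) (\<lambda>b. M g g b * M h h b)"
      using insert h by (intro monic_family_mult) auto
    have "degree (M' h h b) = q + q \<and> lead_coeff (M' h h b) = 1" for b
    proof -
      let ?p = "M g g b * M h h b" and ?r = "- (M h g b * M g h b)"
      have p: "degree ?p = q + q" "lead_coeff ?p = 1" using m unfolding monic_family_def by blast+
      have r: "degree ?r < degree ?p" using small[OF h h, of b] p(1) by simp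
      have eq: "M' h h b = ?p + ?r" by (simp add: M'_def)
      have l: "lead_coeff (?p + ?r) = lead_coeff ?p" using lead_coeff_add_le[OF r] by (simp only: add.commute)
      show ?thesis unfolding eq
        by (rule conjI[OF trans[OF degree_add_eq_left[OF r] p(1)] trans[OF l p(2)]])
    qed
    then show ?thesis unfolding monic_family_def using fam[OF h h] by blast
  qed
  have off: "degree (M' h k b) < q + q" if "h \<in> G" "k \<in> G" "h \<noteq> k" for h k b
  proof -
    have "degree (M h k b) < q" using insert that by auto
    then have "degree (M g g b * M h k b) < q + q" using degree_mult_le[of "M g g b" "M h k b"] dg(1)[of b] by linarith
    then show ?thesis unfolding M'_def using small[OF that(1,2), of b] by (rule degree_diff_less)
  qed
  obtain P e where P: "monic_family e P" "\<And>b s v. (\<forall>h\<in>G. (\<Sum>k\<in>G. poly (M' h k b) s * v k) = 0) \<Longrightarrow> (\<exists>h\<in>G. v h \<noteq> 0) \<Longrightarrow> poly (P b) s = 0"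
    using insert.IH[of "q + q" M', OF diag fam off] by blast
  \<comment> \<open>Either an unknown other than \<open>v g\<close> is nonzero and the smaller
    system applies, or \<open>v g\<close> alone is nonzero and the pivot itself vanishes.\<close>
  have "poly (M g g b * P b) s = 0"
    if ker: "\<forall>h\<in>insert g G. (\<Sum>k\<in>insert g G. poly (M h k b) s * v k) = 0" and nz: "\<exists>h\<in>insert g G. v h \<noteq> 0" for b s v
  proof (cases "\<exists>h\<in>G. v h \<noteq> 0")
    case True
    have row: "(\<Sum>k\<in>G. poly (M h k b) s * v k) = - (poly (M h g b) s * v g)" if "h \<in> insert g G" for h
    proof -
      have "(\<Sum>k\<in>insert g G. poly (M h k b) s * v k) = 0" using ker that by blast
      then show ?thesis using insert(1,2) by (simp add: eq_neg_iff_add_eq_0 add.commute)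
    qed
    have "(\<Sum>k\<in>G. poly (M' h k b) s * v k) = 0" if h: "h \<in> G" for h
    proof -
      have "(\<Sum>k\<in>G. poly (M' h k b) s * v k)
        = poly (M g g b) s * (\<Sum>k\<in>G. poly (M h k b) s * v k) - poly (M h g b) s * (\<Sum>k\<in>G. poly (M g k b) s * v k)"
        by (simp add: M'_def sum_distrib_left sum_subtractf[symmetric] left_diff_distrib mult.assoc)
      also have "\<dots> = 0" using row[of h] row[of g] h by simp
      finally show ?thesis .
    qed
    then have "poly (P b) s = 0" using P(2) True by blast
    then show ?thesis by simp
  next
    case False
    then have vg: "v g \<noteq> 0" and v0: "\<And>k. k \<in> G \<Longrightarrow> v k = 0" using nz by auto
    have "(\<Sum>k\<in>insert g G. poly (M g k b) s * v k) = 0" using ker by blast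
    then have "poly (M g g b) s * v g = 0" using insert(1,2) v0 by simp
    then show ?thesis using vg by simp
  qed
  moreover have "monic_family (q + e) (\<lambda>b. M g g b * P b)" by (rule monic_family_mult[OF mg P(1)])
  ultimately show ?case by blast
qed

text \<open>On the cone, \<open>u $ i\<close> times a monomial of degree \<open>D\<close> is a
  combination of such monomials with coefficients linear in the \<open>K\<close>-coordinates. The
  monomials at \<open>u\<close> thus form an eigenvector with eigenvalue \<open>u $ i\<close>, and
  elimination takes the place of the characteristic polynomial.\<close>

lemma cone_coordinate_integral:
  fixes V :: "(complex ^ 'm::finite) set"
  assumes pc: "polynomial_cone \<G> V K"
  shows "\<exists>P e. monic_family e P \<and> (\<forall>u\<in>V. \<forall>b. u \<noteq> 0 \<longrightarrow> (\<forall>k\<in>K. b $ k = u $ k) \<longrightarrow> poly (P b) (u $ i) = 0)"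
proof -
  from cone_monomials_in_ideal[OF pc]
  obtain D where D: "\<forall>\<alpha>\<in>expts (Suc D). \<exists>H. (\<forall>k\<in>K. in_span_on UNIV (expts D) monomial (H k)) \<and>
     (\<forall>z\<in>V. monomial \<alpha> z = (\<Sum>k\<in>K. z $ k * H k z))" by (elim exE)
  define e :: "'m \<Rightarrow> nat" where "e j = (if j = i then 1 else 0)" for j
  define R where "R \<gamma> a \<longleftrightarrow> (\<forall>z\<in>V. z $ i * monomial \<gamma> z = (\<Sum>k\<in>K. z $ k * (\<Sum>\<delta>\<in>expts D. a k \<delta> * monomial \<delta> z)))"
    for \<gamma> and a :: "'m \<Rightarrow> ('m \<Rightarrow> nat) \<Rightarrow> complex"
  have ex: "\<exists>a. R \<gamma> a" if \<gamma>: "\<gamma> \<in> expts D" for \<gamma> :: "'m \<Rightarrow> nat"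
  proof -
    have "(\<lambda>j. e j + \<gamma> j) \<in> expts (Suc D)" using \<gamma> by (simp add: expts_def e_def sum.distrib)
    then obtain H where H: "\<forall>k\<in>K. in_span_on UNIV (expts D) monomial (H k)"
      "\<forall>z\<in>V. monomial (\<lambda>j. e j + \<gamma> j) z = (\<Sum>k\<in>K. z $ k * H k z)" using D by blast
    have "\<forall>k\<in>K. \<exists>c. \<forall>z. H k z = (\<Sum>\<delta>\<in>expts D. c \<delta> * monomial \<delta> z)" using H(1) unfolding in_span_on_def by auto
    from bchoice[OF this] obtain a where a: "\<forall>k\<in>K. \<forall>z. H k z = (\<Sum>\<delta>\<in>expts D. a k \<delta> * monomial \<delta> z)" by (elim exE)
    have "z $ i * monomial \<gamma> z = (\<Sum>k\<in>K. z $ k * (\<Sum>\<delta>\<in>expts D. a k \<delta> * monomial \<delta> z))" if "z \<in> V" for z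
    proof -
      have "z $ i * monomial \<gamma> z = monomial (\<lambda>j. e j + \<gamma> j) z"
        by (simp add: monomial_mult[symmetric] e_def monomial_single)
      also have "\<dots> = (\<Sum>k\<in>K. z $ k * H k z)" using H(2) that by blast
      also have "\<dots> = (\<Sum>k\<in>K. z $ k * (\<Sum>\<delta>\<in>expts D. a k \<delta> * monomial \<delta> z))"
        using a by (intro sum.cong) auto
      finally show ?thesis .
    qed
    then show ?thesis unfolding R_def by blast
  qed
  have "\<forall>\<gamma>\<in>expts D. \<exists>a. R \<gamma> a" using ex by blast
  from bchoice[OF this] obtain a where "\<forall>\<gamma>\<in>expts D. R \<gamma> (a \<gamma>)" by (elim exE)
  then have a: "\<And>\<gamma> z. \<gamma> \<in> expts D \<Longrightarrow> z \<in> V \<Longrightarrow>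
    z $ i * monomial \<gamma> z = (\<Sum>k\<in>K. z $ k * (\<Sum>\<delta>\<in>expts D. a \<gamma> k \<delta> * monomial \<delta> z))" unfolding R_def by blast
  define L where "L \<gamma> \<delta> b = (\<Sum>k\<in>K. b $ k * a \<gamma> k \<delta>)" for \<gamma> \<delta> :: "'m \<Rightarrow> nat" and b :: "complex ^ 'm"
  have Lp: "polyfun (L \<gamma> \<delta>)" for \<gamma> \<delta>
    unfolding L_def[abs_def] by (intro polyfun_sum polyfun_mult polyfun_coord polyfun_const)
  \<comment> \<open>Entries of the unknown times the identity minus \<open>L\<close>: monic of
    degree 1 on the diagonal, constant in the unknown elsewhere.\<close>
  define M where "M \<gamma> \<delta> b = (if \<gamma> = \<delta> then [:0, 1:] else 0) - [:L \<gamma> \<delta> b:]" for \<gamma> \<delta> b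
  have fam: "poly_family (M \<gamma> \<delta>)" for \<gamma> \<delta>
    unfolding M_def[abs_def] by (intro poly_family_diff poly_family_const poly_family_coeff0 Lp)
  have "\<exists>P e. monic_family e P \<and> (\<forall>b s v. (\<forall>\<gamma>\<in>expts D. (\<Sum>\<delta>\<in>expts D. poly (M \<gamma> \<delta> b) s * v \<delta>) = 0) \<longrightarrow> (\<exists>\<gamma>\<in>expts D. v \<gamma> \<noteq> 0) \<longrightarrow> poly (P b) s = 0)"
  proof (rule pivot_elimination[OF finite_expts, where q = 1])
    show "monic_family 1 (M \<gamma> \<gamma>)" for \<gamma> unfolding monic_family_def using fam by (simp add: M_def)
    show "degree (M \<gamma> \<delta> b) < 1" if "\<gamma> \<noteq> \<delta>" for \<gamma> \<delta> b using that by (simp add: M_def)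
  qed (rule fam)
  then obtain P e where P: "monic_family e P"
    "\<And>b s v. (\<forall>\<gamma>\<in>expts D. (\<Sum>\<delta>\<in>expts D. poly (M \<gamma> \<delta> b) s * v \<delta>) = 0) \<Longrightarrow> (\<exists>\<gamma>\<in>expts D. v \<gamma> \<noteq> 0) \<Longrightarrow> poly (P b) s = 0" by blast
  have "poly (P b) (u $ i) = 0" if u: "u \<in> V" "u \<noteq> 0" and b: "\<forall>k\<in>K. b $ k = u $ k" for u b
  proof (rule P(2)[where v = "\<lambda>\<delta>. monomial \<delta> u"])
    show "\<forall>\<gamma>\<in>expts D. (\<Sum>\<delta>\<in>expts D. poly (M \<gamma> \<delta> b) (u $ i) * monomial \<delta> u) = 0"
    proof
      fix \<gamma> :: "'m \<Rightarrow> nat" assume \<gamma>: "\<gamma> \<in> expts D"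
      have "(\<Sum>\<delta>\<in>expts D. poly (M \<gamma> \<delta> b) (u $ i) * monomial \<delta> u)
        = (\<Sum>\<delta>\<in>expts D. (if \<delta> = \<gamma> then u $ i * monomial \<delta> u else 0)) - (\<Sum>\<delta>\<in>expts D. L \<gamma> \<delta> b * monomial \<delta> u)"
        unfolding sum_subtractf[symmetric] by (intro sum.cong refl) (auto simp: M_def left_diff_distrib)
      also have "(\<Sum>\<delta>\<in>expts D. (if \<delta> = \<gamma> then u $ i * monomial \<delta> u else 0)) = u $ i * monomial \<gamma> u"
        using \<gamma> by (simp add: finite_expts)
      also have "(\<Sum>\<delta>\<in>expts D. L \<gamma> \<delta> b * monomial \<delta> u) = (\<Sum>\<delta>\<in>expts D. \<Sum>k\<in>K. u $ k * (a \<gamma> k \<delta> * monomial \<delta> u))"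
        unfolding L_def sum_distrib_right using b by (intro sum.cong refl) (simp add: mult.assoc)
      also have "\<dots> = (\<Sum>k\<in>K. u $ k * (\<Sum>\<delta>\<in>expts D. a \<gamma> k \<delta> * monomial \<delta> u))"
        by (subst sum.swap) (simp add: sum_distrib_left)
      finally show "(\<Sum>\<delta>\<in>expts D. poly (M \<gamma> \<delta> b) (u $ i) * monomial \<delta> u) = 0" using a[OF \<gamma> u(1)] by simp
    qed
    \<comment> \<open>The power of degree \<open>D\<close> of a nonzero coordinate shows that the
      eigenvector is not 0.\<close>
    obtain j where j: "u $ j \<noteq> 0" using u(2) by (auto simp: vec_eq_iff)
    show "\<exists>\<gamma>\<in>expts D. monomial \<gamma> u \<noteq> 0"
      by (rule bexI[of _ "\<lambda>l. if l = j then D else 0"]) (use j in \<open>simp_all add: monomial_single expts_def\<close>)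
  qed
  then show ?thesis using P(1) by blast
qed

text \<open>The product over all coordinates. With a single polynomial, one count of distinct roots
  governs all coordinates at once.\<close>

lemma cone_integral:
  fixes V :: "(complex ^ 'm::finite) set"
  assumes pc: "polynomial_cone \<G> V K"
  shows "\<exists>P e. monic_family e P \<and> (\<forall>u\<in>V. \<forall>b. u \<noteq> 0 \<longrightarrow> (\<forall>k\<in>K. b $ k = u $ k) \<longrightarrow> (\<forall>i. poly (P b) (u $ i) = 0))"
proof -
  have "\<exists>P e. monic_family e P \<and> (\<forall>u\<in>V. \<forall>b. u \<noteq> 0 \<longrightarrow> (\<forall>k\<in>K. b $ k = u $ k) \<longrightarrow> (\<forall>i\<in>S. poly (P b) (u $ i) = 0))" for S :: "'m set"
  proof (induction S rule: finite_induct[OF finite])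
    case 1
    have "monic_family 0 (\<lambda>_::complex ^ 'm. 1)" by (simp add: monic_family_def poly_family_const)
    then show ?case by blast
  next
    case (2 i S)
    obtain P d where P: "monic_family d P" "\<forall>u\<in>V. \<forall>b. u \<noteq> 0 \<longrightarrow> (\<forall>k\<in>K. b $ k = u $ k) \<longrightarrow> (\<forall>i\<in>S. poly (P b) (u $ i) = 0)"
      using 2 by blast
    obtain Q e where Q: "monic_family e Q" "\<forall>u\<in>V. \<forall>b. u \<noteq> 0 \<longrightarrow> (\<forall>k\<in>K. b $ k = u $ k) \<longrightarrow> poly (Q b) (u $ i) = 0"
      using cone_coordinate_integral[OF pc] by blast
    have "monic_family (d + e) (\<lambda>b. P b * Q b)" by (rule monic_family_mult[OF P(1) Q(1)])
    moreover have "\<forall>u\<in>V. \<forall>b. u \<noteq> 0 \<longrightarrow> (\<forall>k\<in>K. b $ k = u $ k) \<longrightarrow> (\<forall>j\<in>insert i S. poly (P b * Q b) (u $ j) = 0)"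
      using P(2) Q(2) by simp
    ultimately show ?case by blast
  qed
  from this[of UNIV] show ?thesis by simp
qed

section \<open>Branches of roots\<close>

text \<open>Complex differentiability of a scalar function at one point, the componentwise form of
  \<open>holomorphic_map\<close>.\<close>

definition has_cgrad :: "(complex ^ 'm \<Rightarrow> complex) \<Rightarrow> complex ^ 'm \<Rightarrow> bool" where
  "has_cgrad f b \<longleftrightarrow> (\<exists>a :: complex ^ 'm. (f has_derivative (\<lambda>h. \<Sum>i\<in>UNIV. a $ i * h $ i)) (at b))"

lemma has_cgradI: "(f has_derivative D) (at b) \<Longrightarrow> (\<And>h. D h = (\<Sum>i\<in>UNIV. a $ i * h $ i)) \<Longrightarrow> has_cgrad f b"
  unfolding has_cgrad_def by (rule exI[of _ a]) (metis (no_types, lifting) ext)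

lemma has_cgrad_isCont: "has_cgrad f b \<Longrightarrow> isCont f b"
  unfolding has_cgrad_def by (auto intro: has_derivative_continuous)

lemma has_cgrad_const: "has_cgrad (\<lambda>_. c) b"
  by (rule has_cgradI[where D = "\<lambda>_. 0" and a = 0]) simp_all

lemma has_cgrad_coord:
  fixes b :: "complex ^ 'm"
  shows "has_cgrad (\<lambda>z. z $ i) b"
proof (rule has_cgradI[where a = "axis i (1::complex) :: complex ^ 'm"])
  show "((\<lambda>z. z $ i) has_derivative (\<lambda>h. h $ i)) (at b)"
    by (rule bounded_linear.has_derivative[OF bounded_linear_vec_nth has_derivative_ident])
  show "h $ i = (\<Sum>j\<in>UNIV. axis i (1::complex) $ j * h $ j)" for h :: "complex ^ 'm"
  proof -
    have "(\<Sum>j\<in>UNIV. axis i (1::complex) $ j * h $ j) = (\<Sum>j\<in>UNIV. if j = i then h $ j else 0)"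
      by (intro sum.cong) (auto simp: axis_def)
    then show ?thesis by simp
  qed
qed

lemma has_cgrad_add: assumes "has_cgrad f b" "has_cgrad g b" shows "has_cgrad (\<lambda>z. f z + g z) b"
proof -
  obtain a c where "(f has_derivative (\<lambda>h. \<Sum>i\<in>UNIV. a $ i * h $ i)) (at b)" "(g has_derivative (\<lambda>h. \<Sum>i\<in>UNIV. c $ i * h $ i)) (at b)"
    using assms unfolding has_cgrad_def by blast
  from has_derivative_add[OF this] show ?thesis
    by (rule has_cgradI[where a = "a + c"]) (simp add: distrib_right sum.distrib)
qed

lemma has_cgrad_mult: assumes "has_cgrad f b" "has_cgrad g b" shows "has_cgrad (\<lambda>z. f z * g z) b"
proof -
  obtain a c where "(f has_derivative (\<lambda>h. \<Sum>i\<in>UNIV. a $ i * h $ i)) (at b)" "(g has_derivative (\<lambda>h. \<Sum>i\<in>UNIV. c $ i * h $ i)) (at b)"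
    using assms unfolding has_cgrad_def by blast
  from has_derivative_mult[OF this] show ?thesis
    by (rule has_cgradI[where a = "f b *s c + g b *s a"]) (simp add: distrib_right distrib_left sum.distrib sum_distrib_left mult_ac)
qed

lemma has_cgrad_sum: "(\<And>i. i \<in> I \<Longrightarrow> has_cgrad (f i) b) \<Longrightarrow> has_cgrad (\<lambda>z. \<Sum>i\<in>I. f i z) b"
  by (induction I rule: infinite_finite_induct) (simp_all add: has_cgrad_const has_cgrad_add)

lemma polyfun_has_cgrad: "polyfun f \<Longrightarrow> has_cgrad f b"
  by (induction rule: polyfun.induct) (simp_all add: has_cgrad_const has_cgrad_coord has_cgrad_add has_cgrad_mult)

lemma has_cgrad_local:
  assumes "has_cgrad f b" "eventually (\<lambda>x. f x = g x) (nhds b)" shows "has_cgrad g b"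
proof -
  obtain a where a: "(f has_derivative (\<lambda>h. \<Sum>i\<in>UNIV. a $ i * h $ i)) (at b)" using assms(1) unfolding has_cgrad_def by blast
  have "(g has_derivative (\<lambda>h. \<Sum>i\<in>UNIV. a $ i * h $ i)) (at b)"
    by (rule has_derivative_transform_eventually[OF a])
      (use assms(2) in \<open>auto simp: eventually_at_filter elim: eventually_mono dest: eventually_nhds_x_imp_x\<close>)
  then show ?thesis unfolding has_cgrad_def by blast
qed

text \<open>Since \<open>\<psi>\<close> vanishes at \<open>b\<close>, replacing
  \<open>\<kappa>\<close> by its value at \<open>b\<close> changes the product only by a term of
  higher order; continuity of \<open>\<kappa>\<close> suffices.\<close>

lemma has_cgrad_factor:
  assumes \<psi>: "has_cgrad \<psi> b" "\<psi> b = 0" and \<kappa>: "isCont \<kappa> b"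
  shows "has_cgrad (\<lambda>x. \<kappa> x * \<psi> x) b"
proof -
  obtain a where a: "(\<psi> has_derivative (\<lambda>h. \<Sum>i\<in>UNIV. a $ i * h $ i)) (at b)" using \<psi>(1) unfolding has_cgrad_def by blast
  define D where "D h = (\<Sum>i\<in>UNIV. a $ i * h $ i)" for h
  have D: "(\<psi> has_derivative D) (at b)" using a unfolding D_def .
  then have "bounded_linear D" by (rule has_derivative_bounded_linear)
  then obtain B where B: "B > 0" "\<And>h. norm (D h) \<le> norm h * B" using bounded_linear.pos_bounded by blast
  have 0: "((\<lambda>x. (\<kappa> x - \<kappa> b) * \<psi> x) has_derivative (\<lambda>h. 0)) (at b)"
    unfolding has_derivative_at_alt
  proof (intro conjI allI impI)
    fix e :: real assume e: "e > 0"
    obtain d1 where d1: "d1 > 0" "\<And>y. norm (y - b) < d1 \<Longrightarrow> norm (\<psi> y - \<psi> b - D (y - b)) \<le> 1 * norm (y - b)"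
      using D zero_less_one unfolding has_derivative_at_alt by blast
    have "e / (B + 1) > 0" using e B by simp
    then have "eventually (\<lambda>y. dist (\<kappa> y) (\<kappa> b) < e / (B + 1)) (nhds b)"
      using \<kappa> unfolding isCont_def by (intro tendstoD) (simp_all add: tendsto_nhds_iff)
    then obtain d2 where d2: "d2 > 0" "\<forall>y. dist y b < d2 \<longrightarrow> dist (\<kappa> y) (\<kappa> b) < e / (B + 1)"
      unfolding eventually_nhds_metric by blast
    have "norm ((\<kappa> y - \<kappa> b) * \<psi> y - (\<kappa> b - \<kappa> b) * \<psi> b - 0) \<le> e * norm (y - b)"
      if y: "norm (y - b) < min d1 d2" for y
    proof -
      have "norm (\<psi> y - D (y - b)) \<le> norm (y - b)" using d1(2)[of y] y \<psi>(2) by simp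
      then have p: "norm (\<psi> y) \<le> (B + 1) * norm (y - b)"
        using B(2)[of "y - b"] norm_triangle_ineq2[of "\<psi> y" "D (y - b)"] by (simp add: algebra_simps)
      have k: "norm (\<kappa> y - \<kappa> b) \<le> e / (B + 1)" using d2(2) y by (simp add: dist_norm less_imp_le)
      have "norm ((\<kappa> y - \<kappa> b) * \<psi> y) \<le> e / (B + 1) * ((B + 1) * norm (y - b))"
        unfolding norm_mult using k p B e by (intro mult_mono) auto
      also have "\<dots> = e * norm (y - b)" using B by simp
      finally show ?thesis by simp
    qed
    then show "\<exists>d>0. \<forall>y. norm (y - b) < d \<longrightarrow> norm ((\<kappa> y - \<kappa> b) * \<psi> y - (\<kappa> b - \<kappa> b) * \<psi> b - 0) \<le> e * norm (y - b)"
      using d1(1) d2(1) by (intro exI[of _ "min d1 d2"]) auto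
  qed simp
  have "has_cgrad (\<lambda>x. (\<kappa> x - \<kappa> b) * \<psi> x) b" by (rule has_cgradI[OF 0, of 0]) simp
  from has_cgrad_add[OF has_cgrad_mult[OF has_cgrad_const \<psi>(1)] this]
  have "has_cgrad (\<lambda>x. \<kappa> b * \<psi> x + (\<kappa> x - \<kappa> b) * \<psi> x) b" .
  then show ?thesis by (simp add: algebra_simps)
qed

section \<open>Divided differences and implicitly defined roots\<close>

lemma poly_sum_upto:
  fixes p :: "'a::comm_semiring_1 poly"
  assumes "degree p \<le> n" shows "poly p x = (\<Sum>k\<le>n. coeff p k * x ^ k)"
  unfolding poly_altdef
  by (rule sum.mono_neutral_left) (use assms in \<open>auto simp: coeff_eq_0\<close>)

lemma poly_diff_factor:
  fixes p :: "complex poly"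
  assumes "degree p \<le> n"
  shows "poly p x - poly p y = (x - y) * (\<Sum>k\<le>n. coeff p k * (\<Sum>i<k. y ^ (k - Suc i) * x ^ i))"
proof -
  have "poly p x - poly p y = (\<Sum>k\<le>n. coeff p k * (x ^ k - y ^ k))"
    by (simp add: poly_sum_upto[OF assms] sum_subtractf right_diff_distrib)
  then show ?thesis by (simp add: power_diff_sumr2 sum_distrib_left mult.left_commute)
qed

lemma poly_diff_factor_diag:
  fixes p :: "complex poly"
  assumes "degree p \<le> n"
  shows "(\<Sum>k\<le>n. coeff p k * (\<Sum>i<k. y ^ (k - Suc i) * y ^ i)) = poly (pderiv p) y"
proof -
  have "((\<lambda>x. \<Sum>k\<le>n. coeff p k * x ^ k) has_field_derivative (\<Sum>k\<le>n. coeff p k * (of_nat k * y ^ (k - 1)))) (at y)"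
  proof (intro DERIV_sum DERIV_cmult)
    fix k
    show "((\<lambda>x. x ^ k) has_field_derivative of_nat k * y ^ (k - 1)) (at y)"
      using DERIV_power[where f = "\<lambda>x. x" and D = 1 and n = k and x = y and s = UNIV] by simp
  qed
  then have "(poly p has_field_derivative (\<Sum>k\<le>n. coeff p k * (of_nat k * y ^ (k - 1)))) (at y)"
    unfolding poly_sum_upto[OF assms, abs_def] .
  moreover have "(\<Sum>i<k. y ^ (k - Suc i) * y ^ i) = of_nat k * y ^ (k - 1)" for k
  proof -
    have "y ^ (k - Suc i) * y ^ i = y ^ (k - 1)" if "i < k" for i
      using that by (simp add: power_add[symmetric])
    then show ?thesis by simp
  qed
  ultimately have "(poly p has_field_derivative (\<Sum>k\<le>n. coeff p k * (\<Sum>i<k. y ^ (k - Suc i) * y ^ i))) (at y)" by simp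
  then show ?thesis using poly_DERIV by (rule DERIV_unique)
qed

text \<open>The divided difference \<open>q\<close> is continuous and its value at \<open>c\<close>
  is the nonzero derivative; near \<open>c\<close> the root satisfies
  \<open>\<phi> b - z = - poly (T b) z / q b\<close>. The numerator vanishes at \<open>c\<close>, so
  \<open>has_cgrad_factor\<close> applies with \<open>q\<close> merely continuous.\<close>

lemma has_cgrad_implicit_root:
  fixes T :: "complex ^ 'm \<Rightarrow> complex poly"
  assumes deg: "\<And>b. degree (T b) \<le> n" and T: "poly_family T" and \<phi>: "isCont \<phi> c"
    and root: "eventually (\<lambda>b. poly (T b) (\<phi> b) = 0) (nhds c)" and simple: "poly (pderiv (T c)) (\<phi> c) \<noteq> 0"
  shows "has_cgrad \<phi> c"
proof -
  define z where "z = \<phi> c"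
  define q where "q b = (\<Sum>k\<le>n. coeff (T b) k * (\<Sum>i<k. z ^ (k - Suc i) * \<phi> b ^ i))" for b
  have co: "has_cgrad (\<lambda>b. coeff (T b) k) c" for k using T unfolding poly_family_def by (intro polyfun_has_cgrad) blast
  have q: "isCont q c" unfolding q_def by (intro continuous_intros has_cgrad_isCont[OF co] \<phi>)
  have qc: "q c \<noteq> 0" using poly_diff_factor_diag[OF deg, of c z] simple by (simp add: q_def z_def)
  have \<psi>: "has_cgrad (\<lambda>b. poly (T b) z) c"
    unfolding poly_sum_upto[OF deg] by (intro has_cgrad_sum has_cgrad_mult co has_cgrad_const)
  have "has_cgrad (\<lambda>b. (- 1 / q b) * poly (T b) z) c"
  proof (rule has_cgrad_factor[OF \<psi>])
    show "poly (T c) z = 0" using eventually_nhds_x_imp_x[OF root] by (simp add: z_def)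
    show "isCont (\<lambda>b. - 1 / q b) c" using q qc by (intro continuous_intros)
  qed
  then have "has_cgrad (\<lambda>b. z + (- 1 / q b) * poly (T b) z) c" by (intro has_cgrad_add has_cgrad_const)
  moreover have "eventually (\<lambda>b. q b \<noteq> 0) (nhds c)"
    using q qc by (simp add: isCont_def tendsto_nhds_iff tendsto_imp_eventually_ne)
  with root have "eventually (\<lambda>b. z + (- 1 / q b) * poly (T b) z = \<phi> b) (nhds c)"
  proof eventually_elim
    case (elim b)
    have "- poly (T b) z = (\<phi> b - z) * q b"
      using poly_diff_factor[OF deg, of b "\<phi> b" z] elim(1) by (simp add: q_def)
    then have "(- 1 / q b) * poly (T b) z = \<phi> b - z" using elim(2) by (simp add: field_simps)
    then show ?case by simp
  qed
  ultimately show ?thesis by (rule has_cgrad_local)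
qed

section \<open>Continuity of roots\<close>

lemma norm_poly_ge:
  fixes p :: "complex poly"
  assumes p: "lead_coeff p = 1" and far: "\<And>z. poly p z = 0 \<Longrightarrow> \<eta> \<le> cmod (s - z)" and \<eta>: "\<eta> > 0"
  shows "\<eta> ^ degree p \<le> cmod (poly p s)"
proof -
  have "p \<noteq> 0" using p by auto
  then have roots: "\<eta> \<le> cmod (s - z)" if "z \<in># proots p" for z using that far by simp
  have "\<eta> ^ size A \<le> cmod (poly (\<Prod>x\<in>#A. [:-x, 1:]) s)" if "\<forall>z\<in>#A. \<eta> \<le> cmod (s - z)" for A
    using that
  proof (induction A)
    case (add x A)
    then have "\<eta> * \<eta> ^ size A \<le> cmod (s - x) * cmod (poly (\<Prod>x\<in>#A. [:-x, 1:]) s)"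
      using \<eta> by (intro mult_mono) auto
    also have "\<dots> = cmod (poly (\<Prod>x\<in>#add_mset x A. [:-x, 1:]) s)"
      unfolding norm_mult[symmetric] by (simp add: algebra_simps)
    finally show ?case by simp
  qed simp
  from this[of "proots p"] roots show ?thesis
    using complex_poly_decompose_multiset[of p] p by (simp add: size_proots_complex)
qed

lemma isCont_poly_family:
  assumes "poly_family P" "\<And>b. degree (P b) \<le> n" "isCont \<phi> c"
  shows "isCont (\<lambda>b. poly (P b) (\<phi> b)) c"
proof -
  have "isCont (\<lambda>b. coeff (P b) k) c" for k
    using assms(1) unfolding poly_family_def by (intro has_cgrad_isCont polyfun_has_cgrad) blast
  then show ?thesis unfolding poly_sum_upto[OF assms(2)] by (intro continuous_intros assms(3))
qed

text \<open>If all roots were at distance at least \<open>\<eta>\<close> from \<open>s\<close>, the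
  monic polynomial would have modulus at least \<open>\<eta> ^ e\<close> at \<open>s\<close>, while
  its value there tends to 0.\<close>

lemma eventually_root_near:
  assumes Q: "monic_family e Q" and s: "poly (Q c) s = 0" and \<eta>: "\<eta> > 0"
  shows "eventually (\<lambda>b. \<exists>z. poly (Q b) z = 0 \<and> dist z s < \<eta>) (nhds c)"
proof -
  have deg: "degree (Q b) = e" "lead_coeff (Q b) = 1" for b using Q unfolding monic_family_def by auto
  have fam: "poly_family Q" using Q unfolding monic_family_def by blast
  have "isCont (\<lambda>b. poly (Q b) s) c" by (rule isCont_poly_family[OF fam]) (use deg in auto)
  then have "eventually (\<lambda>b. dist (poly (Q b) s) (poly (Q c) s) < \<eta> ^ e) (nhds c)"
    unfolding isCont_def using \<eta> by (intro tendstoD) (simp_all add: tendsto_nhds_iff)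
  then show ?thesis
  proof eventually_elim
    case (elim b)
    then have lt: "cmod (poly (Q b) s) < \<eta> ^ e" using s by simp
    show ?case
    proof (rule ccontr)
      assume "\<not> ?case"
      then have far: "\<eta> \<le> cmod (s - z)" if "poly (Q b) z = 0" for z using that by (auto simp: dist_norm norm_minus_commute not_less)
      have "\<eta> ^ degree (Q b) \<le> cmod (poly (Q b) s)" by (rule norm_poly_ge[OF deg(2) far \<eta>])
      then show False using lt deg(1)[of b] by simp
    qed
  qed
qed

section \<open>Multiplicities and derivatives\<close>

lemma order_higher_pderiv:
  fixes p :: "complex poly"
  assumes "p \<noteq> 0" "j \<le> order a p"
  shows "(pderiv ^^ j) p \<noteq> 0 \<and> order a ((pderiv ^^ j) p) = order a p - j"
  using assms(2)
proof (induction j)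
  case 0
  then show ?case using assms(1) by simp
next
  case (Suc j)
  define q where "q = (pderiv ^^ j) p"
  have q: "q \<noteq> 0" "order a q = order a p - j" using Suc by (auto simp: q_def)
  then have "order a q \<noteq> 0" using Suc by simp
  then have r: "poly q a = 0" using q(1) order_root by blast
  have "pderiv q \<noteq> 0"
  proof
    assume "pderiv q = 0"
    then obtain k where "q = [:k:]" using pderiv_eq_0_iff degree_eq_zeroE by blast
    then show False using r q(1) by simp
  qed
  moreover have "order a q = Suc (order a (pderiv q))" by (rule order_pderiv[OF q(1) r])
  ultimately show ?case using q Suc.prems by (simp add: q_def[symmetric])
qed

lemma poly_family_higher_pderiv:
  assumes "poly_family P" shows "poly_family (\<lambda>b. (pderiv ^^ j) (P b))"
proof (induction j)
  case (Suc j)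
  then show ?case unfolding poly_family_def by (simp add: coeff_pderiv polyfun_mult polyfun_const)
qed (use assms in simp)

lemma degree_higher_pderiv_le: "degree ((pderiv ^^ j) (p :: complex poly)) \<le> degree p"
  by (induction j) (auto simp: degree_pderiv)

lemma sum_order_roots:
  fixes p :: "complex poly"
  assumes "p \<noteq> 0" shows "(\<Sum>z | poly p z = 0. order z p) = degree p"
proof -
  have "degree p = size (proots p)" by (simp add: size_proots_complex)
  also have "\<dots> = (\<Sum>z\<in>set_mset (proots p). count (proots p) z)" by (simp add: size_multiset_overloaded_eq)
  finally show ?thesis using assms by simp
qed

lemma finite_separation:
  fixes Z :: "'a::metric_space set"
  assumes "finite Z" shows "\<exists>\<epsilon>>0. \<forall>s\<in>Z. \<forall>t\<in>Z. s \<noteq> t \<longrightarrow> 2 * \<epsilon> \<le> dist s t"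
proof -
  \<comment> \<open>The element 1 keeps \<open>D\<close> nonempty when \<open>Z\<close> has at most
    one point.\<close>
  define D where "D = insert 1 ((\<lambda>(s, t). dist s t) ` {(s, t). s \<in> Z \<and> t \<in> Z \<and> s \<noteq> t})"
  have "{(s, t). s \<in> Z \<and> t \<in> Z \<and> s \<noteq> t} \<subseteq> Z \<times> Z" by blast
  then have "finite {(s, t). s \<in> Z \<and> t \<in> Z \<and> s \<noteq> t}" using assms by (rule_tac finite_subset) auto
  then have fin: "finite D" by (simp add: D_def)
  have "\<forall>d\<in>D. d > 0" by (auto simp: D_def)
  then have "Min D > 0" using fin Min_in[OF fin] by (auto simp: D_def)
  moreover have "Min D \<le> dist s t" if "s \<in> Z" "t \<in> Z" "s \<noteq> t" for s t
    using that fin by (intro Min_le) (auto simp: D_def)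
  ultimately show ?thesis by (intro exI[of _ "Min D / 2"]) auto
qed

text \<open>Where the number of distinct roots is maximal, the roots neither split nor collide, so they
  have locally constant multiplicity \<open>\<mu>\<close> and each is a simple root of the derivative of order
  \<open>\<mu> - 1\<close>.\<close>

lemma root_branches:
  fixes Q :: "complex ^ 'm \<Rightarrow> complex poly" and c :: "complex ^ 'm"
  defines "Z \<equiv> {z. poly (Q c) z = 0}"
  assumes Q: "monic_family e Q" and max: "\<And>b. card {z. poly (Q b) z = 0} \<le> card Z"
  shows "\<exists>r>0. \<exists>\<epsilon>>0. \<exists>\<phi>. \<forall>b\<in>ball c r.
     (\<forall>s\<in>Z. poly (Q b) (\<phi> s b) = 0 \<and> dist (\<phi> s b) s < \<epsilon> \<and> has_cgrad (\<phi> s) b) \<and>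
     (\<forall>z. poly (Q b) z = 0 \<longrightarrow> (\<exists>s\<in>Z. z = \<phi> s b)) \<and>
     (\<forall>s\<in>Z. \<forall>z. poly (Q b) z = 0 \<longrightarrow> dist z s < \<epsilon> \<longrightarrow> z = \<phi> s b)"
proof -
  have deg: "degree (Q b) = e" "lead_coeff (Q b) = 1" and fam: "poly_family Q" for b
    using Q unfolding monic_family_def by blast+
  have Q0: "Q b \<noteq> 0" for b using deg(2)[of b] by auto
  have fin: "finite {z. poly (Q b) z = 0}" for b by (rule poly_roots_finite[OF Q0])
  have finZ: "finite Z" unfolding Z_def by (rule fin)
  obtain \<epsilon> where \<epsilon>: "\<epsilon> > 0" "\<forall>s\<in>Z. \<forall>t\<in>Z. s \<noteq> t \<longrightarrow> 2 * \<epsilon> \<le> dist s t"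
    using finite_separation[OF finZ] by blast
  have "eventually (\<lambda>b. \<forall>s\<in>Z. \<exists>z. poly (Q b) z = 0 \<and> dist z s < \<epsilon>) (nhds c)"
    by (intro eventually_ball_finite[OF finZ] ballI eventually_root_near[OF Q _ \<epsilon>(1)]) (simp add: Z_def)
  then obtain r where r: "r > 0" "\<forall>b. dist b c < r \<longrightarrow> (\<forall>s\<in>Z. \<exists>z. poly (Q b) z = 0 \<and> dist z s < \<epsilon>)"
    unfolding eventually_nhds_metric by blast
  \<comment> \<open>Any root near \<open>s\<close> may be chosen; it turns out to be the only
    one.\<close>
  define \<phi> where "\<phi> s b = (SOME z. poly (Q b) z = 0 \<and> dist z s < \<epsilon>)" for s b
  have F1: "poly (Q b) (\<phi> s b) = 0 \<and> dist (\<phi> s b) s < \<epsilon>" if "b \<in> ball c r" "s \<in> Z" for b s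
  proof -
    have "dist b c < r" using that(1) by (simp add: dist_commute)
    with r(2) that(2) have "\<exists>z. poly (Q b) z = 0 \<and> dist z s < \<epsilon>" by blast
    then show ?thesis unfolding \<phi>_def by (rule someI_ex)
  qed
  have sep: "s = t" if "s \<in> Z" "t \<in> Z" "dist z s < \<epsilon>" "dist z t < \<epsilon>" for s t z
  proof (rule ccontr)
    assume "s \<noteq> t"
    then have "2 * \<epsilon> \<le> dist s t" using \<epsilon>(2) that by blast
    then show False using dist_triangle[of s t z] that(3,4) by (simp add: dist_commute)
  qed
  have inj: "inj_on (\<lambda>s. \<phi> s b) Z" if "b \<in> ball c r" for b
  proof (rule inj_onI)
    fix s t assume st: "s \<in> Z" "t \<in> Z" "\<phi> s b = \<phi> t b"
    show "s = t" by (rule sep[OF st(1,2), of "\<phi> s b"]) (use F1[OF that st(1)] F1[OF that st(2)] st(3) in auto)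
  qed
  \<comment> \<open>The chosen roots are distinct and their number is already the maximal one, so
    there are no others.\<close>
  have im: "(\<lambda>s. \<phi> s b) ` Z = {z. poly (Q b) z = 0}" if b: "b \<in> ball c r" for b
  proof (rule card_seteq[OF fin])
    show "(\<lambda>s. \<phi> s b) ` Z \<subseteq> {z. poly (Q b) z = 0}" using F1[OF b] by blast
    show "card {z. poly (Q b) z = 0} \<le> card ((\<lambda>s. \<phi> s b) ` Z)"
      unfolding card_image[OF inj[OF b]] by (rule max)
  qed
  have F3: "\<exists>s\<in>Z. z = \<phi> s b" if "b \<in> ball c r" "poly (Q b) z = 0" for b z
    using im[OF that(1)] that(2) by blast
  have F2: "z = \<phi> s b" if b: "b \<in> ball c r" and z: "poly (Q b) z = 0" "s \<in> Z" "dist z s < \<epsilon>" for b z s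
  proof -
    obtain t where t: "t \<in> Z" "z = \<phi> t b" using F3[OF b z(1)] by blast
    have "s = t" by (rule sep[OF z(2) t(1) z(3)]) (use F1[OF b t(1)] t(2) in simp)
    then show ?thesis using t by simp
  qed
  have near: "eventually (\<lambda>b. b \<in> ball c r) (nhds b1)" if "b1 \<in> ball c r" for b1
    using that by (intro eventually_nhds_in_open) auto
  have cont: "isCont (\<phi> s) b1" if b1: "b1 \<in> ball c r" and s: "s \<in> Z" for s b1
  proof -
    have "(\<phi> s \<longlongrightarrow> \<phi> s b1) (nhds b1)"
    proof (rule tendstoI)
      fix \<eta> :: real assume \<eta>: "\<eta> > 0"
      \<comment> \<open>Keeps the new root within \<open>\<epsilon>\<close> of \<open>s\<close> as
        well, where it must be the chosen one.\<close>
      define \<eta>' where "\<eta>' = min \<eta> (\<epsilon> - dist (\<phi> s b1) s)"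
      have "\<eta>' > 0" using \<eta> F1[OF b1 s] by (simp add: \<eta>'_def)
      from eventually_root_near[OF Q conjunct1[OF F1[OF b1 s]] this] near[OF b1]
      show "eventually (\<lambda>b. dist (\<phi> s b) (\<phi> s b1) < \<eta>) (nhds b1)"
      proof eventually_elim
        case (elim b)
        then obtain z where z: "poly (Q b) z = 0" "dist z (\<phi> s b1) < \<eta>'" by blast
        have "dist z s < \<epsilon>" using z(2) dist_triangle[of z s "\<phi> s b1"] by (simp add: \<eta>'_def)
        from F2[OF elim(2) z(1) s this] show ?case using z(2) by (simp add: \<eta>'_def)
      qed
    qed
    then show ?thesis by (simp add: isCont_def tendsto_nhds_iff)
  qed
  define \<mu> where "\<mu> s b = order (\<phi> s b) (Q b)" for s b
  have sum\<mu>: "(\<Sum>s\<in>Z. \<mu> s b) = e" if b: "b \<in> ball c r" for b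
    using sum_order_roots[OF Q0[of b]] unfolding im[OF b, symmetric] sum.reindex[OF inj[OF b]]
    by (simp add: \<mu>_def deg)
  have hp: "(pderiv ^^ j) (Q b) \<noteq> 0 \<and> order a ((pderiv ^^ j) (Q b)) = order a (Q b) - j" if "j \<le> order a (Q b)" for j a b
    by (rule order_higher_pderiv[OF Q0 that])
  \<comment> \<open>Multiplicities can only drop nearby: a derivative that is nonzero at the root
    stays nonzero.\<close>
  have le\<mu>: "eventually (\<lambda>b. \<mu> s b \<le> \<mu> s b1) (nhds b1)" if b1: "b1 \<in> ball c r" and s: "s \<in> Z" for s b1
  proof -
    let ?T = "\<lambda>b. (pderiv ^^ \<mu> s b1) (Q b)"
    have "?T b1 \<noteq> 0 \<and> order (\<phi> s b1) (?T b1) = 0" using hp[of "\<mu> s b1" "\<phi> s b1" b1] by (simp add: \<mu>_def)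
    then have nz: "poly (?T b1) (\<phi> s b1) \<noteq> 0" using order_root by blast
    have "isCont (\<lambda>b. poly (?T b) (\<phi> s b)) b1"
      by (rule isCont_poly_family[OF poly_family_higher_pderiv[OF fam] _ cont[OF b1 s], where n = e])
        (use degree_higher_pderiv_le deg in metis)
    then have "eventually (\<lambda>b. poly (?T b) (\<phi> s b) \<noteq> 0) (nhds b1)"
      using nz by (simp add: isCont_def tendsto_nhds_iff tendsto_imp_eventually_ne)
    then show ?thesis
    proof eventually_elim
      case (elim b)
      show ?case
      proof (rule ccontr)
        assume "\<not> ?case"
        then have lt: "\<mu> s b1 < order (\<phi> s b) (Q b)" by (simp add: \<mu>_def)
        then have "order (\<phi> s b) (?T b) \<noteq> 0" using hp[of "\<mu> s b1" "\<phi> s b" b] by simp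
        then show False using elim order_root by blast
      qed
    qed
  qed
  have eq\<mu>: "eventually (\<lambda>b. \<forall>s\<in>Z. \<mu> s b = \<mu> s b1) (nhds b1)" if b1: "b1 \<in> ball c r" for b1
  proof -
    have "eventually (\<lambda>b. \<forall>s\<in>Z. \<mu> s b \<le> \<mu> s b1) (nhds b1)"
      by (intro eventually_ball_finite[OF finZ] ballI le\<mu>[OF b1])
    with near[OF b1] show ?thesis
    proof eventually_elim
      case (elim b)
      \<comment> \<open>The multiplicities sum to \<open>e\<close> everywhere, so none of them can
        drop.\<close>
      have eq: "(\<Sum>s\<in>Z. \<mu> s b) = (\<Sum>s\<in>Z. \<mu> s b1)" using sum\<mu>[OF elim(1)] sum\<mu>[OF b1] by simp
      show ?case
      proof
        fix s assume s: "s \<in> Z"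
        show "\<mu> s b = \<mu> s b1" by (rule sum_mono_inv[OF eq _ s finZ]) (use elim(2) in blast)
      qed
    qed
  qed
  have der: "has_cgrad (\<phi> s) b1" if b1: "b1 \<in> ball c r" and s: "s \<in> Z" for s b1
  proof -
    define j where "j = \<mu> s b1 - 1"
    have "\<mu> s b1 \<noteq> 0" using F1[OF b1 s] Q0[of b1] order_root[of "Q b1" "\<phi> s b1"] by (simp add: \<mu>_def)
    then have j: "\<mu> s b1 = Suc j" by (simp add: j_def)
    show ?thesis
    proof (rule has_cgrad_implicit_root[where T = "\<lambda>b. (pderiv ^^ j) (Q b)" and n = e])
      show "degree ((pderiv ^^ j) (Q b)) \<le> e" for b using degree_higher_pderiv_le[of j "Q b"] deg by simp
      show "poly_family (\<lambda>b. (pderiv ^^ j) (Q b))" by (rule poly_family_higher_pderiv[OF fam])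
      show "isCont (\<phi> s) b1" by (rule cont[OF b1 s])
      show "eventually (\<lambda>b. poly ((pderiv ^^ j) (Q b)) (\<phi> s b) = 0) (nhds b1)"
        using eq\<mu>[OF b1]
      proof eventually_elim
        case (elim b)
        then have "order (\<phi> s b) (Q b) = Suc j" using s j by (simp add: \<mu>_def)
        then have "order (\<phi> s b) ((pderiv ^^ j) (Q b)) \<noteq> 0" using hp[of j "\<phi> s b" b] by simp
        then show ?case using order_root by blast
      qed
      have "order (\<phi> s b1) (Q b1) = Suc j" using j by (simp add: \<mu>_def)
      then have "(pderiv ^^ Suc j) (Q b1) \<noteq> 0 \<and> order (\<phi> s b1) ((pderiv ^^ Suc j) (Q b1)) = 0"
        using hp[of "Suc j" "\<phi> s b1" b1] by simp
      then have "poly ((pderiv ^^ Suc j) (Q b1)) (\<phi> s b1) \<noteq> 0" using order_root by blast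
      then show "poly (pderiv ((pderiv ^^ j) (Q b1))) (\<phi> s b1) \<noteq> 0" by simp
    qed
  qed
  have A: "\<forall>s\<in>Z. poly (Q b) (\<phi> s b) = 0 \<and> dist (\<phi> s b) s < \<epsilon> \<and> has_cgrad (\<phi> s) b" if b: "b \<in> ball c r" for b
    using F1[OF b] der[OF b] by simp
  have B: "\<forall>z. poly (Q b) z = 0 \<longrightarrow> (\<exists>s\<in>Z. z = \<phi> s b)" if b: "b \<in> ball c r" for b
    using F3[OF b] by simp
  have C: "\<forall>s\<in>Z. \<forall>z. poly (Q b) z = 0 \<longrightarrow> dist z s < \<epsilon> \<longrightarrow> z = \<phi> s b" if b: "b \<in> ball c r" for b
    by (intro ballI allI impI F2[OF b])
  show ?thesis
    by (rule exI[of _ r], rule conjI[OF r(1)], rule exI[of _ \<epsilon>], rule conjI[OF \<epsilon>(1)], rule exI[of _ \<phi>],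
        intro ballI conjI A B C)
qed

section \<open>Holomorphic maps and the identity theorem\<close>

lemma has_cgrad_polyfun_comp:
  fixes G :: "complex ^ 'm \<Rightarrow> complex ^ 'k"
  assumes "polyfun F" "\<And>i. has_cgrad (\<lambda>b. G b $ i) c" shows "has_cgrad (\<lambda>b. F (G b)) c"
  using assms(1) by (induction rule: polyfun.induct) (simp_all add: has_cgrad_const has_cgrad_add has_cgrad_mult assms(2))

lemma polyfun_subst:
  fixes G :: "complex ^ 'm \<Rightarrow> complex ^ 'k"
  assumes "polyfun F" "\<And>i. polyfun (\<lambda>b. G b $ i)" shows "polyfun (\<lambda>b. F (G b))"
  using assms(1) by (induction rule: polyfun.induct) (simp_all add: polyfun_const polyfun_add polyfun_mult assms(2))

lemma bounded_linear_axis: "bounded_linear (\<lambda>c. axis i c :: complex ^ 'b)"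
proof (rule bounded_linear_intro[where K = 1])
  fix c :: complex
  have "norm (axis i c :: complex ^ 'b) = norm c" by (simp add: norm_eq_sqrt_inner inner_axis_axis)
  then show "norm (axis i c :: complex ^ 'b) \<le> norm c * 1" by simp
qed (simp_all add: vec_eq_iff axis_def)

lemma holomorphic_map_of_has_cgrad:
  fixes f :: "complex ^ 'a \<Rightarrow> complex ^ 'b"
  assumes "\<And>x i. x \<in> U \<Longrightarrow> has_cgrad (\<lambda>x. f x $ i) x"
  shows "holomorphic_map f U"
  unfolding holomorphic_map_def
proof
  fix x assume x: "x \<in> U"
  have "\<forall>i. \<exists>a :: complex ^ 'a. ((\<lambda>x. f x $ i) has_derivative (\<lambda>h. \<Sum>k\<in>UNIV. a $ k * h $ k)) (at x)"
    using assms[OF x] unfolding has_cgrad_def by blast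
  from choice[OF this] obtain a :: "'b \<Rightarrow> complex ^ 'a"
    where a: "\<And>i. ((\<lambda>x. f x $ i) has_derivative (\<lambda>h. \<Sum>k\<in>UNIV. a i $ k * h $ k)) (at x)" by blast
  define D :: "complex ^ 'a ^ 'b" where "D = (\<chi> i. a i)"
  have "((\<lambda>x. \<Sum>i\<in>UNIV. axis i (f x $ i)) has_derivative (\<lambda>h. \<Sum>i\<in>UNIV. axis i (\<Sum>k\<in>UNIV. a i $ k * h $ k))) (at x)"
    by (intro has_derivative_sum bounded_linear.has_derivative[OF bounded_linear_axis] a)
  moreover have ax: "(\<Sum>i\<in>UNIV. axis i (v $ i)) = v" for v :: "complex ^ 'b"
    by (simp add: vec_eq_iff axis_def)
  moreover have "(\<Sum>i\<in>UNIV. axis i (\<Sum>k\<in>UNIV. a i $ k * h $ k)) = D *v h" for h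
    using ax[of "D *v h"] by (simp add: matrix_vector_mult_def D_def)
  ultimately have "(f has_derivative (\<lambda>h. D *v h)) (at x)" by simp
  then show "\<exists>D :: complex ^ 'a ^ 'b. (f has_derivative (\<lambda>h. D *v h)) (at x)" by blast
qed

lemma holomorphic_map_continuous: "holomorphic_map f U \<Longrightarrow> continuous_on U f"
  unfolding holomorphic_map_def
  by (meson continuous_at_imp_continuous_on has_derivative_continuous)

text \<open>On the complex line from \<open>p\<close> to \<open>y\<close> the parameters that stay
  in the ball form a convex set, so the one-variable identity theorem carries the zeros near
  \<open>p\<close> to \<open>y\<close>.\<close>

lemma has_cgrad_identity:
  fixes h :: "complex ^ 'm \<Rightarrow> complex"
  assumes h: "\<And>b. b \<in> ball c r \<Longrightarrow> has_cgrad h b" and p: "p \<in> ball c r" "\<delta> > 0"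
    and zero: "\<And>b. b \<in> ball p \<delta> \<Longrightarrow> b \<in> ball c r \<Longrightarrow> h b = 0" and y: "y \<in> ball c r"
  shows "h y = 0"
proof -
  define v where "v = y - p"
  define l where "l \<zeta> = p + \<zeta> *s v" for \<zeta>
  define W where "W = {\<zeta>. l \<zeta> \<in> ball c r}"
  have lin: "bounded_linear (\<lambda>e. e *s v)"
    by (rule bounded_linear_intro[where K = "norm v"]) (simp_all add: vector_sadd_rdistrib vec_eq_iff norm_scale_vec)
  have dl: "(l has_derivative (\<lambda>e. e *s v)) (at \<zeta>)" for \<zeta>
    unfolding l_def by (auto intro!: derivative_eq_intros bounded_linear_imp_has_derivative[OF lin])
  have contl: "continuous_on UNIV l"
    using dl by (meson continuous_at_imp_continuous_on has_derivative_continuous)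
  have opW: "open W" unfolding W_def
    using open_vimage[OF open_ball contl] by (simp add: vimage_def)
  have "convex W"
  proof (rule convexI)
    fix a b :: complex and u w :: real
    assume ab: "a \<in> W" "b \<in> W" "0 \<le> u" "0 \<le> w" "u + w = 1"
    have "l (u *\<^sub>R a + w *\<^sub>R b) = (of_real (u + w)) *s p + (of_real u * a + of_real w * b) *s v"
      by (simp add: l_def ab(5) scaleR_conv_of_real[where 'a = complex])
    also have "\<dots> = u *\<^sub>R l a + w *\<^sub>R l b"
      by (simp add: l_def vec_eq_iff scaleR_conv_of_real[where 'a = complex] algebra_simps)
    finally show "u *\<^sub>R a + w *\<^sub>R b \<in> W"
      using convexD[OF convex_ball, of "l a" c r "l b" u w] ab unfolding W_def by simp
  qed
  then have cW: "connected W" by (rule convex_connected)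
  have hol: "(h \<circ> l) holomorphic_on W"
    unfolding holomorphic_on_def
  proof
    fix \<zeta> assume "\<zeta> \<in> W"
    then obtain a where a: "(h has_derivative (\<lambda>h. \<Sum>i\<in>UNIV. a $ i * h $ i)) (at (l \<zeta>))"
      using h unfolding W_def has_cgrad_def by blast
    have "((\<lambda>\<zeta>. h (l \<zeta>)) has_derivative (\<lambda>e. \<Sum>i\<in>UNIV. a $ i * (e *s v) $ i)) (at \<zeta>)"
      by (rule has_derivative_compose[OF dl a])
    moreover have "(\<lambda>e. \<Sum>i\<in>UNIV. a $ i * (e *s v) $ i) = (*) (\<Sum>i\<in>UNIV. a $ i * v $ i)"
      by (rule ext) (simp add: sum_distrib_left sum_distrib_right mult_ac)
    ultimately have "((\<lambda>\<zeta>. h (l \<zeta>)) has_field_derivative (\<Sum>i\<in>UNIV. a $ i * v $ i)) (at \<zeta>)"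
      by (simp add: has_field_derivative_def)
    then show "(h \<circ> l) field_differentiable at \<zeta> within W"
      unfolding field_differentiable_def o_def by (blast intro: has_field_derivative_at_within)
  qed
  have "isCont l 0" using dl has_derivative_continuous by blast
  then have "eventually (\<lambda>\<zeta>. dist (l \<zeta>) (l 0) < \<delta>) (nhds 0)"
    using p(2) unfolding isCont_def by (intro tendstoD) (simp_all add: tendsto_nhds_iff)
  then obtain d where d: "d > 0" "\<forall>\<zeta>. dist \<zeta> 0 < d \<longrightarrow> dist (l \<zeta>) (l 0) < \<delta>"
    unfolding eventually_nhds_metric by blast
  have l0: "l 0 = p" "l 1 = y" by (simp_all add: l_def v_def)
  define U where "U = ball 0 d \<inter> W"
  have W0: "0 \<in> W" "1 \<in> W" using p y l0 by (simp_all add: W_def)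
  have lim: "0 islimpt U" unfolding U_def
    by (rule interior_limit_point) (use opW W0 d in \<open>simp add: interior_open open_Int\<close>)
  have "(h \<circ> l) \<zeta> = 0" if "\<zeta> \<in> U" for \<zeta>
    using that d(2) zero[of "l \<zeta>"] l0 unfolding U_def W_def by (simp add: dist_commute)
  then have "(h \<circ> l) 1 = 0"
    by (intro analytic_continuation[OF hol opW cW _ W0(1) lim _ W0(2)]) (auto simp: U_def)
  then show ?thesis using l0 by simp
qed

text \<open>The ball is shrunk once for each function; by the identity theorem a function that is
  nonzero somewhere cannot vanish on the whole smaller ball.\<close>

lemma has_cgrad_common_nonzero:
  fixes h :: "'i \<Rightarrow> complex ^ 'm \<Rightarrow> complex"
  assumes "finite I" "r > 0" "\<And>i b. i \<in> I \<Longrightarrow> b \<in> ball c r \<Longrightarrow> has_cgrad (h i) b"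
    and "\<And>i. i \<in> I \<Longrightarrow> \<exists>b\<in>ball c r. h i b \<noteq> 0"
  shows "\<exists>b\<in>ball c r. \<forall>i\<in>I. h i b \<noteq> 0"
proof -
  have "\<exists>p \<delta>. \<delta> > 0 \<and> ball p \<delta> \<subseteq> ball c r \<and> (\<forall>i\<in>I. \<forall>b\<in>ball p \<delta>. h i b \<noteq> 0)"
    using assms(1,3,4)
  proof (induction I rule: finite_induct)
    case empty
    then show ?case using assms(2) by (intro exI[of _ c] exI[of _ r]) simp
  next
    case (insert i I)
    then obtain p \<delta> where p: "\<delta> > 0" "ball p \<delta> \<subseteq> ball c r" "\<forall>j\<in>I. \<forall>b\<in>ball p \<delta>. h j b \<noteq> 0" by auto
    have pc: "p \<in> ball c r" using p centre_in_ball by blast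
    have hi: "has_cgrad (h i) b" if "b \<in> ball c r" for b using insert.prems(1) that by blast
    obtain y where y: "y \<in> ball c r" "h i y \<noteq> 0" using insert.prems(2)[of i] by blast
    have "\<exists>q\<in>ball p \<delta>. h i q \<noteq> 0"
    proof (rule ccontr)
      assume n: "\<not> ?thesis"
      have "h i y = 0" by (rule has_cgrad_identity[OF hi pc p(1) _ y(1)]) (use n in auto)
      then show False using y by simp
    qed
    then obtain q where q: "q \<in> ball p \<delta>" "h i q \<noteq> 0" by blast
    have "isCont (h i) q" using hi p(2) q(1) by (intro has_cgrad_isCont) blast
    then have "eventually (\<lambda>b. h i b \<noteq> 0) (nhds q)"
      using q(2) by (simp add: isCont_def tendsto_nhds_iff tendsto_imp_eventually_ne)
    moreover have "eventually (\<lambda>b. b \<in> ball p \<delta>) (nhds q)" using q(1) by (intro eventually_nhds_in_open) auto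
    ultimately have "eventually (\<lambda>b. h i b \<noteq> 0 \<and> b \<in> ball p \<delta>) (nhds q)" by (rule eventually_conj)
    then obtain d where d: "d > 0" "\<forall>b. dist b q < d \<longrightarrow> h i b \<noteq> 0 \<and> b \<in> ball p \<delta>"
      unfolding eventually_nhds_metric by blast
    then have "b \<in> ball p \<delta> \<and> h i b \<noteq> 0" if "b \<in> ball q d" for b using that by (simp add: dist_commute)
    then have "ball q d \<subseteq> ball c r" "\<forall>j\<in>insert i I. \<forall>b\<in>ball q d. h j b \<noteq> 0" using p by blast+
    then show ?case using d(1) by blast
  qed
  then obtain p \<delta> where p: "\<delta> > 0" "ball p \<delta> \<subseteq> ball c r" "\<forall>i\<in>I. \<forall>b\<in>ball p \<delta>. h i b \<noteq> 0" by blast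
  then show ?thesis using centre_in_ball by blast
qed

section \<open>Generic fibres\<close>

text \<open>Projection to the coordinates in \<open>J\<close>, kept inside the same space so that
  the base of a graph has the same type as the graph.\<close>

definition mask :: "'m set \<Rightarrow> complex ^ 'm \<Rightarrow> complex ^ 'm" where
  "mask J x = (\<chi> i. if i \<in> J then x $ i else 0)"

lemma mask_nth [simp]: "mask J x $ i = (if i \<in> J then x $ i else 0)"
  by (simp add: mask_def)

lemma mask_mask [simp]: "mask J (mask J x) = mask J x"
  by (simp add: vec_eq_iff)

lemma norm_mask_le: "norm (mask J x) \<le> norm x"
  by (rule norm_le_componentwise_cart) simp

lemma mask_diff: "mask J (x - y) = mask J x - mask J y"
  by (simp add: vec_eq_iff)

lemma dist_mask_le: "dist (mask J x) (mask J y) \<le> dist x y"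
  unfolding dist_norm mask_diff[symmetric] by (rule norm_mask_le)

lemma bounded_linear_mask: "bounded_linear (mask J)"
proof (rule bounded_linear_intro[where K = 1])
  show "norm (mask J x) \<le> norm x * 1" for x :: "complex ^ 'a" using norm_mask_le[of J x] by simp
qed (simp_all add: vec_eq_iff)

lemma has_cgrad_mask:
  fixes \<phi> :: "complex ^ 'm \<Rightarrow> complex"
  assumes "has_cgrad \<phi> (mask J x)" shows "has_cgrad (\<lambda>x. \<phi> (mask J x)) x"
proof -
  obtain a :: "complex ^ 'm" where a: "(\<phi> has_derivative (\<lambda>h. \<Sum>i\<in>UNIV. a $ i * h $ i)) (at (mask J x))"
    using assms unfolding has_cgrad_def by blast
  have "((\<lambda>x. \<phi> (mask J x)) has_derivative (\<lambda>h. \<Sum>i\<in>UNIV. a $ i * mask J h $ i)) (at x)"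
    by (rule has_derivative_compose[OF bounded_linear_imp_has_derivative[OF bounded_linear_mask] a])
  then show ?thesis
    by (rule has_cgradI[where a = "mask J a"]) (intro sum.cong refl, simp)
qed

text \<open>Coordinates outside \<open>J\<close> are confined to a polydisc around \<open>s\<close>,
  so that other sheets over the same base do not interfere.\<close>

definition local_graph :: "'m set \<Rightarrow> (complex ^ 'm) set \<Rightarrow> complex ^ 'm \<Rightarrow> bool" where
  "local_graph J Y x \<longleftrightarrow> (\<exists>(c :: complex ^ 'm) r (s :: complex ^ 'm) \<epsilon> (G :: complex ^ 'm \<Rightarrow> complex ^ 'm).
     mask J x \<in> ball c r \<and> (\<forall>i. i \<notin> J \<longrightarrow> dist (x $ i) (s $ i) < \<epsilon>) \<and>
     (\<forall>b\<in>ball c r. G b \<in> Y \<and> mask J (G b) = mask J b \<and> (\<forall>i. has_cgrad (\<lambda>b. (G b :: complex ^ 'm) $ i) b)) \<and>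
     (\<forall>y\<in>Y. mask J y \<in> ball c r \<longrightarrow> (\<forall>i. i \<notin> J \<longrightarrow> dist (y $ i) (s $ i) < \<epsilon>) \<longrightarrow> y = G (mask J y)))"

text \<open>The shear that subtracts the graph from the coordinates outside \<open>J\<close>
  straightens \<open>Y\<close>. The opposite shear inverts it, because neither alters the
  coordinates in \<open>J\<close>.\<close>

lemma local_graph_submanifold:
  fixes Y :: "(complex ^ 'm) set"
  assumes "local_graph J Y x" and xY: "x \<in> Y"
  shows "submanifold_at (card J) Y x"
proof -
  obtain c s :: "complex ^ 'm" and r \<epsilon> and G :: "complex ^ 'm \<Rightarrow> complex ^ 'm" where
    x: "mask J x \<in> ball c r" "\<forall>i. i \<notin> J \<longrightarrow> dist (x $ i) (s $ i) < \<epsilon>" and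
    G: "\<forall>b\<in>ball c r. G b \<in> Y \<and> mask J (G b) = mask J b \<and> (\<forall>i. has_cgrad (\<lambda>b. (G b :: complex ^ 'm) $ i) b)" and
    un: "\<forall>y\<in>Y. mask J y \<in> ball c r \<longrightarrow> (\<forall>i. i \<notin> J \<longrightarrow> dist (y $ i) (s $ i) < \<epsilon>) \<longrightarrow> y = G (mask J y)"
    using assms(1) unfolding local_graph_def by (elim exE conjE)
  define W where "W = {y. mask J y \<in> ball c r}"
  define U where "U = W \<inter> (\<Inter>i\<in>-J. {y. dist (y $ i) (s $ i) < \<epsilon>})"
  define f where "f y = (\<chi> i. y $ i + (- 1) * (if i \<in> J then 0 else G (mask J y) $ i))" for y :: "complex ^ 'm"
  define g where "g y = (\<chi> i. y $ i + (if i \<in> J then 0 else G (mask J y) $ i))" for y :: "complex ^ 'm"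
  \<comment> \<open>Pulled back along \<open>g\<close>, so that openness of \<open>V\<close> follows
    from continuity of \<open>g\<close> alone.\<close>
  define V where "V = W \<inter> g -` U"
  define E where "E = {w :: complex ^ 'm. \<forall>i. i \<notin> J \<longrightarrow> w $ i = 0}"
  have mf: "mask J (f y) = mask J y" "mask J (g y) = mask J y" for y
    by (simp_all add: vec_eq_iff f_def g_def)
  have fg: "f (g y) = y" "g (f y) = y" for y
    by (subst f_def, subst mf, simp add: vec_eq_iff g_def) (subst g_def, subst mf, simp add: vec_eq_iff f_def)
  have opW: "open W"
    using open_vimage[OF open_ball, of "mask J" c r] linear_continuous_on[OF bounded_linear_mask, of UNIV J]
    by (simp add: W_def vimage_def)
  have opU: "open U" unfolding U_def
    by (intro open_Int opW open_INT ballI) (auto intro!: open_Collect_less continuous_intros)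
  have cg: "has_cgrad (\<lambda>y. (if i \<in> J then 0 else G (mask J y) $ i)) y" if "y \<in> W" for y i
  proof (cases "i \<in> J")
    case False
    have "has_cgrad (\<lambda>b. (G b :: complex ^ 'm) $ i) (mask J y)" using G that unfolding W_def by blast
    from has_cgrad_mask[OF this] False show ?thesis by simp
  qed (simp add: has_cgrad_const)
  have hf: "holomorphic_map f W"
    by (rule holomorphic_map_of_has_cgrad) (simp only: f_def vec_lambda_beta, intro has_cgrad_add has_cgrad_mult has_cgrad_const has_cgrad_coord cg)
  have hg: "holomorphic_map g W"
    by (rule holomorphic_map_of_has_cgrad) (simp only: g_def vec_lambda_beta, intro has_cgrad_add has_cgrad_coord cg)
  have opV: "open V" unfolding V_def
    by (rule continuous_open_preimage[OF holomorphic_map_continuous[OF hg] opW opU])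
  have sub: "U \<subseteq> W" "V \<subseteq> W" by (auto simp: U_def V_def)
  have fU: "f y \<in> V" if "y \<in> U" for y
    using that sub(1) by (auto simp: V_def W_def mf fg)
  have gV: "g w \<in> U" if "w \<in> V" for w using that by (simp add: V_def)
  have hom: "homeomorphism U V f g"
    unfolding homeomorphism_def
  proof (intro conjI ballI)
    show "f ` U = V"
    proof (intro equalityI subsetI image_eqI[where f = f])
      fix w assume "w \<in> V"
      then show "w = f (g w)" "g w \<in> U" by (simp_all only: fg gV)
    qed (use fU in blast)
    show "g ` V = U"
    proof (intro equalityI subsetI image_eqI[where f = g])
      fix y assume "y \<in> U"
      then show "y = g (f y)" "f y \<in> V" by (simp_all only: fg fU)
    qed (use gV in blast)
    show "continuous_on U f" "continuous_on V g"
      using holomorphic_map_continuous[OF hf] holomorphic_map_continuous[OF hg] sub continuous_on_subset by blast+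
  qed (simp_all add: fg)
  have img: "f ` (Y \<inter> U) = V \<inter> E"
  proof (intro equalityI subsetI)
    fix w assume "w \<in> f ` (Y \<inter> U)"
    then obtain y where y: "y \<in> Y" "y \<in> U" "w = f y" by blast
    then have eq: "y = G (mask J y)" using un by (auto simp: U_def W_def)
    have "f y $ i = 0" if "i \<notin> J" for i
      using that arg_cong[OF eq, of "\<lambda>v. v $ i"] by (simp add: f_def)
    then show "w \<in> V \<inter> E" using fU y by (simp add: E_def)
  next
    fix w assume w: "w \<in> V \<inter> E"
    then have b: "mask J w \<in> ball c r" using sub by (auto simp: W_def)
    then have mG: "mask J (G (mask J w)) = mask J w" using G by simp
    have "g w $ i = G (mask J w) $ i" for i
      using w arg_cong[OF mG, of "\<lambda>v. v $ i"] by (simp add: g_def E_def split: if_splits)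
    then have "g w = G (mask J w)" by (simp add: vec_eq_iff)
    then have "g w \<in> Y" using G b by simp
    moreover have "g w \<in> U" using w gV by blast
    ultimately have "g w \<in> Y \<inter> U" ..
    then show "w \<in> f ` (Y \<inter> U)" by (intro image_eqI[of _ _ "g w"]) (simp_all only: fg)
  qed
  have xU: "x \<in> U" using x by (simp add: U_def W_def)
  have E: "vec.subspace E" "vec.dim E = card J"
    unfolding E_def by (simp add: vec.subspace_def) (rule dim_substandard_cart)
  have hUV: "holomorphic_map f U" "holomorphic_map g V"
    using hf hg sub unfolding holomorphic_map_def by blast+
  show ?thesis unfolding submanifold_at_def
    by (intro exI[of _ U] exI[of _ V] exI[of _ f] exI[of _ g] exI[of _ E] conjI opU opV IntI xY xU hom hUV E img)
qed

text \<open>A tangent vector is the velocity of a curve defined on the whole line, whence the sine.\<close>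

lemma local_graph_tangent:
  fixes Y :: "(complex ^ 'm) set"
  assumes "local_graph J Y x" and xY: "x \<in> Y" and j: "j \<in> J"
  shows "\<exists>w\<in>tangent_vectors Y x. w $ j = a"
proof -
  obtain c s :: "complex ^ 'm" and r \<epsilon> and G :: "complex ^ 'm \<Rightarrow> complex ^ 'm" where
    x: "mask J x \<in> ball c r" "\<forall>i. i \<notin> J \<longrightarrow> dist (x $ i) (s $ i) < \<epsilon>" and
    G: "\<forall>b\<in>ball c r. G b \<in> Y \<and> mask J (G b) = mask J b \<and> (\<forall>i. has_cgrad (\<lambda>b. (G b :: complex ^ 'm) $ i) b)" and
    un: "\<forall>y\<in>Y. mask J y \<in> ball c r \<longrightarrow> (\<forall>i. i \<notin> J \<longrightarrow> dist (y $ i) (s $ i) < \<epsilon>) \<longrightarrow> y = G (mask J y)"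
    using assms(1) unfolding local_graph_def by (elim exE conjE)
  define m where "m = mask J x"
  have Gm: "G m = x" using un xY x by (simp add: m_def)
  obtain \<rho> where \<rho>: "\<rho> > 0" "ball m \<rho> \<subseteq> ball c r"
    using x(1) open_contains_ball_eq[OF open_ball] unfolding m_def by blast
  \<comment> \<open>Keeps the sine curve, of amplitude \<open>cmod a * \<delta>\<close>, inside the
    ball, while \<open>\<delta> * sin (t / \<delta>)\<close> still has derivative 1 at 0.\<close>
  define \<delta> where "\<delta> = \<rho> / (cmod a + 1)"
  have \<delta>: "\<delta> > 0" "cmod a * \<delta> < \<rho>"
    using \<rho>(1) by (simp_all add: \<delta>_def field_simps add_pos_nonneg add_nonneg_pos)
  define e where "e t = a * of_real (\<delta> * sin (t / \<delta>))" for t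
  define \<beta> where "\<beta> t = m + (axis j (e t) :: complex ^ 'm)" for t
  have in_ball: "\<beta> t \<in> ball c r" for t
  proof -
    have "norm (axis j (e t) :: complex ^ 'm) = cmod (e t)" by (simp add: norm_eq_sqrt_inner inner_axis_axis)
    also have "\<dots> = cmod a * \<delta> * \<bar>sin (t / \<delta>)\<bar>" using \<delta>(1) by (simp add: e_def norm_mult abs_mult)
    also have "\<dots> \<le> cmod a * \<delta> * 1" using \<delta>(1) by (intro mult_left_mono) auto
    finally show ?thesis using \<delta>(2) \<rho>(2) by (auto simp: \<beta>_def dist_norm subset_iff)
  qed
  have de: "(e has_vector_derivative a) (at 0)"
  proof -
    have "((\<lambda>t. \<delta> * sin (t / \<delta>)) has_real_derivative 1) (at 0)"
      using \<delta>(1) by (auto intro!: derivative_eq_intros)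
    from has_vector_derivative_mult_right[OF has_vector_derivative_of_real[OF this], of a]
    show ?thesis by (simp add: e_def[abs_def])
  qed
  have d\<beta>: "(\<beta> has_vector_derivative axis j a) (at 0)"
    using has_vector_derivative_add[OF has_vector_derivative_const
        bounded_linear.has_vector_derivative[OF bounded_linear_axis de], of m j]
    by (simp add: \<beta>_def[abs_def])
  have \<beta>0: "\<beta> 0 = m" by (simp add: \<beta>_def e_def vec_eq_iff axis_def)
  have "holomorphic_map G (ball c r)" by (rule holomorphic_map_of_has_cgrad) (use G in blast)
  then obtain D :: "complex ^ 'm ^ 'm" where D: "(G has_derivative (\<lambda>h. D *v h)) (at (\<beta> 0))"
    using in_ball[of 0] unfolding holomorphic_map_def by blast
  define w where "w = D *v axis j a"
  have dG: "((\<lambda>t. G (\<beta> t)) has_vector_derivative w) (at 0)"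
  proof -
    have "D *v (t *\<^sub>R v) = t *\<^sub>R (D *v v)" for t v
      by (simp add: vec_eq_iff matrix_vector_mult_def scaleR_sum_right)
    then show ?thesis
      using has_derivative_compose[OF d\<beta>[unfolded has_vector_derivative_def] D]
      unfolding has_vector_derivative_def w_def by simp
  qed
  have "G (\<beta> t) $ j = m $ j + e t" for t
  proof -
    have "mask J (G (\<beta> t)) = mask J (\<beta> t)" using G in_ball by blast
    from arg_cong[OF this, of "\<lambda>v. v $ j"] show ?thesis using j by (simp add: \<beta>_def axis_def)
  qed
  then have "((\<lambda>t. m $ j + e t) has_vector_derivative w $ j) (at 0)"
    using bounded_linear.has_vector_derivative[OF bounded_linear_vec_nth dG, of j] by simp
  moreover have "((\<lambda>t. m $ j + e t) has_vector_derivative a) (at 0)"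
    using has_vector_derivative_add[OF has_vector_derivative_const de, of "m $ j"] by simp
  ultimately have wj: "w $ j = a" by (rule vector_derivative_unique_at)
  have "w \<in> tangent_vectors Y x"
    unfolding tangent_vectors_def mem_Collect_eq
    using dG G in_ball \<beta>0 Gm by (intro exI[of _ "\<lambda>t. G (\<beta> t)"]) auto
  with wj show ?thesis by blast
qed

text \<open>Near a base point with the maximal number of distinct roots, each point of
  \<open>Y\<close> selects one branch per coordinate. A selection whose graph is not contained in
  \<open>Y\<close> violates an equation, a holomorphic function of the base that is not identically
  zero; the fibre is chosen off the zeros of these finitely many functions.\<close>

lemma generic_fibre_local_graph:
  fixes Y :: "(complex ^ 'm) set" and Q :: "complex ^ 'm \<Rightarrow> complex poly"
  assumes Y: "Y = {x. \<forall>F\<in>\<H>. F x = 0}" and \<H>: "\<forall>F\<in>\<H>. polyfun F"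
    and Q: "monic_family e Q" and Qm: "\<And>b. Q (mask J b) = Q b"
    and root: "\<And>x i. x \<in> Y \<Longrightarrow> poly (Q x) (x $ i) = 0"
  shows "\<exists>b. mask J b = b \<and> (\<forall>x\<in>Y. mask J x = b \<longrightarrow> local_graph J Y x)"
proof -
  have deg: "degree (Q b) = e" "lead_coeff (Q b) = 1" for b using Q unfolding monic_family_def by blast+
  have Q0: "Q b \<noteq> 0" for b using deg(2)[of b] by auto
  have "card {z. poly (Q b) z = 0} < Suc e" for b
    using card_poly_roots_bound[OF Q0[of b]] deg(1)[of b] by simp
  then have "\<exists>b. \<forall>b'. card {z. poly (Q b') z = 0} \<le> card {z. poly (Q b) z = 0}"
    using ex_has_greatest_nat[of "\<lambda>_. True" undefined "\<lambda>b. card {z. poly (Q b) z = 0}" "Suc e"] by blast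
  then obtain b0 where b0: "\<And>b'. card {z. poly (Q b') z = 0} \<le> card {z. poly (Q b0) z = 0}" by blast
  \<comment> \<open>Masking leaves \<open>Q\<close> unchanged, so the count stays maximal, and it
    puts the centre into the base.\<close>
  define c where "c = mask J b0"
  define Z where "Z = {z. poly (Q c) z = 0}"
  have max: "card {z. poly (Q b) z = 0} \<le> card {z. poly (Q c) z = 0}" for b using b0 by (simp add: c_def Qm)
  have finZ: "finite Z" unfolding Z_def by (rule poly_roots_finite[OF Q0])
  from root_branches[OF Q max] obtain r \<epsilon> \<phi> where r: "r > 0" "\<epsilon> > 0" and br: "\<forall>b\<in>ball c r.
     (\<forall>s\<in>Z. poly (Q b) (\<phi> s b) = 0 \<and> dist (\<phi> s b) s < \<epsilon> \<and> has_cgrad (\<phi> s) b) \<and>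
     (\<forall>z. poly (Q b) z = 0 \<longrightarrow> (\<exists>s\<in>Z. z = \<phi> s b)) \<and>
     (\<forall>s\<in>Z. \<forall>z. poly (Q b) z = 0 \<longrightarrow> dist z s < \<epsilon> \<longrightarrow> z = \<phi> s b)"
    unfolding Z_def by (elim exE conjE)
  have B1: "poly (Q b) (\<phi> s b) = 0 \<and> dist (\<phi> s b) s < \<epsilon> \<and> has_cgrad (\<phi> s) b" if "b \<in> ball c r" "s \<in> Z" for b s
    using br that by simp
  have B2: "\<exists>s\<in>Z. z = \<phi> s b" if "b \<in> ball c r" "poly (Q b) z = 0" for b z
    using br that by simp
  have B3: "z = \<phi> s b" if "b \<in> ball c r" "s \<in> Z" "poly (Q b) z = 0" "dist z s < \<epsilon>" for b s z
    using br that by simp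
  define G where "G \<sigma> b = (\<chi> i. if i \<in> J then b $ i else \<phi> (\<sigma> i) b)" for \<sigma> :: "'m \<Rightarrow> complex" and b :: "complex ^ 'm"
  define \<Sigma> where "\<Sigma> = {\<sigma> :: 'm \<Rightarrow> complex. range \<sigma> \<subseteq> Z}"
  have "finite (UNIV \<rightarrow>\<^sub>E Z :: ('m \<Rightarrow> complex) set)" by (intro finite_PiE finZ) simp
  then have fin\<Sigma>: "finite \<Sigma>" by (rule finite_subset[rotated]) (auto simp: \<Sigma>_def)
  have cG: "has_cgrad (\<lambda>b. G \<sigma> b $ i) b" if "b \<in> ball c r" "\<sigma> \<in> \<Sigma>" for \<sigma> b i
  proof (cases "i \<in> J")
    case True
    then show ?thesis by (simp add: G_def has_cgrad_coord)
  next
    case False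
    have "has_cgrad (\<phi> (\<sigma> i)) b" using B1[OF that(1)] that(2) unfolding \<Sigma>_def by blast
    then show ?thesis using False by (simp add: G_def)
  qed
  define I where "I = {\<sigma>\<in>\<Sigma>. \<not> (\<forall>b\<in>ball c r. G \<sigma> b \<in> Y)}"
  have "\<forall>\<sigma>\<in>I. \<exists>F\<in>\<H>. \<exists>b\<in>ball c r. F (G \<sigma> b) \<noteq> 0" by (auto simp: I_def Y)
  then have "\<forall>\<sigma>\<in>I. \<exists>F. F \<in> \<H> \<and> (\<exists>b\<in>ball c r. F (G \<sigma> b) \<noteq> 0)" by blast
  from bchoice[OF this] obtain F where F: "\<forall>\<sigma>\<in>I. F \<sigma> \<in> \<H> \<and> (\<exists>b\<in>ball c r. F \<sigma> (G \<sigma> b) \<noteq> 0)" ..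
  have "\<exists>b\<in>ball c r. \<forall>\<sigma>\<in>I. F \<sigma> (G \<sigma> b) \<noteq> 0"
  proof (rule has_cgrad_common_nonzero)
    show "finite I" using fin\<Sigma> by (simp add: I_def)
    show "has_cgrad (\<lambda>b. F \<sigma> (G \<sigma> b)) b" if "\<sigma> \<in> I" "b \<in> ball c r" for \<sigma> b
    proof (rule has_cgrad_polyfun_comp)
      show "polyfun (F \<sigma>)" using F \<H> that(1) by blast
      show "has_cgrad (\<lambda>b. G \<sigma> b $ i) b" for i using cG that by (simp add: I_def)
    qed
    show "\<exists>b\<in>ball c r. F \<sigma> (G \<sigma> b) \<noteq> 0" if "\<sigma> \<in> I" for \<sigma> using F that by blast
  qed (rule r(1))
  then obtain b' where b': "b' \<in> ball c r" "\<forall>\<sigma>\<in>I. F \<sigma> (G \<sigma> b') \<noteq> 0" by blast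
  \<comment> \<open>The point is moved into the base. The branches depend on the
    \<open>J\<close>-coordinates only, so no inequality is lost.\<close>
  define b where "b = mask J b'"
  have b: "b \<in> ball c r"
  proof -
    have "dist c b = dist (mask J c) (mask J b')" by (simp add: b_def c_def)
    also have "\<dots> \<le> dist c b'" by (rule dist_mask_le)
    finally show ?thesis using b'(1) by simp
  qed
  have Gb: "G \<sigma> b = G \<sigma> b'" if "\<sigma> \<in> \<Sigma>" for \<sigma>
  proof -
    have "\<phi> (\<sigma> i) b = \<phi> (\<sigma> i) b'" for i
    proof -
      have s: "\<sigma> i \<in> Z" using that by (auto simp: \<Sigma>_def)
      show ?thesis by (rule B3[OF b'(1) s]) (use B1[OF b s] in \<open>simp_all add: b_def Qm\<close>)
    qed
    then show ?thesis by (simp add: G_def vec_eq_iff b_def)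
  qed
  have "local_graph J Y x" if x: "x \<in> Y" "mask J x = b" for x
  proof -
    have "Q x = Q b" using Qm[of x] x(2) by simp
    then have "\<forall>i. \<exists>s. s \<in> Z \<and> x $ i = \<phi> s b" using B2[OF b] root[OF x(1)] by metis
    from choice[OF this] obtain \<sigma> where \<sigma>: "\<And>i. \<sigma> i \<in> Z" "\<And>i. x $ i = \<phi> (\<sigma> i) b" by blast
    have S: "\<sigma> \<in> \<Sigma>" using \<sigma>(1) by (auto simp: \<Sigma>_def)
    have xb: "x $ i = b $ i" if "i \<in> J" for i
      using that arg_cong[OF x(2), of "\<lambda>v. v $ i"] by simp
    have xG: "x = G \<sigma> b" using \<sigma>(2) xb by (simp add: G_def vec_eq_iff)
    \<comment> \<open>For a selection in \<open>I\<close> the chosen equation would be nonzero at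
      \<open>x\<close>, a point of \<open>Y\<close>.\<close>
    have "\<sigma> \<notin> I"
    proof
      assume "\<sigma> \<in> I"
      then have "F \<sigma> (G \<sigma> b') \<noteq> 0" "F \<sigma> \<in> \<H>" using b'(2) F by auto
      moreover have "G \<sigma> b' \<in> Y" using x(1) xG Gb[OF S] by simp
      ultimately show False by (simp add: Y)
    qed
    then have good: "\<forall>b\<in>ball c r. G \<sigma> b \<in> Y" using S by (simp add: I_def)
    have "y = G \<sigma> (mask J y)" if y: "y \<in> Y" "mask J y \<in> ball c r" "\<forall>i. i \<notin> J \<longrightarrow> dist (y $ i) (\<sigma> i) < \<epsilon>" for y
    proof -
      have "y $ i = \<phi> (\<sigma> i) (mask J y)" if "i \<notin> J" for i
        by (rule B3[OF y(2) \<sigma>(1)]) (use y root that in \<open>simp_all add: Qm\<close>)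
      then show ?thesis by (simp add: G_def vec_eq_iff)
    qed
    then have un: "\<forall>y\<in>Y. mask J y \<in> ball c r \<longrightarrow>
        (\<forall>i. i \<notin> J \<longrightarrow> dist (y $ i) ((\<chi> i. \<sigma> i) $ i) < \<epsilon>) \<longrightarrow> y = G \<sigma> (mask J y)"
      unfolding vec_lambda_beta by blast
    have nr: "\<forall>i. i \<notin> J \<longrightarrow> dist (x $ i) ((\<chi> i. \<sigma> i) $ i) < \<epsilon>"
      unfolding vec_lambda_beta \<sigma>(2) using B1[OF b \<sigma>(1)] by blast
    have "mask J (G \<sigma> b) = mask J b" for b by (simp add: vec_eq_iff G_def)
    then have gr: "\<forall>b\<in>ball c r. G \<sigma> b \<in> Y \<and> mask J (G \<sigma> b) = mask J b \<and> (\<forall>i. has_cgrad (\<lambda>b. (G \<sigma> b :: complex ^ 'm) $ i) b)"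
      using good cG[OF _ S] by blast
    have xb': "mask J x \<in> ball c r" using b x(2) by simp
    show ?thesis unfolding local_graph_def
      by (rule exI[of _ c], rule exI[of _ r], rule exI[of _ "\<chi> i. \<sigma> i"], rule exI[of _ \<epsilon>], rule exI[of _ "G \<sigma>"])
        (intro conjI xb' nr gr un)
  qed
  then show ?thesis by (intro exI[of _ b]) (simp add: b_def)
qed

section \<open>Existence of a transverse hyperplane\<close>

lemma unitary_mat_1: "unitary (mat 1)"
proof -
  have "(\<chi> i j. cnj ((mat 1 :: complex ^ 'm ^ 'm) $ j $ i)) = mat 1"
    by (simp add: vec_eq_iff mat_def)
  then show ?thesis by (simp add: unitary_def)
qed

lemma unitary_mult: assumes "unitary A" "unitary B" shows "unitary (A ** B)"
proof -
  have "(\<chi> i j. cnj ((A ** B) $ j $ i)) = (\<chi> i j. cnj (B $ j $ i)) ** (\<chi> i j. cnj (A $ j $ i))"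
    by (simp add: vec_eq_iff matrix_matrix_mult_def mult.commute)
  then have "(A ** B) ** (\<chi> i j. cnj ((A ** B) $ j $ i)) = A ** (B ** (\<chi> i j. cnj (B $ j $ i))) ** (\<chi> i j. cnj (A $ j $ i))"
    by (simp add: matrix_mul_assoc)
  then show ?thesis using assms by (simp add: unitary_def)
qed

text \<open>No point of \<open>X\<close> lies in the linear centre \<open>{(A *v z) $ i = 0, i \<in> K}\<close>, so the coordinates in
  \<open>K\<close> define a finite projection of \<open>X\<close>.\<close>

definition projecting ::
    "'n::finite cproj set \<Rightarrow> complex ^ ('n option) ^ ('n option) \<Rightarrow> 'n option set \<Rightarrow> bool" where
  "projecting X A K \<longleftrightarrow> unitary A \<and> None \<in> K \<and>
     (\<forall>p\<in>X. \<forall>z\<in>Rep_cproj p. (\<forall>i\<in>K. (A *v z) $ i = 0) \<longrightarrow> z = 0)"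

text \<open>A reflection carries the vector of prescribed coordinates to the axis
  \<open>Some j\<close>. By minimality this coordinate cannot be dropped from the reflected system,
  so some point of \<open>X\<close> has all other reflected \<open>K\<close>-coordinates zero;
  reflected back, its \<open>K\<close>-coordinates are proportional to the prescribed ones.\<close>

lemma minimal_projection_surj:
  fixes X :: "'n::finite cproj set" and b :: "complex ^ 'n"
  assumes K: "projecting X A K" and min: "\<forall>A' K'. projecting X A' K' \<longrightarrow> card K \<le> card K'"
    and j: "Some j \<in> K"
  shows "\<exists>x\<in>in_chart A X. \<forall>i. Some i \<in> K \<longrightarrow> x $ i = b $ i"
proof -
  have A: "unitary A" and N: "None \<in> K" using K unfolding projecting_def by blast+
  define u where "u = affine_vec (mask {i. Some i \<in> K} b)"
  have "u $ i = 0" if "i \<notin> K" for i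
    using that N by (cases i) (auto simp: u_def affine_vec_Some)
  then have "\<exists>U c. unitary U \<and> c \<noteq> 0 \<and> U *v u = c *s axis (Some j) 1 \<and>
     (\<forall>w i. i \<notin> K \<longrightarrow> (U *v w) $ i = w $ i) \<and> (\<forall>w. (\<forall>i\<in>K. w $ i = 0) \<longrightarrow> U *v w = w)"
    using affine_vec_nonzero j unfolding u_def by (intro householder) auto
  then obtain U c where U: "unitary U" "c \<noteq> 0" "U *v u = c *s axis (Some j) 1"
    "\<And>w i. i \<notin> K \<Longrightarrow> (U *v w) $ i = w $ i" "\<And>w. \<forall>i\<in>K. w $ i = 0 \<Longrightarrow> U *v w = w"
    by (elim exE conjE) (rule_tac that, blast+)
  have "card (K - {Some j}) < card K" using j by (intro psubset_card_mono) auto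
  then have "\<not> projecting X (U ** A) (K - {Some j})" using min leD by blast
  moreover have "unitary (U ** A)" by (rule unitary_mult[OF U(1) A])
  ultimately obtain p z where p: "p \<in> X" "z \<in> Rep_cproj p" "z \<noteq> 0"
    and z: "\<forall>i\<in>K - {Some j}. ((U ** A) *v z) $ i = 0"
    using N unfolding projecting_def by blast
  define y where "y = A *v z"
  \<comment> \<open>The part of \<open>y\<close> supported in \<open>K\<close>; the reflection fixes
    \<open>y - w\<close>.\<close>
  define w where "w = (\<chi> i. if i \<in> K then y $ i else 0)"
  have "\<forall>i\<in>K. (y - w) $ i = 0" by (simp add: w_def)
  then have "U *v (y - w) = y - w" by (rule U(5))
  then have Uw: "U *v w = U *v y - (y - w)" by (simp add: matrix_vector_mult_diff_distrib algebra_simps)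
  have "(U *v w) $ i = 0" if "i \<noteq> Some j" for i
  proof (cases "i \<in> K")
    case True
    then have "(U *v y) $ i = 0" using z that by (simp add: y_def matrix_vector_mul_assoc)
    then show ?thesis using True Uw by (simp add: w_def)
  next
    case False
    then show ?thesis using U(4)[OF False, of w] by (simp add: w_def)
  qed
  then have "U *v w = ((U *v w) $ Some j / c) *s (U *v u)"
    unfolding U(3) using U(2) by (simp add: vec_eq_iff axis_def)
  then have "U *v w = U *v (((U *v w) $ Some j / c) *s u)" by (simp only: matrix_smult)
  then have "adj U *v (U *v w) = adj U *v (U *v (((U *v w) $ Some j / c) *s u))" by (rule arg_cong)
  then have wu: "w = ((U *v w) $ Some j / c) *s u" by (simp only: adj_inverse(1)[OF U(1)])
  define t where "t = (U *v w) $ Some j / c"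
  have wt: "w = t *s u" using wu unfolding t_def .
  \<comment> \<open>A point with \<open>t = 0\<close> would lie in the centre of the
    projection.\<close>
  have "t \<noteq> 0"
  proof
    assume "t = 0"
    then have "w = 0" using wt by simp
    then have "\<forall>i\<in>K. y $ i = 0" by (simp add: w_def vec_eq_iff) metis
    then show False using K p unfolding projecting_def y_def by blast
  qed
  have yt: "y $ i = t * u $ i" if "i \<in> K" for i
    using that arg_cong[OF wt, of "\<lambda>v. v $ i"] by (simp add: w_def)
  have yN: "y $ None = t" using yt[OF N] by (simp add: u_def affine_vec_None)
  then have nh: "p \<notin> hyperplane_at_inf A" "affine_chart A p = (\<chi> i. y $ Some i / y $ None)"
    using hyperplane_at_inf_iff[OF p(2,3)] chart_eq[OF A p(2)] \<open>t \<noteq> 0\<close> by (simp_all add: y_def)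
  have "affine_chart A p \<in> in_chart A X" using nh(1) p(1) by (simp add: in_chart_def)
  moreover have "affine_chart A p $ i = b $ i" if "Some i \<in> K" for i
    using yt[OF that] yN \<open>t \<noteq> 0\<close> that by (simp add: nh(2) u_def affine_vec_Some)
  ultimately show ?thesis by blast
qed

lemma polyfun_linear: "polyfun (\<lambda>u. (M *v u) $ i)"
  by (simp add: matrix_vector_mult_def) (intro polyfun_sum polyfun.intros)

lemma polyfun_affine_vec: "polyfun (\<lambda>x. affine_vec x $ i)"
  by (cases i) (simp_all add: affine_vec_None affine_vec_Some polyfun.intros)

lemma polyfun_affine_mask: "polyfun (\<lambda>x. affine_vec (mask J x) $ i)"
proof (cases i)
  case (Some k)
  then show ?thesis by (cases "k \<in> J") (simp_all add: affine_vec_Some polyfun.intros)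
qed (simp add: affine_vec_None polyfun.intros)

text \<open>The equations of \<open>X\<close> are carried to the coordinates \<open>A\<close>, on
  the cone for \<open>cone_integral\<close> and with last coordinate 1 for the affine trace.\<close>

lemma projecting_generic_fibre:
  fixes X :: "'n::finite cproj set"
  assumes X: "algebraic_subset X" and K: "projecting X A K"
  defines "J \<equiv> {i. Some i \<in> K}"
  shows "\<exists>b. mask J b = b \<and> (\<forall>x\<in>in_chart A X. mask J x = b \<longrightarrow> local_graph J (in_chart A X) x)"
proof -
  have A: "unitary A"
    and cent: "\<And>p z. p \<in> X \<Longrightarrow> z \<in> Rep_cproj p \<Longrightarrow> \<forall>i\<in>K. (A *v z) $ i = 0 \<Longrightarrow> z = 0"
    using K unfolding projecting_def by blast+
  obtain \<F> where hom: "\<And>F. F \<in> \<F> \<Longrightarrow> \<exists>d. homogeneous_poly d F" and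
    XF: "\<And>p z. z \<in> Rep_cproj p \<Longrightarrow> z \<noteq> 0 \<Longrightarrow> p \<in> X \<longleftrightarrow> (\<forall>F\<in>\<F>. F z = 0)"
    using algebraic_subset_cone[OF X] by metis
  have pF: "polyfun F" if "F \<in> \<F>" for F using hom[OF that] polyfun_homogeneous by blast
  define \<G> where "\<G> = (\<lambda>F u. F (adj A *v u)) ` \<F>"
  define V where "V = {u. \<forall>G\<in>\<G>. G u = 0}"
  define \<H> where "\<H> = (\<lambda>G (x :: complex ^ 'n). G (affine_vec x)) ` \<G>"
  have pG: "polyfun G" if "G \<in> \<G>" for G
    using that pF by (auto simp: \<G>_def intro!: polyfun_subst[OF _ polyfun_linear])
  have pH: "\<forall>F\<in>\<H>. polyfun F"
    using pG by (auto simp: \<H>_def intro!: polyfun_subst[OF _ polyfun_affine_vec])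
  have VX: "u \<in> V \<longleftrightarrow> (\<forall>F\<in>\<F>. F (adj A *v u) = 0)" for u by (auto simp: V_def \<G>_def)
  have pc: "polynomial_cone \<G> V K"
    unfolding polynomial_cone_def
  proof (intro conjI ballI allI impI V_def pG)
    fix u c assume "u \<in> V"
    then show "c *s u \<in> V" unfolding VX matrix_smult using hom homogeneous_poly_scale by (metis mult_zero_right)
  next
    fix u assume u: "u \<in> V" "\<forall>k\<in>K. u $ k = 0"
    show "u = 0"
    proof (rule ccontr)
      assume "u \<noteq> 0"
      define z where "z = adj A *v u"
      have Az: "A *v z = u" by (simp add: z_def adj_inverse[OF A])
      with \<open>u \<noteq> 0\<close> have z0: "z \<noteq> 0" by auto
      have "pt z \<in> X" using XF[OF pt_self[OF z0] z0] u(1) by (simp add: VX z_def)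
      then have "z = 0" by (rule cent[OF _ pt_self[OF z0]]) (use u(2) Az in simp)
      with z0 show False ..
    qed
  qed
  have Y: "in_chart A X = {x. \<forall>F\<in>\<H>. F x = 0}"
  proof (rule set_eqI)
    fix x
    have "x \<in> in_chart A X \<longleftrightarrow> (\<forall>F\<in>\<F>. F (adj A *v affine_vec x) = 0)"
      unfolding in_chart_iff[OF A] by (rule XF[OF unchart(3)[OF A] adj_affine_nonzero[OF A]])
    then show "x \<in> in_chart A X \<longleftrightarrow> x \<in> {x. \<forall>F\<in>\<H>. F x = 0}" by (simp add: \<H>_def \<G>_def)
  qed
  from cone_integral[OF pc] obtain P e where P: "monic_family e P" and
    root: "\<forall>u\<in>V. \<forall>b. u \<noteq> 0 \<longrightarrow> (\<forall>k\<in>K. b $ k = u $ k) \<longrightarrow> (\<forall>i. poly (P b) (u $ i) = 0)" by (elim exE conjE)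
  \<comment> \<open>The coordinate \<open>None\<close> belongs to \<open>K\<close> and has value 1,
    so the parameters left are those in \<open>J\<close>; masking discards the others.\<close>
  define Q where "Q b = P (affine_vec (mask J b))" for b
  show ?thesis
  proof (rule generic_fibre_local_graph[OF Y pH, where Q = Q and e = e])
    show "monic_family e Q"
      using P unfolding monic_family_def poly_family_def Q_def
      by (auto intro!: polyfun_subst[OF _ polyfun_affine_mask])
    show "Q (mask J b) = Q b" for b by (simp add: Q_def)
    show "poly (Q x) (x $ i) = 0" if "x \<in> in_chart A X" for x i
    proof -
      have "affine_vec x \<in> V" using that unfolding Y by (auto simp: \<H>_def V_def)
      moreover have "\<forall>k\<in>K. affine_vec (mask J x) $ k = affine_vec x $ k"
      proof
        fix k assume "k \<in> K"
        then show "affine_vec (mask J x) $ k = affine_vec x $ k"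
          by (cases k) (simp_all add: affine_vec_None affine_vec_Some J_def)
      qed
      ultimately have "\<forall>i. poly (Q x) (affine_vec x $ i) = 0" using root affine_vec_nonzero unfolding Q_def by blast
      then show ?thesis using affine_vec_Some by metis
    qed
  qed
qed

section \<open>Hyperplanes that fix one affine coordinate\<close>

lemma unchart_mem_hyperplane:
  fixes A :: "complex ^ ('n::finite option) ^ ('n option)"
  assumes A: "unitary A"
  shows "unchart A x \<in> {p :: 'n cproj. \<forall>z\<in>Rep_cproj p. (A *v z) $ Some j = b * (A *v z) $ None} \<longleftrightarrow> x $ j = b"
proof
  assume "unchart A x \<in> {p :: 'n cproj. \<forall>z\<in>Rep_cproj p. (A *v z) $ Some j = b * (A *v z) $ None}"
  then have "(A *v (adj A *v affine_vec x)) $ Some j = b * (A *v (adj A *v affine_vec x)) $ None"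
    using unchart(3)[OF A, of x] by blast
  then show "x $ j = b"
    by (simp add: adj_inverse[OF A] affine_vec_None affine_vec_Some)
next
  assume x: "x $ j = b"
  have "(A *v z) $ Some j = b * (A *v z) $ None" if "z \<in> Rep_cproj (unchart A x)" for z
  proof -
    obtain c where "z = c *s (adj A *v affine_vec x)"
      using Rep_scale[OF unchart(3)[OF A] adj_affine_nonzero[OF A] \<open>z \<in> Rep_cproj (unchart A x)\<close>] .
    then show ?thesis by (simp add: matrix_smult adj_inverse[OF A] affine_vec_None affine_vec_Some x)
  qed
  then show "unchart A x \<in> {p :: 'n cproj. \<forall>z\<in>Rep_cproj p. (A *v z) $ Some j = b * (A *v z) $ None}" by blast
qed

lemma hyperplane_of_coordinate:
  fixes A :: "complex ^ ('n::finite option) ^ ('n option)"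
  assumes A: "unitary A"
  shows "hyperplane {p :: 'n cproj. \<forall>z\<in>Rep_cproj p. (A *v z) $ Some j = b * (A *v z) $ None}"
  unfolding hyperplane_def
proof (intro exI conjI)
  define a where "a = (\<chi> i. A $ Some j $ i - b * A $ None $ i)"
  have a: "(\<Sum>i\<in>UNIV. a $ i * z $ i) = (A *v z) $ Some j - b * (A *v z) $ None" for z
    by (simp add: a_def matrix_vector_mult_def left_diff_distrib sum_subtractf sum_distrib_left mult.assoc)
  show "a \<noteq> 0"
  proof
    assume "a = 0"
    then show False using a[of "adj A *v axis (Some j) 1"] by (simp add: adj_inverse[OF A] axis_def)
  qed
  show "{p :: 'n cproj. \<forall>z\<in>Rep_cproj p. (A *v z) $ Some j = b * (A *v z) $ None}
      = {p. \<forall>z\<in>Rep_cproj p. (\<Sum>i\<in>UNIV. a $ i * z $ i) = 0}" by (simp add: a)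
qed

lemma exists_transverse_hyperplane:
  fixes X :: "'n::finite cproj set"
  assumes X: "algebraic_curve X"
  shows "\<exists>H. hyperplane H \<and> (\<forall>p\<in>X \<inter> H. nonsingular_point X p \<and> transverse_at X H p)"
proof -
  have alg: "algebraic_subset X" using X by (simp add: algebraic_curve_def)
  \<comment> \<open>All coordinates together have no common zero, so a set of least size
    exists.\<close>
  have "projecting X (mat 1) UNIV"
    by (simp add: projecting_def unitary_mat_1 vec_eq_iff)
  then have "projecting X (fst (mat 1, UNIV)) (snd (mat 1, UNIV))" by simp
  from ex_has_least_nat[of "\<lambda>AK. projecting X (fst AK) (snd AK)", OF this, of "\<lambda>AK. card (snd AK)"]
  obtain A K where K: "projecting X A K" and min: "\<forall>A' K'. projecting X A' K' \<longrightarrow> card K \<le> card K'"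
    by force
  have A: "unitary A"
    and cent: "\<And>p z. p \<in> X \<Longrightarrow> z \<in> Rep_cproj p \<Longrightarrow> \<forall>i\<in>K. (A *v z) $ i = 0 \<Longrightarrow> z = 0"
    using K unfolding projecting_def by blast+
  define J where "J = {i. Some i \<in> K}"
  show ?thesis
  proof (cases "J = {}")
    \<comment> \<open>Here \<open>K\<close> consists of \<open>None\<close> alone and the centre is
      the hyperplane at infinity itself, which \<open>X\<close> misses.\<close>
    case True
    then have K1: "i = None" if "i \<in> K" for i using that by (cases i) (auto simp: J_def)
    have "p \<notin> hyperplane_at_inf A" if p: "p \<in> X" for p
    proof
      assume "p \<in> hyperplane_at_inf A"
      then have "(A *v rep p) $ None = 0" using hyperplane_at_inf_iff[OF rep] by blast
      then have "rep p = 0" by (intro cent[OF p rep(1)] ballI) (auto dest!: K1)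
      with rep(2)[of p] show False ..
    qed
    then show ?thesis using hyperplane_at_inf_hyperplane[OF A] by blast
  next
    case False
    then obtain j where j: "j \<in> J" by blast
    from projecting_generic_fibre[OF alg K] obtain b where b: "mask J b = b" and
      lg: "\<forall>x\<in>in_chart A X. mask J x = b \<longrightarrow> local_graph J (in_chart A X) x"
      unfolding J_def[symmetric] by (elim exE conjE)
    have reg: "regular_point (card J) X (unchart A x)" if x: "x \<in> in_chart A X" "mask J x = b" for x
    proof -
      have "local_graph J (in_chart A X) x" using lg x by blast
      from local_graph_submanifold[OF this x(1)]
      show ?thesis unfolding regular_point_def
        using x(1) in_chart_iff[OF A, of x X] unchart[OF A, of x] A by auto
    qed
    have "Some j \<in> K" using j by (simp add: J_def)
    \<comment> \<open>The generic fibre is not empty, so it provides a regular point of dimension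
      \<open>card J\<close>; on a curve this leaves a single coordinate.\<close>
    from minimal_projection_surj[where b = b, OF K min this]
    obtain x0 where x0: "x0 \<in> in_chart A X" "\<forall>i. Some i \<in> K \<longrightarrow> x0 $ i = b $ i" by blast
    have "mask J x0 = mask J b" using x0(2) by (simp add: vec_eq_iff J_def)
    then have "regular_point (card J) X (unchart A x0)" using reg[OF x0(1)] b by simp
    then have "card J \<le> 1" by (rule regular_point_dim_le[OF X])
    then have Jj: "J = {j}" using j card_le_Suc0_iff_eq[of J] by auto
    define H where "H = {p :: 'n cproj. \<forall>z\<in>Rep_cproj p. (A *v z) $ Some j = b $ j * (A *v z) $ None}"
    have inH: "x \<in> in_chart A H \<longleftrightarrow> x $ j = b $ j" for x
      unfolding in_chart_iff[OF A] H_def by (rule unchart_mem_hyperplane[OF A])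
    have "nonsingular_point X p \<and> transverse_at X H p" if p: "p \<in> X" "p \<in> H" for p
    proof -
      \<comment> \<open>At a point of \<open>H\<close> at infinity all coordinates in
        \<open>K\<close> vanish, so it cannot lie on \<open>X\<close>.\<close>
      have nh: "p \<notin> hyperplane_at_inf A"
      proof
        assume "p \<in> hyperplane_at_inf A"
        then have z: "(A *v rep p) $ None = 0" using hyperplane_at_inf_iff[OF rep] by blast
        then have z': "(A *v rep p) $ Some j = 0" using p(2) rep(1)[of p] by (auto simp: H_def)
        have "(A *v rep p) $ i = 0" if "i \<in> K" for i
          using that z z' Jj by (cases i) (auto simp: J_def)
        then have "rep p = 0" by (intro cent[OF p(1) rep(1)]) blast
        with rep(2)[of p] show False ..
      qed
      define x where "x = affine_chart A p"
      have up: "unchart A x = p" unfolding x_def by (rule unchart_chart[OF A nh])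
      have xY: "x \<in> in_chart A X" "x \<in> in_chart A H" using p nh by (auto simp: in_chart_def x_def)
      then have xj: "x $ j = b $ j" by (simp add: inH)
      then have "mask J x = mask J b" by (simp add: vec_eq_iff Jj)
      then have mx: "mask J x = b" using b by simp
      have ns: "nonsingular_point X p" unfolding nonsingular_point_def using reg[OF xY(1) mx] up by metis
      have lgx: "local_graph J (in_chart A X) x" using lg xY(1) mx by blast
      \<comment> \<open>The graph provides the \<open>j\<close>-component of \<open>w\<close>, and
        what remains is parallel to \<open>H\<close>.\<close>
      have "\<exists>u v. w = u + v \<and> u \<in> tangent_vectors (in_chart A X) x \<and> v \<in> tangent_vectors (in_chart A H) x" for w
      proof -
        from local_graph_tangent[OF lgx xY(1) j, of "w $ j"]
        obtain u where u: "u \<in> tangent_vectors (in_chart A X) x" "u $ j = w $ j" by blast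
        have d: "((\<lambda>t. x + t *\<^sub>R (w - u)) has_vector_derivative (w - u)) (at 0)"
          by (auto intro!: derivative_eq_intros)
        have "x + t *\<^sub>R (w - u) \<in> in_chart A H" for t by (simp add: inH xj u(2))
        then have "w - u \<in> tangent_vectors (in_chart A H) x"
          unfolding tangent_vectors_def mem_Collect_eq using d
          by (intro exI[of _ "\<lambda>t. x + t *\<^sub>R (w - u)"]) auto
        then show ?thesis using u(1) by (intro exI[of _ u] exI[of _ "w - u"]) simp
      qed
      then have "{u + v | u v. u \<in> tangent_vectors (in_chart A X) x \<and> v \<in> tangent_vectors (in_chart A H) x} = UNIV"
        by blast
      then have "transverse_at X H p" unfolding transverse_at_def x_def using A nh by blast
      with ns show ?thesis ..
    qed
    moreover have "hyperplane H" unfolding H_def by (rule hyperplane_of_coordinate[OF A])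
    ultimately show ?thesis by blast
  qed
qed

theorem theorem9p4:
  fixes X :: "'n::finite cproj set"
  assumes "algebraic_curve X"
  shows "(LNE fs_dist X \<longleftrightarrow>
            (\<exists>H. hyperplane H \<and>
                 (\<forall>p\<in>X \<inter> H. nonsingular_point X p \<and> transverse_at X H p) \<and>
                 affine_LNE H (X - H)))
       \<and> ((\<exists>H. hyperplane H \<and>
                 (\<forall>p\<in>X \<inter> H. nonsingular_point X p \<and> transverse_at X H p) \<and>
                 affine_LNE H (X - H)) \<longleftrightarrow>
            (\<forall>H. hyperplane H \<and>
                 (\<forall>p\<in>X \<inter> H. nonsingular_point X p \<and> transverse_at X H p) \<longrightarrow>
                 affine_LNE H (X - H)))"
proof -
  \<comment> \<open>Affine traces for different hyperplanes are never compared directly; each is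
    tied to the projective property.\<close>
  have eq: "affine_LNE H (X - H) \<longleftrightarrow> LNE fs_dist X"
    if H: "hyperplane H" "\<forall>p\<in>X \<inter> H. nonsingular_point X p \<and> transverse_at X H p" for H
  proof -
    obtain B where B: "unitary B" "hyperplane_at_inf B = H" using unitary_of_hyperplane[OF H(1)] .
    have tr: "nonsingular_point X p \<and> transverse_at X (hyperplane_at_inf B) p"
      if "p \<in> X" "p \<in> hyperplane_at_inf B" for p using that H(2) B(2) by blast
    have "affine_LNE H (X - H) \<longleftrightarrow> LNE (affine_dist B) (X - hyperplane_at_inf B)"
      unfolding B(2)[symmetric] by (rule affine_LNE_iff[OF B(1)]) blast
    also have "\<dots> \<longleftrightarrow> LNE fs_dist X"
      using LNE_fs_of_affine[OF assms B(1) tr] affine_LNE_of_fs[OF assms B(1) tr] by blast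
    finally show ?thesis .
  qed
  show ?thesis using eq exists_transverse_hyperplane[OF assms] by blast
qed

end
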